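(* Let $n\ge1$, $\lambda>n$, and let $a\in L^\infty(\mathscr{S}_n)$ be a $\mathrm{Symm}(n,\mathbb{R})$-invariant symbol, i.e. for every $S\in\mathrm{Symm}(n,\mathbb{R})$ one has $a(Z+S)=a(Z)$ for a.e. $Z\in\mathscr{S}_n$; write $a(Z)=a(Y)$ as a function of $Y=\mathrm{Im}(Z)\in\Omega_n$ only. Let $R_\lambda:L^2(\mathscr{S}_n,\widehat{v}_\lambda)\to L^2(\Omega_n)$ be the operator described in the context, restricted to $\mathcal{A}^2_\lambda(\mathscr{S}_n)$. Then \[ R_\lambda\,T^{(\lambda)}_a = M_{\gamma_{a,\lambda}}\,R_\lambda \quad\text{on } \mathcal{A}^2_\lambda(\mathscr{S}_n), \] where $M_{\gamma_{a,\lambda}}$ is the multiplication operator on $L^2(\Omega_n)$ by the function $\gamma_{a,\lambda}\in L^\infty(\Omega_n)$ given by \[ \gamma_{a,\lambda}(X)=\frac{2^{\frac{n(n+1)}{2}}\det(X)^{\lambda-\frac{n+1}{2}}}{\Gamma_{\Omega_n}\big(\lambda-\frac{n+1}{2}\big)}\int_{\Omega_n}a(Y)\,e^{-2\mathrm{tr}(XY)}\det(2Y)^{\lambda-n-1}\,dY, \] for every $X\in\Omega_n$.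
   Context: $\mathscr{S}_n=\{Z\in\mathrm{Symm}(n,\mathbb{C}) : \mathrm{Im}(Z)>0\}=\mathrm{Symm}(n,\mathbb{R})\oplus i\Omega_n$, where $\Omega_n$ is the cone of positive definite real symmetric $n\times n$ matrices. $\mathrm{Symm}(n,\mathbb{R})$ carries the inner product $\langle A,B\rangle=\mathrm{tr}(AB)$, and $dX,dY,d\xi$ denote the Lebesgue measure normalized with respect to it; $L^2(\Omega_n)$ is taken with respect to it. $\Gamma_{\Omega_n}(\lambda)=(2\pi)^{\frac{n(n-1)}{4}}\prod_{j=1}^n\Gamma\big(\lambda-\frac{j-1}{2}\big)$ for $\lambda>(n-1)/2$. For $\lambda>n$, with $Z=X+iY$, $d\widehat{v}_\lambda(Z)=C_{\lambda,n}\det(2Y)^{\lambda-n-1}dX\,dY$ on $\mathscr{S}_n$, $C_{\lambda,n}=\Gamma_{\Omega_n}(\lambda)\big/\big(\pi^{\frac{n(n+1)}{2}}\Gamma_{\Omega_n}(\lambda-\frac{n+1}{2})\big)$. $\mathcal{A}^2_\lambda(\mathscr{S}_n)$ is the closed subspace of holomorphic functions in $L^2(\mathscr{S}_n,\widehat{v}_\lambda)$, and $T^{(\lambda)}_a=B\circ M_a$ on it, with $B$ the orthogonal projection onto $\mathcal{A}^2_\lambda(\mathscr{S}_n)$ and $M_a$ multiplication by $a$. The operator $R_\lambda$: let $U=\mathcal{F}\otimes I$ on $L^2(\mathscr{S}_n,\widehat{v}_\lambda)\simeq L^2(\mathrm{Symm}(n,\mathbb{R}),dX)\otimes L^2(\Omega_n,C_{\lambda,n}\det(2Y)^{\lambda-n-1}dY)$,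 where $(\mathcal{F}f)(X)=(2\pi)^{-\frac{n(n+1)}{4}}\int_{\mathrm{Symm}(n,\mathbb{R})}e^{-i\mathrm{tr}(X\xi)}f(\xi)\,d\xi$; let $S_\lambda$ be the operator from $L^2(\Omega_n)$ to the same tensor product given by $(S_\lambda f)(X,Y)=\frac{(2\pi)^{n(n+1)/4}}{\Gamma_{\Omega_n}(\lambda)^{1/2}}\chi_{\Omega_n}(X)f(X)\det(X)^{\frac{\lambda}{2}-\frac{n+1}{4}}e^{-\mathrm{tr}(XY)}$. Then $R_\lambda=S_\lambda^*U$. *)

theory Defs
  imports "HOL-Analysis.Analysis"
begin

section \<open>The Euclidean space of real symmetric matrices\<close>

text \<open>
  The size of the matrices is \<open>CARD('n)\<close>. The space of real symmetric matrices is introduced as a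
  type of class \<^class>\<open>euclidean_space\<close> whose inner product is \<open>(A, B) \<mapsto> tr (A B)\<close>; consequently
  \<^const>\<open>lborel\<close> on this type is the Lebesgue measure normalized with respect to that inner product.
\<close>

typedef 'n symm = "{A :: real ^ ('n::finite) ^ 'n. transpose A = A}"
  morphisms smat Abs_symm
  by (rule exI[of _ 0]) (simp add: transpose_def vec_eq_iff)

lemma transpose_smat: "transpose (smat A) = smat A"
  using smat by blast

lemma smat_sym: "smat A $ i $ j = smat A $ j $ i"
  using transpose_smat[of A] by (metis transpose_def vec_lambda_beta)

lemma smat_Abs_symm: "transpose A = A \<Longrightarrow> smat (Abs_symm A) = A"
  by (simp add: Abs_symm_inverse)

lemma symm_eqI: "smat A = smat B \<Longrightarrow> A = B"
  by (simp add: smat_inject)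

instantiation symm :: (finite) real_vector
begin
definition "0 = Abs_symm 0"
definition "A + B = Abs_symm (smat A + smat B)"
definition "A - B = Abs_symm (smat A - smat B)"
definition "- A = Abs_symm (- smat A)"
definition "r *\<^sub>R A = Abs_symm (r *\<^sub>R smat A)"

lemma smat_zero: "smat 0 = 0"
  unfolding zero_symm_def by (intro smat_Abs_symm) (simp add: transpose_def vec_eq_iff)
lemma smat_add: "smat (A + B) = smat A + smat B"
  unfolding plus_symm_def
  by (intro smat_Abs_symm) (simp add: transpose_def vec_eq_iff smat_sym)
lemma smat_diff: "smat (A - B) = smat A - smat B"
  unfolding minus_symm_def
  by (intro smat_Abs_symm) (simp add: transpose_def vec_eq_iff smat_sym)
lemma smat_uminus: "smat (- A) = - smat A"
  unfolding uminus_symm_def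
  by (intro smat_Abs_symm) (simp add: transpose_def vec_eq_iff smat_sym)
lemma smat_scaleR: "smat (r *\<^sub>R A) = r *\<^sub>R smat A"
  unfolding scaleR_symm_def
  by (intro smat_Abs_symm) (simp add: transpose_def vec_eq_iff smat_sym)

instance
  by standard
    (rule symm_eqI, simp add: smat_zero smat_add smat_diff smat_uminus smat_scaleR algebra_simps)+
end

lemma trace_smat_mult: "trace (smat A ** smat B) = smat A \<bullet> smat B"
  unfolding trace_def matrix_matrix_mult_def inner_vec_def by (simp add: smat_sym[of B])

instantiation symm :: (finite) real_inner
begin
definition inner_symm where "A \<bullet> B = trace (smat A ** smat B)"
definition norm_symm where "norm (A :: 'a symm) = sqrt (A \<bullet> A)"
definition dist_symm where "dist (A :: 'a symm) B = norm (A - B)"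
definition sgn_symm where "sgn (A :: 'a symm) = A /\<^sub>R norm A"
definition uniformity_symm where
  "(uniformity :: ('a symm \<times> 'a symm) filter) = (INF e\<in>{0 <..}. principal {(x, y). dist x y < e})"
definition open_symm where
  "open (U :: 'a symm set) \<longleftrightarrow> (\<forall>x\<in>U. eventually (\<lambda>(x', y). x' = x \<longrightarrow> y \<in> U) uniformity)"

instance
proof
  fix A B C :: "'a symm" and r :: real
  show "A \<bullet> B = B \<bullet> A"
    unfolding inner_symm_def trace_smat_mult by (rule inner_commute)
  show "(A + B) \<bullet> C = A \<bullet> C + B \<bullet> C"
    unfolding inner_symm_def trace_smat_mult by (simp only: smat_add inner_add_left)
  show "(r *\<^sub>R A) \<bullet> B = r * (A \<bullet> B)"
    unfolding inner_symm_def trace_smat_mult by (simp only: smat_scaleR inner_scaleR_left)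
  show "0 \<le> A \<bullet> A"
    unfolding inner_symm_def trace_smat_mult by simp
  show "(A \<bullet> A = 0) = (A = 0)"
    unfolding inner_symm_def trace_smat_mult
    by (metis inner_eq_zero_iff smat_zero symm_eqI)
qed (simp_all add: norm_symm_def dist_symm_def sgn_symm_def uniformity_symm_def open_symm_def)
end

lemma inner_symm_eq: "A \<bullet> B = smat A \<bullet> smat B"
  unfolding inner_symm_def by (rule trace_smat_mult)

definition symm_unit :: "'n \<Rightarrow> 'n \<Rightarrow> ('n::finite) symm" where
  "symm_unit i j = Abs_symm (if i = j then axis i (axis i 1)
     else (1 / sqrt 2) *\<^sub>R (axis i (axis j 1) + axis j (axis i 1)))"

lemma smat_symm_unit:
  "smat (symm_unit i j) = (if i = j then axis i (axis i 1)
     else (1 / sqrt 2) *\<^sub>R (axis i (axis j 1) + axis j (axis i 1)))"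
  unfolding symm_unit_def by (intro smat_Abs_symm) (auto simp: transpose_def vec_eq_iff axis_def)

lemma inner_symm_unit: "A \<bullet> symm_unit i j = (if i = j then 1 else sqrt 2) * smat A $ i $ j"
proof -
  have "A \<bullet> symm_unit i j = (2 / sqrt 2) * smat A $ i $ j" if "i \<noteq> j"
    using that smat_sym[of A i j]
    by (simp add: inner_symm_eq smat_symm_unit inner_add_right inner_axis)
  then show ?thesis
    by (auto simp: inner_symm_eq smat_symm_unit inner_axis real_div_sqrt)
qed

lemma symm_unit_commute: "symm_unit i j = symm_unit j i"
  by (rule symm_eqI) (auto simp: smat_symm_unit add.commute)

instantiation symm :: (finite) euclidean_space
begin
definition Basis_symm :: "'a symm set" where "Basis = {symm_unit i j | i j. True}"

instance
proof
  have B: "(Basis :: 'a symm set) = (\<lambda>(i, j). symm_unit i j) ` UNIV"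
    by (auto simp: Basis_symm_def)
  show "(Basis :: 'a symm set) \<noteq> {}" by (simp add: B)
  show "finite (Basis :: 'a symm set)" by (simp add: B)
  fix A B :: "'a symm"
  show "(\<forall>C\<in>Basis. A \<bullet> C = 0) = (A = 0)"
  proof
    assume *: "\<forall>C\<in>Basis. A \<bullet> C = 0"
    have "smat A $ i $ j = 0" for i j
    proof -
      have "A \<bullet> symm_unit i j = 0" using * by (auto simp: Basis_symm_def)
      then show ?thesis by (auto simp: inner_symm_unit split: if_splits)
    qed
    then show "A = 0" by (intro symm_eqI) (simp add: smat_zero vec_eq_iff)
  qed auto
  assume "A \<in> Basis" "B \<in> Basis"
  then obtain i j k l where AB: "A = symm_unit i j" "B = symm_unit k l"
    by (auto simp: Basis_symm_def)
  have *: "symm_unit i j \<bullet> symm_unit k l =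
      (if i = k \<and> j = l \<or> i = l \<and> j = k then 1 else 0)"
    unfolding inner_symm_unit smat_symm_unit by (auto simp: axis_def)
  have "symm_unit i j = symm_unit k l \<longleftrightarrow> i = k \<and> j = l \<or> i = l \<and> j = k"
  proof
    assume "symm_unit i j = symm_unit k l"
    with * have "symm_unit i j \<bullet> symm_unit i j =
      (if i = k \<and> j = l \<or> i = l \<and> j = k then 1 else 0)" by simp
    moreover have "symm_unit i j \<bullet> symm_unit i j = 1"
      unfolding inner_symm_unit smat_symm_unit by (auto simp: axis_def)
    ultimately show "i = k \<and> j = l \<or> i = l \<and> j = k" by (simp split: if_splits)
  qed (auto simp: symm_unit_commute)
  with * show "A \<bullet> B = (if A = B then 1 else 0)" by (simp add: AB)
qed
end


section \<open>The cone of positive definite matrices and the Siegel domain\<close>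

definition pos_def :: "real ^ 'n ^ 'n \<Rightarrow> bool" where
  "pos_def A \<longleftrightarrow> transpose A = A \<and> (\<forall>v. v \<noteq> 0 \<longrightarrow> v \<bullet> (A *v v) > 0)"

definition pd_cone :: "('n::finite) symm set" where
  "pd_cone = {Y. pos_def (smat Y)}"

definition csymm :: "(complex ^ 'n ^ 'n) set" where
  "csymm = {Z. transpose Z = Z}"

definition Im_mat :: "complex ^ 'n ^ 'n \<Rightarrow> real ^ 'n ^ 'n" where
  "Im_mat Z = (\<chi> i j. Im (Z $ i $ j))"

definition siegel :: "(complex ^ 'n ^ 'n) set" where
  "siegel = {Z \<in> csymm. pos_def (Im_mat Z)}"

text \<open>\<open>Im_symm Z\<close> is only meaningful for symmetric \<open>Z\<close>.\<close>

definition Im_symm :: "complex ^ 'n ^ 'n \<Rightarrow> ('n::finite) symm" where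
  "Im_symm Z = Abs_symm (Im_mat Z)"

definition cplx :: "('n::finite) symm \<Rightarrow> complex ^ 'n ^ 'n" where
  "cplx S = (\<chi> i j. of_real (smat S $ i $ j))"

definition XiY :: "('n::finite) symm \<times> 'n symm \<Rightarrow> complex ^ 'n ^ 'n" where
  "XiY = (\<lambda>(X, Y). \<chi> i j. Complex (smat X $ i $ j) (smat Y $ i $ j))"

definition sdet :: "('n::finite) symm \<Rightarrow> real" where
  "sdet Y = det (smat Y)"

definition tr2 :: "('n::finite) symm \<Rightarrow> 'n symm \<Rightarrow> real" where
  "tr2 A B = trace (smat A ** smat B)"

lemma siegel_eq_image: "siegel = XiY ` (UNIV \<times> (pd_cone :: ('n::finite) symm set))"
proof (intro equalityI subsetI)
  fix Z :: "complex ^ 'n ^ 'n" assume Z: "Z \<in> siegel"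
  then have sym: "Z $ i $ j = Z $ j $ i" for i j
    by (auto simp: siegel_def csymm_def transpose_def vec_eq_iff)
  define X Y :: "'n symm" where "X = Abs_symm (\<chi> i j. Re (Z $ i $ j))" and "Y = Im_symm Z"
  have X: "smat X = (\<chi> i j. Re (Z $ i $ j))"
    unfolding X_def by (rule smat_Abs_symm) (simp add: transpose_def vec_eq_iff sym)
  have Y: "smat Y = Im_mat Z"
    unfolding Y_def Im_symm_def
    by (rule smat_Abs_symm) (simp add: Im_mat_def transpose_def vec_eq_iff sym)
  have "Z = XiY (X, Y)" by (simp add: XiY_def X Y Im_mat_def vec_eq_iff)
  moreover have "Y \<in> pd_cone" using Z by (simp add: pd_cone_def Y siegel_def)
  ultimately show "Z \<in> XiY ` (UNIV \<times> pd_cone)" by blast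
next
  fix Z :: "complex ^ 'n ^ 'n" assume "Z \<in> XiY ` (UNIV \<times> pd_cone)"
  then obtain X Y where Z: "Z = XiY (X, Y)" and Y: "Y \<in> pd_cone" by auto
  have "pos_def (Im_mat Z)"
  proof -
    have "Im_mat Z = smat Y" by (simp add: Z XiY_def Im_mat_def vec_eq_iff)
    with Y show ?thesis by (simp add: pd_cone_def)
  qed
  moreover have "Z \<in> csymm"
    by (simp add: csymm_def Z XiY_def transpose_def vec_eq_iff smat_sym[of X] smat_sym[of Y])
  ultimately show "Z \<in> siegel" by (simp add: siegel_def)
qed

definition Gamma_cone :: "nat \<Rightarrow> real \<Rightarrow> real" where
  "Gamma_cone n s =
     (2 * pi) powr (real n * (real n - 1) / 4) * (\<Prod>j=1..n. Gamma (s - (real j - 1) / 2))"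

definition C_const :: "nat \<Rightarrow> real \<Rightarrow> real" where
  "C_const n lam = Gamma_cone n lam /
     (pi powr (real n * (real n + 1) / 2) * Gamma_cone n (lam - (real n + 1) / 2))"


section \<open>Measures\<close>

definition cone_leb :: "('n::finite) symm measure" where
  "cone_leb = restrict_space lborel pd_cone"

definition cone_weight :: "real \<Rightarrow> ('n::finite) symm \<Rightarrow> real" where
  "cone_weight lam Y =
     C_const CARD('n) lam * sdet (2 *\<^sub>R Y) powr (lam - real CARD('n) - 1)"

definition cone_wmeasure :: "real \<Rightarrow> ('n::finite) symm measure" where
  "cone_wmeasure lam = density cone_leb (\<lambda>Y. ennreal (cone_weight lam Y))"

text \<open>The measure \<open>dX dY\<close>, each factor normalized by the trace inner product.\<close>

definition siegel_leb :: "(complex ^ ('n::finite) ^ 'n) measure" where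
  "siegel_leb = distr (lborel \<Otimes>\<^sub>M cone_leb) (restrict_space borel siegel) XiY"

definition vhat :: "real \<Rightarrow> (complex ^ ('n::finite) ^ 'n) measure" where
  "vhat lam = density siegel_leb (\<lambda>Z. ennreal (cone_weight lam (Im_symm Z)))"


section \<open>Square-integrable functions and operators between them\<close>

text \<open>
  Elements of \<open>L\<^sup>2\<close> and \<open>L\<^sup>\<infinity>\<close> are represented by functions, which are to be considered up to equality
  almost everywhere; an operator acts on representatives.
\<close>

definition L2 :: "'a measure \<Rightarrow> ('a \<Rightarrow> complex) set" where
  "L2 M = {f \<in> borel_measurable M. integrable M (\<lambda>x. (cmod (f x))\<^sup>2)}"

definition Linf :: "'a measure \<Rightarrow> ('a \<Rightarrow> complex) set" where
  "Linf M = {f \<in> borel_measurable M. \<exists>C. AE x in M. cmod (f x) \<le> C}"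

definition l2_inner :: "'a measure \<Rightarrow> ('a \<Rightarrow> complex) \<Rightarrow> ('a \<Rightarrow> complex) \<Rightarrow> complex" where
  "l2_inner M f g = (\<integral>x. f x * cnj (g x) \<partial>M)"

definition l2_norm :: "'a measure \<Rightarrow> ('a \<Rightarrow> complex) \<Rightarrow> real" where
  "l2_norm M f = sqrt (\<integral>x. (cmod (f x))\<^sup>2 \<partial>M)"

definition bounded_l2_operator ::
    "'a measure \<Rightarrow> 'b measure \<Rightarrow> (('a \<Rightarrow> complex) \<Rightarrow> ('b \<Rightarrow> complex)) \<Rightarrow> bool" where
  "bounded_l2_operator M N V \<longleftrightarrow>
     (\<forall>f\<in>L2 M. V f \<in> L2 N) \<and>
     (\<forall>f\<in>L2 M. \<forall>g\<in>L2 M. \<forall>c d.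
        AE y in N. V (\<lambda>x. c * f x + d * g x) y = c * V f y + d * V g y) \<and>
     (\<exists>C. \<forall>f\<in>L2 M. l2_norm N (V f) \<le> C * l2_norm M f)"

definition l2_adjoint ::
    "'a measure \<Rightarrow> 'b measure \<Rightarrow> (('a \<Rightarrow> complex) \<Rightarrow> ('b \<Rightarrow> complex))
      \<Rightarrow> (('b \<Rightarrow> complex) \<Rightarrow> ('a \<Rightarrow> complex))" where
  "l2_adjoint M N V g =
     (SOME h. h \<in> L2 M \<and> (\<forall>k\<in>L2 M. l2_inner M k h = l2_inner N (V k) g))"

text \<open>
  \<open>A \<otimes> I\<close> is the bounded operator on \<open>L\<^sup>2(M \<times> N)\<close>, unique up to equality almost everywhere, that maps
  \<open>\<phi> \<otimes> \<psi>\<close> to \<open>A \<phi> \<otimes> \<psi>\<close>. Here \<open>L\<^sup>2(M) \<otimes> L\<^sup>2(N)\<close> is identified with \<open>L\<^sup>2(M \<times> N)\<close>.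
\<close>

definition l2_tensor_id ::
    "'a measure \<Rightarrow> 'b measure \<Rightarrow> (('a \<Rightarrow> complex) \<Rightarrow> ('a \<Rightarrow> complex))
      \<Rightarrow> (('a \<times> 'b \<Rightarrow> complex) \<Rightarrow> ('a \<times> 'b \<Rightarrow> complex))" where
  "l2_tensor_id M N A =
     (SOME V. bounded_l2_operator (M \<Otimes>\<^sub>M N) (M \<Otimes>\<^sub>M N) V \<and>
        (\<forall>\<phi>\<in>L2 M. \<forall>\<psi>\<in>L2 N.
           AE p in M \<Otimes>\<^sub>M N. V (\<lambda>(x, y). \<phi> x * \<psi> y) p = A \<phi> (fst p) * \<psi> (snd p)))"

definition fourier_integral :: "(('n::finite) symm \<Rightarrow> complex) \<Rightarrow> ('n symm \<Rightarrow> complex)" where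
  "fourier_integral f X =
     of_real ((2 * pi) powr (- (real CARD('n) * (real CARD('n) + 1) / 4))) *
     (\<integral>\<xi>. exp (- \<i> * of_real (tr2 X \<xi>)) * f \<xi> \<partial>lborel)"

text \<open>
  On \<open>L\<^sup>2\<close> the Fourier transform is the bounded extension of the integral formula, which converges
  on the dense subspace \<open>L\<^sup>1 \<inter> L\<^sup>2\<close>.
\<close>

definition fourier_L2 :: "(('n::finite) symm \<Rightarrow> complex) \<Rightarrow> ('n symm \<Rightarrow> complex)" where
  "fourier_L2 =
     (SOME V. bounded_l2_operator lborel lborel V \<and>
        (\<forall>f\<in>L2 lborel. integrable lborel f \<longrightarrow> (AE X in lborel. V f X = fourier_integral f X)))"


section \<open>Weighted Bergman spaces and Toeplitz operators\<close>

definition holomorphic_siegel :: "(complex ^ ('n::finite) ^ 'n \<Rightarrow> complex) \<Rightarrow> bool" where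
  "holomorphic_siegel f \<longleftrightarrow>
     (\<forall>Z\<in>siegel. \<exists>D. (f has_derivative D) (at Z within csymm) \<and>
        (\<forall>c. \<forall>W\<in>csymm. D (\<chi> i j. c * W $ i $ j) = c * D W))"

definition bergman_space :: "real \<Rightarrow> (complex ^ ('n::finite) ^ 'n \<Rightarrow> complex) set" where
  "bergman_space lam = {f \<in> L2 (vhat lam). holomorphic_siegel f}"

definition bergman_proj :: "real \<Rightarrow> (complex ^ ('n::finite) ^ 'n \<Rightarrow> complex)
    \<Rightarrow> (complex ^ 'n ^ 'n \<Rightarrow> complex)" where
  "bergman_proj lam f =
     (SOME g. g \<in> bergman_space lam \<and>
        (\<forall>h\<in>bergman_space lam. l2_inner (vhat lam) (\<lambda>Z. f Z - g Z) h = 0))"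

definition toeplitz :: "real \<Rightarrow> (complex ^ ('n::finite) ^ 'n \<Rightarrow> complex)
    \<Rightarrow> (complex ^ 'n ^ 'n \<Rightarrow> complex) \<Rightarrow> (complex ^ 'n ^ 'n \<Rightarrow> complex)" where
  "toeplitz lam a f = bergman_proj lam (\<lambda>Z. a Z * f Z)"


section \<open>The operator \<open>R\<close>\<close>

definition U_op :: "real \<Rightarrow> (complex ^ ('n::finite) ^ 'n \<Rightarrow> complex)
    \<Rightarrow> ('n symm \<times> 'n symm \<Rightarrow> complex)" where
  "U_op lam f = l2_tensor_id lborel (cone_wmeasure lam) fourier_L2 (\<lambda>p. f (XiY p))"

definition S_op :: "real \<Rightarrow> (('n::finite) symm \<Rightarrow> complex)
    \<Rightarrow> ('n symm \<times> 'n symm \<Rightarrow> complex)" where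
  "S_op lam f = (\<lambda>(X, Y).
     of_real ((2 * pi) powr (real CARD('n) * (real CARD('n) + 1) / 4)
       / sqrt (Gamma_cone CARD('n) lam)) *
     indicator pd_cone X * f X *
     of_real (sdet X powr (lam / 2 - (real CARD('n) + 1) / 4) * exp (- tr2 X Y)))"

definition R_op :: "real \<Rightarrow> (complex ^ ('n::finite) ^ 'n \<Rightarrow> complex)
    \<Rightarrow> ('n symm \<Rightarrow> complex)" where
  "R_op lam f =
     l2_adjoint cone_leb (lborel \<Otimes>\<^sub>M cone_wmeasure lam) (S_op lam) (U_op lam f)"


section \<open>Invariant symbols and their spectral functions\<close>

definition symm_invariant :: "(complex ^ ('n::finite) ^ 'n \<Rightarrow> complex) \<Rightarrow> bool" where
  "symm_invariant a \<longleftrightarrow> (\<forall>S :: 'n symm. AE Z in siegel_leb. a (Z + cplx S) = a Z)"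

definition depends_on_Im :: "(complex ^ ('n::finite) ^ 'n \<Rightarrow> complex)
    \<Rightarrow> ('n symm \<Rightarrow> complex) \<Rightarrow> bool" where
  "depends_on_Im a \<alpha> \<longleftrightarrow>
     \<alpha> \<in> borel_measurable cone_leb \<and> (AE Z in siegel_leb. a Z = \<alpha> (Im_symm Z))"

definition gamma_integrand :: "real \<Rightarrow> (('n::finite) symm \<Rightarrow> complex)
    \<Rightarrow> 'n symm \<Rightarrow> 'n symm \<Rightarrow> complex" where
  "gamma_integrand lam \<alpha> X Y = \<alpha> Y *
     of_real (exp (- 2 * tr2 X Y) * sdet (2 *\<^sub>R Y) powr (lam - real CARD('n) - 1))"

definition gamma_fun :: "real \<Rightarrow> (('n::finite) symm \<Rightarrow> complex) \<Rightarrow> 'n symm \<Rightarrow> complex" where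
  "gamma_fun lam \<alpha> X =
     of_real (2 powr (real CARD('n) * (real CARD('n) + 1) / 2)
       * sdet X powr (lam - (real CARD('n) + 1) / 2)
       / Gamma_cone CARD('n) (lam - (real CARD('n) + 1) / 2)) *
     (\<integral>Y. gamma_integrand lam \<alpha> X Y \<partial>cone_leb)"

end

theory Submission
  imports Defs "HOL-Complex_Analysis.Complex_Analysis" "HOL-Probability.Probability"
begin

text \<open>
  The operator \<open>S\<close> is an isometry by the gamma integral of the cone, and \<open>U\<close> is unitary by Plancherel's
  theorem. \<open>U\<close> maps the Bergman space exactly onto the range of \<open>S\<close> (Paley--Wiener): for \<open>f\<close> in the Bergman
  space, Cauchy's theorem makes the integral of \<open>f(X + iY)\<close> times an entire factor over \<open>X\<close> independent of
  \<open>Y\<close>, so that \<open>(U f)(\<xi>, Y) = w(\<xi>) e\<^bsup>-tr(\<xi>Y)\<^esup>\<close>, and square integrability forces \<open>w\<close> to vanish off the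
  cone, where the weighted integral of \<open>e\<^bsup>-2tr(\<xi>Y)\<^esup>\<close> diverges; conversely Laplace integrals are
  holomorphic. Hence \<open>R f = g\<close> whenever \<open>U f = S g\<close>. Since \<open>U\<close> commutes with multiplication by functions of
  \<open>Y\<close>, the Toeplitz operator is carried to \<open>S\<^sup>* M\<^sub>a S\<close>, which is multiplication by the average of \<open>a\<close>
  against \<open>e\<^bsup>-2tr(XY)\<^esup>\<close>, that is, by \<open>\<gamma>\<close>.
\<close>

section \<open>Square-integrable functions\<close>

text \<open>The operators of the statement act on representatives and are mostly picked by
  \<open>SOME\<close>, so for each one a witness is produced and only the defining property of the
  chosen value is used. The value of the Bergman projection exists because the wanted preimage of
  \<gamma> g is exhibited. Square integrability gives no decay of f along horizontal lines, so
  Cauchy's theorem is applied to unit squares and integrated over X: translation invariance replaces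
  the passage to infinity, and independence of Y is obtained almost everywhere. The entire factor is
  a Laplace integral over a bounded set, the transform of a box weighted by exp(tr(\<xi>Y)). The
  divergence off the cone comes from the gamma integral itself: its value is a power det^(-s), which
  blows up at the boundary, while a finite integral at an outer point would bound it along the ray
  in the direction of the identity. The gamma integral is computed by adding one row at a time, with
  minors padded to full size so that the induction over index sets stays in one matrix type.\<close>

definition sqnorm :: "'a measure \<Rightarrow> ('a \<Rightarrow> complex) \<Rightarrow> ennreal" where
  "sqnorm M f = (\<integral>\<^sup>+x. ennreal ((cmod (f x))\<^sup>2) \<partial>M)"

lemma L2_iff: "f \<in> L2 M \<longleftrightarrow> f \<in> borel_measurable M \<and> sqnorm M f < \<infinity>"
  unfolding L2_def sqnorm_def integrable_iff_bounded by (auto simp: borel_measurable_power)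

lemma L2_measurable [dest]: "f \<in> L2 M \<Longrightarrow> f \<in> borel_measurable M"
  by (simp add: L2_iff)

lemma sqnorm_eq_integral: "f \<in> L2 M \<Longrightarrow> sqnorm M f = ennreal (\<integral>x. (cmod (f x))\<^sup>2 \<partial>M)"
  unfolding sqnorm_def L2_def by (intro nn_integral_eq_integral) auto

lemma sqnorm_cong_AE: "AE x in M. f x = g x \<Longrightarrow> sqnorm M f = sqnorm M g"
  unfolding sqnorm_def by (intro nn_integral_cong_AE) auto

lemma sqnorm_cmult:
  "f \<in> borel_measurable M \<Longrightarrow> sqnorm M (\<lambda>x. c * f x) = ennreal ((cmod c)\<^sup>2) * sqnorm M f"
  unfolding sqnorm_def norm_mult power_mult_distrib
  by (subst nn_integral_cmult[symmetric]) (auto simp: ennreal_mult)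

lemma norm_add_sq_le: "(norm (a + b))\<^sup>2 \<le> 2 * (norm a)\<^sup>2 + 2 * (norm b)\<^sup>2" for a b :: "'a::real_normed_vector"
proof -
  have "(norm (a + b))\<^sup>2 \<le> (norm a + norm b)\<^sup>2" by (intro power_mono norm_triangle_ineq) auto
  also have "\<dots> \<le> 2 * (norm a)\<^sup>2 + 2 * (norm b)\<^sup>2"
    using zero_le_power2[of "norm a - norm b"] by (simp add: power2_eq_square algebra_simps)
  finally show ?thesis .
qed

lemma sqnorm_add_le:
  assumes [measurable]: "f \<in> borel_measurable M" "g \<in> borel_measurable M"
  shows "sqnorm M (\<lambda>x. f x + g x) \<le> 2 * sqnorm M f + 2 * sqnorm M g"
proof -
  have "sqnorm M (\<lambda>x. f x + g x) \<le> (\<integral>\<^sup>+x. 2 * ennreal ((cmod (f x))\<^sup>2) + 2 * ennreal ((cmod (g x))\<^sup>2) \<partial>M)"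
    unfolding sqnorm_def
  proof (intro nn_integral_mono)
    fix x
    have "ennreal ((cmod (f x + g x))\<^sup>2) \<le> ennreal (2 * (cmod (f x))\<^sup>2 + 2 * (cmod (g x))\<^sup>2)"
      by (intro ennreal_leI norm_add_sq_le)
    also have "\<dots> = 2 * ennreal ((cmod (f x))\<^sup>2) + 2 * ennreal ((cmod (g x))\<^sup>2)"
      by (simp add: ennreal_plus ennreal_mult)
    finally show "ennreal ((cmod (f x + g x))\<^sup>2) \<le> 2 * ennreal ((cmod (f x))\<^sup>2) + 2 * ennreal ((cmod (g x))\<^sup>2)" .
  qed
  also have "\<dots> = 2 * sqnorm M f + 2 * sqnorm M g"
    unfolding sqnorm_def by (subst nn_integral_add) (auto simp: nn_integral_cmult)
  finally show ?thesis .
qed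

lemma sqnorm_lincomb_le:
  assumes [measurable]: "f \<in> borel_measurable M" "g \<in> borel_measurable M"
  shows "sqnorm M (\<lambda>x. c * f x + d * g x)
    \<le> ennreal (2 * (cmod c)\<^sup>2) * sqnorm M f + ennreal (2 * (cmod d)\<^sup>2) * sqnorm M g"
  using sqnorm_add_le[of "\<lambda>x. c * f x" M "\<lambda>x. d * g x"]
  by (simp add: sqnorm_cmult ennreal_mult mult.assoc)

lemma L2_lincomb:
  assumes "f \<in> L2 M" "g \<in> L2 M" shows "(\<lambda>x. c * f x + d * g x) \<in> L2 M"
proof -
  have [measurable]: "f \<in> borel_measurable M" "g \<in> borel_measurable M" using assms by auto
  have "sqnorm M (\<lambda>x. c * f x + d * g x)
    \<le> ennreal (2 * (cmod c)\<^sup>2) * sqnorm M f + ennreal (2 * (cmod d)\<^sup>2) * sqnorm M g"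
    by (rule sqnorm_lincomb_le) auto
  also have "\<dots> < \<infinity>" using assms by (simp add: L2_iff ennreal_mult_less_top)
  finally show ?thesis by (simp add: L2_iff)
qed

lemma L2_add: "f \<in> L2 M \<Longrightarrow> g \<in> L2 M \<Longrightarrow> (\<lambda>x. f x + g x) \<in> L2 M"
  using L2_lincomb[of f M g 1 1] by simp

lemma L2_diff: "f \<in> L2 M \<Longrightarrow> g \<in> L2 M \<Longrightarrow> (\<lambda>x. f x - g x) \<in> L2 M"
  using L2_lincomb[of f M g 1 "-1"] by simp

lemma L2_cmult: "f \<in> L2 M \<Longrightarrow> (\<lambda>x. c * f x) \<in> L2 M"
  using L2_lincomb[of f M f c 0] by simp

lemma L2_zero: "(\<lambda>x. 0) \<in> L2 M"
  by (simp add: L2_iff sqnorm_def)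

lemma borel_measurable_cnj [measurable (raw)]:
  "f \<in> borel_measurable M \<Longrightarrow> (\<lambda>x. cnj (f x)) \<in> borel_measurable M"
  by (rule measurable_compose[OF _ borel_measurable_continuous_onI]) (auto intro!: continuous_intros)

lemma L2_cnj: "f \<in> L2 M \<Longrightarrow> (\<lambda>x. cnj (f x)) \<in> L2 M"
  by (auto simp: L2_iff sqnorm_def)

lemma sqnorm_minus_commute: "sqnorm M (\<lambda>x. f x - g x) = sqnorm M (\<lambda>x. g x - f x)"
  by (simp add: sqnorm_def norm_minus_commute)

lemma L2_cong_AE: "f \<in> L2 M \<Longrightarrow> g \<in> borel_measurable M \<Longrightarrow> AE x in M. f x = g x \<Longrightarrow> g \<in> L2 M"
  using sqnorm_cong_AE[where M=M and f=f and g=g] by (simp add: L2_iff)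

lemma L2_bound:
  assumes "f \<in> L2 M" "g \<in> borel_measurable M" "AE x in M. cmod (g x) \<le> C * cmod (f x)"
  shows "g \<in> L2 M"
proof -
  have [measurable]: "f \<in> borel_measurable M" using assms by auto
  have "sqnorm M g \<le> (\<integral>\<^sup>+x. ennreal (C\<^sup>2) * ennreal ((cmod (f x))\<^sup>2) \<partial>M)"
    unfolding sqnorm_def
  proof (intro nn_integral_mono_AE, use assms(3) in eventually_elim)
    fix x assume "cmod (g x) \<le> C * cmod (f x)"
    then have "(cmod (g x))\<^sup>2 \<le> (C * cmod (f x))\<^sup>2" by (intro power_mono) auto
    then show "ennreal ((cmod (g x))\<^sup>2) \<le> ennreal (C\<^sup>2) * ennreal ((cmod (f x))\<^sup>2)"
      by (simp add: power_mult_distrib ennreal_mult[symmetric])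
  qed
  also have "\<dots> = ennreal (C\<^sup>2) * sqnorm M f"
    unfolding sqnorm_def by (intro nn_integral_cmult) auto
  also have "\<dots> < \<infinity>" using assms by (simp add: L2_iff ennreal_mult_less_top)
  finally show ?thesis using assms by (simp add: L2_iff)
qed

lemma L2_mult_bounded:
  assumes "f \<in> L2 M" "a \<in> borel_measurable M" "AE x in M. cmod (a x) \<le> C"
  shows "(\<lambda>x. a x * f x) \<in> L2 M"
  by (rule L2_bound[OF assms(1), where C=C])
    (use assms in \<open>auto simp: norm_mult intro!: mult_right_mono\<close>)

lemma L2_mult_integrable:
  assumes "f \<in> L2 M" "g \<in> L2 M" shows "integrable M (\<lambda>x. f x * g x)"
proof (rule Bochner_Integration.integrable_bound)
  show "integrable M (\<lambda>x. (cmod (f x))\<^sup>2 + (cmod (g x))\<^sup>2)"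
    using assms by (auto simp: L2_def)
  have "norm (f x * g x) \<le> norm ((cmod (f x))\<^sup>2 + (cmod (g x))\<^sup>2)" for x
    using sum_squares_bound[of "cmod (f x)" "cmod (g x)"]
      mult_nonneg_nonneg[OF norm_ge_zero[of "f x"] norm_ge_zero[of "g x"]]
    by (simp add: norm_mult del: mult_nonneg_nonneg)
  then show "AE x in M. norm (f x * g x) \<le> norm ((cmod (f x))\<^sup>2 + (cmod (g x))\<^sup>2)" by simp
qed (use assms in \<open>auto intro!: borel_measurable_times\<close>)

lemma L2_inner_integrable:
  "f \<in> L2 M \<Longrightarrow> g \<in> L2 M \<Longrightarrow> integrable M (\<lambda>x. f x * cnj (g x))"
  by (intro L2_mult_integrable L2_cnj)

lemma sqnorm_eq_0_iff: "f \<in> borel_measurable M \<Longrightarrow> sqnorm M f = 0 \<longleftrightarrow> (AE x in M. f x = 0)"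
  unfolding sqnorm_def by (subst nn_integral_0_iff_AE) auto

lemma L2_indicator: "A \<in> sets M \<Longrightarrow> emeasure M A < \<infinity> \<Longrightarrow> indicator A \<in> L2 M"
proof -
  assume A: "A \<in> sets M" "emeasure M A < \<infinity>"
  have "sqnorm M (indicator A) = (\<integral>\<^sup>+x. indicator A x \<partial>M)"
    unfolding sqnorm_def by (intro nn_integral_cong) (auto simp: indicator_def)
  with A show ?thesis by (auto simp: L2_iff)
qed

section \<open>The sesquilinear pairing: polarization and the Cauchy-Schwarz inequality\<close>

lemma l2_inner_lincomb_left:
  assumes "f \<in> L2 M" "g \<in> L2 M" "h \<in> L2 M"
  shows "l2_inner M (\<lambda>x. c * f x + d * g x) h = c * l2_inner M f h + d * l2_inner M g h"
  using L2_inner_integrable[OF assms(1,3)] L2_inner_integrable[OF assms(2,3)]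
  unfolding l2_inner_def by (simp add: algebra_simps)

lemma l2_inner_commute: "l2_inner M g f = cnj (l2_inner M f g)"
  unfolding l2_inner_def by (subst Bochner_Integration.integral_cnj[symmetric]) (simp add: mult.commute)

lemma l2_inner_lincomb_right:
  assumes "f \<in> L2 M" "g \<in> L2 M" "h \<in> L2 M"
  shows "l2_inner M h (\<lambda>x. c * f x + d * g x) = cnj c * l2_inner M h f + cnj d * l2_inner M h g"
  using l2_inner_lincomb_left[OF assms, of c d]
  by (subst (1 2 3) l2_inner_commute) simp

lemma l2_inner_diff_left:
  "f \<in> L2 M \<Longrightarrow> g \<in> L2 M \<Longrightarrow> h \<in> L2 M \<Longrightarrow>
   l2_inner M (\<lambda>x. f x - g x) h = l2_inner M f h - l2_inner M g h"
  using l2_inner_lincomb_left[of f M g h 1 "-1"] by simp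

lemma l2_inner_diff_right:
  "f \<in> L2 M \<Longrightarrow> g \<in> L2 M \<Longrightarrow> h \<in> L2 M \<Longrightarrow>
   l2_inner M h (\<lambda>x. f x - g x) = l2_inner M h f - l2_inner M h g"
  using l2_inner_lincomb_right[of f M g h 1 "-1"] by simp

lemma l2_inner_cong_AE:
  assumes "AE x in M. f x = f' x" "AE x in M. g x = g' x"
    "f \<in> borel_measurable M" "f' \<in> borel_measurable M" "g \<in> borel_measurable M" "g' \<in> borel_measurable M"
  shows "l2_inner M f g = l2_inner M f' g'"
  unfolding l2_inner_def
proof (intro integral_cong_AE)
  show "AE x in M. f x * cnj (g x) = f' x * cnj (g' x)"
    using assms(1,2) by eventually_elim simp
qed (use assms(3-) in \<open>auto intro!: borel_measurable_times borel_measurable_cnj\<close>)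

lemma l2_inner_self: "f \<in> L2 M \<Longrightarrow> l2_inner M f f = of_real (enn2real (sqnorm M f))"
  unfolding l2_inner_def complex_norm_square[symmetric]
  by (simp add: sqnorm_eq_integral del: of_real_power)

lemma l2_inner_self_zero:
  assumes "f \<in> L2 M" "l2_inner M f f = 0" shows "AE x in M. f x = 0"
proof -
  have "enn2real (sqnorm M f) = 0" using assms by (simp add: l2_inner_self)
  then have "sqnorm M f = 0" using assms(1) by (auto simp: L2_iff enn2real_eq_0_iff)
  then show ?thesis using assms by (simp add: sqnorm_eq_0_iff L2_measurable)
qed

lemma L2_eq_AE_I:
  assumes "f \<in> L2 M" "g \<in> L2 M" "\<And>h. h \<in> L2 M \<Longrightarrow> l2_inner M h f = l2_inner M h g"
  shows "AE x in M. f x = g x"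
proof -
  have "l2_inner M (\<lambda>x. f x - g x) (\<lambda>x. f x - g x) = 0"
    using assms by (simp add: l2_inner_diff_right L2_diff)
  then have "AE x in M. f x - g x = 0" using assms by (intro l2_inner_self_zero L2_diff)
  then show ?thesis by simp
qed

lemma sqnorm_add_L2:
  assumes "f \<in> L2 M" "g \<in> L2 M"
  shows "enn2real (sqnorm M (\<lambda>x. f x + c * g x)) =
    enn2real (sqnorm M f) + (cmod c)\<^sup>2 * enn2real (sqnorm M g) + 2 * Re (cnj c * l2_inner M f g)"
proof -
  let ?h = "\<lambda>x. f x + c * g x"
  have h: "?h \<in> L2 M" using L2_lincomb[OF assms, of 1 c] by simp
  have "l2_inner M ?h ?h = l2_inner M f ?h + c * l2_inner M g ?h"
    using l2_inner_lincomb_left[OF assms h, of 1 c] by simp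
  also have "\<dots> = l2_inner M f f + cnj c * l2_inner M f g + c * (l2_inner M g f + cnj c * l2_inner M g g)"
    using l2_inner_lincomb_right[OF assms assms(1), of 1 c] l2_inner_lincomb_right[OF assms assms(2), of 1 c]
    by simp
  also have "l2_inner M g f = cnj (l2_inner M f g)" by (rule l2_inner_commute)
  finally have "complex_of_real (enn2real (sqnorm M ?h)) = of_real (enn2real (sqnorm M f))
     + cnj c * l2_inner M f g + c * (cnj (l2_inner M f g) + cnj c * of_real (enn2real (sqnorm M g)))"
    using assms h by (simp add: l2_inner_self)
  from arg_cong[OF this, of Re] show ?thesis
    by (simp add: algebra_simps complex_norm_square[symmetric] cmod_power2) (simp add: power2_eq_square)
qed

text \<open>Polarization: the norm of f + c g determines Re (cnj c <f, g>), and c = 1 and c = \<i>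
  recover the two parts of the pairing.\<close>

lemma isometry_inner:
  assumes "f \<in> L2 M" "g \<in> L2 M" "f' \<in> L2 N" "g' \<in> L2 N"
    and "sqnorm N f' = sqnorm M f" "sqnorm N g' = sqnorm M g"
    and "\<And>c. sqnorm N (\<lambda>x. f' x + c * g' x) = sqnorm M (\<lambda>x. f x + c * g x)"
  shows "l2_inner N f' g' = l2_inner M f g"
proof -
  have "Re (cnj c * l2_inner N f' g') = Re (cnj c * l2_inner M f g)" for c
    using sqnorm_add_L2[OF assms(1,2), of c] sqnorm_add_L2[OF assms(3,4), of c] assms(5-) by simp
  from this[of 1] this[of \<i>] show ?thesis by (simp add: complex_eq_iff)
qed

lemma l2_inner_cauchy_schwarz:
  assumes "f \<in> L2 M" "g \<in> L2 M"
  shows "ennreal (cmod (l2_inner M f g)) ^ 2 \<le> sqnorm M f * sqnorm M g"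
proof -
  have [measurable]: "f \<in> borel_measurable M" "g \<in> borel_measurable M" using assms by auto
  have "ennreal (cmod (l2_inner M f g)) \<le> (\<integral>\<^sup>+x. norm (f x * cnj (g x)) \<partial>M)"
    unfolding l2_inner_def using assms by (intro integral_norm_bound_ennreal L2_inner_integrable)
  also have "\<dots> = (\<integral>\<^sup>+x. ennreal (cmod (f x)) * ennreal (cmod (g x)) \<partial>M)"
    by (simp add: norm_mult ennreal_mult)
  finally have "ennreal (cmod (l2_inner M f g)) ^ 2 \<le> (\<integral>\<^sup>+x. ennreal (cmod (f x)) * ennreal (cmod (g x)) \<partial>M)^2"
    by (intro power_mono) auto
  also have "\<dots> \<le> (\<integral>\<^sup>+x. ennreal (cmod (f x)) ^ 2 \<partial>M) * (\<integral>\<^sup>+x. ennreal (cmod (g x)) ^ 2 \<partial>M)"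
    by (intro Cauchy_Schwarz_nn_integral) auto
  also have "\<dots> = sqnorm M f * sqnorm M g" unfolding sqnorm_def by (simp add: ennreal_power)
  finally show ?thesis .
qed

subsection \<open>Convergence in mean square\<close>

definition l2_tendsto :: "'a measure \<Rightarrow> (nat \<Rightarrow> 'a \<Rightarrow> complex) \<Rightarrow> ('a \<Rightarrow> complex) \<Rightarrow> bool" where
  "l2_tendsto M F f \<longleftrightarrow> (\<lambda>n. sqnorm M (\<lambda>x. F n x - f x)) \<longlonglongrightarrow> 0"

lemma ennreal_pos_exists_less:
  assumes "0 < (y::ennreal)" obtains e where "0 < e" "ennreal e < y"
proof -
  obtain z where z: "0 < z" "z < y" using dense[OF assms] by blast
  then show ?thesis by (cases z) (auto intro: that)
qed

lemma ennreal_tendsto_0_le: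
  fixes F :: "nat \<Rightarrow> ennreal"
  assumes "G \<longlonglongrightarrow> 0" "\<And>n. F n \<le> G n" shows "F \<longlonglongrightarrow> 0"
  using tendsto_sandwich[of "\<lambda>_. 0" F sequentially G] assms by auto

lemma ennreal_tendsto_0_cmult:
  fixes F :: "nat \<Rightarrow> ennreal"
  assumes "F \<longlonglongrightarrow> 0" "c < \<infinity>" shows "(\<lambda>n. c * F n) \<longlonglongrightarrow> 0"
  using ennreal_tendsto_cmult[of c F 0 sequentially] assms by auto

lemma l2_tendsto_lincomb:
  assumes "l2_tendsto M F f" "l2_tendsto M G g" "\<And>n. F n \<in> L2 M" "\<And>n. G n \<in> L2 M" "f \<in> L2 M" "g \<in> L2 M"
  shows "l2_tendsto M (\<lambda>n x. c * F n x + d * G n x) (\<lambda>x. c * f x + d * g x)"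
  unfolding l2_tendsto_def
proof (rule ennreal_tendsto_0_le)
  have "(\<lambda>n. ennreal (2 * (cmod c)\<^sup>2) * sqnorm M (\<lambda>x. F n x - f x)
      + ennreal (2 * (cmod d)\<^sup>2) * sqnorm M (\<lambda>x. G n x - g x)) \<longlonglongrightarrow> 0 + 0"
    using assms by (intro tendsto_add ennreal_tendsto_0_cmult) (auto simp: l2_tendsto_def)
  then show "(\<lambda>n. ennreal (2 * (cmod c)\<^sup>2) * sqnorm M (\<lambda>x. F n x - f x)
      + ennreal (2 * (cmod d)\<^sup>2) * sqnorm M (\<lambda>x. G n x - g x)) \<longlonglongrightarrow> 0" by simp
  fix n
  have "(\<lambda>x. c * F n x + d * G n x - (c * f x + d * g x)) = (\<lambda>x. c * (F n x - f x) + d * (G n x - g x))"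
    by (simp add: algebra_simps)
  then show "sqnorm M (\<lambda>x. c * F n x + d * G n x - (c * f x + d * g x)) \<le>
     ennreal (2 * (cmod c)\<^sup>2) * sqnorm M (\<lambda>x. F n x - f x)
      + ennreal (2 * (cmod d)\<^sup>2) * sqnorm M (\<lambda>x. G n x - g x)"
    using assms(3-) by (simp, intro sqnorm_lincomb_le) (auto intro!: borel_measurable_diff dest: L2_measurable)
qed

text \<open>The sequence minus itself is constantly 0 and at the same time tends to f - g.\<close>

lemma l2_tendsto_unique:
  assumes "l2_tendsto M F f" "l2_tendsto M F g" "\<And>n. F n \<in> L2 M" "f \<in> L2 M" "g \<in> L2 M"
  shows "AE x in M. f x = g x"
proof -
  have "l2_tendsto M (\<lambda>n x. 1 * F n x + (-1) * F n x) (\<lambda>x. 1 * f x + (-1) * g x)"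
    using assms by (intro l2_tendsto_lincomb)
  then have "(\<lambda>n::nat. sqnorm M (\<lambda>x. g x - f x)) \<longlonglongrightarrow> 0" by (simp add: l2_tendsto_def)
  then have "sqnorm M (\<lambda>x. g x - f x) = 0" by (simp add: LIMSEQ_const_iff)
  then have "AE x in M. g x - f x = 0" using assms
    by (subst (asm) sqnorm_eq_0_iff) (auto intro!: borel_measurable_diff)
  then show ?thesis by eventually_elim simp
qed

lemma l2_tendsto_cong:
  assumes "l2_tendsto M F f" "\<And>n. AE x in M. F n x = G n x" "AE x in M. f x = g x"
  shows "l2_tendsto M G g"
proof -
  have "sqnorm M (\<lambda>x. F n x - f x) = sqnorm M (\<lambda>x. G n x - g x)" for n
    by (rule sqnorm_cong_AE) (use assms(2)[of n] assms(3) in \<open>eventually_elim, simp\<close>)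
  with assms(1) show ?thesis by (simp add: l2_tendsto_def)
qed

lemma l2_tendsto_cnj: "l2_tendsto M F f \<Longrightarrow> l2_tendsto M (\<lambda>n x. cnj (F n x)) (\<lambda>x. cnj (f x))"
  unfolding l2_tendsto_def sqnorm_def complex_cnj_diff[symmetric] complex_mod_cnj .

lemma l2_tendsto_mult_bounded:
  assumes "l2_tendsto M F f" "AE x in M. cmod (a x) \<le> C" "\<And>n. F n \<in> L2 M" "f \<in> L2 M"
  shows "l2_tendsto M (\<lambda>n x. a x * F n x) (\<lambda>x. a x * f x)"
  unfolding l2_tendsto_def
proof (rule ennreal_tendsto_0_le)
  show "(\<lambda>n. ennreal (C\<^sup>2) * sqnorm M (\<lambda>x. F n x - f x)) \<longlonglongrightarrow> 0"
    using assms(1) by (intro ennreal_tendsto_0_cmult) (auto simp: l2_tendsto_def)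
  fix n
  have [measurable]: "F n \<in> borel_measurable M" "f \<in> borel_measurable M" using assms by auto
  have "sqnorm M (\<lambda>x. a x * F n x - a x * f x) \<le> (\<integral>\<^sup>+x. ennreal (C\<^sup>2) * ennreal ((cmod (F n x - f x))\<^sup>2) \<partial>M)"
    unfolding sqnorm_def
  proof (intro nn_integral_mono_AE, use assms(2) in eventually_elim)
    fix x assume "cmod (a x) \<le> C"
    then have "(cmod (a x) * cmod (F n x - f x))\<^sup>2 \<le> (C * cmod (F n x - f x))\<^sup>2"
      by (intro power_mono mult_right_mono) auto
    then show "ennreal ((cmod (a x * F n x - a x * f x))\<^sup>2) \<le> ennreal (C\<^sup>2) * ennreal ((cmod (F n x - f x))\<^sup>2)"
      by (simp add: right_diff_distrib[symmetric] norm_mult power_mult_distrib ennreal_mult[symmetric])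
  qed
  also have "\<dots> = ennreal (C\<^sup>2) * sqnorm M (\<lambda>x. F n x - f x)"
    unfolding sqnorm_def by (intro nn_integral_cmult) auto
  finally show "sqnorm M (\<lambda>x. a x * F n x - a x * f x) \<le> ennreal (C\<^sup>2) * sqnorm M (\<lambda>x. F n x - f x)" .
qed

lemma l2_tendsto_inner:
  assumes "l2_tendsto M F f" "\<And>n. F n \<in> L2 M" "f \<in> L2 M" "g \<in> L2 M"
  shows "(\<lambda>n. l2_inner M (F n) g) \<longlonglongrightarrow> l2_inner M f g"
proof -
  have "(\<lambda>n. ennreal (cmod (l2_inner M (F n) g - l2_inner M f g)) ^ 2) \<longlonglongrightarrow> 0"
  proof (rule ennreal_tendsto_0_le)
    show "(\<lambda>n. sqnorm M g * sqnorm M (\<lambda>x. F n x - f x)) \<longlonglongrightarrow> 0"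
      using assms by (intro ennreal_tendsto_0_cmult) (auto simp: l2_tendsto_def L2_iff)
    fix n
    show "ennreal (cmod (l2_inner M (F n) g - l2_inner M f g)) ^ 2 \<le> sqnorm M g * sqnorm M (\<lambda>x. F n x - f x)"
      using l2_inner_cauchy_schwarz[of "\<lambda>x. F n x - f x" M g] assms
      by (simp add: l2_inner_diff_left L2_diff mult.commute)
  qed
  then have "(\<lambda>n. ennreal ((cmod (l2_inner M (F n) g - l2_inner M f g))\<^sup>2)) \<longlonglongrightarrow> ennreal 0"
    by (simp add: ennreal_power)
  then have "(\<lambda>n. (cmod (l2_inner M (F n) g - l2_inner M f g))\<^sup>2) \<longlonglongrightarrow> 0"
    by (subst (asm) tendsto_ennreal_iff) auto
  from tendsto_real_sqrt[OF this] have "(\<lambda>n. cmod (l2_inner M (F n) g - l2_inner M f g)) \<longlonglongrightarrow> 0"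
    by simp
  then show ?thesis using LIM_zero_cancel tendsto_norm_zero_iff by blast
qed

lemma l2_tendsto_dominated:
  assumes "\<And>n. F n \<in> borel_measurable M" "f \<in> L2 M" "g \<in> L2 M"
    and "\<And>n. AE x in M. cmod (F n x - f x) \<le> cmod (g x)"
    and "AE x in M. (\<lambda>n. F n x) \<longlonglongrightarrow> f x"
  shows "l2_tendsto M F f"
proof -
  have "(\<lambda>n. \<integral>\<^sup>+x. ennreal ((cmod (F n x - f x))\<^sup>2) \<partial>M) \<longlonglongrightarrow> (\<integral>\<^sup>+x. 0 \<partial>M)"
  proof (rule nn_integral_dominated_convergence[where w="\<lambda>x. ennreal ((cmod (g x))\<^sup>2)"])
    show "\<And>j. AE x in M. ennreal ((cmod (F j x - f x))\<^sup>2) \<le> ennreal ((cmod (g x))\<^sup>2)"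
      using assms(4) by (auto intro!: ennreal_leI power_mono elim: eventually_mono)
    show "(\<integral>\<^sup>+x. ennreal ((cmod (g x))\<^sup>2) \<partial>M) < \<infinity>" using assms(3) by (simp add: L2_iff sqnorm_def)
    show "AE x in M. (\<lambda>i. ennreal ((cmod (F i x - f x))\<^sup>2)) \<longlonglongrightarrow> 0"
      using assms(5)
    proof eventually_elim
      fix x assume "(\<lambda>n. F n x) \<longlonglongrightarrow> f x"
      then have "(\<lambda>i. (cmod (F i x - f x))\<^sup>2) \<longlonglongrightarrow> (cmod (f x - f x))\<^sup>2" by (intro tendsto_intros)
      then show "(\<lambda>i. ennreal ((cmod (F i x - f x))\<^sup>2)) \<longlonglongrightarrow> 0" 
        using tendsto_ennrealI by fastforce
    qed
  qed (use assms(1-3) in \<open>auto intro!: borel_measurable_power borel_measurable_norm borel_measurable_diff measurable_compose[OF _ measurable_ennreal]\<close>)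
  then show ?thesis by (simp add: l2_tendsto_def sqnorm_def)
qed

text \<open>Expand the norm of f + (F n - f): the cross term vanishes in the limit by continuity of
  the pairing.\<close>

lemma l2_tendsto_sqnorm:
  assumes "l2_tendsto M F f" "\<And>n. F n \<in> L2 M" "f \<in> L2 M"
  shows "(\<lambda>n. enn2real (sqnorm M (F n))) \<longlonglongrightarrow> enn2real (sqnorm M f)"
proof -
  define d where "d n = (\<lambda>x. F n x - f x)" for n
  have d: "d n \<in> L2 M" for n unfolding d_def using assms by (intro L2_diff)
  have "l2_tendsto M d (\<lambda>x. 0)" using assms(1) by (simp add: l2_tendsto_def d_def)
  from l2_tendsto_inner[OF this d L2_zero assms(3)]
  have "(\<lambda>n. l2_inner M (d n) f) \<longlonglongrightarrow> 0" by (simp add: l2_inner_def)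
  then have "(\<lambda>n. cnj (l2_inner M (d n) f)) \<longlonglongrightarrow> cnj 0" by (intro tendsto_intros)
  then have *: "(\<lambda>n. l2_inner M f (d n)) \<longlonglongrightarrow> 0" by (simp add: l2_inner_commute[symmetric])
  have **: "(\<lambda>n. enn2real (sqnorm M (d n))) \<longlonglongrightarrow> enn2real 0"
    using assms(1) by (intro tendsto_enn2real) (auto simp: l2_tendsto_def d_def)
  have "(\<lambda>n. enn2real (sqnorm M f) + 1 * enn2real (sqnorm M (d n)) + 2 * Re (l2_inner M f (d n)))
     \<longlonglongrightarrow> enn2real (sqnorm M f) + 1 * enn2real 0 + 2 * Re 0"
    by (intro tendsto_add tendsto_mult tendsto_const tendsto_Re * **)
  moreover have "enn2real (sqnorm M (F n)) =
     enn2real (sqnorm M f) + 1 * enn2real (sqnorm M (d n)) + 2 * Re (l2_inner M f (d n))" for n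
    using sqnorm_add_L2[OF assms(3) d[of n], of 1] by (simp add: d_def)
  ultimately show ?thesis by simp
qed

text \<open>Riesz--Fischer: along a subsequence with increments at most \<open>4\<^sup>-\<^sup>k\<close>, the series of
  \<open>2\<^sup>k |F\<^sub>k\<^sub>+\<^sub>1 - F\<^sub>k|\<^sup>2\<close> converges almost everywhere.\<close>

lemma l2_complete:
  assumes F: "\<And>n. F n \<in> L2 M"
    and Cauchy: "\<And>e. e > 0 \<Longrightarrow> \<exists>N. \<forall>m\<ge>N. \<forall>n\<ge>N. sqnorm M (\<lambda>x. F m x - F n x) \<le> ennreal e"
  obtains f where "f \<in> L2 M" "l2_tendsto M F f"
proof -
  have [measurable]: "F n \<in> borel_measurable M" for n using F by auto
  have "\<forall>k. \<exists>N. \<forall>m\<ge>N. \<forall>n\<ge>N. sqnorm M (\<lambda>x. F m x - F n x) \<le> ennreal ((1/4)^k)"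
    using Cauchy by simp
  then obtain N where N: "\<And>k m n. m \<ge> N k \<Longrightarrow> n \<ge> N k \<Longrightarrow> sqnorm M (\<lambda>x. F m x - F n x) \<le> ennreal ((1/4)^k)"
    by metis
  \<comment> \<open>Partial sums make the thresholds monotone while keeping them above
    \<open>N k\<close>.\<close>
  define s where "s k = (\<Sum>j\<le>k. N j)" for k
  have sN: "s k \<ge> N k" for k unfolding s_def by (rule member_le_sum) auto
  have sm: "s (Suc k) \<ge> s k" for k by (simp add: s_def)
  define G where "G k = F (s k)" for k
  have [measurable]: "G n \<in> borel_measurable M" for n by (simp add: G_def)
  define d where "d k = (\<lambda>x. G (Suc k) x - G k x)" for k
  have dle: "sqnorm M (d k) \<le> ennreal ((1/4)^k)" for k
    unfolding d_def G_def using sN[of k] sm[of k] by (intro N) auto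
  have [measurable]: "d n \<in> borel_measurable M" for n by (simp add: d_def)
  have "(\<integral>\<^sup>+x. (\<Sum>k. ennreal (2^k * (cmod (d k x))\<^sup>2)) \<partial>M) = (\<Sum>k. \<integral>\<^sup>+x. ennreal (2^k * (cmod (d k x))\<^sup>2) \<partial>M)"
    by (intro nn_integral_suminf) auto
  also have "\<dots> = (\<Sum>k. ennreal (2^k) * sqnorm M (d k))"
    unfolding sqnorm_def by (simp add: ennreal_mult nn_integral_cmult)
  also have "\<dots> \<le> (\<Sum>k. ennreal ((1/2)^k))"
  proof (intro suminf_le)
    fix k
    have "ennreal (2^k) * sqnorm M (d k) \<le> ennreal (2^k) * ennreal ((1/4)^k)"
      by (intro mult_left_mono dle) auto
    also have "\<dots> = ennreal ((1/2)^k)"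
      by (subst ennreal_mult[symmetric]) (auto simp: power_mult_distrib[symmetric])
    finally show "ennreal (2^k) * sqnorm M (d k) \<le> ennreal ((1/2)^k)" .
  qed auto
  also have "\<dots> = ennreal (\<Sum>k. (1/2)^k)" by (rule suminf_ennreal2) (auto intro: summable_geometric)
  also have "\<dots> < \<infinity>" by simp
  finally have fin: "(\<integral>\<^sup>+x. (\<Sum>k. ennreal (2^k * (cmod (d k x))\<^sup>2)) \<partial>M) < \<infinity>" .
  have "AE x in M. (\<Sum>k. ennreal (2^k * (cmod (d k x))\<^sup>2)) \<noteq> \<infinity>"
  proof (rule nn_integral_noteq_infinite)
    show "(\<lambda>x. \<Sum>k. ennreal (2^k * (cmod (d k x))\<^sup>2)) \<in> borel_measurable M"
      by (rule borel_measurable_suminf_order) measurable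
    show "(\<integral>\<^sup>+x. (\<Sum>k. ennreal (2^k * (cmod (d k x))\<^sup>2)) \<partial>M) \<noteq> \<infinity>"
      using fin by (rule less_imp_neq)
  qed
  then have conv: "AE x in M. convergent (\<lambda>k. G k x)"
  proof eventually_elim
    fix x assume *: "(\<Sum>k. ennreal (2^k * (cmod (d k x))\<^sup>2)) \<noteq> \<infinity>"
    define S where "S = (\<Sum>k. ennreal (2^k * (cmod (d k x))\<^sup>2))"
    obtain C where C: "C \<ge> 0" "S = ennreal C" using * unfolding S_def[symmetric] by (cases S) auto
    \<comment> \<open>Each term is bounded by the sum of the series, so the increments at x decay
      geometrically.\<close>
    have le: "2^k * (cmod (d k x))\<^sup>2 \<le> C" for k
    proof -
      have "ennreal (2^k * (cmod (d k x))\<^sup>2) \<le> ennreal C"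
        using sum_le_suminf[of "\<lambda>k. ennreal (2^k * (cmod (d k x))\<^sup>2)" "{k}"]
        unfolding S_def[symmetric] C(2) by simp
      then show ?thesis using C by simp
    qed
    have "cmod (d k x) \<le> sqrt C * (sqrt (1/2))^k" for k
    proof -
      have "(cmod (d k x))\<^sup>2 \<le> C * (1/2)^k" using le[of k] by (simp add: field_simps)
      then have "cmod (d k x) \<le> sqrt (C * (1/2)^k)" by (rule real_le_rsqrt)
      then show ?thesis by (simp add: real_sqrt_mult real_sqrt_power)
    qed
    moreover have "summable (\<lambda>k. sqrt C * (sqrt (1/2))^k)"
      by (intro summable_mult summable_geometric) (auto simp: real_sqrt_lt_1_iff)
    ultimately have "summable (\<lambda>k. d k x)" by (rule summable_comparison_test'[where N=0, rotated])
    then have "convergent (\<lambda>n. \<Sum>k<n. d k x)" by (simp add: summable_iff_convergent)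
    then have "convergent (\<lambda>n. G n x - G 0 x)"
      unfolding d_def by (simp add: sum_lessThan_telescope[of "\<lambda>k. G k x"])
    then have "convergent (\<lambda>n. (G n x - G 0 x) + G 0 x)" by (intro convergent_add convergent_const)
    then show "convergent (\<lambda>k. G k x)" by simp
  qed
  define f where "f = (\<lambda>x. lim (\<lambda>k. G k x))"
  have [measurable]: "f \<in> borel_measurable M" unfolding f_def by measurable
  have lim: "AE x in M. (\<lambda>k. G k x) \<longlonglongrightarrow> f x"
    using conv by eventually_elim (simp add: f_def convergent_LIMSEQ_iff)
  have close: "\<exists>N. \<forall>m\<ge>N. sqnorm M (\<lambda>x. F m x - f x) \<le> ennreal e" if "e > 0" for e
  proof -
    from Cauchy[OF that] obtain K where K: "\<And>m n. m \<ge> K \<Longrightarrow> n \<ge> K \<Longrightarrow> sqnorm M (\<lambda>x. F m x - F n x) \<le> ennreal e"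
      by blast
    have sK: "\<exists>k0. \<forall>k\<ge>k0. sqnorm M (\<lambda>x. F m x - G k x) \<le> ennreal e" if m: "m \<ge> K" for m
    proof -
      obtain j where j: "(1/4::real)^j < e" using real_arch_pow_inv[OF \<open>e > 0\<close>, of "1/4"] by auto
      show ?thesis
      \<comment> \<open>The monotone thresholds may stay bounded. If they all remain below K, then
        \<open>N k\<close> < K \<le> m for every k, so m is admissible at every level and the bound
        (1/4)^k applies to F m - G k directly.\<close>
      proof (cases "\<exists>k0. s k0 \<ge> K")
        case True
        then obtain k0 where "s k0 \<ge> K" by blast
        then have "s k \<ge> K" if "k \<ge> k0" for k using lift_Suc_mono_le[of s k0 k] sm that by simp
        then show ?thesis using K m unfolding G_def by blast
      next
        case False
        then have lt: "s k < K" for k by (metis not_le)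
        have "sqnorm M (\<lambda>x. F m x - G k x) \<le> ennreal e" if k: "k \<ge> j" for k
        proof -
          have "N k \<le> m" using sN[of k] lt[of k] m by linarith
          then have "sqnorm M (\<lambda>x. F m x - G k x) \<le> ennreal ((1/4)^k)"
            unfolding G_def using sN[of k] by (intro N) auto
          also have "\<dots> \<le> ennreal ((1/4)^j)" using k by (intro ennreal_leI power_decreasing) auto
          also have "\<dots> \<le> ennreal e" using j by (intro ennreal_leI) auto
          finally show ?thesis .
        qed
        then show ?thesis by blast
      qed
    qed
    have "sqnorm M (\<lambda>x. F m x - f x) \<le> ennreal e" if m: "m \<ge> K" for m
    proof -
      \<comment> \<open>Fatou's lemma with m fixed: the Cauchy bound on F m - G k survives the limit
        over k.\<close>
      have "sqnorm M (\<lambda>x. F m x - f x) = (\<integral>\<^sup>+x. liminf (\<lambda>k. ennreal ((cmod (F m x - G k x))\<^sup>2)) \<partial>M)"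
        unfolding sqnorm_def
      proof (intro nn_integral_cong_AE, use lim in eventually_elim)
        fix x assume "(\<lambda>k. G k x) \<longlonglongrightarrow> f x"
        then have "(\<lambda>k. ennreal ((cmod (F m x - G k x))\<^sup>2)) \<longlonglongrightarrow> ennreal ((cmod (F m x - f x))\<^sup>2)"
          by (intro tendsto_ennrealI tendsto_intros)
        then show "ennreal ((cmod (F m x - f x))\<^sup>2) = liminf (\<lambda>k. ennreal ((cmod (F m x - G k x))\<^sup>2))"
          by (intro lim_imp_Liminf[symmetric]) auto
      qed
      also have "\<dots> \<le> liminf (\<lambda>k. \<integral>\<^sup>+x. ennreal ((cmod (F m x - G k x))\<^sup>2) \<partial>M)"
        by (intro nn_integral_liminf) auto
      also have "\<dots> \<le> limsup (\<lambda>k. \<integral>\<^sup>+x. ennreal ((cmod (F m x - G k x))\<^sup>2) \<partial>M)"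
        by (intro Liminf_le_Limsup) auto
      also have "\<dots> \<le> ennreal e"
        using sK[OF m] unfolding sqnorm_def eventually_sequentially[symmetric] by (intro Limsup_bounded)
      finally show ?thesis .
    qed
    then show ?thesis by blast
  qed
  have "f \<in> L2 M"
  proof -
    obtain K where K: "\<And>m. m \<ge> K \<Longrightarrow> sqnorm M (\<lambda>x. F m x - f x) \<le> ennreal 1" using close[of 1] by auto
    have "(\<lambda>x. F K x - f x) \<in> L2 M"
      using K[of K] by (auto simp: L2_iff less_top[symmetric] top_unique)
    from L2_diff[OF F[of K] this] show ?thesis by simp
  qed
  moreover have "l2_tendsto M F f"
    unfolding l2_tendsto_def
  proof (rule order_tendstoI)
    fix y :: ennreal assume "0 < y"
    then obtain e where e: "e > 0" "ennreal e < y" by (rule ennreal_pos_exists_less)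
    from close[OF e(1)] show "\<forall>\<^sub>F n in sequentially. sqnorm M (\<lambda>x. F n x - f x) < y"
      using e(2) unfolding eventually_sequentially by (meson le_less_trans)
  qed auto
  ultimately show ?thesis by (rule that)
qed

text \<open>Density is given by explicit approximants \<open>P n f\<close> in \<open>D\<close>,
  which need not depend linearly on f. The extension is a mean-square limit of
  \<open>V0 (P n f)\<close>; linearity and agreement with \<open>V0\<close> on \<open>D\<close> then
  rest on the limit being the same along every approximating sequence.\<close>

lemma isometric_extension:
  fixes V0 :: "('a \<Rightarrow> complex) \<Rightarrow> ('b \<Rightarrow> complex)"
  assumes D: "D \<subseteq> L2 M" "\<And>f g c d. f \<in> D \<Longrightarrow> g \<in> D \<Longrightarrow> (\<lambda>x. c * f x + d * g x) \<in> D"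
    and P: "\<And>f n. f \<in> L2 M \<Longrightarrow> P n f \<in> D" "\<And>f. f \<in> L2 M \<Longrightarrow> l2_tendsto M (\<lambda>n. P n f) f"
    and V0: "\<And>f. f \<in> D \<Longrightarrow> V0 f \<in> L2 N" "\<And>f. f \<in> D \<Longrightarrow> sqnorm N (V0 f) = sqnorm M f"
      "\<And>f g c d. f \<in> D \<Longrightarrow> g \<in> D \<Longrightarrow>
        AE y in N. V0 (\<lambda>x. c * f x + d * g x) y = c * V0 f y + d * V0 g y"
  obtains V where "\<And>f. f \<in> L2 M \<Longrightarrow> V f \<in> L2 N" "\<And>f. f \<in> L2 M \<Longrightarrow> sqnorm N (V f) = sqnorm M f"
    "\<And>f g c d. f \<in> L2 M \<Longrightarrow> g \<in> L2 M \<Longrightarrow>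
        AE y in N. V (\<lambda>x. c * f x + d * g x) y = c * V f y + d * V g y"
    "\<And>f. f \<in> D \<Longrightarrow> AE y in N. V f y = V0 f y"
proof -
  have iso: "sqnorm N (\<lambda>x. V0 f x - V0 g x) = sqnorm M (\<lambda>x. f x - g x)" if "f \<in> D" "g \<in> D" for f g
  proof -
    have "sqnorm N (\<lambda>x. V0 f x - V0 g x) = sqnorm N (V0 (\<lambda>x. 1 * f x + (-1) * g x))"
      by (rule sqnorm_cong_AE) (use V0(3)[OF that, of 1 "-1"] in \<open>eventually_elim, simp\<close>)
    also have "\<dots> = sqnorm M (\<lambda>x. 1 * f x + (-1) * g x)" by (intro V0 D that)
    finally show ?thesis by simp
  qed
  have lim_ex: "\<exists>h. h \<in> L2 N \<and> l2_tendsto N (\<lambda>n. V0 (P n f)) h" if f: "f \<in> L2 M" for f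
  proof (rule l2_complete[of "\<lambda>n. V0 (P n f)" N])
    show "V0 (P n f) \<in> L2 N" for n using V0(1) P(1) f by blast
    fix e :: real assume e: "e > 0"
    have "(\<lambda>n. sqnorm M (\<lambda>x. P n f x - f x)) \<longlonglongrightarrow> 0" using P(2)[OF f] by (simp add: l2_tendsto_def)
    then have "\<forall>\<^sub>F n in sequentially. sqnorm M (\<lambda>x. P n f x - f x) < ennreal (e/4)"
      using e by (intro order_tendstoD(2)) auto
    then obtain K where K: "\<And>n. n \<ge> K \<Longrightarrow> sqnorm M (\<lambda>x. P n f x - f x) < ennreal (e/4)"
      by (auto simp: eventually_sequentially)
    have "sqnorm N (\<lambda>x. V0 (P m f) x - V0 (P n f) x) \<le> ennreal e" if "m \<ge> K" "n \<ge> K" for m n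
    proof -
      have meas [measurable]: "P m f \<in> borel_measurable M" "P n f \<in> borel_measurable M" "f \<in> borel_measurable M"
        using f P(1)[OF f] D by auto
      have "sqnorm N (\<lambda>x. V0 (P m f) x - V0 (P n f) x) = sqnorm M (\<lambda>x. (P m f x - f x) + (f x - P n f x))"
        using f P by (simp add: iso)
      also have "\<dots> \<le> 2 * sqnorm M (\<lambda>x. P m f x - f x) + 2 * sqnorm M (\<lambda>x. f x - P n f x)"
        by (intro sqnorm_add_le) auto
      also have "\<dots> \<le> 2 * ennreal (e/4) + 2 * ennreal (e/4)"
        using K[OF that(1)] K[OF that(2)] sqnorm_minus_commute[of M f "P n f"]
        by (intro add_mono mult_left_mono) auto
      also have "\<dots> = ennreal (2 * (e/4) + 2 * (e/4))"
        using e by (simp only: ennreal_plus ennreal_mult) simp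
      finally show ?thesis by simp
    qed
    then show "\<exists>N'. \<forall>m\<ge>N'. \<forall>n\<ge>N'. sqnorm N (\<lambda>x. V0 (P m f) x - V0 (P n f) x) \<le> ennreal e" by blast
  qed blast
  define V where "V f = (SOME h. h \<in> L2 N \<and> l2_tendsto N (\<lambda>n. V0 (P n f)) h)" for f
  have V: "V f \<in> L2 N" "l2_tendsto N (\<lambda>n. V0 (P n f)) (V f)" if "f \<in> L2 M" for f
    using someI_ex[OF lim_ex[OF that]] unfolding V_def by auto
  \<comment> \<open>Independence of the approximating sequence: two sequences in \<open>D\<close>
    with the same limit differ by a null sequence, and the isometry \<open>V0\<close> maps it to a
    null sequence.\<close>
  have step: "l2_tendsto N (\<lambda>n. V0 (F n)) (V f)" if F: "\<And>n. F n \<in> D" "l2_tendsto M F f" and f: "f \<in> L2 M" for F f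
  proof -
    have "l2_tendsto M (\<lambda>n x. 1 * F n x + (-1) * P n f x) (\<lambda>x. 1 * f x + (-1) * f x)"
      using F f P D by (intro l2_tendsto_lincomb) auto
    then have "l2_tendsto N (\<lambda>n x. V0 (F n) x - V0 (P n f) x) (\<lambda>x. 0)"
      using F f P by (simp add: l2_tendsto_def iso)
    from l2_tendsto_lincomb[OF this V(2)[OF f], of 1 1] show ?thesis
      using F f P D V0 V by (auto simp: L2_diff L2_zero)
  qed
  show ?thesis
  proof (rule that[of V])
    show "V f \<in> L2 N" if "f \<in> L2 M" for f using V that by auto
    show "sqnorm N (V f) = sqnorm M f" if f: "f \<in> L2 M" for f
    proof -
      have PL: "P n f \<in> L2 M" "V0 (P n f) \<in> L2 N" for n using P(1)[OF f] D V0 by auto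
      have "(\<lambda>n. enn2real (sqnorm N (V0 (P n f)))) \<longlonglongrightarrow> enn2real (sqnorm N (V f))"
        using V[OF f] PL by (intro l2_tendsto_sqnorm)
      moreover have "(\<lambda>n. enn2real (sqnorm M (P n f))) \<longlonglongrightarrow> enn2real (sqnorm M f)"
        using P(2)[OF f] PL f by (intro l2_tendsto_sqnorm)
      moreover have "sqnorm N (V0 (P n f)) = sqnorm M (P n f)" for n using V0(2) P(1) f by blast
      ultimately have "enn2real (sqnorm N (V f)) = enn2real (sqnorm M f)" using LIMSEQ_unique by simp
      then show ?thesis using V(1)[OF f] f unfolding L2_iff
        by (metis ennreal_enn2real infinity_ennreal_def)
    qed
    show "AE y in N. V (\<lambda>x. c * f x + d * g x) y = c * V f y + d * V g y"
      if f: "f \<in> L2 M" and g: "g \<in> L2 M" for f g c d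
    proof (rule l2_tendsto_unique)
      let ?F = "\<lambda>n x. c * P n f x + d * P n g x"
      show "l2_tendsto N (\<lambda>n. V0 (?F n)) (V (\<lambda>x. c * f x + d * g x))"
        using f g P D by (intro step l2_tendsto_lincomb L2_lincomb) auto
      have "l2_tendsto N (\<lambda>n x. c * V0 (P n f) x + d * V0 (P n g) x) (\<lambda>y. c * V f y + d * V g y)"
        using f g P V V0 by (intro l2_tendsto_lincomb) auto
      then show "l2_tendsto N (\<lambda>n. V0 (?F n)) (\<lambda>y. c * V f y + d * V g y)"
      proof (rule l2_tendsto_cong)
        fix n show "AE x in N. c * V0 (P n f) x + d * V0 (P n g) x = V0 (?F n) x"
          using V0(3)[of "P n f" "P n g" c d] P f g by (auto elim: eventually_mono)
      qed auto
    qed (use f g V V0 D P in \<open>auto intro!: L2_lincomb\<close>)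
    show "AE y in N. V f y = V0 f y" if f: "f \<in> D" for f
    proof (rule l2_tendsto_unique)
      show "l2_tendsto N (\<lambda>n. V0 f) (V f)"
        using f D by (intro step) (auto simp: l2_tendsto_def sqnorm_def)
      show "l2_tendsto N (\<lambda>n. V0 f) (V0 f)" by (simp add: l2_tendsto_def sqnorm_def)
    qed (use f V V0 D in auto)
  qed
qed

text \<open>Linearity up to null sets reduces the claim to the operator bound, which is squared to
  become an inequality between values of \<open>sqnorm\<close>.\<close>

lemma bounded_l2_operator_tendsto:
  assumes W: "bounded_l2_operator M N W" and F: "l2_tendsto M F f" "\<And>n. F n \<in> L2 M" "f \<in> L2 M"
  shows "l2_tendsto N (\<lambda>n. W (F n)) (W f)"
proof -
  from W obtain C where C: "\<And>g. g \<in> L2 M \<Longrightarrow> l2_norm N (W g) \<le> C * l2_norm M g"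
    and WL: "\<And>g. g \<in> L2 M \<Longrightarrow> W g \<in> L2 N"
    and lin: "\<And>g h c d. g \<in> L2 M \<Longrightarrow> h \<in> L2 M \<Longrightarrow> AE y in N. W (\<lambda>x. c * g x + d * h x) y = c * W g y + d * W h y"
    unfolding bounded_l2_operator_def by blast
  have bd: "sqnorm N (W g) \<le> ennreal (C\<^sup>2) * sqnorm M g" if g: "g \<in> L2 M" for g
  proof -
    have nonneg: "(\<integral>x. (cmod (h x))\<^sup>2 \<partial>K) \<ge> 0" for h and K :: "'x measure" by (intro Bochner_Integration.integral_nonneg) auto
    have "(l2_norm N (W g))\<^sup>2 \<le> (C * l2_norm M g)\<^sup>2"
      using C[OF g] nonneg by (intro power_mono) (auto simp: l2_norm_def)
    then have "(\<integral>x. (cmod (W g x))\<^sup>2 \<partial>N) \<le> C\<^sup>2 * (\<integral>x. (cmod (g x))\<^sup>2 \<partial>M)"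
      by (simp add: l2_norm_def power_mult_distrib nonneg)
    then show ?thesis using g WL[OF g]
      by (simp add: sqnorm_eq_integral ennreal_mult[symmetric] nonneg)
  qed
  show ?thesis unfolding l2_tendsto_def
  proof (rule ennreal_tendsto_0_le)
    show "(\<lambda>n. ennreal (C\<^sup>2) * sqnorm M (\<lambda>x. F n x - f x)) \<longlonglongrightarrow> 0"
      using F(1) by (intro ennreal_tendsto_0_cmult) (auto simp: l2_tendsto_def)
    fix n
    have "sqnorm N (\<lambda>x. W (F n) x - W f x) = sqnorm N (W (\<lambda>x. 1 * F n x + (-1) * f x))"
      by (rule sqnorm_cong_AE) (use lin[OF F(2)[of n] F(3), of 1 "-1"] in \<open>eventually_elim, simp\<close>)
    also have "\<dots> \<le> ennreal (C\<^sup>2) * sqnorm M (\<lambda>x. 1 * F n x + (-1) * f x)"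
      by (intro bd L2_lincomb F)
    finally show "sqnorm N (\<lambda>x. W (F n) x - W f x) \<le> ennreal (C\<^sup>2) * sqnorm M (\<lambda>x. F n x - f x)" by simp
  qed
qed

subsection \<open>Density of step functions over a generator\<close>

text \<open>The \<pi>-\<lambda> argument runs on the sets S \<inter> R i with R i fixed, because the
  complement of S in the whole space may have infinite measure. Simple functions cut off by the
  exhausting sets R i then approximate any f.\<close>

lemma L2_dense_generator:
  assumes G: "Int_stable G" "G \<subseteq> Pow (space M)" "sets M = sigma_sets (space M) G"
    and R: "range R \<subseteq> G" "(\<Union>i::nat. R i) = space M" "incseq R" "\<And>i. emeasure M (R i) < \<infinity>"
    and Q_lin: "\<And>f g c d. f \<in> L2 M \<Longrightarrow> g \<in> L2 M \<Longrightarrow> Q f \<Longrightarrow> Q g \<Longrightarrow> Q (\<lambda>x. c * f x + d * g x)"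
    and Q_lim: "\<And>F f. (\<And>n. F n \<in> L2 M) \<Longrightarrow> (\<And>n. Q (F n)) \<Longrightarrow> f \<in> L2 M \<Longrightarrow> l2_tendsto M F f \<Longrightarrow> Q f"
    and Q_G: "\<And>S. S \<in> G \<Longrightarrow> emeasure M S < \<infinity> \<Longrightarrow> Q (indicator S)"
    and f: "f \<in> L2 M"
  shows "Q f"
proof -
  have RM [measurable]: "R i \<in> sets M" for i using R(1) G by auto
  have RL: "indicator (S \<inter> R i) \<in> L2 M" if "S \<in> sets M" for S i
    using R(4)[of i] emeasure_mono[of "S \<inter> R i" "R i" M] that
    by (intro L2_indicator) (auto intro: le_less_trans)
  have Q0: "Q (\<lambda>x. 0)"
    using Q_lin[of "indicator (R 0)" "indicator (R 0)" 0 0] Q_G[of "R 0"] R RL[of "R 0" 0] by auto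
  have QS: "Q (indicator (S \<inter> R i))" if "S \<in> sets M" for S i
  proof -
    have "S \<in> sigma_sets (space M) G" using that G by simp
    then show ?thesis
    proof (induction S rule: sigma_sets_induct_disjoint[OF G(1,2), consumes 1])
      case (1 A)
      have "A \<inter> R i \<in> G" using 1 R(1) G(1) by (auto simp: Int_stable_def)
      moreover have "emeasure M (A \<inter> R i) < \<infinity>"
        using R(4)[of i] emeasure_mono[of "A \<inter> R i" "R i" M] by (auto intro: le_less_trans)
      ultimately show ?case by (intro Q_G) auto
    next
      case 2 then show ?case using Q0 by (simp add: indicator_def[abs_def])
    next
      case (3 A)
      then have "A \<in> sets M" using G by simp
      have "Q (\<lambda>x. 1 * indicator (R i) x + (-1) * indicator (A \<inter> R i) x)"
        using 3 RL[of "R i" i] RL[OF \<open>A \<in> sets M\<close>, of i] Q_G[of "R i"] R by (intro Q_lin) auto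
      also have "(\<lambda>x. 1 * indicator (R i) x + (-1) * indicator (A \<inter> R i) x :: complex) = indicator ((space M - A) \<inter> R i)"
        using sets.sets_into_space[OF RM[of i]] by (auto simp: indicator_def fun_eq_iff)
      finally show ?case .
    next
      case (4 A)
      then have A: "A k \<in> sets M" for k using G by auto
      have UA: "\<Union>(range A) \<in> sets M" using A by auto
      have QF: "Q (\<lambda>x. \<Sum>k<n. indicator (A k \<inter> R i) x) \<and> (\<lambda>x. \<Sum>k<n. indicator (A k \<inter> R i) x) \<in> L2 M" for n
      proof (induction n)
        case (Suc n)
        then show ?case
          using Q_lin[of "\<lambda>x. \<Sum>k<n. indicator (A k \<inter> R i) x" "indicator (A n \<inter> R i)" 1 1]
            L2_add[of "\<lambda>x. \<Sum>k<n. indicator (A k \<inter> R i) x" M "indicator (A n \<inter> R i)"] RL[OF A] 4 by simp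
      qed (simp add: Q0 L2_zero)
      have lim: "l2_tendsto M (\<lambda>n x. \<Sum>k<n. indicator (A k \<inter> R i) x) (indicator (\<Union>(range A) \<inter> R i))"
      proof (rule l2_tendsto_dominated[where g="indicator (\<Union>(range A) \<inter> R i)"])
        have eq: "(\<Sum>k<n. indicator (A k \<inter> R i) x :: complex) = indicator ((\<Union>k<n. A k) \<inter> R i) x" for n x
        proof -
          have "indicator ((\<Union>k<n. A k) \<inter> R i) x = (indicator (\<Union>k<n. A k) x * indicator (R i) x :: complex)"
            by (simp add: indicator_inter_arith)
          also have "indicator (\<Union>k<n. A k) x = (\<Sum>k<n. indicator (A k) x :: complex)"
            using 4 by (intro indicator_UN_disjoint) (auto simp: disjoint_family_on_def)
          finally show ?thesis by (simp only: sum_distrib_right indicator_inter_arith)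
        qed
        show "AE x in M. cmod ((\<Sum>k<n. indicator (A k \<inter> R i) x) - indicator (\<Union>(range A) \<inter> R i) x)
          \<le> cmod (indicator (\<Union>(range A) \<inter> R i) x)" for n
          unfolding eq by (intro AE_I2) (simp split: split_indicator)
        show "AE x in M. (\<lambda>n. \<Sum>k<n. indicator (A k \<inter> R i) x :: complex) \<longlonglongrightarrow> indicator (\<Union>(range A) \<inter> R i) x"
        proof (intro AE_I2)
          fix x
          have "\<forall>\<^sub>F n in sequentially. (indicator ((\<Union>k<n. A k) \<inter> R i) x :: complex) = indicator (\<Union>(range A) \<inter> R i) x"
          proof (cases "x \<in> \<Union>(range A)")
            case True
            then obtain k where "x \<in> A k" by auto
            then have "x \<in> (\<Union>k<n. A k)" if "n > k" for n using that by auto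
            then show ?thesis using True unfolding eventually_sequentially
              by (intro exI[of _ "Suc k"]) (auto simp: indicator_def)
          qed (auto simp: indicator_def)
          then show "(\<lambda>n. \<Sum>k<n. indicator (A k \<inter> R i) x :: complex) \<longlonglongrightarrow> indicator (\<Union>(range A) \<inter> R i) x"
            unfolding eq by (rule tendsto_eventually)
        qed
      qed (use A UA RL in auto)
      show ?case
        by (rule Q_lim[OF _ _ RL[OF UA] lim]) (use QF in blast)+
    qed
  qed
  have [measurable]: "f \<in> borel_measurable M" using f by auto
  obtain F where "(\<forall>i. simple_function M (F i)) \<and> (\<forall>x\<in>space M. (\<lambda>i. F i x) \<longlonglongrightarrow> f x) \<and>
      (\<forall>i. \<forall>x\<in>space M. dist (F i x) 0 \<le> 2 * dist (f x) 0)"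
    using borel_measurable_implies_sequence_metric[OF \<open>f \<in> borel_measurable M\<close>, of 0] by blast
  then have F: "\<And>i. simple_function M (F i)" "\<And>x. x \<in> space M \<Longrightarrow> (\<lambda>i. F i x) \<longlonglongrightarrow> f x"
      "\<And>i x. x \<in> space M \<Longrightarrow> dist (F i x) 0 \<le> 2 * dist (f x) 0"
    by blast+
  define H where "H i x = F i x * indicator (R i) x" for i x
  have QH: "Q (H i) \<and> H i \<in> L2 M" for i
  proof -
    have fin: "finite (F i ` space M)" using F(1)[of i] by (auto simp: simple_function_def)
    have sets: "F i -` {y} \<inter> space M \<in> sets M" for y
      using F(1)[of i] by (rule simple_functionD)
    let ?S = "\<lambda>Y x. \<Sum>y\<in>Y. y * indicator (F i -` {y} \<inter> space M \<inter> R i) x"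
    have "Q (?S Y) \<and> ?S Y \<in> L2 M" if "finite Y" for Y
      using that
    proof (induction Y)
      case (insert y Y)
      have "?S (insert y Y) = (\<lambda>x. y * indicator (F i -` {y} \<inter> space M \<inter> R i) x + 1 * ?S Y x)"
        by (simp only: sum.insert[OF insert(1,2)] mult_1)
      moreover have IH: "Q (?S Y)" "?S Y \<in> L2 M" using insert.IH by blast+
      note Q_lin[OF RL[OF sets, of y i] IH(2) QS[OF sets, of y i] IH(1), of y 1]
        L2_lincomb[OF RL[OF sets, of y i] IH(2), of y 1]
      ultimately show ?case by (simp only: simp_thms)
    qed (simp add: Q0 L2_zero)
    moreover have "H i = ?S (F i ` space M)"
    proof
      fix x show "H i x = ?S (F i ` space M) x"
      proof (cases "x \<in> R i")
        case True
        then have x: "x \<in> space M" using sets.sets_into_space[OF RM[of i]] by auto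
        have "?S (F i ` space M) x = (\<Sum>y\<in>F i ` space M. if y = F i x then y else 0)"
        proof (intro sum.cong refl)
          fix y assume "y \<in> F i ` space M"
          show "y * indicator (F i -` {y} \<inter> space M \<inter> R i) x = (if y = F i x then y else 0)"
            using True x by (cases "y = F i x") simp_all
        qed
        also have "\<dots> = F i x" using fin x by (subst sum.delta) auto
        finally show ?thesis using True by (simp add: H_def)
      qed (simp add: H_def)
    qed
    ultimately show ?thesis using fin by (simp only:)
  qed
  have lim: "l2_tendsto M H f"
  \<comment> \<open>The approximating simple functions satisfy |F n| \<le> 2 |f|, so the distance to
    f is at most 3 |f|.\<close>
  proof (rule l2_tendsto_dominated[where g="\<lambda>x. 3 * f x"])
    show "AE x in M. cmod (H n x - f x) \<le> cmod (3 * f x)" for n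
    proof (intro AE_I2)
      fix x assume "x \<in> space M"
      then have "cmod (F n x) \<le> 2 * cmod (f x)" using F(3)[of x n] by simp
      then show "cmod (H n x - f x) \<le> cmod (3 * f x)"
        using norm_triangle_ineq4[of "F n x" "f x"] by (cases "x \<in> R n") (auto simp: H_def norm_mult)
    qed
    show "AE x in M. (\<lambda>n. H n x) \<longlonglongrightarrow> f x"
    proof (intro AE_I2)
      fix x assume x: "x \<in> space M"
      then obtain k where "x \<in> R k" using R(2) by auto
      then have "x \<in> R n" if "n \<ge> k" for n using R(3) that by (auto simp: incseq_def)
      then have "\<forall>\<^sub>F n in sequentially. F n x = H n x"
        unfolding eventually_sequentially H_def by (intro exI[of _ k]) auto
      with F(2)[OF x] show "(\<lambda>n. H n x) \<longlonglongrightarrow> f x" by (rule Lim_transform_eventually)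
    qed
  qed (use QH f in \<open>auto intro!: L2_cmult\<close>)
  show "Q f" by (rule Q_lim[OF _ _ f lim]) (use QH in blast)+
qed

lemma (in pair_sigma_finite) L2_dense_products:
  assumes Q_lin: "\<And>f g c d. f \<in> L2 (M1 \<Otimes>\<^sub>M M2) \<Longrightarrow> g \<in> L2 (M1 \<Otimes>\<^sub>M M2) \<Longrightarrow> Q f \<Longrightarrow> Q g \<Longrightarrow> Q (\<lambda>x. c * f x + d * g x)"
    and Q_lim: "\<And>F f. (\<And>n. F n \<in> L2 (M1 \<Otimes>\<^sub>M M2)) \<Longrightarrow> (\<And>n. Q (F n)) \<Longrightarrow> f \<in> L2 (M1 \<Otimes>\<^sub>M M2) \<Longrightarrow>
        l2_tendsto (M1 \<Otimes>\<^sub>M M2) F f \<Longrightarrow> Q f"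
    and Q_prod: "\<And>A B. A \<in> sets M1 \<Longrightarrow> B \<in> sets M2 \<Longrightarrow> emeasure M1 A < \<infinity> \<Longrightarrow> emeasure M2 B < \<infinity> \<Longrightarrow>
        Q (\<lambda>(x, y). indicator A x * indicator B y)"
    and f: "f \<in> L2 (M1 \<Otimes>\<^sub>M M2)"
  shows "Q f"
proof -
  let ?G = "{A \<times> B | A B. A \<in> sets M1 \<and> B \<in> sets M2}"
  obtain R :: "nat \<Rightarrow> ('a \<times> 'b) set" where R: "range R \<subseteq> ?G" "incseq R" "(\<Union>i. R i) = space M1 \<times> space M2"
      "\<And>i. emeasure (M1 \<Otimes>\<^sub>M M2) (R i) \<noteq> \<infinity>"
    using sigma_finite_up_in_pair_measure_generator by auto
  have ind: "(\<lambda>(x, y). indicator A x * indicator B y) = (indicator (A \<times> B) :: _ \<Rightarrow> complex)" for A B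
    by (auto simp: fun_eq_iff indicator_def)
  have Q0: "Q (\<lambda>x. 0)"
    using Q_prod[of "{}" "{}"] by (simp add: case_prod_unfold)
  have QG: "Q (indicator S)" if SG: "S \<in> ?G" "emeasure (M1 \<Otimes>\<^sub>M M2) S < \<infinity>" for S
  proof -
    obtain A B where S: "S = A \<times> B" and A: "A \<in> sets M1" and B: "B \<in> sets M2" using SG(1) by auto
    have e: "emeasure M1 A * emeasure M2 B < \<infinity>" using SG(2) A B by (simp add: S M2.emeasure_pair_measure_Times)
    show ?thesis
    proof (cases "emeasure M1 A = 0 \<or> emeasure M2 B = 0")
      case False
      then have "emeasure M1 A < \<infinity> \<and> emeasure M2 B < \<infinity>"
        using e by (auto simp: ennreal_mult_less_top)
      then show ?thesis using Q_prod[OF A B] by (simp add: ind S)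
    next
      \<comment> \<open>A null side may be paired with a side of infinite measure, where
        \<open>Q_prod\<close> is silent. The indicator is then zero almost everywhere, hence a
        mean-square limit of the zero function.\<close>
      case True
      then have "emeasure (M1 \<Otimes>\<^sub>M M2) (A \<times> B) = 0" using A B by (auto simp: M2.emeasure_pair_measure_Times)
      then have *: "sqnorm (M1 \<Otimes>\<^sub>M M2) (indicator (A \<times> B)) = 0"
        using A B by (subst sqnorm_eq_0_iff) (auto intro!: AE_I[of _ _ "A \<times> B"] simp: indicator_def)
      have L: "indicator (A \<times> B) \<in> L2 (M1 \<Otimes>\<^sub>M M2)" using * A B by (simp add: L2_iff)
      have "l2_tendsto (M1 \<Otimes>\<^sub>M M2) (\<lambda>n x. 0) (indicator (A \<times> B))"
        using * sqnorm_minus_commute[of _ "\<lambda>x. 0" "indicator (A \<times> B)"] by (simp add: l2_tendsto_def)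
      from Q_lim[OF L2_zero Q0 L this] show ?thesis unfolding S .
    qed
  qed
  show ?thesis
  proof (rule L2_dense_generator[where G="?G" and R=R and M="M1 \<Otimes>\<^sub>M M2" and Q=Q and f=f, OF _ _ _ R(1) _ R(2) _ _ _ _ f])
    show "Int_stable ?G" by (rule Int_stable_pair_measure_generator)
    show "?G \<subseteq> Pow (space (M1 \<Otimes>\<^sub>M M2))" using pair_measure_closed[of M1 M2] by (simp add: space_pair_measure)
    show "sets (M1 \<Otimes>\<^sub>M M2) = sigma_sets (space (M1 \<Otimes>\<^sub>M M2)) ?G"
      by (simp add: sets_pair_measure space_pair_measure)
    show "(\<Union>i. R i) = space (M1 \<Otimes>\<^sub>M M2)" using R by (simp add: space_pair_measure)
    show "emeasure (M1 \<Otimes>\<^sub>M M2) (R i) < \<infinity>" for i using R(4)[of i] by (simp add: less_top)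
    show "Q (indicator S)" if "S \<in> ?G" "emeasure (M1 \<Otimes>\<^sub>M M2) S < \<infinity>" for S
      by (rule QG[OF that])
    show "Q g" if "\<And>n. F n \<in> L2 (M1 \<Otimes>\<^sub>M M2)" "\<And>n. Q (F n)" "g \<in> L2 (M1 \<Otimes>\<^sub>M M2)" "l2_tendsto (M1 \<Otimes>\<^sub>M M2) F g" for F g
      by (rule Q_lim[OF that])
    show "Q (\<lambda>x. c * g x + d * h x)"
      if "g \<in> L2 (M1 \<Otimes>\<^sub>M M2)" "h \<in> L2 (M1 \<Otimes>\<^sub>M M2)" "Q g" "Q h" for g h c d
      by (rule Q_lin[OF that])
  qed
qed

section \<open>The Fourier transform on a Euclidean space\<close>

lemma lborel_integral_affine:
  fixes f :: "'a::euclidean_space \<Rightarrow> complex" and c :: real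
  assumes c: "c \<noteq> 0" and f: "f \<in> borel_measurable borel"
  shows "(\<integral>x. f x \<partial>lborel) = of_real (\<bar>c\<bar> ^ DIM('a)) * (\<integral>x. f (t + c *\<^sub>R x) \<partial>lborel)"
    and "integrable lborel f \<longleftrightarrow> integrable lborel (\<lambda>x. f (t + c *\<^sub>R x))"
proof -
  have [measurable]: "f \<in> borel_measurable borel" by fact
  show "(\<integral>x. f x \<partial>lborel) = of_real (\<bar>c\<bar> ^ DIM('a)) * (\<integral>x. f (t + c *\<^sub>R x) \<partial>lborel)"
    by (subst lborel_affine[OF c, of t], subst integral_density)
      (auto simp: integral_distr scaleR_conv_of_real)
  have "integrable lborel f \<longleftrightarrow> integrable (density (distr lborel borel (\<lambda>x. t + c *\<^sub>R x)) (\<lambda>_. ennreal (\<bar>c\<bar>^DIM('a)))) f"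
    using lborel_affine[OF c, of t] by simp
  also have "\<dots> \<longleftrightarrow> integrable lborel (\<lambda>x. \<bar>c\<bar>^DIM('a) *\<^sub>R f (t + c *\<^sub>R x))"
    by (subst integrable_density) (auto simp: integrable_distr_eq)
  also have "\<dots> \<longleftrightarrow> integrable lborel (\<lambda>x. f (t + c *\<^sub>R x))"
  proof
    assume "integrable lborel (\<lambda>x. \<bar>c\<bar>^DIM('a) *\<^sub>R f (t + c *\<^sub>R x))"
    from integrable_scaleR_right[OF this, of "inverse (\<bar>c\<bar>^DIM('a))"]
    show "integrable lborel (\<lambda>x. f (t + c *\<^sub>R x))" using c by simp
  qed (rule integrable_scaleR_right)
  finally show "integrable lborel f \<longleftrightarrow> integrable lborel (\<lambda>x. f (t + c *\<^sub>R x))" .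
qed

lemma lborel_nn_integral_translate:
  fixes f :: "'a::euclidean_space \<Rightarrow> ennreal"
  assumes [measurable]: "f \<in> borel_measurable borel"
  shows "(\<integral>\<^sup>+x. f (x + t) \<partial>lborel) = (\<integral>\<^sup>+x. f x \<partial>lborel)"
  by (subst (2) lborel_affine[of 1 t]) (auto simp: nn_integral_density nn_integral_distr add.commute)

lemma lborel_integral_prod:
  fixes g :: "'a::euclidean_space \<Rightarrow> real \<Rightarrow> complex"
  assumes g: "\<And>b. b \<in> Basis \<Longrightarrow> integrable lborel (g b)"
  shows "integrable lborel (\<lambda>x::'a. \<Prod>b\<in>Basis. g b (x \<bullet> b))"
    and "(\<integral>x. (\<Prod>b\<in>Basis. g b (x \<bullet> b)) \<partial>(lborel::'a measure)) = (\<Prod>b\<in>Basis. \<integral>t. g b t \<partial>lborel)"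
proof -
  interpret product_sigma_finite "\<lambda>_::'a. lborel::real measure" by standard
  let ?T = "\<lambda>f. \<Sum>b\<in>Basis. f b *\<^sub>R b :: 'a"
  have [measurable]: "g b \<in> borel_measurable borel" if "b \<in> Basis" for b using g[OF that] by auto
  have T: "?T \<in> measurable (\<Pi>\<^sub>M b\<in>Basis. lborel) borel" by measurable
  have eq: "(\<Prod>b\<in>Basis. g b (?T f \<bullet> b)) = (\<Prod>b\<in>Basis. g b (f b))" for f
    by (intro prod.cong) (auto simp: inner_sum_left_Basis)
  have m: "(\<lambda>x::'a. \<Prod>b\<in>Basis. g b (x \<bullet> b)) \<in> borel_measurable borel" by measurable
  show "integrable lborel (\<lambda>x::'a. \<Prod>b\<in>Basis. g b (x \<bullet> b))"
    using product_integrable_prod[OF finite_Basis g]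
    by (subst lborel_eq, subst integrable_distr_eq[OF T m]) (simp add: eq)
  show "(\<integral>x. (\<Prod>b\<in>Basis. g b (x \<bullet> b)) \<partial>(lborel::'a measure)) = (\<Prod>b\<in>Basis. \<integral>t. g b t \<partial>lborel)"
    using product_integral_prod[OF finite_Basis g]
    by (subst lborel_eq, subst integral_distr[OF T m]) (simp add: eq)
qed

text \<open>This is the characteristic function of the standard normal law at -s, with the
  normalizing factor of the density moved to the right.\<close>

lemma gauss_ft_real:
  fixes s :: real
  shows "integrable lborel (\<lambda>t. exp (- \<i> * of_real (t * s)) * of_real (exp (- t\<^sup>2 / 2)))"
    and "(\<integral>t. exp (- \<i> * of_real (t * s)) * of_real (exp (- t\<^sup>2 / 2)) \<partial>lborel)
      = of_real (sqrt (2 * pi) * exp (- s\<^sup>2 / 2))"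
proof -
  have eq: "exp (- \<i> * of_real (t * s)) * of_real (exp (- t\<^sup>2 / 2))
      = of_real (sqrt (2 * pi)) * (std_normal_density t *\<^sub>R iexp ((-s) * t))" for t
    by (simp add: std_normal_density_def scaleR_conv_of_real mult_ac exp_of_real[symmetric])
  interpret real_distribution std_normal_distribution by (rule real_dist_normal_dist)
  have "integrable std_normal_distribution (\<lambda>t. iexp ((-s) * t))"
    by (rule integrable_iexp) auto
  then have i: "integrable lborel (\<lambda>t. std_normal_density t *\<^sub>R iexp ((-s) * t))"
    by (subst (asm) integrable_density) auto
  then show "integrable lborel (\<lambda>t. exp (- \<i> * of_real (t * s)) * of_real (exp (- t\<^sup>2 / 2)))"
    unfolding eq by (intro integrable_mult_right)
  have "(\<integral>t. std_normal_density t *\<^sub>R iexp ((-s) * t) \<partial>lborel) = char std_normal_distribution (-s)"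
    unfolding char_def by (subst integral_density) auto
  then have "(\<integral>t. std_normal_density t *\<^sub>R iexp ((-s) * t) \<partial>lborel) = of_real (exp (- s\<^sup>2 / 2))"
    by (simp add: char_std_normal_distribution)
  then show "(\<integral>t. exp (- \<i> * of_real (t * s)) * of_real (exp (- t\<^sup>2 / 2)) \<partial>lborel)
      = of_real (sqrt (2 * pi) * exp (- s\<^sup>2 / 2))"
    unfolding eq by (subst integral_mult_right_zero) simp
qed

lemma norm_sq_Basis: "(norm (x::'a::euclidean_space))\<^sup>2 = (\<Sum>b\<in>Basis. (x \<bullet> b)\<^sup>2)"
  unfolding power2_norm_eq_inner by (subst euclidean_inner) (simp add: power2_eq_square)

lemma gauss_ft_1:
  fixes z :: "'a::euclidean_space"
  shows "integrable lborel (\<lambda>x::'a. exp (- \<i> * of_real (x \<bullet> z)) * of_real (exp (- (norm x)\<^sup>2 / 2)))"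
    and "(\<integral>x. exp (- \<i> * of_real (x \<bullet> z)) * of_real (exp (- (norm x)\<^sup>2 / 2)) \<partial>(lborel::'a measure))
      = of_real ((2 * pi) powr (DIM('a) / 2) * exp (- (norm z)\<^sup>2 / 2))"
proof -
  have eq: "exp (- \<i> * of_real (x \<bullet> z)) * of_real (exp (- (norm x)\<^sup>2 / 2))
     = (\<Prod>b\<in>Basis. exp (- \<i> * of_real ((x \<bullet> b) * (z \<bullet> b))) * of_real (exp (- (x \<bullet> b)\<^sup>2 / 2)))" for x :: 'a
    unfolding prod.distrib norm_sq_Basis
    by (subst euclidean_inner[of x z])
      (simp add: exp_sum[symmetric] sum_negf[symmetric] sum_distrib_left sum_divide_distrib
        flip: of_real_prod)
  show "integrable lborel (\<lambda>x::'a. exp (- \<i> * of_real (x \<bullet> z)) * of_real (exp (- (norm x)\<^sup>2 / 2)))"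
    unfolding eq by (rule lborel_integral_prod) (rule gauss_ft_real)
  have "(\<integral>x. exp (- \<i> * of_real (x \<bullet> z)) * of_real (exp (- (norm x)\<^sup>2 / 2)) \<partial>(lborel::'a measure))
     = (\<Prod>b\<in>(Basis::'a set). of_real (sqrt (2 * pi) * exp (- (z \<bullet> b)\<^sup>2 / 2)))"
    unfolding eq by (subst lborel_integral_prod(2), rule gauss_ft_real, simp only: gauss_ft_real)
  also have "\<dots> = of_real (sqrt (2 * pi) ^ DIM('a) * (\<Prod>b\<in>Basis. exp (- (z \<bullet> b)\<^sup>2 / 2)))"
    by (simp add: prod.distrib)
  also have "sqrt (2 * pi) ^ DIM('a) = (2 * pi) powr (DIM('a) / 2)"
    by (simp add: powr_half_sqrt[symmetric] powr_powr powr_realpow[symmetric])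
  also have "(\<Prod>b\<in>Basis. exp (- (z \<bullet> b)\<^sup>2 / 2)) = exp (- (norm z)\<^sup>2 / 2)"
    by (simp add: norm_sq_Basis exp_sum[symmetric] sum_negf sum_divide_distrib)
  finally show "(\<integral>x. exp (- \<i> * of_real (x \<bullet> z)) * of_real (exp (- (norm x)\<^sup>2 / 2)) \<partial>(lborel::'a measure))
      = of_real ((2 * pi) powr (DIM('a) / 2) * exp (- (norm z)\<^sup>2 / 2))" .
qed

lemma gauss_ft:
  fixes z :: "'a::euclidean_space" and e :: real
  assumes e: "e > 0"
  shows "integrable lborel (\<lambda>x::'a. exp (- \<i> * of_real (x \<bullet> z)) * of_real (exp (- (norm (e *\<^sub>R x))\<^sup>2 / 2)))"
    and "(\<integral>x. exp (- \<i> * of_real (x \<bullet> z)) * of_real (exp (- (norm (e *\<^sub>R x))\<^sup>2 / 2)) \<partial>(lborel::'a measure))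
      = of_real ((1 / e) ^ DIM('a) * ((2 * pi) powr (DIM('a) / 2) * exp (- (norm ((1/e) *\<^sub>R z))\<^sup>2 / 2)))"
proof -
  let ?f = "\<lambda>x::'a. exp (- \<i> * of_real (x \<bullet> z)) * of_real (exp (- (norm (e *\<^sub>R x))\<^sup>2 / 2)) :: complex"
  have m: "?f \<in> borel_measurable borel" by measurable
  have eq: "?f (0 + (1/e) *\<^sub>R x) = exp (- \<i> * of_real (x \<bullet> ((1/e) *\<^sub>R z))) * of_real (exp (- (norm x)\<^sup>2 / 2))" for x
    using e by simp
  have e1: "1 / e \<noteq> 0" using e by simp
  show "integrable lborel ?f"
    by (subst lborel_integral_affine(2)[OF e1 m, of 0]) (simp only: eq gauss_ft_1)
  show "integral\<^sup>L lborel ?f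
      = of_real ((1 / e) ^ DIM('a) * ((2 * pi) powr (DIM('a) / 2) * exp (- (norm ((1/e) *\<^sub>R z))\<^sup>2 / 2)))"
    using e by (subst lborel_integral_affine(1)[OF e1 m, of 0]) (simp only: eq gauss_ft_1, simp)
qed

subsection \<open>Continuity of translations\<close>

lemma translate_L2:
  fixes f :: "'a::euclidean_space \<Rightarrow> complex"
  assumes "f \<in> L2 lborel"
  shows "(\<lambda>x. f (x - h)) \<in> L2 lborel" "sqnorm lborel (\<lambda>x. f (x - h)) = sqnorm lborel f"
proof -
  have [measurable]: "f \<in> borel_measurable borel" using assms L2_measurable by fastforce
  show *: "sqnorm lborel (\<lambda>x. f (x - h)) = sqnorm lborel f"
    unfolding sqnorm_def using lborel_nn_integral_translate[of "\<lambda>x. ennreal ((cmod (f x))\<^sup>2)" "-h"] by simp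
  show "(\<lambda>x. f (x - h)) \<in> L2 lborel" using assms by (simp add: L2_iff *)
qed

text \<open>Pointwise convergence can fail only on the faces of the box, a null set. The shifts are
  bounded, so all translated boxes lie in one ball, whose indicator dominates.\<close>

lemma translate_continuous_box:
  fixes a b :: "'a::euclidean_space"
  assumes h: "h \<longlonglongrightarrow> 0"
  shows "l2_tendsto lborel (\<lambda>n x. indicator (box a b) (x - h n)) (indicator (box a b))"
proof -
  obtain r where r: "\<And>x. x \<in> box a b \<Longrightarrow> norm x \<le> r"
    using bounded_box[of a b] by (auto simp: bounded_iff)
  have "Bseq h" using h by (intro convergent_imp_Bseq) (auto simp: convergent_def)
  then obtain C where C: "\<And>n. norm (h n) \<le> C" by (auto simp: Bseq_def)
  have C0: "C \<ge> 0" using C[of 0] norm_ge_zero order_trans by blast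
  show ?thesis
  proof (rule l2_tendsto_dominated[where g="indicator (cball 0 (r + C))"])
    show "indicator (box a b) \<in> L2 lborel"
      by (intro L2_indicator emeasure_lborel_box_finite) auto
    show "indicator (cball 0 (r + C)) \<in> L2 lborel"
      by (intro L2_indicator emeasure_lborel_cball_finite) auto
    show "AE x in lborel. cmod (indicator (box a b) (x - h n) - indicator (box a b) x)
        \<le> cmod (indicator (cball 0 (r + C)) x)" for n
    proof (intro AE_I2)
      fix x
      have "norm x \<le> r + C" if "x - h n \<in> box a b \<or> x \<in> box a b"
        using that r[of "x - h n"] r[of x] C[of n] C0 norm_triangle_sub[of x "h n"] by auto
      then show "cmod (indicator (box a b) (x - h n) - indicator (box a b) x) \<le> cmod (indicator (cball 0 (r + C)) x)"
        by (simp split: split_indicator)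
    qed
    have "AE x in lborel. \<forall>k\<in>Basis. x \<bullet> k \<noteq> a \<bullet> k \<and> x \<bullet> k \<noteq> b \<bullet> k"
      by (subst AE_finite_all) (auto intro!: AE_conjI AE_lborel_inner_neq)
    then show "AE x in lborel. (\<lambda>n. indicator (box a b) (x - h n) :: complex) \<longlonglongrightarrow> indicator (box a b) x"
    proof eventually_elim
      fix x :: 'a assume x: "\<forall>k\<in>Basis. x \<bullet> k \<noteq> a \<bullet> k \<and> x \<bullet> k \<noteq> b \<bullet> k"
      have lim: "(\<lambda>n. x - h n) \<longlonglongrightarrow> x" using tendsto_diff[OF tendsto_const[of x] h] by simp
      have "\<forall>\<^sub>F n in sequentially. (x - h n \<in> box a b) = (x \<in> box a b)"
      proof (cases "x \<in> box a b")
        case True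
        from topological_tendstoD[OF lim open_box True] show ?thesis using True by (auto elim: eventually_mono)
      next
        case False
        then have "x \<in> - cbox a b" using x by (auto simp: box_def cbox_def) (metis less_le)+
        from topological_tendstoD[OF lim open_Compl[OF closed_cbox] this] show ?thesis using False box_subset_cbox[of a b]
          by (auto elim!: eventually_mono)
      qed
      then show "(\<lambda>n. indicator (box a b) (x - h n) :: complex) \<longlonglongrightarrow> indicator (box a b) x"
        by (intro tendsto_eventually) (auto elim!: eventually_mono simp: indicator_def)
    qed
  qed auto
qed

text \<open>Boxes generate the Borel sets, so the property spreads from their indicators by density.
  Closure under limits is a three-term estimate in which translation invariance of the norm controls
  the shifted error.\<close>

lemma translate_continuous_L2:
  fixes f :: "'a::euclidean_space \<Rightarrow> complex"
  assumes f: "f \<in> L2 lborel" and h: "h \<longlonglongrightarrow> 0"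
  shows "l2_tendsto lborel (\<lambda>n x. f (x - h n)) f"
proof (rule L2_dense_generator[where M=lborel and G="range (\<lambda>(a,b). box a b)" and R="\<lambda>n. box (- real n *\<^sub>R One) (real n *\<^sub>R One)"
      and f=f and Q="\<lambda>f. l2_tendsto lborel (\<lambda>n x. f (x - h n)) f", OF _ _ _ _ _ _ _ _ _ _ f])
  show "Int_stable (range (\<lambda>(a, b). box a b :: 'a set))"
    by (auto simp: Int_stable_def box_Int_box)
  show "sets lborel = sigma_sets (space lborel) (range (\<lambda>(a, b). box a b :: 'a set))"
    by (simp add: borel_eq_box sets_measure_of)
  show "(\<Union>n. box (- real n *\<^sub>R One) (real n *\<^sub>R One) :: 'a set) = space lborel"
    using UN_box_eq_UNIV by simp
  show "incseq (\<lambda>n. box (- real n *\<^sub>R One) (real n *\<^sub>R One) :: 'a set)"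
    by (auto simp: incseq_def box_def inner_sum_left inner_Basis if_distrib intro: order.strict_trans2 order.strict_trans1)
  show "l2_tendsto lborel (\<lambda>n x. c * f (x - h n) + d * g (x - h n)) (\<lambda>x. c * f x + d * g x)"
    if "f \<in> L2 lborel" "g \<in> L2 lborel" "l2_tendsto lborel (\<lambda>n x. f (x - h n)) f" "l2_tendsto lborel (\<lambda>n x. g (x - h n)) g" 
    for f g :: "'a \<Rightarrow> complex" and c d
    using that by (intro l2_tendsto_lincomb translate_L2)
  show "l2_tendsto lborel (\<lambda>n x. f (x - h n)) f"
    if F: "\<And>n. F n \<in> L2 lborel" "\<And>k. l2_tendsto lborel (\<lambda>n x. F k (x - h n)) (F k)" "f \<in> L2 lborel" "l2_tendsto lborel F f"
    for F and f :: "'a \<Rightarrow> complex"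
    unfolding l2_tendsto_def
  proof (rule order_tendstoI)
    fix y :: ennreal assume "0 < y"
    then obtain e where e: "e > 0" "ennreal e < y" by (rule ennreal_pos_exists_less)
    have "\<forall>\<^sub>F k in sequentially. sqnorm lborel (\<lambda>x. F k x - f x) < ennreal (e/12)"
      using F(4) e unfolding l2_tendsto_def by (intro order_tendstoD(2)) auto
    then obtain k where k: "sqnorm lborel (\<lambda>x. F k x - f x) < ennreal (e/12)"
      by (auto simp: eventually_sequentially)
    have "\<forall>\<^sub>F n in sequentially. sqnorm lborel (\<lambda>x. F k (x - h n) - F k x) < ennreal (e/12)"
      using F(2)[of k] e unfolding l2_tendsto_def by (intro order_tendstoD(2)) auto
    then show "\<forall>\<^sub>F n in sequentially. sqnorm lborel (\<lambda>x. f (x - h n) - f x) < y"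
    proof eventually_elim
      fix n assume n: "sqnorm lborel (\<lambda>x. F k (x - h n) - F k x) < ennreal (e/12)"
      have [measurable]: "f \<in> borel_measurable borel" "F k \<in> borel_measurable borel"
        using F(3) F(1)[of k] L2_measurable by fastforce+
      have two: "2 * ennreal r = ennreal (2 * r)" if "r \<ge> 0" for r using that by (simp add: ennreal_mult)
      have "sqnorm lborel (\<lambda>x. f (x - h n) - F k (x - h n)) = sqnorm lborel (\<lambda>x. f x - F k x)"
        using translate_L2(2)[OF L2_diff[OF F(3) F(1)[of k]], of "h n"] by simp
      also have "\<dots> < ennreal (e/12)" using k by (simp add: sqnorm_minus_commute)
      finally have t: "sqnorm lborel (\<lambda>x. f (x - h n) - F k (x - h n)) \<le> ennreal (e/12)" by simp
      have "sqnorm lborel (\<lambda>x. f (x - h n) - f x)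
        = sqnorm lborel (\<lambda>x. ((f (x - h n) - F k (x - h n)) + (F k (x - h n) - F k x)) + (F k x - f x))" by simp
      also have "\<dots> \<le> 2 * sqnorm lborel (\<lambda>x. (f (x - h n) - F k (x - h n)) + (F k (x - h n) - F k x)) + 2 * sqnorm lborel (\<lambda>x. F k x - f x)"
        by (intro sqnorm_add_le) auto
      also have "\<dots> \<le> 2 * (2 * sqnorm lborel (\<lambda>x. f (x - h n) - F k (x - h n)) + 2 * sqnorm lborel (\<lambda>x. F k (x - h n) - F k x)) + 2 * sqnorm lborel (\<lambda>x. F k x - f x)"
        by (intro add_mono mult_left_mono sqnorm_add_le) auto
      \<comment> \<open>The coefficients 4, 4 and 2 sum to 10, so a tolerance of e/12 for each term
        leaves room below e.\<close>
      also have "\<dots> \<le> 2 * (2 * ennreal (e/12) + 2 * ennreal (e/12)) + 2 * ennreal (e/12)"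
        using k n t by (intro add_mono mult_left_mono) auto
      also have "\<dots> = ennreal (2 * (2 * (e/12) + 2 * (e/12)) + 2 * (e/12))"
        using e by (simp add: two ennreal_plus[symmetric] del: ennreal_plus)
      also have "\<dots> < y" using e by (intro le_less_trans[OF _ e(2)] ennreal_leI) simp
      finally show "sqnorm lborel (\<lambda>x. f (x - h n) - f x) < y" .
    qed
  qed auto
qed (auto simp: translate_continuous_box[OF h] emeasure_lborel_box_finite)

subsection \<open>Plancherel's theorem\<close>

lemma integrable_tensor:
  fixes f :: "'a \<Rightarrow> complex" and g :: "'b \<Rightarrow> complex"
  assumes "sigma_finite_measure M" "sigma_finite_measure N"
    and f: "integrable M f" and g: "integrable N g"
  shows "integrable (M \<Otimes>\<^sub>M N) (\<lambda>p. f (fst p) * g (snd p))"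
    and "(\<integral>p. f (fst p) * g (snd p) \<partial>(M \<Otimes>\<^sub>M N)) = (\<integral>x. f x \<partial>M) * (\<integral>y. g y \<partial>N)"
proof -
  interpret M: sigma_finite_measure M by fact
  interpret N: sigma_finite_measure N by fact
  interpret pair_sigma_finite M N ..
  have [measurable]: "f \<in> borel_measurable M" "g \<in> borel_measurable N" using f g by auto
  have "integrable (M \<Otimes>\<^sub>M N) (\<lambda>(x, y). f x * g y)"
  proof (rule Fubini_integrable)
    show "integrable M (\<lambda>x. \<integral>y. norm (case (x, y) of (x, y) \<Rightarrow> f x * g y) \<partial>N)"
      using f by (simp add: norm_mult)
    show "AE x in M. integrable N (\<lambda>y. case (x, y) of (x, y) \<Rightarrow> f x * g y)"
      using g by simp
  qed auto
  then show i: "integrable (M \<Otimes>\<^sub>M N) (\<lambda>p. f (fst p) * g (snd p))"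
    by (simp add: case_prod_unfold)
  show "(\<integral>p. f (fst p) * g (snd p) \<partial>(M \<Otimes>\<^sub>M N)) = (\<integral>x. f x \<partial>M) * (\<integral>y. g y \<partial>N)"
    by (subst integral_fst'[OF i, symmetric]) simp
qed

definition ft :: "('a::euclidean_space \<Rightarrow> complex) \<Rightarrow> 'a \<Rightarrow> complex" where
  "ft f x = of_real ((2 * pi) powr (- (real DIM('a) / 2))) *
     (\<integral>\<xi>. exp (- \<i> * of_real (x \<bullet> \<xi>)) * f \<xi> \<partial>lborel)"

lemma norm_iexp [simp]: "cmod (exp (- \<i> * of_real t)) = 1" "cmod (exp (- (\<i> * of_real t))) = 1"
  by (simp_all add: norm_exp_eq_Re)

lemma integrable_iexp_mult:
  fixes f :: "'a::euclidean_space \<Rightarrow> complex"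
  assumes f: "integrable lborel f"
  shows "integrable lborel (\<lambda>\<xi>. exp (- \<i> * of_real (x \<bullet> \<xi>)) * f \<xi>)"
proof (rule Bochner_Integration.integrable_bound[OF f])
  have [measurable]: "f \<in> borel_measurable borel" using f by auto
  show "(\<lambda>\<xi>. exp (- \<i> * of_real (x \<bullet> \<xi>)) * f \<xi>) \<in> borel_measurable lborel" by measurable
qed (simp add: norm_mult)

lemma ft_measurable [measurable]:
  fixes f :: "'a::euclidean_space \<Rightarrow> complex"
  assumes [measurable]: "f \<in> borel_measurable borel"
  shows "ft f \<in> borel_measurable borel"
  unfolding ft_def by measurable

text \<open>The Gaussian damping makes the triple integral over x, \<xi> and \<eta> absolutely
  convergent after |ft f|^2 is expanded. Integrating x first leaves a Gaussian in (\<xi> -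
  \<eta>)/e, and rescaling turns the result into a Gaussian average of the autocorrelation of f at
  the shifts e z.\<close>

lemma ft_gauss:
  fixes f :: "'a::euclidean_space \<Rightarrow> complex" and e :: real
  assumes f: "f \<in> L2 lborel" "integrable lborel f" and e: "e > 0"
  shows "integrable lborel (\<lambda>x. (cmod (ft f x))\<^sup>2 * exp (- (norm (e *\<^sub>R x))\<^sup>2 / 2))" (is ?I)
    and "of_real (\<integral>x. (cmod (ft f x))\<^sup>2 * exp (- (norm (e *\<^sub>R x))\<^sup>2 / 2) \<partial>lborel) =
      of_real ((2 * pi) powr (- (real DIM('a) / 2))) *
        (\<integral>z. of_real (exp (- (norm z)\<^sup>2 / 2)) * l2_inner lborel f (\<lambda>\<xi>. f (\<xi> - e *\<^sub>R z)) \<partial>lborel)" (is ?E)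
proof -
  have [measurable]: "f \<in> borel_measurable borel" using f by auto
  define c where "c = complex_of_real ((2 * pi) powr (- (real DIM('a) / 2)))"
  define G where "G x = complex_of_real (exp (- (norm (e *\<^sub>R x))\<^sup>2 / 2))" for x :: 'a
  define K where "K x \<xi> = exp (- \<i> * of_real (x \<bullet> \<xi>))" for x \<xi> :: 'a
  have [measurable]: "G \<in> borel_measurable borel" unfolding G_def by measurable
  have [measurable]: "(\<lambda>p. K (fst p) (snd p)) \<in> borel_measurable (borel \<Otimes>\<^sub>M borel)" unfolding K_def by measurable
  have Gi: "integrable lborel G" using gauss_ft(1)[OF e, of 0] unfolding G_def by simp
  define ff where "ff p = f (fst p) * cnj (f (snd p))" for p :: "'a \<times> 'a"
  have ffi: "integrable (lborel \<Otimes>\<^sub>M lborel) ff"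
    unfolding ff_def using f by (intro integrable_tensor(1)) (auto simp: lborel.sigma_finite_measure_axioms)
  have [measurable]: "ff \<in> borel_measurable (borel \<Otimes>\<^sub>M borel)" unfolding ff_def by measurable
  define H where "H x p = G x * (K x (fst p) * cnj (K x (snd p))) * ff p" for x :: 'a and p
  have sf2: "sigma_finite_measure (lborel \<Otimes>\<^sub>M lborel :: ('a \<times> 'a) measure)"
    unfolding lborel_prod by (rule lborel.sigma_finite_measure_axioms)
  interpret L2: sigma_finite_measure "lborel \<Otimes>\<^sub>M lborel :: ('a \<times> 'a) measure" by (rule sf2)
  interpret LL: pair_sigma_finite "lborel :: 'a measure" "lborel \<Otimes>\<^sub>M lborel :: ('a \<times> 'a) measure" ..
  have Hi: "integrable (lborel \<Otimes>\<^sub>M (lborel \<Otimes>\<^sub>M lborel)) (\<lambda>(x, p). H x p)"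
  proof (rule Bochner_Integration.integrable_bound)
    show "integrable (lborel \<Otimes>\<^sub>M (lborel \<Otimes>\<^sub>M lborel)) (\<lambda>q. G (fst q) * ff (snd q))"
      by (intro integrable_tensor(1) Gi ffi sf2) (simp add: lborel.sigma_finite_measure_axioms)
    show "(\<lambda>(x, p). H x p) \<in> borel_measurable (lborel \<Otimes>\<^sub>M (lborel \<Otimes>\<^sub>M lborel))"
      unfolding H_def K_def by measurable
    show "AE q in lborel \<Otimes>\<^sub>M (lborel \<Otimes>\<^sub>M lborel). norm (case q of (x, p) \<Rightarrow> H x p) \<le> norm (G (fst q) * ff (snd q))"
      by (simp add: H_def K_def norm_mult case_prod_unfold)
  qed
  have inner: "(\<integral>p. H x p \<partial>(lborel \<Otimes>\<^sub>M lborel)) * c\<^sup>2 = of_real ((cmod (ft f x))\<^sup>2 * exp (- (norm (e *\<^sub>R x))\<^sup>2 / 2))" for x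
  proof -
    have "(\<integral>p. H x p \<partial>(lborel \<Otimes>\<^sub>M lborel)) =
       G x * (\<integral>p. (K x (fst p) * f (fst p)) * cnj (K x (snd p) * f (snd p)) \<partial>(lborel \<Otimes>\<^sub>M lborel))"
      unfolding H_def ff_def by (subst integral_mult_right_zero[symmetric]) (simp add: mult_ac)
    also have "(\<integral>p. (K x (fst p) * f (fst p)) * cnj (K x (snd p) * f (snd p)) \<partial>(lborel \<Otimes>\<^sub>M lborel)) =
        (\<integral>\<xi>. K x \<xi> * f \<xi> \<partial>lborel) * (\<integral>\<xi>. cnj (K x \<xi> * f \<xi>) \<partial>lborel)"
      using f unfolding K_def
      by (intro integrable_tensor(2) integrable_iexp_mult) (auto simp: lborel.sigma_finite_measure_axioms simp del: complex_cnj_mult intro!: integrable_iexp_mult[unfolded mult_minus_left])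
    also have "(\<integral>\<xi>. cnj (K x \<xi> * f \<xi>) \<partial>lborel) = cnj (\<integral>\<xi>. K x \<xi> * f \<xi> \<partial>lborel)"
      by (rule Bochner_Integration.integral_cnj)
    finally have "(\<integral>p. H x p \<partial>(lborel \<Otimes>\<^sub>M lborel)) * c\<^sup>2 = G x * ((c * (\<integral>\<xi>. K x \<xi> * f \<xi> \<partial>lborel)) * cnj (c * (\<integral>\<xi>. K x \<xi> * f \<xi> \<partial>lborel)))"
      by (simp add: c_def power2_eq_square mult_ac)
    also have "c * (\<integral>\<xi>. K x \<xi> * f \<xi> \<partial>lborel) = ft f x" by (simp add: ft_def c_def K_def)
    finally show ?thesis by (simp add: complex_norm_square[symmetric] G_def mult.commute flip: of_real_power)
  qed
  have Hx: "integrable lborel (\<lambda>x. \<integral>p. H x p \<partial>(lborel \<Otimes>\<^sub>M lborel))"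
    using LL.integrable_fst'[OF Hi] by simp
  from integrable_mult_left[OF this, of "c\<^sup>2"]
  have "integrable lborel (\<lambda>x. complex_of_real ((cmod (ft f x))\<^sup>2 * exp (- (norm (e *\<^sub>R x))\<^sup>2 / 2)))"
    unfolding inner .
  then show ?I by (subst (asm) complex_of_real_integrable_eq)
  define d where "d = complex_of_real ((2 * pi) powr (real DIM('a) / 2))"
  have cd: "c * d = 1" unfolding c_def d_def by (simp add: powr_add[symmetric] flip: of_real_mult)
  define g where "g z = complex_of_real (exp (- (norm z)\<^sup>2 / 2))" for z :: 'a
  have [measurable]: "g \<in> borel_measurable borel" unfolding g_def by measurable
  have gi: "integrable lborel g" using gauss_ft_1(1)[of 0] unfolding g_def by simp
  have xint: "(\<integral>x. H x p \<partial>lborel) = ff p * (of_real ((1 / e) ^ DIM('a)) * (d * g ((1/e) *\<^sub>R (fst p - snd p))))" for p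
  proof -
    have "H x p = ff p * (exp (- \<i> * of_real (x \<bullet> (fst p - snd p))) * G x)" for x
      by (simp add: H_def K_def exp_cnj inner_diff_right algebra_simps exp_add[symmetric] exp_diff exp_minus divide_inverse)
    then have "(\<integral>x. H x p \<partial>lborel) = ff p * (\<integral>x. exp (- \<i> * of_real (x \<bullet> (fst p - snd p))) * G x \<partial>lborel)" by simp
    then show ?thesis unfolding G_def gauss_ft(2)[OF e] g_def d_def by simp
  qed
  have J: "integrable (lborel \<Otimes>\<^sub>M lborel) (\<lambda>p. \<integral>x. H x p \<partial>lborel)"
    using LL.integrable_snd[OF Hi] by simp
  have "(\<integral>x. (\<integral>p. H x p \<partial>(lborel \<Otimes>\<^sub>M lborel)) \<partial>lborel) = (\<integral>p. (\<integral>x. H x p \<partial>lborel) \<partial>(lborel \<Otimes>\<^sub>M lborel))"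
    using LL.Fubini_integral[OF Hi] by simp
  also have "\<dots> = (\<integral>\<xi>. (\<integral>\<eta>. (\<integral>x. H x (\<xi>, \<eta>) \<partial>lborel) \<partial>lborel) \<partial>lborel)"
    by (rule lborel_pair.integral_fst'[OF J, symmetric])
  also have "\<dots> = (\<integral>\<xi>. d * (\<integral>z. g z * (f \<xi> * cnj (f (\<xi> - e *\<^sub>R z))) \<partial>lborel) \<partial>lborel)"
  proof (rule Bochner_Integration.integral_cong[OF refl])
    fix \<xi> :: 'a
    let ?h = "\<lambda>\<eta>. \<integral>x. H x (\<xi>, \<eta>) \<partial>lborel"
    have m: "?h \<in> borel_measurable borel" unfolding xint ff_def fst_conv snd_conv by measurable
    have e': "- e \<noteq> 0" using e by simp
    \<comment> \<open>The substitution \<eta> = \<xi> - e z cancels the factor (1/e)^dim that the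
      x-integral has produced.\<close>
    have "(\<integral>\<eta>. ?h \<eta> \<partial>lborel) = of_real (e ^ DIM('a)) * (\<integral>z. ?h (\<xi> + (- e) *\<^sub>R z) \<partial>lborel)"
      using lborel_integral_affine(1)[OF e' m, of \<xi>] e by simp
    also have "\<dots> = (\<integral>z. of_real (e ^ DIM('a)) * ?h (\<xi> + (- e) *\<^sub>R z) \<partial>lborel)" by simp
    also have "\<dots> = (\<integral>z. d * (g z * (f \<xi> * cnj (f (\<xi> - e *\<^sub>R z)))) \<partial>lborel)"
      unfolding xint ff_def using e by (intro Bochner_Integration.integral_cong refl) (simp add: power_one_over field_simps)
    finally show "(\<integral>\<eta>. ?h \<eta> \<partial>lborel) = d * (\<integral>z. g z * (f \<xi> * cnj (f (\<xi> - e *\<^sub>R z))) \<partial>lborel)" by simp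
  qed
  also have "\<dots> = d * (\<integral>\<xi>. (\<integral>z. g z * (f \<xi> * cnj (f (\<xi> - e *\<^sub>R z))) \<partial>lborel) \<partial>lborel)" by simp
  also have "(\<integral>\<xi>. (\<integral>z. g z * (f \<xi> * cnj (f (\<xi> - e *\<^sub>R z))) \<partial>lborel) \<partial>lborel)
     = (\<integral>z. (\<integral>\<xi>. g z * (f \<xi> * cnj (f (\<xi> - e *\<^sub>R z))) \<partial>lborel) \<partial>lborel)"
  proof (rule lborel_pair.Fubini_integral)
    define B where "B = (\<integral>x. (cmod (f x))\<^sup>2 \<partial>lborel)"
    \<comment> \<open>By 2ab \<le> a^2 + b^2 and translation invariance the autocorrelation is
      bounded by B uniformly in the shift, which is the majorant for exchanging z and \<xi>.\<close>
    have bd: "integrable lborel (\<lambda>\<xi>. f \<xi> * cnj (f (\<xi> - h)))" 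
      "(\<integral>\<xi>. norm (f \<xi> * cnj (f (\<xi> - h))) \<partial>lborel) \<le> B" for h
    proof -
      show i: "integrable lborel (\<lambda>\<xi>. f \<xi> * cnj (f (\<xi> - h)))" by (intro L2_inner_integrable f translate_L2)
      have fi: "integrable lborel (\<lambda>x. (cmod (f x))\<^sup>2)" "integrable lborel (\<lambda>x. (cmod (f (x - h)))\<^sup>2)"
        using f(1) translate_L2(1)[OF f(1), of h] by (auto simp: L2_def)
      have "ennreal (\<integral>x. (cmod (f (x - h)))\<^sup>2 \<partial>lborel) = ennreal B"
        using translate_L2[OF f(1), of h] f(1) by (simp add: sqnorm_eq_integral B_def)
      then have eqB: "(\<integral>x. (cmod (f (x - h)))\<^sup>2 \<partial>lborel) = B" unfolding B_def by (subst (asm) ennreal_inj) auto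
      have "(\<integral>\<xi>. norm (f \<xi> * cnj (f (\<xi> - h))) \<partial>lborel) \<le> (\<integral>\<xi>. ((cmod (f \<xi>))\<^sup>2 + (cmod (f (\<xi> - h)))\<^sup>2) / 2 \<partial>lborel)"
      proof (intro integral_mono integrable_norm i)
        show "norm (f \<xi> * cnj (f (\<xi> - h))) \<le> ((cmod (f \<xi>))\<^sup>2 + (cmod (f (\<xi> - h)))\<^sup>2) / 2" for \<xi>
          using sum_squares_bound[of "cmod (f \<xi>)" "cmod (f (\<xi> - h))"] by (simp add: norm_mult)
      qed (use fi in simp)
      also have "\<dots> = B" using fi eqB by (simp add: B_def)
      finally show "(\<integral>\<xi>. norm (f \<xi> * cnj (f (\<xi> - h))) \<partial>lborel) \<le> B" .
    qed
    have "integrable (lborel \<Otimes>\<^sub>M lborel) (\<lambda>p. g (fst p) * (f (snd p) * cnj (f (snd p - e *\<^sub>R fst p))))"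
    proof (rule lborel_pair.Fubini_integrable)
      show "(\<lambda>p. g (fst p) * (f (snd p) * cnj (f (snd p - e *\<^sub>R fst p)))) \<in> borel_measurable (lborel \<Otimes>\<^sub>M lborel)"
        by measurable
      show "integrable lborel (\<lambda>z. \<integral>\<xi>. norm (g (fst (z, \<xi>)) * (f (snd (z, \<xi>)) * cnj (f (snd (z, \<xi>) - e *\<^sub>R fst (z, \<xi>))))) \<partial>lborel)"
      proof (rule Bochner_Integration.integrable_bound)
        show "integrable lborel (\<lambda>z. B * norm (g z))" using gi by simp
        show "AE z in lborel. norm (\<integral>\<xi>. norm (g (fst (z, \<xi>)) * (f (snd (z, \<xi>)) * cnj (f (snd (z, \<xi>) - e *\<^sub>R fst (z, \<xi>))))) \<partial>lborel) \<le> norm (B * norm (g z))"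
        proof (intro AE_I2)
          fix z
          have "norm (\<integral>\<xi>. norm (g z * (f \<xi> * cnj (f (\<xi> - e *\<^sub>R z)))) \<partial>lborel) = norm (g z) * (\<integral>\<xi>. norm (f \<xi> * cnj (f (\<xi> - e *\<^sub>R z))) \<partial>lborel)"
            by (simp add: norm_mult[of "g z"] abs_mult)
          also have "\<dots> \<le> norm (g z) * B" by (intro mult_left_mono bd) auto
          also have "\<dots> \<le> norm (B * norm (g z))" by (simp add: abs_mult mult.commute mult_left_mono mult_right_mono)
          finally show "norm (\<integral>\<xi>. norm (g (fst (z, \<xi>)) * (f (snd (z, \<xi>)) * cnj (f (snd (z, \<xi>) - e *\<^sub>R fst (z, \<xi>))))) \<partial>lborel) \<le> norm (B * norm (g z))"
            by simp
        qed
      qed measurable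
    qed (use bd in simp)
    then show "integrable (lborel \<Otimes>\<^sub>M lborel) (\<lambda>(z, \<xi>). g z * (f \<xi> * cnj (f (\<xi> - e *\<^sub>R z))))"
      by (simp add: case_prod_unfold)
  qed
  also have "\<dots> = (\<integral>z. g z * l2_inner lborel f (\<lambda>\<xi>. f (\<xi> - e *\<^sub>R z)) \<partial>lborel)"
    by (simp add: l2_inner_def)
  finally have fin: "(\<integral>x. (\<integral>p. H x p \<partial>(lborel \<Otimes>\<^sub>M lborel)) \<partial>lborel) = d * (\<integral>z. g z * l2_inner lborel f (\<lambda>\<xi>. f (\<xi> - e *\<^sub>R z)) \<partial>lborel)" .
  have "of_real (\<integral>x. (cmod (ft f x))\<^sup>2 * exp (- (norm (e *\<^sub>R x))\<^sup>2 / 2) \<partial>lborel) =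
     (\<integral>x. (\<integral>p. H x p \<partial>(lborel \<Otimes>\<^sub>M lborel)) * c\<^sup>2 \<partial>lborel)"
    unfolding inner by (rule integral_complex_of_real[symmetric])
  also have "\<dots> = (c * d) * c * (\<integral>z. g z * l2_inner lborel f (\<lambda>\<xi>. f (\<xi> - e *\<^sub>R z)) \<partial>lborel)"
    unfolding integral_mult_left_zero fin by (simp add: power2_eq_square mult_ac)
  finally show ?E unfolding cd by (simp add: c_def g_def)
qed

text \<open>Let e tend to 0 in \<open>ft_gauss\<close>. The damped integrals increase to the norm of
  the transform by monotone convergence; the autocorrelation averages tend to the norm of f by
  dominated convergence and continuity of translations.\<close>

theorem plancherel:
  fixes f :: "'a::euclidean_space \<Rightarrow> complex"
  assumes f: "f \<in> L2 lborel" "integrable lborel f"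
  shows "ft f \<in> L2 lborel" "sqnorm lborel (ft f) = sqnorm lborel f"
proof -
  have [measurable]: "f \<in> borel_measurable borel" using f by auto
  define e where "e n = 1 / real (Suc n)" for n
  have e: "e n > 0" for n by (simp add: e_def)
  have e0: "e \<longlonglongrightarrow> 0" unfolding e_def by (rule LIMSEQ_Suc[OF lim_1_over_n])
  define c where "c = (2 * pi) powr (- (real DIM('a) / 2))"
  define g where "g z = exp (- (norm z)\<^sup>2 / 2)" for z :: 'a
  have [measurable]: "g \<in> borel_measurable borel" unfolding g_def by measurable
  have gi: "integrable lborel (\<lambda>z. complex_of_real (g z))" using gauss_ft_1(1)[of 0] by (simp add: g_def)
  have gI: "(\<integral>z. complex_of_real (g z) \<partial>lborel) = of_real ((2 * pi) powr (real DIM('a) / 2))"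
    using gauss_ft_1(2)[of "0::'a"] by (simp add: g_def)
  have gR: "(\<integral>z. g z \<partial>lborel) = (2 * pi) powr (real DIM('a) / 2)"
    using gI unfolding integral_complex_of_real of_real_eq_iff .
  define S where "S = enn2real (sqnorm lborel f)"
  have SS: "sqnorm lborel f = ennreal S" using f(1) by (simp add: S_def L2_iff)
  have S0: "S \<ge> 0" by (simp add: S_def)
  define A where "A h = l2_inner lborel f (\<lambda>\<xi>. f (\<xi> - h))" for h
  have Ab: "cmod (A h) \<le> S" for h
  proof -
    have "ennreal (cmod (A h)) ^ 2 \<le> ennreal S * ennreal S"
      using l2_inner_cauchy_schwarz[OF f(1) translate_L2(1)[OF f(1), of h]] translate_L2(2)[OF f(1), of h]
      by (simp add: A_def SS)
    then have "(cmod (A h))\<^sup>2 \<le> S\<^sup>2"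
      using S0 by (simp add: ennreal_power ennreal_mult[symmetric] power2_eq_square)
    then show ?thesis using S0 by (rule power2_le_imp_le)
  qed
  have Am [measurable]: "(\<lambda>z. A (e n *\<^sub>R z)) \<in> borel_measurable borel" for n
    unfolding A_def l2_inner_def by measurable
  have Al: "(\<lambda>n. A (e n *\<^sub>R z)) \<longlonglongrightarrow> of_real S" for z
  proof -
    have "(\<lambda>n. e n *\<^sub>R z) \<longlonglongrightarrow> 0 *\<^sub>R z" by (intro tendsto_intros e0)
    then have "l2_tendsto lborel (\<lambda>n x. f (x - e n *\<^sub>R z)) f" by (intro translate_continuous_L2 f) simp
    from l2_tendsto_inner[OF this translate_L2(1)[OF f(1)] f(1) f(1)]
    have "(\<lambda>n. cnj (A (e n *\<^sub>R z))) \<longlonglongrightarrow> l2_inner lborel f f"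
      unfolding A_def by (subst l2_inner_commute[symmetric])
    from tendsto_cnj[OF this] show ?thesis by (simp add: l2_inner_self[OF f(1)] S_def)
  qed
  define I where "I n = (\<integral>x. (cmod (ft f x))\<^sup>2 * exp (- (norm (e n *\<^sub>R x))\<^sup>2 / 2) \<partial>lborel)" for n
  have "(\<lambda>n. \<integral>z. of_real (g z) * A (e n *\<^sub>R z) \<partial>lborel) \<longlonglongrightarrow> (\<integral>z. of_real (g z) * of_real S \<partial>lborel)"
  proof (rule integral_dominated_convergence[where w="\<lambda>z. S * norm (complex_of_real (g z))"])
    show "integrable lborel (\<lambda>z. S * norm (complex_of_real (g z)))" using gi by (intro integrable_mult_right integrable_norm)
    show "AE z in lborel. norm (of_real (g z) * A (e n *\<^sub>R z)) \<le> S * norm (complex_of_real (g z))" for n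
      by (intro AE_I2) (simp add: norm_mult mult.commute[of S] mult_left_mono Ab)
    show "AE z in lborel. (\<lambda>n. of_real (g z) * A (e n *\<^sub>R z)) \<longlonglongrightarrow> of_real (g z) * of_real S"
      by (intro AE_I2 tendsto_mult Al tendsto_const)
  qed measurable
  also have "(\<integral>z. complex_of_real (g z) * of_real S \<partial>lborel) = of_real ((2 * pi) powr (real DIM('a) / 2) * S)"
    by (simp add: gR)
  finally have "(\<lambda>n. of_real c * (\<integral>z. of_real (g z) * A (e n *\<^sub>R z) \<partial>lborel)) \<longlonglongrightarrow>
     of_real c * of_real ((2 * pi) powr (real DIM('a) / 2) * S)"
    by (intro tendsto_mult tendsto_const)
  moreover have "of_real c * (\<integral>z. of_real (g z) * A (e n *\<^sub>R z) \<partial>lborel) = complex_of_real (I n)" for n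
    using ft_gauss(2)[OF f e[of n]] by (simp add: I_def A_def g_def c_def)
  moreover have "complex_of_real c * of_real ((2 * pi) powr (real DIM('a) / 2) * S) = of_real S"
    unfolding of_real_mult[symmetric] c_def mult.assoc[symmetric] powr_add[symmetric] by simp
  ultimately have "(\<lambda>n. complex_of_real (I n)) \<longlonglongrightarrow> of_real S" by (simp only:)
  from tendsto_Re[OF this] have "I \<longlonglongrightarrow> S" by simp
  then have lim1: "(\<lambda>n. ennreal (I n)) \<longlonglongrightarrow> ennreal S" by (rule tendsto_ennrealI)
  let ?h = "\<lambda>n x. ennreal ((cmod (ft f x))\<^sup>2 * exp (- (norm (e n *\<^sub>R x))\<^sup>2 / 2))"
  have Ieq: "ennreal (I n) = (\<integral>\<^sup>+x. ?h n x \<partial>lborel)" for n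
    unfolding I_def by (rule nn_integral_eq_integral[symmetric, OF ft_gauss(1)[OF f e]]) simp
  have mono: "incseq ?h"
  proof (rule incseq_SucI, rule le_funI, rule ennreal_leI, rule mult_left_mono)
    fix n and x :: 'a
    have "(norm (e (Suc n) *\<^sub>R x))\<^sup>2 \<le> (norm (e n *\<^sub>R x))\<^sup>2"
      by (intro power_mono) (auto simp: e_def intro!: mult_right_mono divide_left_mono)
    then show "exp (- (norm (e n *\<^sub>R x))\<^sup>2 / 2) \<le> exp (- (norm (e (Suc n) *\<^sub>R x))\<^sup>2 / 2)" by simp
  qed simp
  have hl: "(\<lambda>n. ?h n x) \<longlonglongrightarrow> ennreal ((cmod (ft f x))\<^sup>2)" for x
  proof -
    have "(\<lambda>n. (cmod (ft f x))\<^sup>2 * exp (- (norm (e n *\<^sub>R x))\<^sup>2 / 2)) \<longlonglongrightarrow> (cmod (ft f x))\<^sup>2 * exp (- (norm (0 *\<^sub>R x))\<^sup>2 / 2)"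
      by (intro tendsto_intros e0) simp
    then show ?thesis by (intro tendsto_ennrealI) simp
  qed
  have "(\<lambda>n. \<integral>\<^sup>+x. ?h n x \<partial>lborel) \<longlonglongrightarrow> (\<integral>\<^sup>+x. ennreal ((cmod (ft f x))\<^sup>2) \<partial>lborel)"
    by (rule nn_integral_LIMSEQ[OF mono _ hl]) measurable
  then have "(\<lambda>n. ennreal (I n)) \<longlonglongrightarrow> sqnorm lborel (ft f)" unfolding Ieq sqnorm_def .
  with lim1 show eq: "sqnorm lborel (ft f) = sqnorm lborel f"
    unfolding SS using LIMSEQ_unique by blast
  show "ft f \<in> L2 lborel" by (simp add: L2_iff eq SS)
qed

subsection \<open>The partial Fourier transform\<close>

text \<open>Fubini for a kernel that is symmetric in its two variables. This is the source of the
  adjoint of the transform.\<close>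

lemma ft_multiplication:
  fixes f g :: "'a::euclidean_space \<Rightarrow> complex"
  assumes f: "integrable lborel f" and g: "integrable lborel g"
  shows "(\<integral>x. ft f x * g x \<partial>lborel) = (\<integral>x. f x * ft g x \<partial>lborel)"
proof -
  have [measurable]: "f \<in> borel_measurable borel" "g \<in> borel_measurable borel" using f g by auto
  define c where "c = complex_of_real ((2 * pi) powr (- (real DIM('a) / 2)))"
  define K where "K x \<xi> = exp (- \<i> * of_real (x \<bullet> \<xi>))" for x \<xi> :: 'a
  have i: "integrable (lborel \<Otimes>\<^sub>M lborel) (\<lambda>(x, \<xi>). K x \<xi> * (g x * f \<xi>))"
  proof (rule Bochner_Integration.integrable_bound)
    show "integrable (lborel \<Otimes>\<^sub>M lborel) (\<lambda>p. g (fst p) * f (snd p))"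
      by (intro integrable_tensor(1) f g) (auto simp: lborel.sigma_finite_measure_axioms)
    show "(\<lambda>(x, \<xi>). K x \<xi> * (g x * f \<xi>)) \<in> borel_measurable (lborel \<Otimes>\<^sub>M lborel)"
      unfolding K_def by measurable
  qed (simp add: K_def norm_mult case_prod_unfold)
  have "(\<integral>x. ft f x * g x \<partial>lborel) = (\<integral>x. c * (\<integral>\<xi>. K x \<xi> * (g x * f \<xi>) \<partial>lborel) \<partial>lborel)"
  proof (rule Bochner_Integration.integral_cong[OF refl])
    fix x
    have "(\<integral>\<xi>. K x \<xi> * (g x * f \<xi>) \<partial>lborel) = (\<integral>\<xi>. g x * (K x \<xi> * f \<xi>) \<partial>lborel)" by (simp add: mult_ac)
    then show "ft f x * g x = c * (\<integral>\<xi>. K x \<xi> * (g x * f \<xi>) \<partial>lborel)"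
      by (simp add: ft_def c_def K_def)
  qed
  also have "\<dots> = c * (\<integral>x. (\<integral>\<xi>. K x \<xi> * (g x * f \<xi>) \<partial>lborel) \<partial>lborel)" by simp
  also have "(\<integral>x. (\<integral>\<xi>. K x \<xi> * (g x * f \<xi>) \<partial>lborel) \<partial>lborel) = (\<integral>\<xi>. (\<integral>x. K x \<xi> * (g x * f \<xi>) \<partial>lborel) \<partial>lborel)"
    using lborel_pair.Fubini_integral[OF i] by simp
  also have "c * \<dots> = (\<integral>\<xi>. f \<xi> * ft g \<xi> \<partial>lborel)"
  proof -
    have "c * (\<integral>x. K x \<xi> * (g x * f \<xi>) \<partial>lborel) = f \<xi> * ft g \<xi>" for \<xi>
    proof -
      have "(\<integral>x. K x \<xi> * (g x * f \<xi>) \<partial>lborel) = (\<integral>x. f \<xi> * (K \<xi> x * g x) \<partial>lborel)"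
        by (simp add: mult_ac K_def inner_commute)
      then show ?thesis by (simp add: ft_def c_def K_def)
    qed
    then have "(\<integral>\<xi>. c * (\<integral>x. K x \<xi> * (g x * f \<xi>) \<partial>lborel) \<partial>lborel) = (\<integral>\<xi>. f \<xi> * ft g \<xi> \<partial>lborel)" by simp
    then show ?thesis by simp
  qed
  finally show ?thesis .
qed

lemma ft_lincomb:
  fixes f g :: "'a::euclidean_space \<Rightarrow> complex"
  assumes "integrable lborel f" "integrable lborel g"
  shows "ft (\<lambda>x. c * f x + d * g x) x = c * ft f x + d * ft g x"
proof -
  have "(\<integral>\<xi>. exp (- \<i> * of_real (x \<bullet> \<xi>)) * (c * f \<xi> + d * g \<xi>) \<partial>lborel) =
    (\<integral>\<xi>. c * (exp (- \<i> * of_real (x \<bullet> \<xi>)) * f \<xi>) + d * (exp (- \<i> * of_real (x \<bullet> \<xi>)) * g \<xi>) \<partial>lborel)"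
    by (simp add: algebra_simps)
  also have "\<dots> = c * (\<integral>\<xi>. exp (- \<i> * of_real (x \<bullet> \<xi>)) * f \<xi> \<partial>lborel) + d * (\<integral>\<xi>. exp (- \<i> * of_real (x \<bullet> \<xi>)) * g \<xi> \<partial>lborel)"
    using integrable_iexp_mult[OF assms(1), of x] integrable_iexp_mult[OF assms(2), of x]
    by (subst Bochner_Integration.integral_add) auto
  finally show ?thesis by (simp add: ft_def algebra_simps)
qed

lemma ft_cmult: "ft (\<lambda>x. c * f x) x = c * ft f x"
proof -
  have "(\<integral>\<xi>. exp (- \<i> * of_real (x \<bullet> \<xi>)) * (c * f \<xi>) \<partial>lborel) = (\<integral>\<xi>. c * (exp (- \<i> * of_real (x \<bullet> \<xi>)) * f \<xi>) \<partial>lborel)"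
    by (simp add: mult_ac)
  then show ?thesis by (simp add: ft_def)
qed

section \<open>Null sets, truncations and tensor products on product measures\<close>

lemma AE_pair_snd:
  assumes "sigma_finite_measure N" and "AE y in N. Q y"
  shows "AE p in M \<Otimes>\<^sub>M N. Q (snd p)"
proof -
  interpret N: sigma_finite_measure N by fact
  obtain S where S: "{y \<in> space N. \<not> Q y} \<subseteq> S" "S \<in> null_sets N" using assms(2) by (auto elim!: AE_E)
  have "space M \<times> S \<in> null_sets (M \<Otimes>\<^sub>M N)"
    using S by (auto simp: null_sets_def N.emeasure_pair_measure_Times)
  then show ?thesis by (rule AE_I') (use S in \<open>auto simp: space_pair_measure\<close>)
qed

lemma AE_pair_fst:
  assumes "sigma_finite_measure N" and "AE x in M. Q x"
  shows "AE p in M \<Otimes>\<^sub>M N. Q (fst p)"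
proof -
  interpret N: sigma_finite_measure N by fact
  obtain S where S: "{x \<in> space M. \<not> Q x} \<subseteq> S" "S \<in> null_sets M" using assms(2) by (auto elim!: AE_E)
  have "S \<times> space N \<in> null_sets (M \<Otimes>\<^sub>M N)"
    using S by (auto simp: null_sets_def N.emeasure_pair_measure_Times)
  then show ?thesis by (rule AE_I') (use S in \<open>auto simp: space_pair_measure\<close>)
qed

lemma L2_ball_integrable:
  fixes f :: "'a::euclidean_space \<Rightarrow> complex"
  assumes "f \<in> L2 lborel"
  shows "integrable lborel (\<lambda>x. indicator (cball 0 r) x * f x)"
  by (intro L2_mult_integrable assms L2_indicator emeasure_lborel_cball_finite) auto

lemma L2_truncate:
  fixes f :: "'a::euclidean_space \<Rightarrow> complex"
  assumes f: "f \<in> L2 lborel"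
  shows "(\<lambda>x. indicator (cball 0 (real n)) x * f x) \<in> L2 lborel"
    and "l2_tendsto lborel (\<lambda>n x. indicator (cball 0 (real n)) x * f x) f"
proof -
  have [measurable]: "f \<in> borel_measurable borel" using f by auto
  show "(\<lambda>x. indicator (cball 0 (real n)) x * f x) \<in> L2 lborel" for n
    by (rule L2_mult_bounded[OF f, where C=1]) (auto simp: indicator_def)
  show "l2_tendsto lborel (\<lambda>n x. indicator (cball 0 (real n)) x * f x) f"
  proof (rule l2_tendsto_dominated[OF _ f f])
    show "AE x in lborel. (\<lambda>n. indicator (cball 0 (real n)) x * f x) \<longlonglongrightarrow> f x"
    proof (intro AE_I2)
      fix x :: 'a
      obtain k where "norm x \<le> real k" using real_arch_simple by blast
      then have "\<forall>\<^sub>F n in sequentially. indicator (cball 0 (real n)) x * f x = f x"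
        unfolding eventually_sequentially by (intro exI[of _ k]) (auto simp: indicator_def)
      then show "(\<lambda>n. indicator (cball 0 (real n)) x * f x) \<longlonglongrightarrow> f x" by (rule tendsto_eventually)
    qed
  qed (auto simp: indicator_def)
qed

lemma sqnorm_tensor:
  assumes "sigma_finite_measure N" and [measurable]: "f \<in> borel_measurable M" "g \<in> borel_measurable N"
  shows "sqnorm (M \<Otimes>\<^sub>M N) (\<lambda>p. f (fst p) * g (snd p)) = sqnorm M f * sqnorm N g"
proof -
  interpret N: sigma_finite_measure N by fact
  have "sqnorm (M \<Otimes>\<^sub>M N) (\<lambda>p. f (fst p) * g (snd p)) =
    (\<integral>\<^sup>+x. \<integral>\<^sup>+y. ennreal ((cmod (f x))\<^sup>2) * ennreal ((cmod (g y))\<^sup>2) \<partial>N \<partial>M)"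
    unfolding sqnorm_def
    by (subst N.nn_integral_fst[symmetric]) (auto simp: norm_mult power_mult_distrib ennreal_mult)
  also have "\<dots> = sqnorm M f * sqnorm N g"
    unfolding sqnorm_def by (simp add: nn_integral_cmult nn_integral_multc)
  finally show ?thesis .
qed

lemma L2_tensor:
  assumes "sigma_finite_measure N" "f \<in> L2 M" "g \<in> L2 N"
  shows "(\<lambda>p. f (fst p) * g (snd p)) \<in> L2 (M \<Otimes>\<^sub>M N)"
proof -
  have [measurable]: "f \<in> borel_measurable M" "g \<in> borel_measurable N" using assms by auto
  show ?thesis using assms by (simp add: L2_iff sqnorm_tensor ennreal_mult_less_top)
qed

definition pft :: "('a::euclidean_space \<times> 'b \<Rightarrow> complex) \<Rightarrow> 'a \<times> 'b \<Rightarrow> complex" where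
  "pft F p = ft (\<lambda>\<xi>. F (\<xi>, snd p)) (fst p)"

text \<open>The domain on which the partial transform is given by an integral: integrability is
  asked of almost every slice, not of the function on the product.\<close>

definition slice_dom :: "'b measure \<Rightarrow> ('a::euclidean_space \<times> 'b \<Rightarrow> complex) set" where
  "slice_dom N = {F \<in> L2 (lborel \<Otimes>\<^sub>M N). AE y in N. integrable lborel (\<lambda>\<xi>. F (\<xi>, y))}"

lemma pft_measurable [measurable]:
  assumes [measurable]: "F \<in> borel_measurable (lborel \<Otimes>\<^sub>M N)"
  shows "pft F \<in> borel_measurable (lborel \<Otimes>\<^sub>M N)"
  unfolding pft_def[abs_def] ft_def by measurable

lemma bounded_l2_operator_isometry:
  assumes "\<And>f. f \<in> L2 M \<Longrightarrow> V f \<in> L2 N" "\<And>f. f \<in> L2 M \<Longrightarrow> sqnorm N (V f) = sqnorm M f"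
    "\<And>f g c d. f \<in> L2 M \<Longrightarrow> g \<in> L2 M \<Longrightarrow> AE y in N. V (\<lambda>x. c * f x + d * g x) y = c * V f y + d * V g y"
  shows "bounded_l2_operator M N V"
proof -
  have "l2_norm N (V f) \<le> 1 * l2_norm M f" if f: "f \<in> L2 M" for f
  proof -
    have "ennreal (\<integral>x. (cmod (V f x))\<^sup>2 \<partial>N) = ennreal (\<integral>x. (cmod (f x))\<^sup>2 \<partial>M)"
      using assms(1,2)[OF f] f by (simp add: sqnorm_eq_integral)
    then have "(\<integral>x. (cmod (V f x))\<^sup>2 \<partial>N) = (\<integral>x. (cmod (f x))\<^sup>2 \<partial>M)"
      by (subst (asm) ennreal_inj) auto
    then show ?thesis by (simp add: l2_norm_def)
  qed
  then show ?thesis using assms unfolding bounded_l2_operator_def by blast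
qed

text \<open>On a ball square-integrable functions are integrable, so truncations to balls supply the
  approximants in L1 \<inter> L2 for the isometric extension.\<close>

lemma fourier_extension_exists:
  obtains A :: "('a::euclidean_space \<Rightarrow> complex) \<Rightarrow> ('a \<Rightarrow> complex)"
  where "bounded_l2_operator lborel lborel A"
    "\<And>f. f \<in> L2 lborel \<Longrightarrow> integrable lborel f \<Longrightarrow> AE x in lborel. A f x = ft f x"
proof -
  obtain A :: "('a \<Rightarrow> complex) \<Rightarrow> ('a \<Rightarrow> complex)" where
    A: "\<And>f. f \<in> L2 lborel \<Longrightarrow> A f \<in> L2 lborel" "\<And>f. f \<in> L2 lborel \<Longrightarrow> sqnorm lborel (A f) = sqnorm lborel f"
    "\<And>f g c d. f \<in> L2 lborel \<Longrightarrow> g \<in> L2 lborel \<Longrightarrow>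
        AE y in lborel. A (\<lambda>x. c * f x + d * g x) y = c * A f y + d * A g y"
    "\<And>f. f \<in> {f \<in> L2 lborel. integrable lborel f} \<Longrightarrow> AE y in lborel. A f y = ft f y"
  proof (rule isometric_extension[of "{f \<in> L2 lborel. integrable lborel f}" lborel
      "\<lambda>n f x. indicator (cball 0 (real n)) x * f x" ft lborel])
    show "(\<lambda>x. c * f x + d * g x) \<in> {f \<in> L2 lborel. integrable lborel f}"
      if "f \<in> {f \<in> L2 lborel. integrable lborel f}" "g \<in> {f \<in> L2 lborel. integrable lborel f}"
      for f g :: "'a \<Rightarrow> complex" and c d
      using that by (auto intro: L2_lincomb)
    show "AE y in lborel. ft (\<lambda>x. c * f x + d * g x) y = c * ft f y + d * ft g y"
      if "f \<in> {f \<in> L2 lborel. integrable lborel f}" "g \<in> {f \<in> L2 lborel. integrable lborel f}"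
      for f g :: "'a \<Rightarrow> complex" and c d
      using that by (auto simp: ft_lincomb)
  qed (auto simp: plancherel L2_truncate L2_ball_integrable)
  show ?thesis by (rule that[OF bounded_l2_operator_isometry[OF A(1-3)] A(4)]) auto
qed

text \<open>The transform \<open>A\<close> is only known through these two properties, because the
  operator that will be put in its place is selected by \<open>SOME\<close>.\<close>

locale partial_fourier = sigma_finite_measure N for N :: "'b measure" +
  fixes A :: "('a::euclidean_space \<Rightarrow> complex) \<Rightarrow> ('a \<Rightarrow> complex)"
  assumes A_bounded: "bounded_l2_operator lborel lborel A"
    and A_ft: "\<And>f. f \<in> L2 lborel \<Longrightarrow> integrable lborel f \<Longrightarrow> AE x in lborel. A f x = ft f x"
begin

abbreviation P :: "('a \<times> 'b) measure" where "P \<equiv> lborel \<Otimes>\<^sub>M N"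
abbreviation D :: "('a \<times> 'b \<Rightarrow> complex) set" where "D \<equiv> slice_dom N"

sublocale PP: pair_sigma_finite "lborel :: 'a measure" N ..

lemma sigma_finite_N: "sigma_finite_measure N" by (rule sigma_finite_measure_axioms)

lemma sqnorm_slices:
  assumes [measurable]: "F \<in> borel_measurable P"
  shows "sqnorm P F = (\<integral>\<^sup>+y. sqnorm lborel (\<lambda>x. F (x, y)) \<partial>N)"
  unfolding sqnorm_def by (subst PP.nn_integral_snd[symmetric]) auto

lemma L2_slices:
  assumes F: "F \<in> L2 P" shows "AE y in N. (\<lambda>x. F (x, y)) \<in> L2 lborel"
proof -
  have [measurable]: "F \<in> borel_measurable P" using F by auto
  have m: "(\<lambda>y. sqnorm lborel (\<lambda>x. F (x, y))) \<in> borel_measurable N" unfolding sqnorm_def by measurable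
  have "AE y in N. sqnorm lborel (\<lambda>x. F (x, y)) \<noteq> \<infinity>"
    using F by (intro nn_integral_noteq_infinite m) (simp add: L2_iff sqnorm_slices less_top)
  with AE_space show ?thesis
    by eventually_elim (auto simp: L2_iff less_top)
qed

lemma D_L2: "F \<in> D \<Longrightarrow> F \<in> L2 P" by (simp add: slice_dom_def)

lemma pft_L2:
  assumes F: "F \<in> D"
  shows "pft F \<in> L2 P" "sqnorm P (pft F) = sqnorm P F"
proof -
  have [measurable]: "F \<in> borel_measurable P" using D_L2[OF F] by auto
  have "sqnorm P (pft F) = (\<integral>\<^sup>+y. sqnorm lborel (\<lambda>x. pft F (x, y)) \<partial>N)" by (rule sqnorm_slices) measurable
  also have "\<dots> = (\<integral>\<^sup>+y. sqnorm lborel (\<lambda>x. F (x, y)) \<partial>N)"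
  proof (rule nn_integral_cong_AE)
    have "AE y in N. integrable lborel (\<lambda>\<xi>. F (\<xi>, y))" using F by (simp add: slice_dom_def)
    with L2_slices[OF D_L2[OF F]] show "AE y in N. sqnorm lborel (\<lambda>x. pft F (x, y)) = sqnorm lborel (\<lambda>x. F (x, y))"
      by eventually_elim (simp add: pft_def plancherel(2))
  qed
  also have "\<dots> = sqnorm P F" by (rule sqnorm_slices[symmetric]) measurable
  finally show *: "sqnorm P (pft F) = sqnorm P F" .
  show "pft F \<in> L2 P" using D_L2[OF F] by (simp add: L2_iff *)
qed

definition cut :: "nat \<Rightarrow> ('a \<times> 'b \<Rightarrow> complex) \<Rightarrow> 'a \<times> 'b \<Rightarrow> complex" where
  "cut n F p = indicator (cball 0 (real n)) (fst p) * F p"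

text \<open>Truncating in the first variable alone suffices to reach \<open>slice_dom\<close>:
  almost every slice is square-integrable, hence integrable over a ball.\<close>

lemma cut:
  assumes F: "F \<in> L2 P"
  shows "cut n F \<in> D" "l2_tendsto P (\<lambda>n. cut n F) F"
proof -
  have [measurable]: "F \<in> borel_measurable P" using F by auto
  have L: "cut n F \<in> L2 P" for n
    unfolding cut_def[abs_def] by (rule L2_mult_bounded[OF F, where C=1]) (auto simp: indicator_def)
  show "cut n F \<in> D" for n
    unfolding slice_dom_def using L L2_slices[OF F]
    by (auto simp: cut_def L2_ball_integrable elim: eventually_mono)
  show "l2_tendsto P (\<lambda>n. cut n F) F"
  proof (rule l2_tendsto_dominated[OF _ F F])
    show "AE p in P. (\<lambda>n. cut n F p) \<longlonglongrightarrow> F p"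
    proof (intro AE_I2)
      fix p :: "'a \<times> 'b"
      obtain k where "norm (fst p) \<le> real k" using real_arch_simple by blast
      then have "\<forall>\<^sub>F n in sequentially. cut n F p = F p"
        unfolding eventually_sequentially cut_def by (intro exI[of _ k]) (auto simp: indicator_def)
      then show "(\<lambda>n. cut n F p) \<longlonglongrightarrow> F p" by (rule tendsto_eventually)
    qed
  qed (use L in \<open>auto simp: cut_def indicator_def\<close>)
qed

lemma D_lincomb:
  assumes "F \<in> D" "G \<in> D"
  shows "(\<lambda>p. c * F p + d * G p) \<in> D"
    "AE p in P. pft (\<lambda>p. c * F p + d * G p) p = c * pft F p + d * pft G p"
proof -
  have ae: "AE y in N. integrable lborel (\<lambda>\<xi>. F (\<xi>, y)) \<and> integrable lborel (\<lambda>\<xi>. G (\<xi>, y))"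
    using assms by (simp add: slice_dom_def)
  then have "AE y in N. integrable lborel (\<lambda>\<xi>. c * F (\<xi>, y) + d * G (\<xi>, y))"
    by eventually_elim auto
  then show "(\<lambda>p. c * F p + d * G p) \<in> D" using assms by (auto simp: slice_dom_def L2_lincomb)
  from AE_pair_snd[OF sigma_finite_N ae]
  show "AE p in P. pft (\<lambda>p. c * F p + d * G p) p = c * pft F p + d * pft G p"
    by eventually_elim (simp add: pft_def ft_lincomb)
qed

definition W :: "('a \<times> 'b \<Rightarrow> complex) \<Rightarrow> 'a \<times> 'b \<Rightarrow> complex" where
  "W = l2_tensor_id lborel N A"

text \<open>The slicewise transform is isometric on \<open>D\<close> by Plancherel and Tonelli, so
  it extends to an isometry V. It has the tensor property, hence the choice defining
  \<open>W\<close> is not void; and since products are dense, every bounded operator with that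
  property agrees with V almost everywhere. All properties of \<open>W\<close> are inherited from
  V.\<close>

lemma W_properties:
  shows W_L2: "F \<in> L2 P \<Longrightarrow> W F \<in> L2 P"
    and W_isometry: "F \<in> L2 P \<Longrightarrow> sqnorm P (W F) = sqnorm P F"
    and W_bounded: "bounded_l2_operator P P W"
    and W_pft: "F \<in> D \<Longrightarrow> AE p in P. W F p = pft F p"
proof -
  obtain V where V: "\<And>f. f \<in> L2 P \<Longrightarrow> V f \<in> L2 P" "\<And>f. f \<in> L2 P \<Longrightarrow> sqnorm P (V f) = sqnorm P f"
    "\<And>f g c d. f \<in> L2 P \<Longrightarrow> g \<in> L2 P \<Longrightarrow> AE y in P. V (\<lambda>x. c * f x + d * g x) y = c * V f y + d * V g y"
    "\<And>f. f \<in> D \<Longrightarrow> AE y in P. V f y = pft f y"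
    by (rule isometric_extension[of D P cut pft P]) (auto simp: D_L2 D_lincomb cut pft_L2)
  have Vb: "bounded_l2_operator P P V" using V by (intro bounded_l2_operator_isometry)
  have AL: "A f \<in> L2 lborel" if "f \<in> L2 lborel" for f using A_bounded that by (auto simp: bounded_l2_operator_def)
  have prod: "AE p in P. V (\<lambda>(x, y). \<phi> x * \<psi> y) p = A \<phi> (fst p) * \<psi> (snd p)"
    if \<phi>: "\<phi> \<in> L2 lborel" and \<psi>: "\<psi> \<in> L2 N" for \<phi> \<psi>
  proof -
    \<comment> \<open>The slices of a product are multiples of \<phi>, in general not integrable, so
      the tensor property is checked on truncations of \<phi> and carried to the limit on both
      sides.\<close>
    define \<phi>n where "\<phi>n n = (\<lambda>x. indicator (cball 0 (real n)) x * \<phi> x)" for n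
    have \<phi>n: "\<phi>n n \<in> L2 lborel" "integrable lborel (\<phi>n n)" "l2_tendsto lborel \<phi>n \<phi>" for n
      unfolding \<phi>n_def using L2_truncate[OF \<phi>] L2_ball_integrable[OF \<phi>] by auto
    have tens: "l2_tendsto P (\<lambda>n p. F n (fst p) * \<psi> (snd p)) (\<lambda>p. f (fst p) * \<psi> (snd p))"
      if F: "l2_tendsto lborel F f" "\<And>n. F n \<in> L2 lborel" "f \<in> L2 lborel" for F f
    proof -
      have meas: "F n \<in> borel_measurable lborel" "f \<in> borel_measurable lborel" "\<psi> \<in> borel_measurable N" for n
        using L2_measurable[OF F(2)] L2_measurable[OF F(3)] L2_measurable[OF \<psi>] by blast+
      have "sqnorm P (\<lambda>p. F n (fst p) * \<psi> (snd p) - f (fst p) * \<psi> (snd p)) = sqnorm N \<psi> * sqnorm lborel (\<lambda>x. F n x - f x)" for n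
        using sqnorm_tensor[OF sigma_finite_N borel_measurable_diff[OF meas(1)[of n] meas(2)] meas(3)]
        by (simp add: left_diff_distrib mult.commute[of "sqnorm N \<psi>"])
      then show ?thesis using F(1) \<psi> unfolding l2_tendsto_def by (simp add: ennreal_tendsto_0_cmult L2_iff)
    qed
    let ?T = "\<lambda>f p. f (fst p) * \<psi> (snd p)"
    have TL: "?T f \<in> L2 P" if "f \<in> L2 lborel" for f using L2_tensor[OF sigma_finite_N that \<psi>] .
    have "l2_tendsto P (\<lambda>n. V (?T (\<phi>n n))) (V (?T \<phi>))"
      by (intro bounded_l2_operator_tendsto[OF Vb] tens TL \<phi>n \<phi>)
    moreover have "AE p in P. V (?T (\<phi>n n)) p = ?T (A (\<phi>n n)) p" for n
    proof -
      have "integrable lborel (\<lambda>\<xi>. \<psi> y * \<phi>n n \<xi>)" for y using \<phi>n(2) by simp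
      then have "?T (\<phi>n n) \<in> D" using TL[OF \<phi>n(1)] by (simp add: slice_dom_def mult.commute)
      from V(4)[OF this] AE_pair_fst[OF sigma_finite_N A_ft[OF \<phi>n(1,2)]]
      show ?thesis
      proof eventually_elim
        fix p :: "'a \<times> 'b"
        assume *: "V (?T (\<phi>n n)) p = pft (?T (\<phi>n n)) p" "A (\<phi>n n) (fst p) = ft (\<phi>n n) (fst p)"
        have "pft (?T (\<phi>n n)) p = ft (\<lambda>\<xi>. \<psi> (snd p) * \<phi>n n \<xi>) (fst p)" by (simp add: pft_def mult.commute)
        then show "V (?T (\<phi>n n)) p = ?T (A (\<phi>n n)) p" unfolding * by (simp add: ft_cmult)
      qed
    qed
    ultimately have l1: "l2_tendsto P (\<lambda>n. ?T (A (\<phi>n n))) (V (?T \<phi>))" by (rule l2_tendsto_cong) simp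
    have l2: "l2_tendsto P (\<lambda>n. ?T (A (\<phi>n n))) (?T (A \<phi>))"
      by (intro tens AL \<phi>n \<phi> bounded_l2_operator_tendsto[OF A_bounded])
    have "AE p in P. V (?T \<phi>) p = ?T (A \<phi>) p"
      by (rule l2_tendsto_unique[OF l1 l2]) (auto intro!: TL AL \<phi>n \<phi> V(1))
    then show ?thesis by (simp add: case_prod_unfold)
  qed
  have "bounded_l2_operator P P W \<and>
        (\<forall>\<phi>\<in>L2 lborel. \<forall>\<psi>\<in>L2 N. AE p in P. W (\<lambda>(x, y). \<phi> x * \<psi> y) p = A \<phi> (fst p) * \<psi> (snd p))"
    unfolding W_def l2_tensor_id_def by (rule someI[of _ V]) (use Vb prod in blast)
  then have Wb: "bounded_l2_operator P P W"
    and Wprod: "\<And>\<phi> \<psi>. \<phi>\<in>L2 lborel \<Longrightarrow> \<psi>\<in>L2 N \<Longrightarrow> AE p in P. W (\<lambda>(x, y). \<phi> x * \<psi> y) p = A \<phi> (fst p) * \<psi> (snd p)"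
    by auto
  have WL: "W F \<in> L2 P" if "F \<in> L2 P" for F using Wb that by (auto simp: bounded_l2_operator_def)
  \<comment> \<open>Uniqueness: two bounded operators that agree on indicators of rectangles agree
    on all of L2.\<close>
  have eq: "AE p in P. W F p = V F p" if F: "F \<in> L2 P" for F
  proof (rule PP.L2_dense_products[where Q="\<lambda>F. AE p in P. W F p = V F p", OF _ _ _ F])
    fix f g c d assume L: "f \<in> L2 P" "g \<in> L2 P" and e: "AE p in P. W f p = V f p" "AE p in P. W g p = V g p"
    have "AE p in P. W (\<lambda>x. c * f x + d * g x) p = c * W f p + d * W g p"
      using Wb L by (auto simp: bounded_l2_operator_def)
    with e V(3)[OF L, of c d] show "AE p in P. W (\<lambda>x. c * f x + d * g x) p = V (\<lambda>x. c * f x + d * g x) p"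
      by eventually_elim simp
  next
    fix G f assume G: "\<And>n. G n \<in> L2 P" "\<And>n. AE p in P. W (G n) p = V (G n) p" "f \<in> L2 P" "l2_tendsto P G f"
    have "l2_tendsto P (\<lambda>n. W (G n)) (W f)" by (rule bounded_l2_operator_tendsto[OF Wb G(4,1,3)])
    then have "l2_tendsto P (\<lambda>n. V (G n)) (W f)" by (rule l2_tendsto_cong) (use G in auto)
    from l2_tendsto_unique[OF this bounded_l2_operator_tendsto[OF Vb G(4,1,3)]] 
    show "AE p in P. W f p = V f p" using G V(1) WL by blast
  next
    fix X :: "'a set" and B assume "X \<in> sets lborel" "B \<in> sets N" "emeasure lborel X < \<infinity>" "emeasure N B < \<infinity>"
    then have L: "(indicator X :: _ \<Rightarrow> complex) \<in> L2 lborel" "(indicator B :: _ \<Rightarrow> complex) \<in> L2 N" by (auto intro: L2_indicator)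
    from Wprod[OF L] prod[OF L]
    show "AE p in P. W (\<lambda>(x, y). indicator X x * indicator B y) p = V (\<lambda>(x, y). indicator X x * indicator B y) p"
      by eventually_elim simp
  qed
  show "F \<in> L2 P \<Longrightarrow> W F \<in> L2 P" by (rule WL)
  show "bounded_l2_operator P P W" by (rule Wb)
  show "sqnorm P (W F) = sqnorm P F" if F: "F \<in> L2 P"
    using sqnorm_cong_AE[OF eq[OF F]] V(2)[OF F] by simp
  show "AE p in P. W F p = pft F p" if F: "F \<in> D"
    using eq[OF D_L2[OF F]] V(4)[OF F] by eventually_elim simp
qed

lemma W_lincomb:
  "F \<in> L2 P \<Longrightarrow> G \<in> L2 P \<Longrightarrow> AE p in P. W (\<lambda>p. c * F p + d * G p) p = c * W F p + d * W G p"
  using W_bounded by (auto simp: bounded_l2_operator_def)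

lemmas W_tendsto = bounded_l2_operator_tendsto[OF W_bounded]

text \<open>\<open>W\<close> acts on representatives; a constant sequence converges to every
  function that equals it almost everywhere, and boundedness transfers this to the images.\<close>

lemma W_cong:
  assumes L: "F \<in> L2 P" "G \<in> L2 P" and "AE p in P. F p = G p"
  shows "AE p in P. W F p = W G p"
proof (rule l2_tendsto_unique)
  have "l2_tendsto P (\<lambda>n. F) F" by (simp add: l2_tendsto_def sqnorm_def)
  then have "l2_tendsto P (\<lambda>n. F) G" by (rule l2_tendsto_cong) (use assms in auto)
  from W_tendsto[OF this L] show "l2_tendsto P (\<lambda>n::nat. W F) (W G)" .
  show "l2_tendsto P (\<lambda>n::nat. W F) (W F)" by (simp add: l2_tendsto_def sqnorm_def)
qed (auto intro: W_L2 L)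

lemma W_inner:
  assumes "F \<in> L2 P" "G \<in> L2 P" shows "l2_inner P (W F) (W G) = l2_inner P F G"
proof (rule isometry_inner[OF assms W_L2[OF assms(1)] W_L2[OF assms(2)] W_isometry[OF assms(1)] W_isometry[OF assms(2)]])
  fix c
  have "sqnorm P (\<lambda>x. W F x + c * W G x) = sqnorm P (W (\<lambda>x. 1 * F x + c * G x))"
    by (rule sqnorm_cong_AE) (use W_lincomb[OF assms, of 1 c] in \<open>eventually_elim, simp\<close>)
  also have "\<dots> = sqnorm P (\<lambda>x. 1 * F x + c * G x)" by (intro W_isometry L2_lincomb assms)
  finally show "sqnorm P (\<lambda>x. W F x + c * W G x) = sqnorm P (\<lambda>x. F x + c * G x)" by simp
qed

text \<open>The kernel exp(-i x \<xi>) is symmetric, so the adjoint has the conjugate kernel and is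
  \<open>W\<close> conjugated on both sides.\<close>

definition W_adj :: "('a \<times> 'b \<Rightarrow> complex) \<Rightarrow> 'a \<times> 'b \<Rightarrow> complex" where
  "W_adj G p = cnj (W (\<lambda>p. cnj (G p)) p)"

lemma W_adj_L2: "G \<in> L2 P \<Longrightarrow> W_adj G \<in> L2 P"
  unfolding W_adj_def[abs_def] by (intro L2_cnj W_L2)

lemma D_cnj: "G \<in> D \<Longrightarrow> (\<lambda>p. cnj (G p)) \<in> D"
  by (auto simp: slice_dom_def L2_cnj)

lemma W_adj_pft: "G \<in> D \<Longrightarrow> AE p in P. W_adj G p = cnj (pft (\<lambda>p. cnj (G p)) p)"
  using W_pft[OF D_cnj] by (auto simp: W_adj_def elim: eventually_mono)

text \<open>The multiplication formula on almost every slice, integrated over the second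
  variable.\<close>

lemma W_adjoint_D:
  assumes F: "F \<in> D" and G: "G \<in> D"
  shows "l2_inner P (W F) G = l2_inner P F (W_adj G)"
proof -
  define H where "H p = cnj (G p)" for p
  have H: "H \<in> D" unfolding H_def[abs_def] by (rule D_cnj[OF G])
  have meas: "F \<in> borel_measurable P" "G \<in> borel_measurable P" "H \<in> borel_measurable P"
    using F G H D_L2 L2_measurable by blast+
  have "l2_inner P (W F) G = (\<integral>p. pft F p * H p \<partial>P)"
    unfolding l2_inner_def
  proof (rule integral_cong_AE)
    show "AE p in P. W F p * cnj (G p) = pft F p * H p"
      using W_pft[OF F] by eventually_elim (simp add: H_def)
  qed (use meas W_L2[OF D_L2[OF F]] in \<open>auto intro!: borel_measurable_times borel_measurable_cnj\<close>)
  also have "\<dots> = (\<integral>y. \<integral>x. pft F (x, y) * H (x, y) \<partial>lborel \<partial>N)"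
    using PP.integral_snd[of "\<lambda>x y. pft F (x, y) * H (x, y)"] L2_mult_integrable[OF pft_L2(1)[OF F] D_L2[OF H]] by (simp add: case_prod_unfold)
  also have "\<dots> = (\<integral>y. \<integral>x. F (x, y) * pft H (x, y) \<partial>lborel \<partial>N)"
  proof (rule integral_cong_AE)
    have "AE y in N. integrable lborel (\<lambda>\<xi>. F (\<xi>, y))" "AE y in N. integrable lborel (\<lambda>\<xi>. H (\<xi>, y))"
      using F H by (auto simp: slice_dom_def)
    then show "AE y in N. (\<integral>x. pft F (x, y) * H (x, y) \<partial>lborel) = (\<integral>x. F (x, y) * pft H (x, y) \<partial>lborel)"
      by eventually_elim (simp add: pft_def ft_multiplication)
    have [measurable]: "F \<in> borel_measurable P" "H \<in> borel_measurable P" by (fact meas)+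
    show "(\<lambda>y. \<integral>x. pft F (x, y) * H (x, y) \<partial>lborel) \<in> borel_measurable N" by measurable
    show "(\<lambda>y. \<integral>x. F (x, y) * pft H (x, y) \<partial>lborel) \<in> borel_measurable N" by measurable
  qed
  also have "\<dots> = (\<integral>p. F p * pft H p \<partial>P)"
    using PP.integral_snd[of "\<lambda>x y. F (x, y) * pft H (x, y)"] L2_mult_integrable[OF D_L2[OF F] pft_L2(1)[OF H]] by (simp add: case_prod_unfold)
  also have "\<dots> = l2_inner P F (W_adj G)"
    unfolding l2_inner_def
  proof (rule integral_cong_AE)
    show "AE p in P. F p * pft H p = F p * cnj (W_adj G p)"
      using W_adj_pft[OF G] by eventually_elim (simp add: H_def[abs_def])
  qed (use meas W_adj_L2[OF D_L2[OF G]] in \<open>auto intro!: borel_measurable_times borel_measurable_cnj\<close>)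
  finally show ?thesis .
qed

text \<open>The identity spreads from \<open>D\<close> by truncating first F and then G, with both
  sides continuous in mean square.\<close>

lemma W_adjoint:
  assumes F: "F \<in> L2 P" and G: "G \<in> L2 P"
  shows "l2_inner P (W F) G = l2_inner P F (W_adj G)"
proof -
  have cL: "cut n F \<in> L2 P" if "F \<in> L2 P" for n F using D_L2[OF cut(1)[OF that]] .
  have 1: "l2_inner P (W F) G = l2_inner P F (W_adj G)" if F: "F \<in> L2 P" and G: "G \<in> D" for F G
  proof (rule LIMSEQ_unique)
    show "(\<lambda>n. l2_inner P (W (cut n F)) G) \<longlonglongrightarrow> l2_inner P (W F) G"
      by (rule l2_tendsto_inner[OF W_tendsto[OF cut(2)[OF F] cL[OF F] F] W_L2[OF cL[OF F]] W_L2[OF F] D_L2[OF G]])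
    have "(\<lambda>n. l2_inner P (cut n F) (W_adj G)) \<longlonglongrightarrow> l2_inner P F (W_adj G)"
      by (rule l2_tendsto_inner[OF cut(2)[OF F] cL[OF F] F W_adj_L2[OF D_L2[OF G]]])
    then show "(\<lambda>n. l2_inner P (W (cut n F)) G) \<longlonglongrightarrow> l2_inner P F (W_adj G)"
      by (simp add: W_adjoint_D[OF cut(1)[OF F] G])
  qed
  have "l2_tendsto P (\<lambda>n. W_adj (cut n G)) (W_adj G)"
    unfolding W_adj_def[abs_def] using G by (intro l2_tendsto_cnj W_tendsto cut(2) cL L2_cnj)
  from l2_tendsto_inner[OF this W_adj_L2[OF cL[OF G]] W_adj_L2[OF G] F]
  have a: "(\<lambda>n. cnj (l2_inner P F (W_adj (cut n G)))) \<longlonglongrightarrow> cnj (l2_inner P F (W_adj G))"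
    by (simp add: l2_inner_commute[symmetric])
  from l2_tendsto_inner[OF cut(2)[OF G] cL[OF G] G W_L2[OF F]]
  have b: "(\<lambda>n. cnj (l2_inner P (W F) (cut n G))) \<longlonglongrightarrow> cnj (l2_inner P (W F) G)"
    by (simp add: l2_inner_commute[symmetric])
  from a have "(\<lambda>n. cnj (l2_inner P (W F) (cut n G))) \<longlonglongrightarrow> cnj (l2_inner P F (W_adj G))"
    by (simp add: 1[OF F cut(1)[OF G]])
  from LIMSEQ_unique[OF b this] show ?thesis by simp
qed

text \<open>Isometry means that \<open>W_adj\<close> is a left inverse of \<open>W\<close>;
  conjugating that identity exchanges the two operators, so it is also a right inverse.\<close>

lemma W_W_adj:
  assumes G: "G \<in> L2 P" shows "AE p in P. W (W_adj G) p = G p"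
proof -
  have *: "AE p in P. W_adj (W H) p = H p" if H: "H \<in> L2 P" for H
  proof (rule L2_eq_AE_I)
    show "l2_inner P F (W_adj (W H)) = l2_inner P F H" if F: "F \<in> L2 P" for F
      using W_adjoint[OF F W_L2[OF H]] W_inner[OF F H] by simp
  qed (auto intro: W_adj_L2 W_L2 H)
  from *[OF L2_cnj[OF G]] show ?thesis
    by eventually_elim (simp add: W_adj_def[abs_def])
qed

text \<open>On a slice the factor \<alpha> y is a scalar and comes out of the Fourier integral. The
  general case follows by truncation, as multiplication by a bounded function is continuous.\<close>

lemma W_mult_snd:
  assumes F: "F \<in> L2 P" and [measurable]: "\<alpha> \<in> borel_measurable N" and b: "AE y in N. cmod (\<alpha> y) \<le> C"
  shows "AE p in P. W (\<lambda>p. \<alpha> (snd p) * F p) p = \<alpha> (snd p) * W F p"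
proof -
  have bb: "AE p in P. cmod (\<alpha> (snd p)) \<le> C" by (rule AE_pair_snd[OF sigma_finite_N b])
  have mL: "(\<lambda>p. \<alpha> (snd p) * G p) \<in> L2 P" if "G \<in> L2 P" for G
    by (rule L2_mult_bounded[OF that _ bb]) measurable
  have cL: "cut n F \<in> L2 P" for n using D_L2[OF cut(1)[OF F]] .
  have "l2_tendsto P (\<lambda>n. W (\<lambda>p. \<alpha> (snd p) * cut n F p)) (W (\<lambda>p. \<alpha> (snd p) * F p))"
    by (intro W_tendsto mL cL F l2_tendsto_mult_bounded[OF _ bb] cut(2))
  moreover have "AE p in P. W (\<lambda>p. \<alpha> (snd p) * cut n F p) p = \<alpha> (snd p) * W (cut n F) p" for n
  proof -
    have "(\<lambda>p. \<alpha> (snd p) * cut n F p) \<in> D"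
      using cut(1)[OF F, of n] mL[OF cL[of n]] by (auto simp: slice_dom_def)
    from W_pft[OF this] W_pft[OF cut(1)[OF F, of n]] show ?thesis
      by eventually_elim (simp add: pft_def ft_cmult)
  qed
  ultimately have "l2_tendsto P (\<lambda>n p. \<alpha> (snd p) * W (cut n F) p) (W (\<lambda>p. \<alpha> (snd p) * F p))"
    by (rule l2_tendsto_cong) simp
  moreover have "l2_tendsto P (\<lambda>n p. \<alpha> (snd p) * W (cut n F) p) (\<lambda>p. \<alpha> (snd p) * W F p)"
    by (intro l2_tendsto_mult_bounded[OF _ bb] W_tendsto cut(2) F cL W_L2)
  ultimately show ?thesis
    by (rule l2_tendsto_unique) (auto intro!: mL W_L2 cL F)
qed

end

section \<open>The gamma integral of the cone\<close>

text \<open>The block of X with indices in I, completed by the identity. Its determinant is the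
  principal minor of I, expressed in a matrix type that does not change with I, which makes
  induction over index sets possible.\<close>

definition pad :: "'n set \<Rightarrow> real ^ 'n ^ 'n \<Rightarrow> real ^ 'n ^ 'n" where
  "pad I X = (\<chi> i j. if i \<in> I \<and> j \<in> I then X $ i $ j else if i = j then 1 else 0)"

definition schur :: "'n \<Rightarrow> real ^ 'n ^ 'n \<Rightarrow> real ^ 'n ^ 'n" where
  "schur i X = (\<chi> j k. X $ j $ k - X $ j $ i * X $ i $ k / X $ i $ i)"

definition qform :: "'n set \<Rightarrow> real ^ 'n ^ 'n \<Rightarrow> ('n \<Rightarrow> real) \<Rightarrow> real" where
  "qform I X v = (\<Sum>j\<in>I. \<Sum>k\<in>I. v j * X $ j $ k * v k)"

definition pd_on :: "'n set \<Rightarrow> real ^ 'n ^ 'n \<Rightarrow> bool" where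
  "pd_on I X \<longleftrightarrow> (\<forall>v. (\<exists>i\<in>I. v i \<noteq> 0) \<longrightarrow> qform I X v > 0)"

definition sym_mat :: "real ^ 'n ^ 'n \<Rightarrow> bool" where
  "sym_mat X \<longleftrightarrow> (\<forall>i j. X $ i $ j = X $ j $ i)"

section \<open>Principal minors, quadratic forms and Schur complements\<close>

lemma sym_matD: "sym_mat X \<Longrightarrow> X $ i $ j = X $ j $ i" by (simp add: sym_mat_def)

lemma sym_mat_schur: "sym_mat X \<Longrightarrow> sym_mat (schur i X)"
  unfolding sym_mat_def schur_def by (simp add: mult.commute)

lemma sum2_insert:
  fixes g :: "'n \<Rightarrow> 'n \<Rightarrow> real"
  assumes "finite I" "i \<notin> I"
  shows "(\<Sum>j\<in>insert i I. \<Sum>k\<in>insert i I. g j k)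
    = g i i + (\<Sum>k\<in>I. g i k) + (\<Sum>j\<in>I. g j i) + (\<Sum>j\<in>I. \<Sum>k\<in>I. g j k)"
  using assms by (simp add: sum.distrib)

lemma det_replace_column:
  fixes w :: "real ^ 'n::finite"
  assumes "w $ k = 1"
  shows "det (\<chi> i j. if j = k then w $ i else mat 1 $ i $ j :: real ^ 'n ^ 'n) = 1"
  using cramer_lemma[of k "mat 1" w, unfolded matrix_vector_mul_lid] assms by simp

text \<open>One step of Gaussian elimination: the padded block factors as L D U, where L differs
  from the identity in column i, U differs from it in row i, and D is the padded Schur complement
  with row i multiplied by the pivot.\<close>

lemma det_pad_insert:
  fixes X :: "real ^ 'n ^ 'n::finite"
  assumes i: "i \<notin> I" and x: "X $ i $ i \<noteq> 0"
  shows "det (pad (insert i I) X) = X $ i $ i * det (pad I (schur i X))"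
proof -
  define x where "x = X $ i $ i"
  define l :: "real ^ 'n" where "l = (\<chi> j. if j = i then 1 else if j \<in> I then X $ j $ i / x else 0)"
  define u :: "real ^ 'n" where "u = (\<chi> k. if k = i then 1 else if k \<in> I then X $ i $ k / x else 0)"
  define L :: "real ^ 'n ^ 'n" where "L = (\<chi> j k. if k = i then l $ j else mat 1 $ j $ k)"
  define U :: "real ^ 'n ^ 'n" where "U = (\<chi> k j. if k = i then u $ j else mat 1 $ j $ k)"
  define S where "S = pad I (schur i X)"
  define D where "D = (\<chi> j. if j = i then x *s S $ i else S $ j)"
  have dL: "det L = 1" unfolding L_def by (rule det_replace_column) (simp add: l_def)
  have "transpose U = (\<chi> j k. if k = i then u $ j else mat 1 $ j $ k)"
    by (simp add: U_def transpose_def vec_eq_iff)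
  then have "det (transpose U) = 1" using det_replace_column[of u i] by (simp add: u_def)
  then have dU: "det U = 1" by (simp add: det_transpose)
  have "det D = x * det (\<chi> j. if j = i then S $ i else S $ j)"
    unfolding D_def by (rule det_row_mul)
  also have "(\<chi> j. if j = i then S $ i else S $ j) = S" by (simp add: vec_eq_iff)
  finally have dD: "det D = x * det S" .
  have Dji: "D $ j $ i = (if j = i then x else 0)" "D $ i $ k = (if k = i then x else 0)" for j k
    using i by (auto simp: D_def S_def pad_def)
  have DU: "(D ** U) $ j $ k = D $ j $ k + (if j = i \<and> k \<in> I then X $ i $ k else 0)" for j k
  proof -
    have "(D ** U) $ j $ k = (\<Sum>m\<in>UNIV. D $ j $ m * (if m = k then 1 else 0) + (if m = i then D $ j $ i * (if k \<in> I then X $ i $ k / x else 0) else 0))"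
      unfolding matrix_matrix_mult_def U_def using i
      by (auto simp: mat_def u_def intro!: sum.cong)
    also have "\<dots> = D $ j $ k + D $ j $ i * (if k \<in> I then X $ i $ k / x else 0)"
      by (simp add: sum.distrib if_distrib[where f="\<lambda>y. _ * y"] cong: if_cong)
    finally show ?thesis using x by (simp add: Dji x_def)
  qed
  have LM: "(L ** M) $ j $ k = M $ j $ k + (if j \<in> I then X $ j $ i / x else 0) * M $ i $ k" for M :: "real ^ 'n ^ 'n" and j k
  proof -
    have "(L ** M) $ j $ k = (\<Sum>m\<in>UNIV. (if m = j then 1 else 0) * M $ m $ k + (if m = i then (if j \<in> I then X $ j $ i / x else 0) * M $ i $ k else 0))"
      unfolding matrix_matrix_mult_def L_def using i
      by (auto simp: mat_def l_def intro!: sum.cong)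
    also have "\<dots> = M $ j $ k + (if j \<in> I then X $ j $ i / x else 0) * M $ i $ k"
      by (simp add: sum.distrib if_distrib[where f="\<lambda>y. y * _"] cong: if_cong)
    finally show ?thesis .
  qed
  have "pad (insert i I) X = L ** (D ** U)"
  proof (simp only: vec_eq_iff, intro allI)
    fix j k
    show "pad (insert i I) X $ j $ k = (L ** (D ** U)) $ j $ k"
    proof (cases "j = i \<or> k = i")
      case True
      then show ?thesis unfolding LM DU Dji using i x
        by (auto simp: pad_def x_def Dji)
    next
      case False
      then have "D $ j $ k = S $ j $ k" by (simp add: D_def)
      then show ?thesis unfolding LM DU Dji using i x False
        by (auto simp: pad_def x_def S_def schur_def)
    qed
  qed
  then have "det (pad (insert i I) X) = det L * (det D * det U)" by (simp add: det_mul)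
  then show ?thesis by (simp add: dL dU dD S_def x_def)
qed

lemma det_pad_empty: "det (pad {} X) = (1::real)"
proof -
  have "pad {} X = mat 1" by (simp add: pad_def mat_def vec_eq_iff)
  then show ?thesis by simp
qed

lemma det_pad_singleton:
  fixes X :: "real ^ 'n ^ 'n::finite" shows "det (pad {i} X) = X $ i $ i"
proof -
  have "det (pad {i} X) = (\<Prod>j\<in>UNIV. pad {i} X $ j $ j)"
    by (rule det_diagonal) (auto simp: pad_def)
  also have "\<dots> = (\<Prod>j\<in>UNIV. if j = i then X $ i $ i else 1)"
    by (intro prod.cong) (auto simp: pad_def)
  finally show ?thesis by simp
qed

text \<open>Completing the square in the variable \<open>v i\<close>, with the symmetry of X merging
  the two cross terms.\<close>

lemma qform_insert:
  fixes X :: "real ^ 'n ^ 'n::finite"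
  assumes i: "i \<notin> I" and x: "X $ i $ i \<noteq> 0" and X: "sym_mat X"
  shows "qform (insert i I) X v
    = X $ i $ i * (v i + (\<Sum>k\<in>I. X $ i $ k * v k) / X $ i $ i)\<^sup>2 + qform I (schur i X) v"
proof -
  define x where "x = X $ i $ i"
  define s where "s = (\<Sum>k\<in>I. X $ i $ k * v k)"
  have fin: "finite I" by simp
  have ss: "(\<Sum>j\<in>I. \<Sum>k\<in>I. v j * (X $ j $ i * X $ i $ k / x) * v k) = s\<^sup>2 / x"
    unfolding s_def power2_eq_square sum_product sum_divide_distrib
    by (intro sum.cong refl) (simp add: sym_matD[OF X, of _ i])
  have s1: "(\<Sum>k\<in>I. v i * X $ i $ k * v k) = v i * s" unfolding s_def by (simp add: sum_distrib_left mult_ac)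
  have s2: "(\<Sum>j\<in>I. v j * X $ j $ i * v i) = v i * s"
    unfolding s_def sum_distrib_left by (intro sum.cong refl) (simp add: sym_matD[OF X, of _ i])
  have "qform I (schur i X) v = qform I X v - s\<^sup>2 / x"
    unfolding ss[symmetric] qform_def sum_subtractf[symmetric]
    by (intro sum.cong refl) (simp add: schur_def x_def algebra_simps)
  moreover have "qform (insert i I) X v = x * (v i)\<^sup>2 + 2 * (v i * s) + qform I X v"
    unfolding qform_def sum2_insert[OF fin i] s1 s2 by (simp add: x_def power2_eq_square)
  moreover have "x * (v i + s / x)\<^sup>2 = x * (v i)\<^sup>2 + 2 * (v i * s) + s\<^sup>2 / x"
    using x unfolding x_def by (simp add: power2_eq_square field_simps)
  ultimately show ?thesis unfolding x_def[symmetric] s_def[symmetric] by simp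
qed

lemma qform_cong: "(\<And>j. j \<in> I \<Longrightarrow> v j = w j) \<Longrightarrow> (\<And>j k. j \<in> I \<Longrightarrow> k \<in> I \<Longrightarrow> X $ j $ k = Y $ j $ k) \<Longrightarrow> qform I X v = qform I Y w"
  unfolding qform_def by (intro sum.cong refl) auto

lemma pd_on_cong: "(\<And>j k. j \<in> I \<Longrightarrow> k \<in> I \<Longrightarrow> X $ j $ k = Y $ j $ k) \<Longrightarrow> pd_on I X = pd_on I Y"
  unfolding pd_on_def using qform_cong[of I _ _ X Y] by metis

lemma pad_cong: "(\<And>j k. j \<in> I \<Longrightarrow> k \<in> I \<Longrightarrow> X $ j $ k = Y $ j $ k) \<Longrightarrow> pad I X = pad I Y"
  unfolding pad_def by (auto simp: vec_eq_iff)

lemma pd_on_insert: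
  fixes X :: "real ^ 'n ^ 'n::finite"
  assumes i: "i \<notin> I" and X: "sym_mat X"
  shows "pd_on (insert i I) X \<longleftrightarrow> X $ i $ i > 0 \<and> pd_on I (schur i X)"
proof
  assume pd: "pd_on (insert i I) X"
  have "qform (insert i I) X (\<lambda>j. if j = i then 1 else 0) > 0"
    using pd by (auto simp: pd_on_def)
  also have "qform (insert i I) X (\<lambda>j. if j = i then 1 else 0) = X $ i $ i"
    unfolding qform_def by (simp add: if_distrib[where f="\<lambda>y. _ * y"] if_distrib[where f="\<lambda>y. y * _"] cong: if_cong)
  finally have x: "X $ i $ i > 0" .
  moreover have "pd_on I (schur i X)"
    unfolding pd_on_def
  proof (intro allI impI)
    fix v :: "'n \<Rightarrow> real" assume v: "\<exists>j\<in>I. v j \<noteq> 0"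
    \<comment> \<open>This value at i makes the completed square vanish, so only the form of the
      Schur complement remains.\<close>
    define w where "w = v(i := - (\<Sum>k\<in>I. X $ i $ k * v k) / X $ i $ i)"
    have s: "(\<Sum>k\<in>I. X $ i $ k * w k) = (\<Sum>k\<in>I. X $ i $ k * v k)"
      using i by (intro sum.cong) (auto simp: w_def)
    have "\<exists>j\<in>insert i I. w j \<noteq> 0" using v i by (auto simp: w_def)
    then have "qform (insert i I) X w > 0" using pd by (simp add: pd_on_def)
    also have "qform (insert i I) X w = qform I (schur i X) w"
      using x by (subst qform_insert[OF i _ X]) (auto simp: s, simp add: w_def)
    also have "\<dots> = qform I (schur i X) v" using i by (intro qform_cong) (auto simp: w_def)
    finally show "qform I (schur i X) v > 0" .
  qed
  ultimately show "X $ i $ i > 0 \<and> pd_on I (schur i X)" ..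
next
  assume *: "X $ i $ i > 0 \<and> pd_on I (schur i X)"
  show "pd_on (insert i I) X"
    unfolding pd_on_def
  proof (intro allI impI)
    fix v :: "'n \<Rightarrow> real" assume v: "\<exists>j\<in>insert i I. v j \<noteq> 0"
    show "qform (insert i I) X v > 0"
    proof (cases "\<exists>j\<in>I. v j \<noteq> 0")
      case True
      then have "qform I (schur i X) v > 0" using * by (auto simp: pd_on_def)
      then show ?thesis using * by (subst qform_insert[OF i _ X]) (auto intro: add_nonneg_pos)
    next
      case False
      then have 0: "\<And>j. j \<in> I \<Longrightarrow> v j = 0" and vi: "v i \<noteq> 0" using v by auto
      have "qform I (schur i X) v = 0" "(\<Sum>k\<in>I. X $ i $ k * v k) = 0"
        using 0 by (auto simp: qform_def intro!: sum.neutral)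
      then show ?thesis using * vi by (subst qform_insert[OF i _ X]) auto
    qed
  qed
qed

lemma pd_on_empty: "pd_on {} X" by (simp add: pd_on_def)

text \<open>The minor is a product of pivots, each positive by \<open>pd_on_insert\<close>.\<close>

lemma det_pad_pos:
  fixes X :: "real ^ 'n ^ 'n::finite"
  assumes "sym_mat X" "pd_on I X" shows "det (pad I X) > 0"
proof -
  have "finite I" by simp
  then show ?thesis using assms
  proof (induction I arbitrary: X rule: finite_induct)
    case (insert i I)
    then show ?case
      using pd_on_insert[of i I X] det_pad_insert[of i I X] sym_mat_schur[of X i] by auto
  qed (simp add: det_pad_empty)
qed

text \<open>Elimination replaces the uncountable quantifier over vectors by finitely many sign
  conditions on pivots, which are rational functions of the entries.\<close>

lemma pd_on_measurable:
  fixes A :: "'w \<Rightarrow> real ^ 'n ^ 'n::finite"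
  assumes "\<And>j k. (\<lambda>w. A w $ j $ k) \<in> borel_measurable M" "\<And>w. sym_mat (A w)"
  shows "Measurable.pred M (\<lambda>w. pd_on I (A w))"
proof -
  have "finite I" by simp
  then show ?thesis using assms
  proof (induction I arbitrary: A rule: finite_induct)
    case (insert i I)
    note [measurable] = insert.prems(1)
    have "Measurable.pred M (\<lambda>w. pd_on I (schur i (A w)))"
      by (rule insert.IH) (auto simp: schur_def intro: sym_mat_schur[unfolded schur_def] insert.prems)
    moreover have "Measurable.pred M (\<lambda>w. A w $ i $ i > 0)" by measurable
    ultimately show ?case
      using insert by (simp add: pd_on_insert)
  qed (simp add: pd_on_empty)
qed

lemma det_measurable:
  fixes A :: "'w \<Rightarrow> real ^ 'n ^ 'n::finite"
  assumes [measurable]: "\<And>j k. (\<lambda>w. A w $ j $ k) \<in> borel_measurable M"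
  shows "(\<lambda>w. det (A w)) \<in> borel_measurable M"
  unfolding det_def by measurable

section \<open>Gaussian integrals over one row of a symmetric matrix\<close>

lemma gauss_real_shift:
  fixes x c s :: real
  assumes "x > 0" "c > 0"
  shows "(\<integral>\<^sup>+t. ennreal (exp (- (x * (c * t + s)\<^sup>2))) \<partial>lborel) = ennreal (sqrt (pi / x) / c)"
proof -
  have *: "(\<integral>\<^sup>+t. ennreal (std_normal_density t) \<partial>lborel) = 1"
    using prob_space.emeasure_space_1[OF prob_space_normal_density[of 1 0]] by (simp add: emeasure_density)
  have cc: "c * sqrt (2 * x) \<noteq> 0" using assms by simp
  have "(1::ennreal) = ennreal \<bar>c * sqrt (2 * x)\<bar> * (\<integral>\<^sup>+t. ennreal (std_normal_density (s * sqrt (2 * x) + c * sqrt (2 * x) * t)) \<partial>lborel)"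
    using nn_integral_real_affine[OF _ cc, of "\<lambda>t. ennreal (std_normal_density t)" "s * sqrt (2 * x)"] * by simp
  also have "(\<lambda>t. std_normal_density (s * sqrt (2 * x) + c * sqrt (2 * x) * t)) =
     (\<lambda>t. (1 / sqrt (2 * pi)) * exp (- (x * (c * t + s)\<^sup>2)))"
  proof
    fix t
    have "(s * sqrt (2 * x) + c * sqrt (2 * x) * t)\<^sup>2 = (sqrt (2 * x))\<^sup>2 * (c * t + s)\<^sup>2"
      by (simp only: power_mult_distrib[symmetric]) (simp add: algebra_simps)
    also have "\<dots> = 2 * (x * (c * t + s)\<^sup>2)" using assms by simp
    finally show "std_normal_density (s * sqrt (2 * x) + c * sqrt (2 * x) * t) = (1 / sqrt (2 * pi)) * exp (- (x * (c * t + s)\<^sup>2))"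
      by (simp add: std_normal_density_def)
  qed
  also have "(\<integral>\<^sup>+t. ennreal ((1 / sqrt (2 * pi)) * exp (- (x * (c * t + s)\<^sup>2))) \<partial>lborel) =
      ennreal (1 / sqrt (2 * pi)) * (\<integral>\<^sup>+t. ennreal (exp (- (x * (c * t + s)\<^sup>2))) \<partial>lborel)"
    by (subst nn_integral_cmult[symmetric]) (auto intro!: nn_integral_cong simp: ennreal_mult[symmetric])
  finally have "1 = ennreal (c * sqrt (2 * x) / sqrt (2 * pi)) * (\<integral>\<^sup>+t. ennreal (exp (- (x * (c * t + s)\<^sup>2))) \<partial>lborel)"
    using assms by (simp add: mult.assoc[symmetric] ennreal_mult[symmetric] abs_mult)
  also have "c * sqrt (2 * x) / sqrt (2 * pi) = c / sqrt (pi / x)"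
    by (simp add: real_sqrt_mult real_sqrt_divide)
  finally have e: "1 = ennreal (c / sqrt (pi / x)) * (\<integral>\<^sup>+t. ennreal (exp (- (x * (c * t + s)\<^sup>2))) \<partial>lborel)" .
  have "ennreal (sqrt (pi / x) / c) * 1 = ennreal (sqrt (pi / x) / c) * ennreal (c / sqrt (pi / x)) * (\<integral>\<^sup>+t. ennreal (exp (- (x * (c * t + s)\<^sup>2))) \<partial>lborel)"
    by (subst e) (simp add: mult.assoc)
  also have "ennreal (sqrt (pi / x) / c) * ennreal (c / sqrt (pi / x)) = 1"
    using assms by (subst ennreal_mult[symmetric]) auto
  finally show ?thesis by simp
qed

text \<open>Carrying an extra row \<open>i0\<close> along makes the linear term of the Gaussian part of the form, so
  that completing the square is again a Schur complement.\<close>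

lemma gauss_qform:
  fixes X :: "real ^ 'n ^ 'n::finite" and h :: "'n \<Rightarrow> 'b"
  assumes "sym_mat X" "pd_on I X" "i0 \<notin> I" "inj_on h I" "c > 0"
  shows "(\<integral>\<^sup>+b. ennreal (exp (- qform (insert i0 I) X (\<lambda>j. if j = i0 then a else c * b (h j)))) \<partial>(Pi\<^sub>M (h ` I) (\<lambda>_. lborel)))
    = ennreal ((sqrt pi / c) ^ card I / sqrt (det (pad I X)) * exp (- (a\<^sup>2 * (det (pad (insert i0 I) X) / det (pad I X)))))"
proof -
  have "finite I" by simp
  then show ?thesis using assms
  proof (induction I arbitrary: X rule: finite_induct)
    case empty
    then show ?case
      by (simp add: PiM_empty nn_integral_count_space_finite det_pad_empty det_pad_singleton qform_def power2_eq_square mult_ac)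
  next
    case (insert i I)
    interpret product_sigma_finite "\<lambda>_::'b. lborel::real measure" by standard
    define x where "x = X $ i $ i"
    have x: "x > 0" and pS: "pd_on I (schur i X)" using pd_on_insert[of i I X] insert by (auto simp: x_def)
    have sS: "sym_mat (schur i X)" using insert by (simp add: sym_mat_schur)
    have ii0: "i \<noteq> i0" "i0 \<notin> I" "i \<notin> I" using insert by auto
    have hi: "h i \<notin> h ` I" "inj_on h I" using insert by auto
    have d1: "det (pad (insert i I) X) = x * det (pad I (schur i X))"
      using x ii0 unfolding x_def by (intro det_pad_insert) auto
    have d2: "det (pad (insert i0 (insert i I)) X) = x * det (pad (insert i0 I) (schur i X))"
      using x ii0 unfolding x_def by (subst insert_commute, intro det_pad_insert) auto
    have dp: "det (pad I (schur i X)) > 0" by (intro det_pad_pos sS pS)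
    let ?w = "\<lambda>b j. if j = i0 then a else c * b (h j)"
    have inner: "(\<integral>\<^sup>+t. ennreal (exp (- qform (insert i0 (insert i I)) X (?w (b(h i := t))))) \<partial>lborel)
       = ennreal (sqrt (pi / x) / c) * ennreal (exp (- qform (insert i0 I) (schur i X) (?w b)))" for b
    proof -
      \<comment> \<open>Minus s is the value of c t at the centre of the Gaussian in t; the sum
        includes the fixed coordinate \<open>i0\<close>, which carries the linear term.\<close>
      define s where "s = (\<Sum>k\<in>insert i0 I. X $ i $ k * ?w b k) / x"
      have hk: "h k \<noteq> h i" if "k \<in> I" for k using that hi(1) by (metis imageI)
      have "qform (insert i0 (insert i I)) X (?w (b(h i := t))) = x * (c * t + s)\<^sup>2 + qform (insert i0 I) (schur i X) (?w b)" for t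
      proof -
        have 1: "qform (insert i0 I) (schur i X) (?w (b(h i := t))) = qform (insert i0 I) (schur i X) (?w b)"
          by (rule qform_cong) (auto simp: hk)
        have 2: "(\<Sum>k\<in>insert i0 I. X $ i $ k * ?w (b(h i := t)) k) = (\<Sum>k\<in>insert i0 I. X $ i $ k * ?w b k)"
          by (intro sum.cong refl) (auto simp: hk)
        have 3: "?w (b(h i := t)) i = c * t" using ii0 by simp
        have "qform (insert i (insert i0 I)) X (?w (b(h i := t))) =
          x * (c * t + s)\<^sup>2 + qform (insert i0 I) (schur i X) (?w b)"
          unfolding x_def s_def using x ii0 insert.prems(1)
          by (subst qform_insert) (auto simp only: 1 2 3 x_def insert_iff if_False fun_upd_same)
        then show ?thesis by (simp only: insert_commute)
      qed
      then have "(\<integral>\<^sup>+t. ennreal (exp (- qform (insert i0 (insert i I)) X (?w (b(h i := t))))) \<partial>lborel)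
        = (\<integral>\<^sup>+t. ennreal (exp (- (x * (c * t + s)\<^sup>2))) * ennreal (exp (- qform (insert i0 I) (schur i X) (?w b))) \<partial>lborel)"
        by (simp only: minus_add_distrib exp_add) (simp add: ennreal_mult)
      also have "\<dots> = ennreal (sqrt (pi / x) / c) * ennreal (exp (- qform (insert i0 I) (schur i X) (?w b)))"
        by (subst nn_integral_multc) (auto simp: gauss_real_shift[OF x \<open>c > 0\<close>])
      finally show ?thesis .
    qed
    have m: "(\<lambda>b. ennreal (exp (- qform (insert i0 J) X (?w b)))) \<in> borel_measurable (Pi\<^sub>M (h ` J) (\<lambda>_. lborel))" for J X
    proof -
      have v: "(\<lambda>b. ?w b k) \<in> borel_measurable (Pi\<^sub>M (h ` J) (\<lambda>_. lborel))" if "k \<in> insert i0 J" for k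
        using that by (cases "k = i0") auto
      show ?thesis unfolding qform_def
        by (intro measurable_compose[OF _ measurable_ennreal] measurable_compose[OF _ borel_measurable_exp]
            borel_measurable_uminus borel_measurable_sum borel_measurable_times v borel_measurable_const)
    qed
    have "(\<integral>\<^sup>+b. ennreal (exp (- qform (insert i0 (insert i I)) X (?w b))) \<partial>(Pi\<^sub>M (h ` insert i I) (\<lambda>_. lborel)))
       = (\<integral>\<^sup>+b. (\<integral>\<^sup>+t. ennreal (exp (- qform (insert i0 (insert i I)) X (?w (b(h i := t))))) \<partial>lborel) \<partial>(Pi\<^sub>M (h ` I) (\<lambda>_. lborel)))"
      using product_nn_integral_insert[of "h ` I" "h i" "\<lambda>b. ennreal (exp (- qform (insert i0 (insert i I)) X (?w b)))"]
        hi insert.hyps(1) m[of "insert i I" X] by simp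
    also have "\<dots> = ennreal (sqrt (pi / x) / c) * (\<integral>\<^sup>+b. ennreal (exp (- qform (insert i0 I) (schur i X) (?w b))) \<partial>(Pi\<^sub>M (h ` I) (\<lambda>_. lborel)))"
      unfolding inner using m[of I "schur i X"] by (intro nn_integral_cmult)
    also have "(\<integral>\<^sup>+b. ennreal (exp (- qform (insert i0 I) (schur i X) (?w b))) \<partial>(Pi\<^sub>M (h ` I) (\<lambda>_. lborel)))
       = ennreal ((sqrt pi / c) ^ card I / sqrt (det (pad I (schur i X))) * exp (- (a\<^sup>2 * (det (pad (insert i0 I) (schur i X)) / det (pad I (schur i X))))))"
      by (rule insert.IH[OF sS pS ii0(2) hi(2) \<open>c > 0\<close>])
    also have "ennreal (sqrt (pi / x) / c) * \<dots> =
      ennreal ((sqrt pi / c) ^ card (insert i I) / sqrt (det (pad (insert i I) X)) * exp (- (a\<^sup>2 * (det (pad (insert i0 (insert i I)) X) / det (pad (insert i I) X)))))"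
      unfolding d1 d2 using x dp ii0 \<open>c > 0\<close> insert.hyps(1)
      by (subst ennreal_mult[symmetric]) (auto simp: real_sqrt_mult real_sqrt_divide field_simps)
    finally show ?case .
  qed
qed

section \<open>Recursion for the gamma integrand when one row is split off\<close>

definition trI :: "'n set \<Rightarrow> real ^ 'n ^ 'n \<Rightarrow> real ^ 'n ^ 'n \<Rightarrow> real" where
  "trI I X Y = (\<Sum>j\<in>I. \<Sum>k\<in>I. X $ j $ k * Y $ j $ k)"

text \<open>The integrand of the gamma integral on the block I. The exponent is s relative to the
  invariant measure det^(-(m+1)/2) dY on positive definite matrices of size m = card I.\<close>

definition cone_kernel :: "'n set \<Rightarrow> real \<Rightarrow> real ^ 'n ^ 'n \<Rightarrow> real ^ 'n ^ 'n::finite \<Rightarrow> real" where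
  "cone_kernel I s X Y =
    (if pd_on I Y then exp (- trI I X Y) * det (pad I Y) powr (s - (real (card I) + 1) / 2) else 0)"

lemma cone_kernel_cong:
  "(\<And>j k. j \<in> I \<Longrightarrow> k \<in> I \<Longrightarrow> Y $ j $ k = Z $ j $ k) \<Longrightarrow> cone_kernel I s X Y = cone_kernel I s X Z"
  unfolding cone_kernel_def trI_def using pd_on_cong[of I Y Z] pad_cong[of I Y Z] by simp

lemma sym_mat_pad: "sym_mat Y \<Longrightarrow> sym_mat (pad I Y)"
  by (auto simp: sym_mat_def pad_def)

text \<open>Only the entries inside I are known to be measurable; the kernel sees no others, so the
  matrix may be replaced by its padded block, all of whose entries are measurable.\<close>

lemma cone_kernel_measurable:
  fixes A :: "'w \<Rightarrow> real ^ 'n ^ 'n::finite"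
  assumes A: "\<And>j k. j \<in> I \<Longrightarrow> k \<in> I \<Longrightarrow> (\<lambda>w. A w $ j $ k) \<in> borel_measurable M" and S: "\<And>w. sym_mat (A w)"
  shows "(\<lambda>w. cone_kernel I s X (A w)) \<in> borel_measurable M"
proof -
  define B where "B w = pad I (A w)" for w
  have [measurable]: "(\<lambda>w. B w $ j $ k) \<in> borel_measurable M" for j k
    unfolding B_def pad_def using A by (cases "j \<in> I \<and> k \<in> I") auto
  have eq: "cone_kernel I s X (A w) = cone_kernel I s X (B w)" for w
    by (rule cone_kernel_cong) (simp add: B_def pad_def)
  have [measurable]: "Measurable.pred M (\<lambda>w. pd_on I (B w))"
  proof (rule pd_on_measurable)
    show "sym_mat (B w)" for w unfolding B_def by (intro sym_mat_pad S)
  qed measurable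
  have padB: "pad I (B w) = B w" for w by (simp add: B_def pad_def vec_eq_iff)
  have [measurable]: "(\<lambda>w. det (B w)) \<in> borel_measurable M" by (rule det_measurable) measurable
  have "(\<lambda>w. cone_kernel I s X (B w)) \<in> borel_measurable M"
    unfolding cone_kernel_def trI_def padB by measurable
  then show ?thesis by (simp only: eq)
qed

lemma qform_scale: "qform I X (\<lambda>j. c * v j) = c\<^sup>2 * qform I X v"
  unfolding qform_def sum_distrib_left by (simp add: power2_eq_square mult_ac)

text \<open>In the coordinates t (the pivot), w (row i divided by t) and Z (the Schur complement),
  positivity becomes t > 0 together with positivity of Z, the determinant becomes t det Z, and the
  trace pairing becomes t times the form of X at w plus the pairing with Z. Adding an index raises m
  by 1, so the same exponent belongs to the parameter s - 1/2 on the smaller block.\<close>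

lemma cone_kernel_insert:
  fixes X Y Z :: "real ^ 'n ^ 'n::finite"
  assumes i: "i \<notin> I" and Y: "sym_mat Y" and t: "Y $ i $ i = t" "t > 0" and w: "w i = 1"
    and Yw: "\<And>j. j \<in> I \<Longrightarrow> Y $ i $ j = t * w j"
    and Z: "\<And>j k. j \<in> I \<Longrightarrow> k \<in> I \<Longrightarrow> Z $ j $ k = Y $ j $ k - t * w j * w k"
  shows "cone_kernel (insert i I) s X Y =
    exp (- (t * qform (insert i I) X w)) * t powr (s - (real (card I) + 2) / 2) * cone_kernel I (s - 1 / 2) X Z"
proof -
  have fin: "finite I" by simp
  have YZ: "Y $ j $ k = Z $ j $ k + t * w j * w k" if "j \<in> I" "k \<in> I" for j k using Z[OF that] by simp
  have Yji: "Y $ j $ i = t * w j" if "j \<in> I" for j using Yw[OF that] sym_matD[OF Y, of i j] by simp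
  have SZ: "schur i Y $ j $ k = Z $ j $ k" if "j \<in> I" "k \<in> I" for j k
    using that t by (simp add: schur_def Yw Yji Z power2_eq_square)
  have pd: "pd_on (insert i I) Y \<longleftrightarrow> pd_on I Z"
    using pd_on_insert[OF i Y] pd_on_cong[of I "schur i Y" Z] SZ t by simp
  have det: "det (pad (insert i I) Y) = t * det (pad I Z)"
    using det_pad_insert[OF i, of Y] pad_cong[of I "schur i Y" Z] SZ t by simp
  have tr: "trI (insert i I) X Y = t * qform (insert i I) X w + trI I X Z"
  proof -
    have "(\<Sum>j\<in>I. \<Sum>k\<in>I. X $ j $ k * Y $ j $ k) = (\<Sum>j\<in>I. \<Sum>k\<in>I. t * (w j * X $ j $ k * w k) + X $ j $ k * Z $ j $ k)"
      by (intro sum.cong refl) (simp add: YZ algebra_simps)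
    also have "\<dots> = t * (\<Sum>j\<in>I. \<Sum>k\<in>I. w j * X $ j $ k * w k) + trI I X Z"
      by (simp add: sum.distrib sum_distrib_left trI_def)
    finally have 1: "(\<Sum>j\<in>I. \<Sum>k\<in>I. X $ j $ k * Y $ j $ k) = t * (\<Sum>j\<in>I. \<Sum>k\<in>I. w j * X $ j $ k * w k) + trI I X Z" .
    have 2: "(\<Sum>k\<in>I. X $ i $ k * Y $ i $ k) = t * (\<Sum>k\<in>I. w i * X $ i $ k * w k)"
      unfolding sum_distrib_left by (intro sum.cong refl) (simp add: Yw w)
    have 3: "(\<Sum>j\<in>I. X $ j $ i * Y $ j $ i) = t * (\<Sum>j\<in>I. w j * X $ j $ i * w i)"
      unfolding sum_distrib_left by (intro sum.cong refl) (simp add: Yji w)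
    show ?thesis
      unfolding trI_def[of "insert i I"] qform_def sum2_insert[OF fin i] 1 2 3
      using t w by (simp add: algebra_simps)
  qed
  have card: "real (card (insert i I)) = real (card I) + 1" using i by simp
  show ?thesis
  proof (cases "pd_on I Z")
    case True
    \<comment> \<open>\<open>det_pad_pos\<close> asks for a matrix symmetric in all entries, while Z
      is controlled only on I; outside I it is replaced by 0, which changes neither the padded block
      nor positivity on I.\<close>
    have symZ: "sym_mat (\<chi> j k. if j \<in> I \<and> k \<in> I then Z $ j $ k else 0)"
      using Z sym_matD[OF Y] by (auto simp: sym_mat_def)
    have "pad I (\<chi> j k. if j \<in> I \<and> k \<in> I then Z $ j $ k else 0) = pad I Z" by (rule pad_cong) simp
    moreover have "pd_on I (\<chi> j k. if j \<in> I \<and> k \<in> I then Z $ j $ k else 0)"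
      using True pd_on_cong[of I "\<chi> j k. if j \<in> I \<and> k \<in> I then Z $ j $ k else 0" Z] by simp
    ultimately have "det (pad I Z) > 0" using det_pad_pos[OF symZ, of I] by simp
    define p where "p = s - (real (card I) + 2) / 2"
    have pw: "(t * det (pad I Z)) powr p = t powr p * det (pad I Z) powr p"
      using t \<open>det (pad I Z) > 0\<close> by (simp add: powr_mult)
    have e: "s - (real (card I) + 1 + 1) / 2 = p" "s - 1 / 2 - (real (card I) + 1) / 2 = p"
      by (simp_all add: p_def field_simps)
    have "cone_kernel (insert i I) s X Y = exp (- (t * qform (insert i I) X w + trI I X Z)) * (t powr p * det (pad I Z) powr p)"
      by (simp only: cone_kernel_def pd det tr card e True if_True pw)
    moreover have "cone_kernel I (s - 1 / 2) X Z = exp (- trI I X Z) * det (pad I Z) powr p"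
      by (simp only: cone_kernel_def e True if_True)
    ultimately show ?thesis unfolding p_def[symmetric] by (simp only: minus_add_distrib exp_add mult_ac)
  qed (simp add: cone_kernel_def pd)
qed

text \<open>Serves to remove the rank-one shift by t times w j w k that separates the block of Y
  from its Schur complement.\<close>

lemma nn_integral_PiM_translate:
  assumes "finite J" and "F \<in> borel_measurable (Pi\<^sub>M J (\<lambda>_. lborel :: real measure))"
  shows "(\<integral>\<^sup>+f. F (\<lambda>e\<in>J. f e + \<tau> e) \<partial>(Pi\<^sub>M J (\<lambda>_. lborel))) = (\<integral>\<^sup>+f. F f \<partial>(Pi\<^sub>M J (\<lambda>_. lborel)))"
  using assms
proof (induction J arbitrary: F rule: finite_induct)
  case empty
  then show ?case by (simp add: PiM_empty nn_integral_count_space_finite)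
next
  case (insert i J)
  interpret product_sigma_finite "\<lambda>_::'a. lborel::real measure" by standard
  note [measurable] = insert.prems
  have Fup [measurable]: "(\<lambda>p. F ((fst p)(i := snd p))) \<in> borel_measurable (Pi\<^sub>M J (\<lambda>_. lborel) \<Otimes>\<^sub>M lborel)"
    using measurable_compose[OF measurable_add_dim[of i J "\<lambda>_. lborel"] insert.prems] by (simp add: case_prod_unfold)
  define G where "G x = (\<integral>\<^sup>+y. F (x(i := y)) \<partial>lborel)" for x
  have G [measurable]: "G \<in> borel_measurable (Pi\<^sub>M J (\<lambda>_. lborel))"
    unfolding G_def using Fup by (intro lborel.borel_measurable_nn_integral) (simp add: case_prod_unfold)
  have m: "(\<lambda>f. F (\<lambda>e\<in>insert i J. f e + \<tau> e)) \<in> borel_measurable (Pi\<^sub>M (insert i J) (\<lambda>_. lborel))"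
    by measurable
  have "(\<integral>\<^sup>+f. F (\<lambda>e\<in>insert i J. f e + \<tau> e) \<partial>(Pi\<^sub>M (insert i J) (\<lambda>_. lborel)))
     = (\<integral>\<^sup>+x. (\<integral>\<^sup>+y. F (\<lambda>e\<in>insert i J. (x(i := y)) e + \<tau> e) \<partial>lborel) \<partial>(Pi\<^sub>M J (\<lambda>_. lborel)))"
    using product_nn_integral_insert[OF insert.hyps m] by simp
  also have "\<dots> = (\<integral>\<^sup>+x. G (\<lambda>e\<in>J. x e + \<tau> e) \<partial>(Pi\<^sub>M J (\<lambda>_. lborel)))"
  proof (rule nn_integral_cong)
    fix x :: "'a \<Rightarrow> real"
    define z where "z = (\<lambda>e\<in>J. x e + \<tau> e)"
    have "z \<in> space (Pi\<^sub>M J (\<lambda>_. lborel))" by (simp add: z_def space_PiM)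
    then have [measurable]: "(\<lambda>y. F (z(i := y))) \<in> borel_measurable borel"
      using measurable_compose[OF measurable_Pair1' Fup, of z] by simp
    have "(\<lambda>e\<in>insert i J. (x(i := y)) e + \<tau> e) = z(i := y + \<tau> i)" for y
      using insert.hyps by (auto simp: z_def restrict_def fun_eq_iff)
    then show "(\<integral>\<^sup>+y. F (\<lambda>e\<in>insert i J. (x(i := y)) e + \<tau> e) \<partial>lborel) = G (\<lambda>e\<in>J. x e + \<tau> e)"
      using lborel_nn_integral_translate[of "\<lambda>y. F (z(i := y))" "\<tau> i"] by (simp add: G_def z_def[symmetric])
  qed
  also have "\<dots> = (\<integral>\<^sup>+x. G x \<partial>(Pi\<^sub>M J (\<lambda>_. lborel)))" by (rule insert.IH[OF G])
  also have "\<dots> = (\<integral>\<^sup>+f. F f \<partial>(Pi\<^sub>M (insert i J) (\<lambda>_. lborel)))"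
    unfolding G_def using product_nn_integral_insert[OF insert.hyps insert.prems] by (simp add: fun_upd_def)
  finally show ?case .
qed

lemma Gamma_integral_scaled:
  fixes s R :: real
  assumes "s > 0" "R > 0"
  shows "(\<integral>\<^sup>+t. ennreal (indicator {0<..} t * t powr (s - 1) * exp (- (t * R))) \<partial>lborel) = ennreal (Gamma s * R powr (- s))"
proof -
  have "ennreal (Gamma s) = (\<integral>\<^sup>+t. ennreal (indicator {0..} t * t powr (s - 1) / exp t) \<partial>lborel)"
    by (rule Gamma_conv_nn_integral_real[OF assms(1)])
  also have "\<dots> = ennreal \<bar>R\<bar> * (\<integral>\<^sup>+t. ennreal (indicator {0..} (0 + R * t) * (0 + R * t) powr (s - 1) / exp (0 + R * t)) \<partial>lborel)"
    using assms by (intro nn_integral_real_affine) auto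
  also have "(\<integral>\<^sup>+t. ennreal (indicator {0..} (0 + R * t) * (0 + R * t) powr (s - 1) / exp (0 + R * t)) \<partial>lborel)
     = (\<integral>\<^sup>+t. ennreal (R powr (s - 1)) * ennreal (indicator {0<..} t * t powr (s - 1) * exp (- (t * R))) \<partial>lborel)"
  proof (rule nn_integral_cong)
    fix t
    have "indicator {0..} (0 + R * t) * (0 + R * t) powr (s - 1) / exp (0 + R * t) =
       R powr (s - 1) * (indicator {0<..} t * t powr (s - 1) * exp (- (t * R)))"
      using assms by (cases t "0::real" rule: linorder_cases)
        (auto simp: indicator_def powr_mult exp_minus divide_inverse mult_ac zero_le_mult_iff)
    then show "ennreal (indicator {0..} (0 + R * t) * (0 + R * t) powr (s - 1) / exp (0 + R * t)) =
       ennreal (R powr (s - 1)) * ennreal (indicator {0<..} t * t powr (s - 1) * exp (- (t * R)))"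
      by (simp add: ennreal_mult)
  qed
  also have "ennreal \<bar>R\<bar> * \<dots> = ennreal (R powr s) * (\<integral>\<^sup>+t. ennreal (indicator {0<..} t * t powr (s - 1) * exp (- (t * R))) \<partial>lborel)"
    using assms by (subst nn_integral_cmult) (auto simp: mult.assoc[symmetric] ennreal_mult[symmetric] powr_mult_base)
  finally have e: "ennreal (Gamma s) = ennreal (R powr s) * (\<integral>\<^sup>+t. ennreal (indicator {0<..} t * t powr (s - 1) * exp (- (t * R))) \<partial>lborel)" .
  have "ennreal (R powr (-s)) * ennreal (Gamma s) =
    (ennreal (R powr (-s)) * ennreal (R powr s)) * (\<integral>\<^sup>+t. ennreal (indicator {0<..} t * t powr (s - 1) * exp (- (t * R))) \<partial>lborel)"
    by (simp only: e mult.assoc)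
  also have "ennreal (R powr (-s)) * ennreal (R powr s) = 1"
    using assms by (simp add: ennreal_mult[symmetric] powr_add[symmetric])
  finally show ?thesis using assms by (simp add: ennreal_mult[symmetric] Gamma_real_pos less_imp_le mult.commute)
qed

section \<open>Coordinates by matrix units, and the gamma integral by induction\<close>

lemma symm_unit_eq_iff:
  "symm_unit i j = symm_unit k l \<longleftrightarrow> i = k \<and> j = l \<or> i = l \<and> j = k"
proof
  assume eq: "symm_unit i j = symm_unit k l"
  have "symm_unit i j \<bullet> symm_unit i j = 1"
    unfolding inner_symm_unit smat_symm_unit by (auto simp: axis_def)
  then have "symm_unit i j \<bullet> symm_unit k l \<noteq> 0" by (simp add: eq)
  then have "smat (symm_unit i j) $ k $ l \<noteq> 0" by (auto simp: inner_symm_unit)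
  then show "i = k \<and> j = l \<or> i = l \<and> j = k"
    unfolding smat_symm_unit by (auto simp: axis_def split: if_splits)
qed (auto simp: symm_unit_commute)

text \<open>The symmetric matrix with coordinates f in the orthonormal basis. An off-diagonal entry
  occurs twice in the trace form, hence the factor 1/sqrt 2.\<close>

definition Ym :: "('n::finite symm \<Rightarrow> real) \<Rightarrow> real ^ 'n ^ 'n" where
  "Ym f = (\<chi> j k. f (symm_unit j k) * (if j = k then 1 else 1 / sqrt 2))"

lemma sym_mat_Ym: "sym_mat (Ym f)"
  by (simp add: sym_mat_def Ym_def symm_unit_commute)

definition unit_block :: "'n set \<Rightarrow> 'n::finite symm set" where
  "unit_block I = (\<lambda>(j, k). symm_unit j k) ` (I \<times> I)"

lemma unit_blockI: "j \<in> I \<Longrightarrow> k \<in> I \<Longrightarrow> symm_unit j k \<in> unit_block I"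
  unfolding unit_block_def by force

lemma unit_block_insert:
  "unit_block (insert i I) = insert (symm_unit i i) (symm_unit i ` I) \<union> unit_block I"
proof (intro equalityI subsetI)
  fix e assume "e \<in> unit_block (insert i I)"
  then obtain j k where e: "e = symm_unit j k" and jk: "j \<in> insert i I" "k \<in> insert i I"
    unfolding unit_block_def by force
  consider "j = i" | "k = i" | "j \<in> I" "k \<in> I" using jk by blast
  then show "e \<in> insert (symm_unit i i) (symm_unit i ` I) \<union> unit_block I"
  proof cases
    case 1 then show ?thesis using e jk by auto
  next
    case 2
    then have "e = symm_unit i j" using e symm_unit_commute[of j i] by simp
    then show ?thesis using jk by auto
  next
    case 3 then show ?thesis using e unit_blockI by blast
  qed
next
  fix e assume "e \<in> insert (symm_unit i i) (symm_unit i ` I) \<union> unit_block I"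
  then show "e \<in> unit_block (insert i I)" unfolding unit_block_def by force
qed

text \<open>A new index adds card I + 1 units. The value identifies the constant of the Fourier
  integral on symmetric matrices with that of the general transform.\<close>

lemma DIM_symm: "real DIM('n::finite symm) = real CARD('n) * (real CARD('n) + 1) / 2"
proof -
  have card_block: "real (card (unit_block I)) = real (card I) * (real (card I) + 1) / 2" for I :: "'n set"
  proof -
    have "finite I" by simp
    then show ?thesis
    proof (induction I rule: finite_induct)
      case (insert i I)
      let ?J = "insert (symm_unit i i) (symm_unit i ` I)"
      have "symm_unit i i \<notin> symm_unit i ` I" using insert.hyps by (auto simp: symm_unit_eq_iff)
      moreover have "inj_on (symm_unit i) I" by (auto simp: inj_on_def symm_unit_eq_iff)
      ultimately have J: "card ?J = Suc (card I)" by (simp add: card_image)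
      have "?J \<inter> unit_block I = {}" using insert.hyps by (auto simp: unit_block_def symm_unit_eq_iff)
      then have "card (unit_block (insert i I)) = Suc (card I) + card (unit_block I)"
        unfolding unit_block_insert J[symmetric] by (intro card_Un_disjoint) (auto simp: unit_block_def)
      then show ?case using insert by (simp add: field_simps)
    qed (simp add: unit_block_def)
  qed
  have "Basis = unit_block (UNIV :: 'n set)" by (auto simp: Basis_symm_def unit_block_def)
  then have "card (Basis :: 'n symm set) = card (unit_block (UNIV :: 'n set))" by (rule arg_cong[where f=card])
  then show ?thesis using card_block[of UNIV] by linarith
qed

lemma Ym_measurable:
  assumes "\<And>j k. j \<in> I \<Longrightarrow> k \<in> I \<Longrightarrow> symm_unit j k \<in> K" and "j \<in> I" "k \<in> I"
  shows "(\<lambda>f. Ym f $ j $ k) \<in> borel_measurable (Pi\<^sub>M K (\<lambda>_. lborel))"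
  unfolding Ym_def using assms by simp

text \<open>The three factors correspond to the splitting of one row: (2 pi)^(m/2) to its m
  off-diagonal coordinates, Gamma s to the pivot, and the shift by 1/2 to the Schur
  complement.\<close>

lemma Gamma_cone_Suc:
  "Gamma_cone (Suc m) s = (2 * pi) powr (real m / 2) * Gamma s * Gamma_cone m (s - 1 / 2)"
proof -
  have "(\<Prod>j=1..Suc m. Gamma (s - (real j - 1) / 2)) = Gamma s * (\<Prod>j=Suc 1..Suc m. Gamma (s - (real j - 1) / 2))"
    by (subst prod.atLeast_Suc_atMost) auto
  also have "(\<Prod>j=Suc 1..Suc m. Gamma (s - (real j - 1) / 2)) = (\<Prod>j=1..m. Gamma (s - 1 / 2 - (real j - 1) / 2))"
    by (subst prod.shift_bounds_cl_Suc_ivl) (intro prod.cong refl arg_cong[where f=Gamma], simp add: field_simps)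
  finally have 1: "(\<Prod>j=1..Suc m. Gamma (s - (real j - 1) / 2)) = Gamma s * (\<Prod>j=1..m. Gamma (s - 1 / 2 - (real j - 1) / 2))" .
  have "real (Suc m) * (real (Suc m) - 1) / 4 = real m / 2 + real m * (real m - 1) / 4"
    by (simp add: field_simps)
  then show ?thesis unfolding Gamma_cone_def 1 by (simp only: powr_add mult_ac)
qed

lemma Gamma_cone_pos: "s > (real n - 1) / 2 \<Longrightarrow> Gamma_cone n s > 0"
  unfolding Gamma_cone_def
proof (intro mult_pos_pos prod_pos ballI Gamma_real_pos)
  fix j assume "s > (real n - 1) / 2" "j \<in> {1..n}"
  then show "0 < s - (real j - 1) / 2" by (auto simp: field_simps)
qed simp

text \<open>Induction on I, with the new row split into its pivot t and its off-diagonal coordinates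
  b. For fixed t and b the remaining block is translated to the Schur complement and integrated by
  the induction hypothesis at s - 1/2. What is left is Gaussian in b, evaluated by
  \<open>gauss_qform\<close>, and then a one-dimensional Gamma integral in t.\<close>

theorem nn_integral_cone_kernel:
  fixes X :: "real ^ 'n ^ 'n::finite"
  assumes "sym_mat X" "pd_on I X" "s > (real (card I) - 1) / 2"
  shows "(\<integral>\<^sup>+f. ennreal (cone_kernel I s X (Ym f)) \<partial>(Pi\<^sub>M (unit_block I) (\<lambda>_. lborel)))
    = ennreal (Gamma_cone (card I) s * det (pad I X) powr (- s))"
proof -
  have "finite I" by simp
  then show ?thesis using assms
  proof (induction I arbitrary: s rule: finite_induct)
    case empty
    then show ?case
      by (simp add: unit_block_def PiM_empty nn_integral_count_space_finite cone_kernel_def pd_on_empty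
          det_pad_empty trI_def Gamma_cone_def)
  next
    case (insert i I)
    interpret product_sigma_finite "\<lambda>_::'n symm. lborel::real measure" by standard
    let ?u = "symm_unit i"
    let ?m = "card I"
    define J where "J = insert (?u i) (?u ` I)"
    have iI: "i \<notin> I" by fact
    have blk: "unit_block (insert i I) = J \<union> unit_block I"
      unfolding J_def by (rule unit_block_insert)
    have dis: "J \<inter> unit_block I = {}"
      using iI by (auto simp: unit_block_def J_def symm_unit_eq_iff)
    have finb: "finite J" "finite (unit_block I)" by (simp_all add: J_def unit_block_def)
    have ui: "?u i \<notin> ?u ` I" using iI by (auto simp: symm_unit_eq_iff)
    have inju: "inj_on ?u I" by (auto simp: inj_on_def symm_unit_eq_iff)
    have pdI: "pd_on I X"
      unfolding pd_on_def
    proof (intro allI impI)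
      fix v :: "'n \<Rightarrow> real" assume v: "\<exists>j\<in>I. v j \<noteq> 0"
      have "qform (insert i I) X (\<lambda>j. if j \<in> I then v j else 0) > 0"
        using insert.prems(2) v by (auto simp: pd_on_def)
      also have "qform (insert i I) X (\<lambda>j. if j \<in> I then v j else 0) = qform I X v"
        unfolding qform_def sum2_insert[OF insert.hyps] using iI by (auto intro!: sum.cong)
      finally show "qform I X v > 0" .
    qed
    have dI: "det (pad I X) > 0" and dI': "det (pad (insert i I) X) > 0"
      using insert.prems pdI by (auto intro: det_pad_pos)
    \<comment> \<open>A quotient of consecutive minors: the Schur complement of the block I in X at
      the entry (i, i). It is the rate that survives the Gaussian integration over the row.\<close>
    define R where "R = det (pad (insert i I) X) / det (pad I X)"
    have R: "R > 0" using dI dI' by (simp add: R_def)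
    have card: "card (insert i I) = Suc ?m" using iI by simp
    have s: "s > real ?m / 2" using insert.prems(3) unfolding card by simp
    have s0: "s > 0" using s by (smt (verit) divide_nonneg_nonneg of_nat_0_le_iff)
    define C where "C = Gamma_cone ?m (s - 1 / 2) * det (pad I X) powr (- (s - 1 / 2))"
    have C0: "C \<ge> 0" unfolding C_def using s by (intro mult_nonneg_nonneg less_imp_le[OF Gamma_cone_pos]) (auto simp: field_simps)
    have IH: "(\<integral>\<^sup>+f. ennreal (cone_kernel I (s - 1 / 2) X (Ym f)) \<partial>(Pi\<^sub>M (unit_block I) (\<lambda>_. lborel))) = ennreal C"
      unfolding C_def using s by (intro insert.IH insert.prems pdI) (auto simp: field_simps)
    let ?K = "\<lambda>f. ennreal (cone_kernel (insert i I) s X (Ym f))"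
    have Km: "?K \<in> borel_measurable (Pi\<^sub>M (J \<union> unit_block I) (\<lambda>_. lborel))"
      by (intro measurable_compose[OF _ measurable_ennreal] cone_kernel_measurable Ym_measurable[where I="insert i I"] sym_mat_Ym)
        (auto simp: blk[symmetric] intro: unit_blockI)
    have KIm: "(\<lambda>f. ennreal (cone_kernel I (s - 1 / 2) X (Ym f))) \<in> borel_measurable (Pi\<^sub>M (unit_block I) (\<lambda>_. lborel))"
      by (intro measurable_compose[OF _ measurable_ennreal] cone_kernel_measurable Ym_measurable[where I=I] sym_mat_Ym)
        (auto intro: unit_blockI)
    \<comment> \<open>The form t times \<open>qform\<close> at w, with sqrt t absorbed into the
      vector: position i becomes sqrt t, and b j / (sqrt 2 t) becomes b j / sqrt (2 t). Position i
      plays the role of the fixed row in \<open>gauss_qform\<close>.\<close>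
    define q where "q t b = qform (insert i I) X (\<lambda>j. if j = i then sqrt t else (1 / sqrt (2 * t)) * b (?u j))" for t b
    define \<Phi> where "\<Phi> y = (\<integral>\<^sup>+f. ?K (merge J (unit_block I) (y, f)) \<partial>(Pi\<^sub>M (unit_block I) (\<lambda>_. lborel)))" for y
    have \<Phi>: "\<Phi> y = (if y (?u i) > 0 then ennreal (exp (- q (y (?u i)) y) * (y (?u i)) powr (s - (real ?m + 2) / 2)) * ennreal C else 0)" for y
    proof -
      define t where "t = y (?u i)"
      have e: "Ym (merge J (unit_block I) (y, f)) $ i $ i = t"
        "\<And>j. j \<in> I \<Longrightarrow> Ym (merge J (unit_block I) (y, f)) $ i $ j = y (?u j) / sqrt 2"
        "\<And>j k. j \<in> I \<Longrightarrow> k \<in> I \<Longrightarrow> Ym (merge J (unit_block I) (y, f)) $ j $ k = Ym f $ j $ k" for f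
      proof -
        show "Ym (merge J (unit_block I) (y, f)) $ i $ i = t" by (simp add: Ym_def merge_def J_def t_def)
        show "Ym (merge J (unit_block I) (y, f)) $ i $ j = y (?u j) / sqrt 2" if "j \<in> I" for j
          using that iI by (auto simp: Ym_def merge_def J_def)
        show "Ym (merge J (unit_block I) (y, f)) $ j $ k = Ym f $ j $ k" if "j \<in> I" "k \<in> I" for j k
        proof -
          have "symm_unit j k \<in> unit_block I" using that by (rule unit_blockI)
          then have "symm_unit j k \<notin> J" using dis by blast
          then show ?thesis using \<open>symm_unit j k \<in> unit_block I\<close> by (simp add: Ym_def merge_def)
        qed
      qed
      show ?thesis
      proof (cases "t > 0")
        case False
        have "?K (merge J (unit_block I) (y, f)) = 0" for f
          using False pd_on_insert[OF iI sym_mat_Ym, of "merge J (unit_block I) (y, f)"] e(1)[of f]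
          by (simp add: cone_kernel_def)
        then show ?thesis using False by (simp add: \<Phi>_def t_def)
      next
        case True
        define w where "w j = (if j = i then 1 else y (?u j) / (sqrt 2 * t))" for j
        \<comment> \<open>The coordinates of the rank-one matrix with entries - t w j w k, read off
          by pairing it with the basis units.\<close>
        define \<tau> where "\<tau> e = - (t * qform I (smat e) w)" for e :: "'n symm"
        have \<tau>: "\<tau> (symm_unit j k) * (if j = k then 1 else 1 / sqrt 2) = - (t * w j * w k)" if "j \<in> I" "k \<in> I" for j k
        proof -
          have fin: "finite I" by simp
          have "qform I (smat (symm_unit j k)) w = (if j = k then 1 else sqrt 2) * (w j * w k)"
          proof (cases "j = k")
            case True
            have "qform I (smat (symm_unit j k)) w = (\<Sum>a\<in>I. \<Sum>b\<in>I. if b = j then if a = j then w j * w j else 0 else 0)"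
              unfolding qform_def smat_symm_unit using True by (intro sum.cong refl) (auto simp: axis_def)
            then show ?thesis using that True fin by simp
          next
            case False
            have "qform I (smat (symm_unit j k)) w = (\<Sum>a\<in>I. \<Sum>b\<in>I. (if b = k then if a = j then w j * w k / sqrt 2 else 0 else 0)
                + (if b = j then if a = k then w j * w k / sqrt 2 else 0 else 0))"
              unfolding qform_def smat_symm_unit using False by (intro sum.cong refl) (auto simp: axis_def)
            also have "\<dots> = w j * w k / sqrt 2 + w j * w k / sqrt 2"
              using that fin by (simp add: sum.distrib)
            also have "\<dots> = sqrt 2 * (w j * w k)"
              by (simp add: field_simps)
            finally show ?thesis using False by simp
          qed
          then show ?thesis by (simp add: \<tau>_def)
        qed
        have wY: "y (?u j) / sqrt 2 = t * w j" if "j \<in> I" for j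
          using that iI True by (auto simp: w_def)
        have K: "?K (merge J (unit_block I) (y, f)) = ennreal (exp (- (t * qform (insert i I) X w)) * t powr (s - (real ?m + 2) / 2))
           * ennreal (cone_kernel I (s - 1 / 2) X (Ym (\<lambda>e\<in>unit_block I. f e + \<tau> e)))" for f
        proof -
          have Z: "Ym (\<lambda>e\<in>unit_block I. f e + \<tau> e) $ j $ k = Ym (merge J (unit_block I) (y, f)) $ j $ k - t * w j * w k"
            if "j \<in> I" "k \<in> I" for j k
            using \<tau>[OF that] e(3)[OF that, of f] unit_blockI[OF that]
            by (simp add: Ym_def distrib_right split: if_splits)
          show ?thesis
            by (subst cone_kernel_insert[OF iI sym_mat_Ym e(1) True, where w=w and Z="Ym (\<lambda>e\<in>unit_block I. f e + \<tau> e)"])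
              (auto simp: w_def[of i] e(2) wY Z ennreal_mult cone_kernel_def)
        qed
        have "t * qform (insert i I) X w = q t y"
        proof -
          have "q t y = qform (insert i I) X (\<lambda>j. sqrt t * w j)"
            unfolding q_def
          proof (rule qform_cong)
            fix j assume "j \<in> insert i I"
            have "1 / sqrt (2 * t) = sqrt t * (1 / (sqrt 2 * t))"
              using True by (simp add: real_sqrt_mult field_simps)
            then show "(if j = i then sqrt t else 1 / sqrt (2 * t) * y (?u j)) = sqrt t * w j"
              by (simp add: w_def)
          qed simp
          also have "\<dots> = t * qform (insert i I) X w" using True by (simp add: qform_scale)
          finally show ?thesis ..
        qed
        moreover have "(\<integral>\<^sup>+f. ennreal (cone_kernel I (s - 1 / 2) X (Ym (\<lambda>e\<in>unit_block I. f e + \<tau> e))) \<partial>(Pi\<^sub>M (unit_block I) (\<lambda>_. lborel))) = ennreal C"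
          using nn_integral_PiM_translate[OF finb(2) KIm, of \<tau>] IH by simp
        moreover have "(\<lambda>f. ennreal (cone_kernel I (s - 1 / 2) X (Ym (\<lambda>e\<in>unit_block I. f e + \<tau> e)))) \<in> borel_measurable (Pi\<^sub>M (unit_block I) (\<lambda>_. lborel))"
          by (rule measurable_compose[OF _ KIm]) measurable
        ultimately show ?thesis using True
          unfolding \<Phi>_def K t_def[symmetric] by (subst nn_integral_cmult) auto
      qed
    qed
    have qm: "(\<lambda>b. q t b) \<in> borel_measurable (Pi\<^sub>M (?u ` I) (\<lambda>_. lborel))" for t
    proof -
      have v: "(\<lambda>b. if j = i then sqrt t else (1 / sqrt (2 * t)) * b (?u j)) \<in> borel_measurable (Pi\<^sub>M (?u ` I) (\<lambda>_. lborel))" if "j \<in> insert i I" for j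
        using that by (cases "j = i") auto
      show ?thesis unfolding q_def qform_def
        by (intro borel_measurable_sum borel_measurable_times v borel_measurable_const)
    qed
    have "(\<integral>\<^sup>+f. ?K f \<partial>(Pi\<^sub>M (unit_block (insert i I)) (\<lambda>_. lborel))) = (\<integral>\<^sup>+y. \<Phi> y \<partial>(Pi\<^sub>M J (\<lambda>_. lborel)))"
      unfolding blk \<Phi>_def by (rule product_nn_integral_fold[OF dis finb Km])
    also have "\<dots> = (\<integral>\<^sup>+t. (\<integral>\<^sup>+b. \<Phi> (b(?u i := t)) \<partial>(Pi\<^sub>M (?u ` I) (\<lambda>_. lborel))) \<partial>lborel)"
      unfolding J_def
    proof (rule product_nn_integral_insert_rev)
      interpret FI: finite_product_sigma_finite "\<lambda>_::'n symm. lborel::real measure" "unit_block I" by standard (rule finb)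
      have "(\<lambda>(y, f). ?K (merge J (unit_block I) (y, f))) \<in> borel_measurable (Pi\<^sub>M J (\<lambda>_. lborel) \<Otimes>\<^sub>M Pi\<^sub>M (unit_block I) (\<lambda>_. lborel))"
        using measurable_compose[OF measurable_merge Km] by (simp add: case_prod_unfold)
      then show "\<Phi> \<in> borel_measurable (Pi\<^sub>M (insert (?u i) (?u ` I)) (\<lambda>_. lborel))"
        unfolding \<Phi>_def J_def[symmetric] by (rule FI.borel_measurable_nn_integral)
    qed (use ui in auto)
    also have "\<dots> = (\<integral>\<^sup>+t. ennreal (C * (2 * pi) powr (real ?m / 2) / sqrt (det (pad I X))) * ennreal (indicator {0<..} t * t powr (s - 1) * exp (- (t * R))) \<partial>lborel)"
    proof (rule nn_integral_cong)
      fix t :: real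
      show "(\<integral>\<^sup>+b. \<Phi> (b(?u i := t)) \<partial>(Pi\<^sub>M (?u ` I) (\<lambda>_. lborel))) =
        ennreal (C * (2 * pi) powr (real ?m / 2) / sqrt (det (pad I X))) * ennreal (indicator {0<..} t * t powr (s - 1) * exp (- (t * R)))"
      proof (cases "t > 0")
        case False
        then show ?thesis unfolding \<Phi> by simp
      next
        case True
        have qq: "q t (b(?u i := t)) = q t b" for b
          unfolding q_def by (intro qform_cong) (auto simp: symm_unit_eq_iff)
        have c: "1 / sqrt (2 * t) > 0" using True by simp
        have "(\<integral>\<^sup>+b. \<Phi> (b(?u i := t)) \<partial>(Pi\<^sub>M (?u ` I) (\<lambda>_. lborel))) =
          (\<integral>\<^sup>+b. ennreal (t powr (s - (real ?m + 2) / 2) * C) * ennreal (exp (- q t b)) \<partial>(Pi\<^sub>M (?u ` I) (\<lambda>_. lborel)))"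
          unfolding \<Phi> using True C0 by (intro nn_integral_cong) (simp add: qq ennreal_mult mult_ac)
        also have "\<dots> = ennreal (t powr (s - (real ?m + 2) / 2) * C) * (\<integral>\<^sup>+b. ennreal (exp (- q t b)) \<partial>(Pi\<^sub>M (?u ` I) (\<lambda>_. lborel)))"
          using qm by (intro nn_integral_cmult) auto
        also have "(\<integral>\<^sup>+b. ennreal (exp (- q t b)) \<partial>(Pi\<^sub>M (?u ` I) (\<lambda>_. lborel))) =
          ennreal ((sqrt pi / (1 / sqrt (2 * t))) ^ ?m / sqrt (det (pad I X)) * exp (- ((sqrt t)\<^sup>2 * R)))"
          unfolding q_def R_def by (rule gauss_qform[OF insert.prems(1) pdI iI inju c])
        also have "(sqrt pi / (1 / sqrt (2 * t))) ^ ?m = (2 * pi) powr (real ?m / 2) * t powr (real ?m / 2)"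
        proof -
          have "sqrt pi / (1 / sqrt (2 * t)) = sqrt (2 * pi * t)" by (simp add: real_sqrt_mult)
          also have "\<dots> ^ ?m = (2 * pi * t) powr (real ?m / 2)"
            using True by (simp add: powr_half_sqrt[symmetric] powr_powr powr_realpow[symmetric])
          finally show ?thesis using True by (simp add: powr_mult)
        qed
        also have "ennreal (t powr (s - (real ?m + 2) / 2) * C) *
            ennreal ((2 * pi) powr (real ?m / 2) * t powr (real ?m / 2) / sqrt (det (pad I X)) * exp (- ((sqrt t)\<^sup>2 * R)))
          = ennreal (C * (2 * pi) powr (real ?m / 2) / sqrt (det (pad I X)) * ((t powr (s - (real ?m + 2) / 2) * t powr (real ?m / 2)) * exp (- (t * R))))"
          using True C0 dI by (subst ennreal_mult[symmetric]) (auto simp: mult_ac)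
        \<comment> \<open>The m Gaussian factors sqrt (2 pi t) bring the exponent to the one of the
          Gamma integral.\<close>
        also have "t powr (s - (real ?m + 2) / 2) * t powr (real ?m / 2) = t powr (s - 1)"
          unfolding powr_add[symmetric] by (rule arg_cong[where f="\<lambda>x. t powr x"]) (simp add: field_simps)
        also have "ennreal (C * (2 * pi) powr (real ?m / 2) / sqrt (det (pad I X)) * (t powr (s - 1) * exp (- (t * R))))
          = ennreal (C * (2 * pi) powr (real ?m / 2) / sqrt (det (pad I X))) * ennreal (indicator {0<..} t * t powr (s - 1) * exp (- (t * R)))"
          using True C0 dI by (subst ennreal_mult[symmetric]) (auto simp: mult.assoc)
        finally show ?thesis .
      qed
    qed
    also have "\<dots> = ennreal (C * (2 * pi) powr (real ?m / 2) / sqrt (det (pad I X))) * ennreal (Gamma s * R powr (- s))"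
      by (subst nn_integral_cmult) (auto simp: Gamma_integral_scaled[OF s0 R])
    also have "\<dots> = ennreal ((C * (2 * pi) powr (real ?m / 2) / sqrt (det (pad I X))) * (Gamma s * R powr (- s)))"
      using C0 dI s0 by (intro ennreal_mult[symmetric]) (auto simp: Gamma_real_pos less_imp_le)
    also have "(C * (2 * pi) powr (real ?m / 2) / sqrt (det (pad I X))) * (Gamma s * R powr (- s))
       = Gamma_cone (card (insert i I)) s * det (pad (insert i I) X) powr (- s)"
    proof -
      define d where "d = det (pad I X)"
      define d' where "d' = det (pad (insert i I) X)"
      have d: "d > 0" "d' > 0" using dI dI' by (auto simp: d_def d'_def)
      have sd: "1 / sqrt d = d powr (- (1 / 2))"
        using d by (simp add: powr_minus powr_half_sqrt inverse_eq_divide)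
      have qd: "(d' / d) powr (- s) = d' powr (- s) * d powr s"
        using powr_divide[of d' d "- s"] powr_minus[of d s] d by (simp add: divide_inverse)
      \<comment> \<open>The powers of the smaller minor cancel: - (s - 1/2) - 1/2 + s = 0.\<close>
      have "d powr (- (s - 1 / 2)) / sqrt d * (d' / d) powr (- s)
          = d' powr (- s) * (d powr (- (s - 1 / 2)) * (1 / sqrt d) * d powr s)"
        unfolding qd by simp
      also have "d powr (- (s - 1 / 2)) * (1 / sqrt d) * d powr s = d powr 0"
        unfolding sd powr_add[symmetric] by (rule arg_cong[where f="\<lambda>x. d powr x"]) simp
      finally have e: "d powr (- (s - 1 / 2)) / sqrt d * (d' / d) powr (- s) = d' powr (- s)" using d by simp
      have alg: "(a * b * c / r) * (g * q) = c * g * a * (b / r * q)" for a b c r g q :: real by simp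
      show ?thesis unfolding card Gamma_cone_Suc C_def R_def d_def[symmetric] d'_def[symmetric] alg e ..
    qed
    finally show ?case .
  qed
qed

section \<open>Transfer of the gamma integral to the space of symmetric matrices\<close>

lemma pd_on_UNIV: "pos_def (smat Y) \<longleftrightarrow> pd_on UNIV (smat Y)"
proof -
  have q: "v \<bullet> (smat Y *v v) = qform UNIV (smat Y) (\<lambda>i. v $ i)" for v
    by (simp add: inner_vec_def matrix_vector_mult_def qform_def sum_distrib_left mult_ac)
  show ?thesis
  proof
    assume p: "pos_def (smat Y)"
    show "pd_on UNIV (smat Y)"
      unfolding pd_on_def
    proof (intro allI impI)
      fix v :: "'a \<Rightarrow> real" assume "\<exists>i\<in>UNIV. v i \<noteq> 0"
      then have "(\<chi> i. v i) \<noteq> 0" by (auto simp: vec_eq_iff)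
      then show "qform UNIV (smat Y) v > 0" using p q[of "\<chi> i. v i"] by (auto simp: pos_def_def)
    qed
  next
    assume p: "pd_on UNIV (smat Y)"
    have "v \<bullet> (smat Y *v v) > 0" if "v \<noteq> 0" for v
    proof -
      have "\<exists>i\<in>UNIV. v $ i \<noteq> 0" using that by (auto simp: vec_eq_iff)
      then show ?thesis unfolding q using p by (auto simp: pd_on_def)
    qed
    then show "pos_def (smat Y)" by (simp add: pos_def_def transpose_smat)
  qed
qed

lemma pad_UNIV: "pad UNIV X = X" by (simp add: pad_def vec_eq_iff)

lemma sym_mat_smat: "sym_mat (smat X)" by (simp add: sym_mat_def smat_sym)

lemma tr2_inner: "tr2 X Y = X \<bullet> Y" by (simp add: tr2_def inner_symm_def)

lemma tr2_trI: "tr2 X Y = trI UNIV (smat X) (smat Y)"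
  by (simp add: tr2_inner inner_symm_eq trI_def inner_vec_def)

lemma smat_entry: "smat A $ i $ j = (A \<bullet> symm_unit i j) * (if i = j then 1 else 1 / sqrt 2)"
  by (simp add: inner_symm_unit)

lemma sdet_pos: "Y \<in> pd_cone \<Longrightarrow> sdet Y > 0"
  using det_pad_pos[OF sym_mat_smat[of Y], of UNIV] by (simp add: pd_cone_def pd_on_UNIV pad_UNIV sdet_def)

lemma smat_measurable [measurable]: "(\<lambda>Y::'n::finite symm. smat Y $ j $ k) \<in> borel_measurable borel"
  unfolding smat_entry by measurable

lemma sdet_measurable [measurable]: "(sdet :: 'n::finite symm \<Rightarrow> real) \<in> borel_measurable borel"
  unfolding sdet_def[abs_def] by (rule det_measurable) measurable

lemma pd_cone_sets [measurable]: "(pd_cone :: 'n::finite symm set) \<in> sets borel"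
proof -
  have "Measurable.pred borel (\<lambda>Y::'n symm. pd_on UNIV (smat Y))"
    by (rule pd_on_measurable) (measurable, simp add: sym_mat_smat)
  then show ?thesis by (simp add: pd_cone_def pd_on_UNIV)
qed

theorem nn_integral_cone:
  fixes X :: "'n::finite symm"
  assumes X: "X \<in> pd_cone" and s: "s > (real CARD('n) - 1) / 2"
  shows "(\<integral>\<^sup>+Y. ennreal (indicator pd_cone Y * (exp (- tr2 X Y) * sdet Y powr (s - (real CARD('n) + 1) / 2))) \<partial>lborel)
    = ennreal (Gamma_cone CARD('n) s * sdet X powr (- s))"
proof -
  have B: "(Basis :: 'n symm set) = unit_block UNIV" by (auto simp: Basis_symm_def unit_block_def)
  let ?T = "\<lambda>f. \<Sum>b\<in>Basis. f b *\<^sub>R b :: 'n symm"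
  have T: "smat (?T f) = Ym f" for f
  proof -
    have "?T f \<bullet> symm_unit j k = f (symm_unit j k)" for j k
      by (rule inner_sum_left_Basis) (auto simp: Basis_symm_def)
    then show ?thesis by (simp add: vec_eq_iff smat_entry Ym_def)
  qed
  have k: "indicator pd_cone Y * (exp (- tr2 X Y) * sdet Y powr (s - (real CARD('n) + 1) / 2)) = cone_kernel UNIV s (smat X) (smat Y)" for Y
    by (simp add: cone_kernel_def pd_cone_def pd_on_UNIV[symmetric] tr2_trI sdet_def pad_UNIV)
  have "(\<integral>\<^sup>+Y. ennreal (cone_kernel UNIV s (smat X) (smat Y)) \<partial>lborel) =
    (\<integral>\<^sup>+f. ennreal (cone_kernel UNIV s (smat X) (smat (?T f))) \<partial>(Pi\<^sub>M Basis (\<lambda>_. lborel)))"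
    by (subst lborel_eq, subst nn_integral_distr)
      (auto intro!: measurable_compose[OF _ measurable_ennreal] cone_kernel_measurable sym_mat_smat)
  also have "\<dots> = (\<integral>\<^sup>+f. ennreal (cone_kernel UNIV s (smat X) (Ym f)) \<partial>(Pi\<^sub>M (unit_block UNIV) (\<lambda>_. lborel)))"
    unfolding T by (simp only: B)
  also have "\<dots> = ennreal (Gamma_cone (card (UNIV::'n set)) s * det (pad UNIV (smat X)) powr (- s))"
    using X s by (intro nn_integral_cone_kernel sym_mat_smat) (auto simp: pd_cone_def pd_on_UNIV)
  finally show ?thesis unfolding k by (simp add: pad_UNIV sdet_def)
qed

subsection \<open>Geometry of the cone\<close>

lemma smat_quad: "v \<bullet> (smat A *v v) = (\<Sum>i\<in>UNIV. \<Sum>j\<in>UNIV. smat A $ i $ j * (v $ i * v $ j))"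
proof -
  have e: "(smat A *v v) $ i = (\<Sum>j\<in>UNIV. smat A $ i $ j * v $ j)" for i
    by (simp add: matrix_vector_mult_def)
  have "v \<bullet> (smat A *v v) = (\<Sum>i\<in>UNIV. v $ i * (smat A *v v) $ i)" by (simp add: inner_vec_def)
  then show ?thesis by (simp only: e sum_distrib_left mult_ac)
qed

text \<open>The form is the pairing of A with the rank-one matrix of the products v i v j, whose
  norm is the square of the norm of v.\<close>

lemma smat_quad_le: "\<bar>v \<bullet> (smat A *v v)\<bar> \<le> norm A * (norm v)\<^sup>2"
proof -
  define V where "V = (\<chi> i j. v $ i * v $ j)"
  have "v \<bullet> (smat A *v v) = smat A \<bullet> V" unfolding smat_quad by (simp add: V_def inner_vec_def)
  also have "\<bar>\<dots>\<bar> \<le> norm (smat A) * norm V" by (rule Cauchy_Schwarz_ineq2)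
  also have "norm (smat A) = norm A" by (simp add: norm_eq_sqrt_inner inner_symm_eq)
  also have "norm V = (norm v)\<^sup>2"
  proof -
    have "V \<bullet> V = (\<Sum>i\<in>UNIV. v $ i * v $ i) * (\<Sum>j\<in>UNIV. v $ j * v $ j)"
      unfolding V_def inner_vec_def sum_product by (simp add: mult_ac)
    also have "\<dots> = (v \<bullet> v)\<^sup>2" by (simp add: inner_vec_def power2_eq_square)
    finally show ?thesis by (simp add: norm_eq_sqrt_inner real_sqrt_abs)
  qed
  finally show ?thesis .
qed

lemma pd_cone_iff: "Y \<in> pd_cone \<longleftrightarrow> (\<forall>v. v \<noteq> 0 \<longrightarrow> v \<bullet> (smat Y *v v) > 0)"
  by (simp add: pd_cone_def pos_def_def transpose_smat)

lemma quad_add: "v \<bullet> (smat (A + B) *v v) = v \<bullet> (smat A *v v) + v \<bullet> (smat B *v v)"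
  by (simp add: smat_add matrix_vector_mult_add_rdistrib inner_add_right)

lemma quad_scaleR: "v \<bullet> (smat (c *\<^sub>R A) *v v) = c * (v \<bullet> (smat A *v v))"
  unfolding smat_quad unfolding smat_scaleR by (simp add: sum_distrib_left mult_ac)

lemma pd_cone_add: "A \<in> pd_cone \<Longrightarrow> B \<in> pd_cone \<Longrightarrow> A + B \<in> pd_cone"
  by (simp add: pd_cone_iff quad_add add_pos_pos)

lemma pd_cone_scale: "A \<in> pd_cone \<Longrightarrow> c > 0 \<Longrightarrow> c *\<^sub>R A \<in> pd_cone"
  by (simp add: pd_cone_iff quad_scaleR)

lemma convex_pd_cone: "convex (pd_cone :: 'n::finite symm set)"
proof (rule convexI)
  fix x y :: "'n symm" and u v :: real
  assume *: "x \<in> pd_cone" "y \<in> pd_cone" "0 \<le> u" "0 \<le> v" "u + v = 1"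
  then consider "u = 0" "v = 1" | "v = 0" "u = 1" | "u > 0" "v > 0" by fastforce
  then show "u *\<^sub>R x + v *\<^sub>R y \<in> pd_cone" using * by cases (auto intro: pd_cone_add pd_cone_scale)
qed

definition symm_one :: "'n::finite symm" where "symm_one = Abs_symm (mat 1)"

lemma smat_symm_one: "smat symm_one = mat 1"
  unfolding symm_one_def by (rule smat_Abs_symm) (auto simp: transpose_def mat_def vec_eq_iff)

lemma quad_one: "v \<bullet> (smat symm_one *v v) = (norm v)\<^sup>2"
  by (simp add: smat_symm_one power2_norm_eq_inner)

lemma symm_one_in: "symm_one \<in> pd_cone"
  by (simp add: pd_cone_iff quad_one)

lemma inner_symm_one_nonneg: "Y \<in> pd_cone \<Longrightarrow> symm_one \<bullet> Y \<ge> 0"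
proof -
  assume Y: "Y \<in> pd_cone"
  have "symm_one \<bullet> Y = (\<Sum>i\<in>UNIV. smat Y $ i $ i)"
    by (simp add: inner_symm_eq smat_symm_one inner_vec_def mat_def if_distrib[where f="\<lambda>y. y * _"] cong: if_cong)
  moreover have "smat Y $ i $ i > 0" for i
  proof -
    have "axis i 1 \<bullet> (smat Y *v axis i 1) > 0" using Y by (auto simp: pd_cone_iff)
    then show ?thesis by (simp add: inner_axis' matrix_vector_mult_basis column_def)
  qed
  ultimately show ?thesis by (simp add: sum_nonneg less_imp_le)
qed

text \<open>The minimum m of the form on the unit sphere is positive, and a perturbation of norm
  less than m cannot destroy positivity.\<close>

lemma open_pd_cone: "open (pd_cone :: 'n::finite symm set)"
proof (rule openI)
  fix Y :: "'n symm" assume Y: "Y \<in> pd_cone"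
  have "compact (sphere (0::real^'n) 1)" "sphere (0::real^'n) 1 \<noteq> {}" by auto
  moreover have "continuous_on (sphere 0 1) (\<lambda>v. v \<bullet> (smat Y *v v))"
    by (intro continuous_intros matrix_vector_mult_linear_continuous_on)
  ultimately obtain v0 where v0: "v0 \<in> sphere 0 1" "\<And>v. v \<in> sphere 0 1 \<Longrightarrow> v0 \<bullet> (smat Y *v v0) \<le> v \<bullet> (smat Y *v v)"
    using continuous_attains_inf[of "sphere 0 1" "\<lambda>v. v \<bullet> (smat Y *v v)"] by blast
  define m where "m = v0 \<bullet> (smat Y *v v0)"
  have "v0 \<noteq> 0" using v0(1) by auto
  then have m: "m > 0" using Y by (simp add: m_def pd_cone_iff)
  have low: "v \<bullet> (smat Y *v v) \<ge> m * (norm v)\<^sup>2" for v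
  proof (cases "v = 0")
    case False
    define u where "u = (1 / norm v) *\<^sub>R v"
    have "u \<in> sphere 0 1" using False by (simp add: u_def)
    then have "m \<le> u \<bullet> (smat Y *v u)" using v0(2) m_def by simp
    also have "u \<bullet> (smat Y *v u) = (v \<bullet> (smat Y *v v)) / (norm v)\<^sup>2"
      by (simp add: u_def smat_quad sum_divide_distrib power2_eq_square mult_ac)
    finally show ?thesis using False by (simp add: field_simps)
  qed simp
  have "ball Y m \<subseteq> pd_cone"
  proof
    fix Z assume Z: "Z \<in> ball Y m"
    show "Z \<in> pd_cone"
      unfolding pd_cone_iff
    proof (intro allI impI)
      fix v :: "real^'n" assume v: "v \<noteq> 0"
      have "v \<bullet> (smat Z *v v) = v \<bullet> (smat Y *v v) + v \<bullet> (smat (Z - Y) *v v)"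
        using quad_add[of v Y "Z - Y"] by simp
      then have "(m - norm (Z - Y)) * (norm v)\<^sup>2 \<le> v \<bullet> (smat Z *v v)"
        using low[of v] smat_quad_le[of v "Z - Y"] by (simp add: left_diff_distrib)
      moreover have "0 < (m - norm (Z - Y)) * (norm v)\<^sup>2" using Z v by (simp add: dist_norm norm_minus_commute)
      ultimately show "v \<bullet> (smat Z *v v) > 0" by (rule less_le_trans[rotated])
    qed
  qed
  then show "\<exists>e>0. ball Y e \<subseteq> pd_cone" using m by blast
qed

lemma continuous_on_smat_entry: "continuous_on S (\<lambda>Y::'n::finite symm. smat Y $ i $ j)"
  unfolding smat_entry by (intro continuous_intros)

lemma continuous_on_sdet: "continuous_on S (sdet :: 'n::finite symm \<Rightarrow> real)"
  unfolding sdet_def[abs_def] det_def by (intro continuous_intros continuous_on_smat_entry)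

text \<open>A vector on which a semidefinite form vanishes lies in the kernel: otherwise moving it
  slightly along its image makes the form negative.\<close>

lemma psd_det_nz_imp_pd:
  fixes M :: "'n::finite symm"
  assumes psd: "\<And>v. v \<bullet> (smat M *v v) \<ge> 0" and det: "sdet M \<noteq> 0"
  shows "M \<in> pd_cone"
proof (rule ccontr)
  assume "M \<notin> pd_cone"
  then obtain v where v: "v \<noteq> 0" "v \<bullet> (smat M *v v) \<le> 0" by (auto simp: pd_cone_iff not_less)
  then have v0: "v \<bullet> (smat M *v v) = 0" using psd[of v] by simp
  have "smat M *v v = 0"
  proof (rule ccontr)
    assume nz: "smat M *v v \<noteq> 0"
    define w where "w = smat M *v v"
    define a where "a = w \<bullet> w"
    define b where "b = w \<bullet> (smat M *v w)"
    have a: "a > 0" using nz by (simp add: a_def w_def)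
    have b: "b \<ge> 0" using psd by (simp add: b_def)
    have sym: "v \<bullet> (smat M *v w) = w \<bullet> w"
      by (metis dot_lmul_matrix inner_commute transpose_matrix_vector transpose_smat w_def)
    \<comment> \<open>Close to the minimizer - a / b of 2 r a + r^2 b, with b + 1 in place of b
      because b may be 0; the value becomes r (a - r), which is negative.\<close>
    define r where "r = - a / (b + 1)"
    have "(v + r *\<^sub>R w) \<bullet> (smat M *v (v + r *\<^sub>R w)) = 2 * r * a + r\<^sup>2 * b"
      using v0 sym by (simp add: matrix_vector_right_distrib matrix_vector_mult_scaleR inner_add_left inner_add_right
          w_def[symmetric] a_def b_def power2_eq_square distrib_left)
    moreover have "2 * r * a + r\<^sup>2 * b < 0"
    proof -
      have "r * (b + 1) = - a" using b by (simp add: r_def)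
      then have "r * b = - a - r" by (simp add: algebra_simps)
      have "2 * r * a + r\<^sup>2 * b = 2 * r * a + r * (r * b)" by (simp add: power2_eq_square)
      also have "\<dots> = r * (a - r)" unfolding \<open>r * b = - a - r\<close> by (simp add: algebra_simps)
      also have "\<dots> < 0" using a b 
        by (intro mult_neg_pos) (auto simp: r_def divide_neg_pos intro!: add_pos_pos divide_pos_pos add_nonneg_pos)
      finally show ?thesis .
    qed
    ultimately show False using psd[of "v + r *\<^sub>R w"] by simp
  qed
  moreover have "invertible (smat M)" using det by (simp add: invertible_det_nz sdet_def)
  ultimately have "v = 0" using matrix_left_invertible_ker[of "smat M"] invertible_left_inverse by blast
  with v show False by simp
qed

text \<open>Suppose the integral is finite at \<xi>. Adding multiples of the identity only decreases
  it, and where the ray lies in the cone it equals a constant times det^(-s). So det stays bounded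
  away from 0 down to the point where the ray enters the cone. By continuity that point is
  semidefinite with nonzero determinant, hence already in the open cone, which contradicts its being
  the first one.\<close>

lemma nn_integral_cone_infinite:
  fixes \<xi> :: "'n::finite symm"
  assumes xi: "\<xi> \<notin> pd_cone" and s: "s > (real CARD('n) - 1) / 2"
  shows "(\<integral>\<^sup>+Y. ennreal (indicator pd_cone Y * (exp (- tr2 \<xi> Y) * sdet Y powr (s - (real CARD('n) + 1) / 2))) \<partial>lborel) = \<infinity>"
proof (rule ccontr)
  define I where "I X = (\<integral>\<^sup>+Y. ennreal (indicator pd_cone Y * (exp (- tr2 X Y) * sdet Y powr (s - (real CARD('n) + 1) / 2))) \<partial>lborel)" for X :: "'n symm"
  assume "\<not> ?thesis"
  then obtain K where K: "K \<ge> 0" "I \<xi> = ennreal K" unfolding I_def[symmetric] by (cases "I \<xi>") auto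
  define Z where "Z t = \<xi> + t *\<^sub>R symm_one" for t :: real
  have ZI: "I (Z t) \<le> ennreal K" if "t \<ge> 0" for t
    unfolding K(2)[symmetric] I_def
  proof (intro nn_integral_mono ennreal_leI)
    fix Y :: "'n symm"
    have "- tr2 (Z t) Y \<le> - tr2 \<xi> Y" if "Y \<in> pd_cone"
      using inner_symm_one_nonneg[OF that] \<open>t \<ge> 0\<close> by (simp add: Z_def tr2_inner inner_add_left)
    then show "indicator pd_cone Y * (exp (- tr2 (Z t) Y) * sdet Y powr (s - (real CARD('n) + 1) / 2)) \<le>
       indicator pd_cone Y * (exp (- tr2 \<xi> Y) * sdet Y powr (s - (real CARD('n) + 1) / 2))"
      by (auto simp: indicator_def intro!: mult_right_mono)
  qed
  define G where "G = Gamma_cone CARD('n) s"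
  have G: "G > 0" unfolding G_def by (rule Gamma_cone_pos[OF s])
  have s0: "s > 0"
  proof -
    have "0 \<le> (real CARD('n) - 1) / 2" by simp
    then show ?thesis using s by (rule le_less_trans)
  qed
  have powr_le: "sdet (Z t) powr (- s) \<le> K / G" if "t \<ge> 0" "Z t \<in> pd_cone" for t
  proof -
    have "ennreal (G * sdet (Z t) powr (- s)) \<le> ennreal K"
      using ZI[OF that(1)] nn_integral_cone[OF that(2) s] by (simp add: I_def G_def)
    then show ?thesis using K G by (simp add: field_simps)
  qed
  define T where "T = {t. t \<ge> 0 \<and> Z t \<in> pd_cone}"
  have Zup: "Z u \<in> pd_cone" if "Z t \<in> pd_cone" "t < u" for t u
  proof -
    have "Z u = Z t + (u - t) *\<^sub>R symm_one" by (simp add: Z_def algebra_simps)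
    then show ?thesis using that by (simp add: pd_cone_add pd_cone_scale symm_one_in)
  qed
  \<comment> \<open>The identity times the norm of \<xi> compensates the most negative value of the
    form of \<xi>; the extra 1 makes the sum strictly positive.\<close>
  have "norm \<xi> + 1 \<in> T"
  proof -
    have "v \<bullet> (smat (Z (norm \<xi> + 1)) *v v) > 0" if "v \<noteq> 0" for v
    proof -
      have "v \<bullet> (smat (Z (norm \<xi> + 1)) *v v) = v \<bullet> (smat \<xi> *v v) + norm \<xi> * (norm v)\<^sup>2 + (norm v)\<^sup>2"
        by (simp add: Z_def quad_add quad_scaleR quad_one algebra_simps)
      moreover have "(norm v)\<^sup>2 > 0" using that by simp
      ultimately show ?thesis using smat_quad_le[of v \<xi>] by linarith
    qed
    then show ?thesis by (simp add: T_def pd_cone_iff add_nonneg_pos)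
  qed
  then have Tne: "T \<noteq> {}" by blast
  have Tbd: "bdd_below T" by (auto simp: T_def bdd_below_def)
  define t0 where "t0 = Inf T"
  have t0: "t0 \<ge> 0" unfolding t0_def using Tne by (intro cInf_greatest) (auto simp: T_def)
  have above: "Z t \<in> pd_cone" if tt: "t > t0" for t
  proof -
    obtain u where "u \<in> T" "u < t" using cInf_lessD[OF Tne, of t] tt unfolding t0_def by blast
    then show ?thesis using Zup[of u t] by (auto simp: T_def)
  qed
  have cZ: "continuous_on UNIV Z" unfolding Z_def by (intro continuous_intros)
  have notin: "Z t0 \<notin> pd_cone"
  proof
    assume in0: "Z t0 \<in> pd_cone"
    show False
    proof (cases "t0 = 0")
      case True then show False using in0 xi by (simp add: Z_def)
    next
      case False
      have "open (Z -` pd_cone)" by (rule open_vimage[OF open_pd_cone cZ])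
      moreover have "t0 \<in> Z -` pd_cone" using in0 by simp
      ultimately obtain e where e: "e > 0" "ball t0 e \<subseteq> Z -` pd_cone" by (meson openE)
      \<comment> \<open>A smaller parameter that is still in T, contradicting the choice of t0 as
        infimum.\<close>
      define u where "u = max 0 (t0 - e / 2)"
      have "u \<in> ball t0 e" using e t0 by (auto simp: u_def dist_real_def max_def)
      then have "u \<in> T" using e(2) by (auto simp: T_def u_def)
      then have "t0 \<le> u" unfolding t0_def using Tbd by (rule cInf_lower)
      then show False using False t0 e by (auto simp: u_def max_def split: if_splits)
    qed
  qed
  define tn where "tn n = t0 + 1 / real (Suc n)" for n
  have tn: "tn \<longlonglongrightarrow> t0"
    unfolding tn_def using tendsto_add[OF tendsto_const[of t0] LIMSEQ_Suc[OF lim_1_over_n]] by simp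
  have tnp: "tn n > t0" "tn n \<ge> 0" "Z (tn n) \<in> pd_cone" for n
  proof -
    show a: "tn n > t0" by (simp add: tn_def)
    then show "tn n \<ge> 0" using t0 by linarith
    show "Z (tn n) \<in> pd_cone" using above[OF a] .
  qed
  have lim: "(\<lambda>n. f (Z (tn n))) \<longlonglongrightarrow> f (Z t0)" if "continuous_on UNIV f" for f :: "'n symm \<Rightarrow> real"
  proof -
    have "continuous_on UNIV (\<lambda>t. f (Z t))" by (rule continuous_on_compose2[OF that cZ]) auto
    then have "isCont (\<lambda>t. f (Z t)) t0" by (simp add: continuous_on_eq_continuous_at)
    then show ?thesis by (rule isCont_tendsto_compose[OF _ tn])
  qed
  define \<kappa> where "\<kappa> = K / G"
  \<comment> \<open>Inverting det^(-s) \<le> \<kappa> gives a lower bound for det that is uniform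
    along the approach to t0.\<close>
  have det_ge: "sdet (Z (tn n)) \<ge> \<kappa> powr (- 1 / s) \<and> \<kappa> > 0" for n
  proof -
    define d where "d = sdet (Z (tn n))"
    have d: "d > 0" unfolding d_def by (rule sdet_pos[OF tnp(3)])
    have le: "d powr (- s) \<le> \<kappa>" unfolding d_def \<kappa>_def by (rule powr_le[OF tnp(2,3)])
    then have k: "\<kappa> > 0" using d by (smt (verit) powr_gt_zero)
    have "\<kappa> powr (- 1 / s) \<le> (d powr (- s)) powr (- 1 / s)"
      using le d s0 by (intro powr_mono2') auto
    also have "\<dots> = d" using d s0 by (simp add: powr_powr)
    finally show ?thesis using k by (simp add: d_def)
  qed
  have "sdet (Z t0) \<ge> \<kappa> powr (- 1 / s)"
    using det_ge by (intro LIMSEQ_le_const[OF lim[OF continuous_on_sdet]]) auto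
  moreover have "\<kappa> powr (- 1 / s) > 0" using det_ge[of 0] by simp
  ultimately have "0 < sdet (Z t0)" by (rule less_le_trans[rotated])
  then have "sdet (Z t0) \<noteq> 0" by simp
  moreover have "v \<bullet> (smat (Z t0) *v v) \<ge> 0" for v
  proof (rule LIMSEQ_le_const)
    show "(\<lambda>n. v \<bullet> (smat (Z (tn n)) *v v)) \<longlonglongrightarrow> v \<bullet> (smat (Z t0) *v v)"
      by (rule lim) (unfold smat_quad, intro continuous_intros continuous_on_smat_entry)
    show "\<exists>N. \<forall>n\<ge>N. 0 \<le> v \<bullet> (smat (Z (tn n)) *v v)"
    proof (cases "v = 0")
      case False
      then show ?thesis using tnp(3) by (auto simp: pd_cone_iff intro: less_imp_le)
    qed simp
  qed
  ultimately show False using psd_det_nz_imp_pd notin by blast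
qed

section \<open>Holomorphic functions on tubes\<close>

lemma AE_lborel_translate:
  fixes P :: "'a::euclidean_space \<Rightarrow> bool"
  assumes "AE x in lborel. P x" shows "AE x in lborel. P (t + x)"
proof -
  have "AE x in distr lborel borel ((+) t). P x" using assms unfolding lborel_distr_plus .
  then show ?thesis by (rule AE_distrD[rotated]) simp
qed

lemma AE_lborel_open_ex:
  fixes P :: "'a::euclidean_space \<Rightarrow> bool"
  assumes "AE x in lborel. P x" "open S" "S \<noteq> {}"
  shows "\<exists>x\<in>S. P x"
proof (rule ccontr)
  assume "\<not> ?thesis"
  then have "AE x in lborel. x \<notin> S" using assms(1) by (auto elim!: eventually_mono)
  then have "emeasure lborel S = 0"
    using assms(2) by (subst (asm) AE_iff_measurable[of S]) auto
  moreover have "S \<in> sets lborel" using assms(2) by simp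
  ultimately have "negligible S"
    by (simp add: negligible_iff_null_sets null_setsI null_sets_completionI)
  then show False using assms open_not_negligible by blast
qed

abbreviation unit_leb :: "real measure" where "unit_leb \<equiv> restrict_space lborel {0..1}"

lemma sigma_finite_unit_leb: "sigma_finite_measure unit_leb"
proof -
  have "finite_measure unit_leb" by (rule finite_measureI) (simp add: emeasure_restrict_space)
  then interpret finite_measure unit_leb .
  show ?thesis ..
qed

lemma emeasure_unit_leb [simp]: "emeasure unit_leb {0..1} = 1" "measure unit_leb {0..1} = 1"
  by (simp_all add: emeasure_restrict_space measure_def)

text \<open>An edge integral written over a probability measure on the unit interval, so that it can
  later be exchanged with the integral over X by Fubini.\<close>

lemma primitive_edge:
  fixes g G :: "complex \<Rightarrow> complex"
  assumes G: "\<And>z. z \<in> S \<Longrightarrow> (G has_field_derivative g z) (at z)" and g: "continuous_on S g"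
    and S: "\<And>t. t \<in> {0..1} \<Longrightarrow> a + of_real t * d \<in> S"
  shows "d * (\<integral>t. g (a + of_real t * d) \<partial>unit_leb) = G (a + d) - G a"
proof -
  let ?\<gamma> = "\<lambda>t. a + complex_of_real t * d"
  have "((\<lambda>t. d * g (?\<gamma> t)) has_integral (G (?\<gamma> 1) - G (?\<gamma> 0))) {0..1}"
  proof (rule fundamental_theorem_of_calculus)
    fix t :: real assume t: "t \<in> {0..1}"
    have "(?\<gamma> has_vector_derivative d) (at t)"
      by (auto intro!: derivative_eq_intros simp: has_vector_derivative_def scaleR_conv_of_real)
    from field_vector_diff_chain_at[OF this G[OF S[OF t]]]
    have "((\<lambda>t. G (?\<gamma> t)) has_vector_derivative (d * g (?\<gamma> t))) (at t)" by (simp add: o_def)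
    then show "((\<lambda>t. G (?\<gamma> t)) has_vector_derivative (d * g (?\<gamma> t))) (at t within {0..1})"
      by (rule has_vector_derivative_at_within)
  qed simp
  then have I: "integral {0..1} (\<lambda>t. d * g (?\<gamma> t)) = G (?\<gamma> 1) - G (?\<gamma> 0)" by (rule integral_unique)
  have c: "continuous_on {0..1} (\<lambda>t. d * g (?\<gamma> t))"
    by (intro continuous_intros continuous_on_compose2[OF g]) (use S in auto)
  have si: "set_integrable lborel {0..1} (\<lambda>t. d * g (?\<gamma> t))"
    unfolding set_integrable_def by (rule borel_integrable_compact[OF compact_Icc c])
  have "d * (\<integral>t. g (?\<gamma> t) \<partial>unit_leb) = (\<integral>t. d * g (?\<gamma> t) \<partial>unit_leb)"
    by (rule integral_mult_right_zero[symmetric])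
  also have "\<dots> = (LINT t:{0..1}|lborel. d * g (?\<gamma> t))"
    unfolding set_lebesgue_integral_def by (subst integral_restrict_space) auto
  also have "\<dots> = integral {0..1} (\<lambda>t. d * g (?\<gamma> t))"
    by (rule set_borel_integral_eq_integral(2)[OF si])
  finally show ?thesis unfolding I by simp
qed

text \<open>For fixed X, Y and V, Cauchy's theorem on a unit square relates the lines at the heights
  Y and Y + V. After integration over X the two vertical edges differ by a translation and cancel,
  and the horizontal edges give J Y and J (Y + V). The hypothesis \<open>fin\<close> provides the
  absolute convergence for almost every Y.\<close>

lemma tube_integral_constant:
  fixes h :: "'a::euclidean_space \<times> 'a \<Rightarrow> complex" and \<Omega> :: "'a set"
  assumes \<Omega>: "open \<Omega>" "convex \<Omega>" "\<Omega> \<noteq> {}"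
    and add: "\<And>Y V. Y \<in> \<Omega> \<Longrightarrow> V \<in> \<Omega> \<Longrightarrow> Y + V \<in> \<Omega>" and scale: "\<And>V c. V \<in> \<Omega> \<Longrightarrow> c > 0 \<Longrightarrow> c *\<^sub>R V \<in> \<Omega>"
    and h [measurable]: "h \<in> borel_measurable (borel \<Otimes>\<^sub>M borel)"
    and hol: "\<And>X Y V. (\<lambda>z. h (X + Re z *\<^sub>R V, Y + Im z *\<^sub>R V)) holomorphic_on {z. Y + Im z *\<^sub>R V \<in> \<Omega>}"
    and fin: "\<And>K. compact K \<Longrightarrow> K \<subseteq> \<Omega> \<Longrightarrow>
      (\<integral>\<^sup>+Y. indicator K Y * (\<integral>\<^sup>+X. ennreal (cmod (h (X, Y))) \<partial>lborel) \<partial>lborel) < \<infinity>"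
  shows "\<exists>c. AE Y in lborel. Y \<in> \<Omega> \<longrightarrow> (\<integral>X. h (X, Y) \<partial>lborel) = c"
proof -
  define \<phi> where "\<phi> Y = (\<integral>\<^sup>+X. ennreal (cmod (h (X, Y))) \<partial>lborel)" for Y
  define J where "J Y = (\<integral>X. h (X, Y) \<partial>lborel)" for Y
  have [measurable]: "\<phi> \<in> borel_measurable borel" unfolding \<phi>_def by measurable
  have [measurable]: "J \<in> borel_measurable borel" unfolding J_def by measurable
  have [measurable]: "\<Omega> \<in> sets borel" using \<Omega> by simp
  interpret U: sigma_finite_measure unit_leb by (rule sigma_finite_unit_leb)
  interpret LU: pair_sigma_finite "lborel :: 'a measure" unit_leb ..
  have id_unit [measurable]: "(\<lambda>t. t) \<in> borel_measurable unit_leb" by (rule measurable_restrict_space1) simp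
  \<comment> \<open>Fubini along a curve of shifts p and heights q: a shift in X leaves the integral
    over X unchanged, so only the heights remain.\<close>
  have shift: "(\<integral>X. (\<integral>t. h (X + p t, Y + q t) \<partial>unit_leb) \<partial>lborel) = (\<integral>t. J (Y + q t) \<partial>unit_leb) \<and>
      integrable lborel (\<lambda>X. \<integral>t. h (X + p t, Y + q t) \<partial>unit_leb)"
    if [measurable]: "p \<in> borel_measurable borel" "q \<in> borel_measurable borel" and f: "(\<integral>\<^sup>+t. \<phi> (Y + q t) \<partial>unit_leb) < \<infinity>"
    for p q :: "real \<Rightarrow> 'a" and Y
  proof -
    have [measurable]: "p \<in> borel_measurable unit_leb" "q \<in> borel_measurable unit_leb"
      by (rule measurable_restrict_space1, simp)+
    have tr: "(\<integral>X. h (X + p t, Y + q t) \<partial>lborel) = J (Y + q t)" for t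
      using lborel_integral_affine(1)[of 1 "\<lambda>X. h (X, Y + q t)" "p t"] by (simp add: J_def add.commute)
    have trn: "(\<integral>\<^sup>+X. ennreal (cmod (h (X + p t, Y + q t))) \<partial>lborel) = \<phi> (Y + q t)" for t
      unfolding \<phi>_def by (rule lborel_nn_integral_translate) measurable
    have i: "integrable (lborel \<Otimes>\<^sub>M unit_leb) (\<lambda>(X, t). h (X + p t, Y + q t))"
    proof (rule integrableI_bounded)
      have "(\<integral>\<^sup>+x. ennreal (norm (case x of (X, t) \<Rightarrow> h (X + p t, Y + q t))) \<partial>(lborel \<Otimes>\<^sub>M unit_leb)) =
         (\<integral>\<^sup>+t. (\<integral>\<^sup>+X. ennreal (cmod (h (X + p t, Y + q t))) \<partial>lborel) \<partial>unit_leb)"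
        by (subst LU.nn_integral_snd[symmetric]) (auto simp: case_prod_unfold)
      then show "(\<integral>\<^sup>+x. ennreal (norm (case x of (X, t) \<Rightarrow> h (X + p t, Y + q t))) \<partial>(lborel \<Otimes>\<^sub>M unit_leb)) < \<infinity>"
        using f by (simp add: trn)
    qed measurable
    show ?thesis using LU.Fubini_integral[OF i] LU.integrable_fst[OF i] by (simp add: tr)
  qed
  have step: "AE Y in lborel. Y \<in> \<Omega> \<longrightarrow> J Y = J (Y + V)" if V: "V \<in> \<Omega>" for V
  proof -
    have seg: "Y + t *\<^sub>R V \<in> \<Omega>" if "Y \<in> \<Omega>" "t \<ge> 0" for Y t
      using that V add scale by (cases "t = 0") auto
    have good: "J Y = J (Y + V)" if Y: "Y \<in> \<Omega>" and f: "\<phi> Y < \<infinity>" "\<phi> (Y + V) < \<infinity>" "(\<integral>\<^sup>+t. \<phi> (Y + t *\<^sub>R V) \<partial>unit_leb) < \<infinity>" for Y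
    proof -
      let ?A = "\<lambda>X. \<integral>t. h (X + t *\<^sub>R V, Y) \<partial>unit_leb"
      let ?B = "\<lambda>X. \<integral>t. h (X + V, Y + t *\<^sub>R V) \<partial>unit_leb"
      let ?C = "\<lambda>X. \<integral>t. h (X + t *\<^sub>R V, Y + V) \<partial>unit_leb"
      let ?D = "\<lambda>X. \<integral>t. h (X, Y + t *\<^sub>R V) \<partial>unit_leb"
      have A: "integrable lborel ?A" "(\<integral>X. ?A X \<partial>lborel) = J Y"
        using shift[of "\<lambda>t. t *\<^sub>R V" "\<lambda>_. 0" Y] f by auto
      have B: "integrable lborel ?B" "(\<integral>X. ?B X \<partial>lborel) = (\<integral>t. J (Y + t *\<^sub>R V) \<partial>unit_leb)"
        using shift[of "\<lambda>t. V" "\<lambda>t. t *\<^sub>R V" Y] f by auto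
      have C: "integrable lborel ?C" "(\<integral>X. ?C X \<partial>lborel) = J (Y + V)"
        using shift[of "\<lambda>t. t *\<^sub>R V" "\<lambda>_. V" Y] f by auto
      have D: "integrable lborel ?D" "(\<integral>X. ?D X \<partial>lborel) = (\<integral>t. J (Y + t *\<^sub>R V) \<partial>unit_leb)"
        using shift[of "\<lambda>t. 0" "\<lambda>t. t *\<^sub>R V" Y] f by auto
      \<comment> \<open>The square with corners 0, 1, 1 + \<i>, \<i> in the parameter z of (X + Re z
        V, Y + Im z V). Its preimage region is convex and open, so a primitive exists and the four
        edges telescope.\<close>
      have rect: "?A X + \<i> * ?B X - ?C X - \<i> * ?D X = 0" for X
      proof -
        define g where "g z = h (X + Re z *\<^sub>R V, Y + Im z *\<^sub>R V)" for z
        define S where "S = {z. Y + Im z *\<^sub>R V \<in> \<Omega>}"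
        have gS: "g holomorphic_on S" unfolding g_def S_def by (rule hol)
        have "open ((\<lambda>z. Y + Im z *\<^sub>R V) -` \<Omega>)"
          by (rule open_vimage[OF \<Omega>(1)]) (intro continuous_intros)
        then have oS: "open S" by (simp add: S_def vimage_def)
        have cS: "convex S"
          unfolding S_def convex_def
        proof safe
          fix x y :: complex and u v :: real
          assume *: "Y + Im x *\<^sub>R V \<in> \<Omega>" "Y + Im y *\<^sub>R V \<in> \<Omega>" "0 \<le> u" "0 \<le> v" "u + v = 1"
          have "Y + Im (u *\<^sub>R x + v *\<^sub>R y) *\<^sub>R V = (u + v) *\<^sub>R Y + Im (u *\<^sub>R x + v *\<^sub>R y) *\<^sub>R V" using * by simp
          also have "\<dots> = u *\<^sub>R (Y + Im x *\<^sub>R V) + v *\<^sub>R (Y + Im y *\<^sub>R V)"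
            by (simp add: scaleR_add_left scaleR_add_right)
          finally show "Y + Im (u *\<^sub>R x + v *\<^sub>R y) *\<^sub>R V \<in> \<Omega>" using \<Omega>(2) * by (simp add: convex_def)
        qed
        obtain G where G: "\<And>z. z \<in> S \<Longrightarrow> (G has_field_derivative g z) (at z within S)"
          using holomorphic_convex_primitive'[OF cS oS gS] by blast
        then have G: "\<And>z. z \<in> S \<Longrightarrow> (G has_field_derivative g z) (at z)" using oS by (metis at_within_open)
        have gc: "continuous_on S g" using gS by (rule holomorphic_on_imp_continuous_on)
        note edge = primitive_edge[OF G gc]
        have inS: "z \<in> S" if "Im z \<ge> 0" for z using seg[OF Y that] by (simp add: S_def)
        have e: "?A X = G 1 - G 0" "\<i> * ?B X = G (1 + \<i>) - G 1" "?C X = G (1 + \<i>) - G \<i>" "\<i> * ?D X = G \<i> - G 0"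
          using edge[of 0 1] edge[of 1 \<i>] edge[of \<i> 1] edge[of 0 \<i>] by (simp_all add: g_def inS add.commute[of \<i> 1])
        show ?thesis unfolding e by simp
      qed
      have "0 = (\<integral>X. ?A X + \<i> * ?B X - ?C X - \<i> * ?D X \<partial>lborel)" unfolding rect by simp
      also have "\<dots> = J Y - J (Y + V)" using A B C D by simp
      finally show ?thesis by simp
    qed
    obtain K :: "nat \<Rightarrow> 'a set" where K: "\<And>n. compact (K n)" "\<And>n. K n \<subseteq> \<Omega>" "\<Union>(range K) = \<Omega>"
      using open_Union_compact_subsets[OF \<Omega>(1)] by metis
    have AEK: "AE Y in lborel. Y \<in> K n \<longrightarrow> \<phi> Y < \<infinity> \<and> \<phi> (Y + V) < \<infinity> \<and> (\<integral>\<^sup>+t. \<phi> (Y + t *\<^sub>R V) \<partial>unit_leb) < \<infinity>" for n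
    proof -
      \<comment> \<open>The compact set swept out when K n moves along V; it stays in the domain and
        bounds all translated integrals at once.\<close>
      define L where "L = (\<lambda>(Y, t). Y + t *\<^sub>R V) ` (K n \<times> {0..1})"
      have L: "compact L" unfolding L_def
        by (intro compact_continuous_image compact_Times K compact_Icc)
          (auto simp: case_prod_unfold intro!: continuous_intros)
      have LO: "L \<subseteq> \<Omega>" unfolding L_def using seg K(2)[of n] by auto
      have [measurable]: "K n \<in> sets borel" "L \<in> sets borel" using K(1) L by (auto intro: borel_closed compact_imp_closed)
      define B where "B = (\<integral>\<^sup>+Y. indicator L Y * \<phi> Y \<partial>lborel)"
      have Bf: "B < \<infinity>" unfolding B_def \<phi>_def by (rule fin[OF L LO])
      have le: "(\<integral>\<^sup>+Y. indicator (K n) Y * \<phi> (Y + t *\<^sub>R V) \<partial>lborel) \<le> B" if t: "t \<in> {0..1}" for t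
      proof -
        have "(\<integral>\<^sup>+Y. indicator (K n) Y * \<phi> (Y + t *\<^sub>R V) \<partial>lborel) \<le> (\<integral>\<^sup>+Y. indicator L (Y + t *\<^sub>R V) * \<phi> (Y + t *\<^sub>R V) \<partial>lborel)"
        proof (intro nn_integral_mono mult_right_mono)
          fix Y
          have "Y \<in> K n \<Longrightarrow> Y + t *\<^sub>R V \<in> L" using t unfolding L_def by force
          then show "(indicator (K n) Y :: ennreal) \<le> indicator L (Y + t *\<^sub>R V)" by (auto simp: indicator_def)
        qed simp
        also have "\<dots> = B" unfolding B_def
          by (rule lborel_nn_integral_translate[of "\<lambda>Y. indicator L Y * \<phi> Y"]) measurable
        finally show ?thesis .
      qed
      have "(\<integral>\<^sup>+Y. indicator (K n) Y * (\<integral>\<^sup>+t. \<phi> (Y + t *\<^sub>R V) \<partial>unit_leb) \<partial>lborel) =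
        (\<integral>\<^sup>+Y. (\<integral>\<^sup>+t. indicator (K n) Y * \<phi> (Y + t *\<^sub>R V) \<partial>unit_leb) \<partial>lborel)"
        by (intro nn_integral_cong nn_integral_cmult[symmetric]) measurable
      also have "\<dots> = (\<integral>\<^sup>+t. (\<integral>\<^sup>+Y. indicator (K n) Y * \<phi> (Y + t *\<^sub>R V) \<partial>lborel) \<partial>unit_leb)"
        by (rule LU.Fubini'[symmetric]) measurable
      also have "\<dots> \<le> (\<integral>\<^sup>+t. B \<partial>unit_leb)"
        by (intro nn_integral_mono le) simp
      also have "\<dots> = B" by simp
      finally have i3: "(\<integral>\<^sup>+Y. indicator (K n) Y * (\<integral>\<^sup>+t. \<phi> (Y + t *\<^sub>R V) \<partial>unit_leb) \<partial>lborel) < \<infinity>"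
        using Bf by (rule le_less_trans)
      have i1: "(\<integral>\<^sup>+Y. indicator (K n) Y * \<phi> Y \<partial>lborel) < \<infinity>" "(\<integral>\<^sup>+Y. indicator (K n) Y * \<phi> (Y + V) \<partial>lborel) < \<infinity>"
        using le[of 0] le[of 1] Bf by (auto intro: le_less_trans)
      have ae: "AE Y in lborel. Y \<in> K n \<longrightarrow> F Y < \<infinity>"
        if "F \<in> borel_measurable borel" "(\<integral>\<^sup>+Y. indicator (K n) Y * F Y \<partial>lborel) < \<infinity>" for F :: "'a \<Rightarrow> ennreal"
      proof -
        have "AE Y in lborel. indicator (K n) Y * F Y \<noteq> \<infinity>"
          using that by (intro nn_integral_noteq_infinite less_imp_neq) measurable
        then show ?thesis by eventually_elim (auto simp: indicator_def less_top)
      qed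
      have m3: "(\<lambda>Y. \<integral>\<^sup>+t. \<phi> (Y + t *\<^sub>R V) \<partial>unit_leb) \<in> borel_measurable borel" by measurable
      have m2: "(\<lambda>Y. \<phi> (Y + V)) \<in> borel_measurable borel" by measurable
      have m1: "\<phi> \<in> borel_measurable borel" by measurable
      from ae[OF m1 i1(1)] ae[OF m2 i1(2)] ae[OF m3 i3] show ?thesis by eventually_elim simp
    qed
    have "AE Y in lborel. \<forall>n. Y \<in> K n \<longrightarrow> \<phi> Y < \<infinity> \<and> \<phi> (Y + V) < \<infinity> \<and> (\<integral>\<^sup>+t. \<phi> (Y + t *\<^sub>R V) \<partial>unit_leb) < \<infinity>"
      by (intro iffD2[OF AE_all_countable] allI AEK)
    then show ?thesis
    proof eventually_elim
      case (elim Y)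
      then show ?case using good[of Y] K(3) by blast
    qed
  qed
  have m: "{x \<in> space (lborel \<Otimes>\<^sub>M lborel). fst x \<in> \<Omega> \<longrightarrow> snd x \<in> \<Omega> \<longrightarrow> J (snd x) = J (snd x + fst x)} \<in> sets (lborel \<Otimes>\<^sub>M lborel)"
    by measurable
  \<comment> \<open>So far the null set of heights depends on V. Exchanging the quantifiers gives,
    for almost every height, almost every direction.\<close>
  have "AE V in lborel. AE Y in lborel. V \<in> \<Omega> \<longrightarrow> Y \<in> \<Omega> \<longrightarrow> J Y = J (Y + V)"
  proof (rule AE_I2)
    fix V show "AE Y in lborel. V \<in> \<Omega> \<longrightarrow> Y \<in> \<Omega> \<longrightarrow> J Y = J (Y + V)"
      by (cases "V \<in> \<Omega>") (use step[of V] in simp_all)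
  qed
  then have AE2: "AE Y in lborel. AE V in lborel. V \<in> \<Omega> \<longrightarrow> Y \<in> \<Omega> \<longrightarrow> J Y = J (Y + V)"
    by (subst lborel_pair.AE_commute[symmetric, OF m])
  \<comment> \<open>Both values are compared with the one at the common height Y1 + Y2 + W, reached
    from Y1 by V = Y2 + W and from Y2 by V = Y1 + W.\<close>
  have same: "J Y1 = J Y2"
    if "Y1 \<in> \<Omega>" "Y2 \<in> \<Omega>" "AE V in lborel. V \<in> \<Omega> \<longrightarrow> Y1 \<in> \<Omega> \<longrightarrow> J Y1 = J (Y1 + V)"
      "AE V in lborel. V \<in> \<Omega> \<longrightarrow> Y2 \<in> \<Omega> \<longrightarrow> J Y2 = J (Y2 + V)" for Y1 Y2
  proof -
    have "AE W in lborel. (W \<in> \<Omega> \<longrightarrow> J Y1 = J Y2)"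
      using AE_lborel_translate[OF that(3), of Y2] AE_lborel_translate[OF that(4), of Y1]
    proof eventually_elim
      case (elim W)
      then show ?case using that(1,2) add by (auto simp: add_ac)
    qed
    from AE_lborel_open_ex[OF this \<Omega>(1,3)] show ?thesis by blast
  qed
  obtain Y1 where Y1: "Y1 \<in> \<Omega>" "AE V in lborel. V \<in> \<Omega> \<longrightarrow> Y1 \<in> \<Omega> \<longrightarrow> J Y1 = J (Y1 + V)"
    using AE_lborel_open_ex[OF AE2 \<Omega>(1,3)] by blast
  from AE2 have "AE Y in lborel. Y \<in> \<Omega> \<longrightarrow> J Y = J Y1"
    by eventually_elim (use same[OF _ Y1(1) _ Y1(2)] in blast)
  then show ?thesis unfolding J_def by blast
qed

subsection \<open>Laplace integrals\<close>

text \<open>The exponent is i times the pairing of \<xi> with X + iY, so this is a Laplace integral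
  in the complex variable X + iY.\<close>

definition lap :: "('a::euclidean_space \<Rightarrow> complex) \<Rightarrow> 'a \<times> 'a \<Rightarrow> complex" where
  "lap g p = (\<integral>\<xi>. g \<xi> * exp (\<i> * of_real (\<xi> \<bullet> fst p) - of_real (\<xi> \<bullet> snd p)) \<partial>lborel)"

lemma norm_lap_kernel: "cmod (exp (\<i> * of_real a - of_real b)) = exp (- b)"
  by (simp add: norm_exp_eq_Re)

text \<open>Some coordinate of \<xi> is at least norm \<xi> / d in absolute value, so exp(k norm
  \<xi>) with k = r / d is dominated by finitely many exponentials, which amounts to moving Y by r
  along a basis vector in either direction. Those points lie in S, where integrability is
  assumed.\<close>

lemma lap_dominating:
  fixes g :: "'a::euclidean_space \<Rightarrow> complex"
  assumes S: "open S" "Y \<in> S" and g [measurable]: "g \<in> borel_measurable borel"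
    and i: "\<And>Y. Y \<in> S \<Longrightarrow> integrable lborel (\<lambda>\<xi>. g \<xi> * of_real (exp (- (\<xi> \<bullet> Y))))"
  obtains k :: real where "k > 0" "integrable lborel (\<lambda>\<xi>. cmod (g \<xi>) * (exp (- (\<xi> \<bullet> Y)) * exp (k * norm \<xi>)))"
proof -
  obtain r where r: "r > 0" "cball Y r \<subseteq> S" using S by (auto simp: open_contains_cball)
  define d where "d = real DIM('a)"
  have d: "d > 0" by (simp add: d_def)
  define k where "k = r / d"
  define M where "M \<xi> = (\<Sum>b\<in>Basis. exp (- (\<xi> \<bullet> (Y + r *\<^sub>R b))) + exp (- (\<xi> \<bullet> (Y - r *\<^sub>R b))))" for \<xi> :: 'a
  have inS: "Y + r *\<^sub>R b \<in> S" "Y - r *\<^sub>R b \<in> S" if "b \<in> Basis" for b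
    using that r by (auto intro!: subsetD[OF r(2)] simp: dist_norm)
  have iM: "integrable lborel (\<lambda>\<xi>. cmod (g \<xi>) * M \<xi>)"
  proof -
    have "integrable lborel (\<lambda>\<xi>. \<Sum>b\<in>Basis. cmod (g \<xi> * of_real (exp (- (\<xi> \<bullet> (Y + r *\<^sub>R b))))) + cmod (g \<xi> * of_real (exp (- (\<xi> \<bullet> (Y - r *\<^sub>R b))))))"
      by (intro Bochner_Integration.integrable_sum Bochner_Integration.integrable_add integrable_norm i inS)
    then show ?thesis by (simp add: M_def norm_mult sum_distrib_left distrib_left)
  qed
  have le: "exp (- (\<xi> \<bullet> Y)) * exp (k * norm \<xi>) \<le> M \<xi>" for \<xi>
  proof -
    have "\<exists>b\<in>Basis. norm \<xi> \<le> d * \<bar>\<xi> \<bullet> b\<bar>"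
    proof (rule ccontr)
      assume "\<not> ?thesis"
      then have "\<bar>\<xi> \<bullet> b\<bar> < norm \<xi> / d" if "b \<in> Basis" for b using that d by (auto simp: field_simps not_le)
      then have "(\<Sum>b\<in>(Basis::'a set). \<bar>\<xi> \<bullet> b\<bar>) < (\<Sum>b\<in>(Basis::'a set). norm \<xi> / d)" by (intro sum_strict_mono) auto
      also have "\<dots> = norm \<xi>" using d by (simp add: d_def)
      finally show False using norm_le_l1[of \<xi>] by simp
    qed
    then obtain b where b: "b \<in> Basis" "norm \<xi> \<le> d * \<bar>\<xi> \<bullet> b\<bar>" by blast
    have "k * norm \<xi> \<le> r * \<bar>\<xi> \<bullet> b\<bar>"
      using mult_left_mono[OF b(2), of k] r d by (simp add: k_def)
    then have "exp (- (\<xi> \<bullet> Y)) * exp (k * norm \<xi>) \<le> exp (- (\<xi> \<bullet> Y)) * exp (r * \<bar>\<xi> \<bullet> b\<bar>)" by simp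
    also have "\<dots> \<le> exp (- (\<xi> \<bullet> (Y + r *\<^sub>R b))) + exp (- (\<xi> \<bullet> (Y - r *\<^sub>R b)))"
      by (cases "\<xi> \<bullet> b \<ge> 0") (auto simp: exp_add[symmetric] inner_add_right inner_diff_right add_increasing add_increasing2)
    also have "\<dots> \<le> M \<xi>"
      unfolding M_def using b(1) by (intro member_le_sum[where f="\<lambda>b. exp (- (\<xi> \<bullet> (Y + r *\<^sub>R b))) + exp (- (\<xi> \<bullet> (Y - r *\<^sub>R b)))"]) (auto intro: add_nonneg_nonneg)
    finally show ?thesis .
  qed
  have "integrable lborel (\<lambda>\<xi>. cmod (g \<xi>) * (exp (- (\<xi> \<bullet> Y)) * exp (k * norm \<xi>)))"
  proof (rule Bochner_Integration.integrable_bound[OF iM])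
    show "AE \<xi> in lborel. norm (cmod (g \<xi>) * (exp (- (\<xi> \<bullet> Y)) * exp (k * norm \<xi>))) \<le> norm (cmod (g \<xi>) * M \<xi>)"
    proof (intro AE_I2)
      fix \<xi>
      have "M \<xi> \<ge> 0" using le[of \<xi>] by (meson exp_ge_zero mult_nonneg_nonneg order_trans)
      then show "norm (cmod (g \<xi>) * (exp (- (\<xi> \<bullet> Y)) * exp (k * norm \<xi>))) \<le> norm (cmod (g \<xi>) * M \<xi>)"
        using le[of \<xi>] by (simp add: abs_mult mult_left_mono)
    qed
  qed measurable
  moreover have "k > 0" using r d by (simp add: k_def)
  ultimately show ?thesis using that by blast
qed

text \<open>Differentiation under the integral sign with the quadratic Taylor remainder of exp. An
  increment q of norm below k/2 costs at most exp(k norm \<xi> / 2), and the other half of the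
  dominating exponential absorbs the factor (norm \<xi>)^2.\<close>

lemma lap_has_derivative:
  fixes g :: "'a::euclidean_space \<Rightarrow> complex"
  assumes S: "open S" "Y \<in> S" and g [measurable]: "g \<in> borel_measurable borel"
    and i: "\<And>Y. Y \<in> S \<Longrightarrow> integrable lborel (\<lambda>\<xi>. g \<xi> * of_real (exp (- (\<xi> \<bullet> Y))))"
  shows "(lap g has_derivative
     (\<lambda>q. \<integral>\<xi>. g \<xi> * exp (\<i> * of_real (\<xi> \<bullet> X) - of_real (\<xi> \<bullet> Y)) * (\<i> * of_real (\<xi> \<bullet> fst q) - of_real (\<xi> \<bullet> snd q)) \<partial>lborel)) (at (X, Y))"
proof -
  obtain k where k: "k > 0" and ik: "integrable lborel (\<lambda>\<xi>. cmod (g \<xi>) * (exp (- (\<xi> \<bullet> Y)) * exp (k * norm \<xi>)))"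
    using lap_dominating[OF S g i] by blast
  define D where "D \<xi> = cmod (g \<xi>) * (exp (- (\<xi> \<bullet> Y)) * exp (k * norm \<xi>))" for \<xi>
  have iD: "integrable lborel D" using ik unfolding D_def .
  have D0: "D \<xi> \<ge> 0" for \<xi> by (simp add: D_def)
  define E where "E \<xi> = g \<xi> * exp (\<i> * of_real (\<xi> \<bullet> X) - of_real (\<xi> \<bullet> Y))" for \<xi>
  define w where "w q \<xi> = \<i> * of_real (\<xi> \<bullet> fst q) - of_real (\<xi> \<bullet> snd q)" for q :: "'a \<times> 'a" and \<xi>
  have [measurable]: "E \<in> borel_measurable borel" "w q \<in> borel_measurable borel" for q
    unfolding E_def w_def by measurable
  have nE: "cmod (E \<xi>) = cmod (g \<xi>) * exp (- (\<xi> \<bullet> Y))" for \<xi>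
    by (simp add: E_def norm_mult norm_lap_kernel)
  have nw: "cmod (w q \<xi>) \<le> 2 * norm q * norm \<xi>" for q \<xi>
  proof -
    have "cmod (w q \<xi>) \<le> \<bar>\<xi> \<bullet> fst q\<bar> + \<bar>\<xi> \<bullet> snd q\<bar>"
      unfolding w_def using norm_triangle_ineq4[of "\<i> * of_real (\<xi> \<bullet> fst q)" "complex_of_real (\<xi> \<bullet> snd q)"] by (simp add: norm_mult)
    also have "\<dots> \<le> norm \<xi> * norm (fst q) + norm \<xi> * norm (snd q)"
      by (intro add_mono Cauchy_Schwarz_ineq2)
    also have "\<dots> \<le> norm \<xi> * norm q + norm \<xi> * norm q"
      using norm_fst_le[of "fst q" "snd q"] norm_snd_le[of "snd q" "fst q"] by (intro add_mono mult_left_mono) auto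
    finally show ?thesis by (simp add: mult_ac)
  qed
  have rw: "\<bar>Re (w q \<xi>)\<bar> \<le> norm q * norm \<xi>" for q \<xi>
  proof -
    have "\<bar>Re (w q \<xi>)\<bar> = \<bar>\<xi> \<bullet> snd q\<bar>" by (simp add: w_def)
    also have "\<dots> \<le> norm \<xi> * norm (snd q)" by (rule Cauchy_Schwarz_ineq2)
    also have "\<dots> \<le> norm \<xi> * norm q" using norm_snd_le[of "snd q" "fst q"] by (intro mult_left_mono) auto
    finally show ?thesis by (simp add: mult.commute)
  qed
  have iE: "integrable lborel E"
  proof (rule Bochner_Integration.integrable_bound[OF iD])
    have "exp (- (\<xi> \<bullet> Y)) \<le> exp (- (\<xi> \<bullet> Y)) * exp (k * norm \<xi>)" for \<xi> using k by simp
    then show "AE \<xi> in lborel. norm (E \<xi>) \<le> norm (D \<xi>)" by (simp add: nE D_def abs_mult mult_left_mono)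
  qed measurable
  have iEw: "integrable lborel (\<lambda>\<xi>. E \<xi> * w q \<xi>)" for q
  proof (rule Bochner_Integration.integrable_bound)
    show "integrable lborel (\<lambda>\<xi>. (2 * norm q / k) * D \<xi>)" using iD by simp
    show "AE \<xi> in lborel. norm (E \<xi> * w q \<xi>) \<le> norm (2 * norm q / k * D \<xi>)"
    proof (intro AE_I2)
      fix \<xi> :: 'a
      have "k * norm \<xi> \<le> exp (k * norm \<xi>)" using exp_ge_add_one_self[of "k * norm \<xi>"] by linarith
      then have "norm \<xi> \<le> exp (k * norm \<xi>) / k" using k by (simp add: field_simps)
      then have "cmod (w q \<xi>) \<le> 2 * norm q * (exp (k * norm \<xi>) / k)"
        using nw[of q \<xi>] by (meson mult_left_mono norm_ge_zero order_trans mult_nonneg_nonneg zero_le_numeral)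
      then have "norm (E \<xi> * w q \<xi>) \<le> cmod (g \<xi>) * exp (- (\<xi> \<bullet> Y)) * (2 * norm q * (exp (k * norm \<xi>) / k))"
        unfolding norm_mult nE by (intro mult_left_mono) auto
      also have "\<dots> = norm (2 * norm q / k * D \<xi>)" using k D0[of \<xi>] by (simp add: D_def abs_mult)
      finally show "norm (E \<xi> * w q \<xi>) \<le> norm (2 * norm q / k * D \<xi>)" .
    qed
  qed measurable
  define L where "L q = (\<integral>\<xi>. E \<xi> * w q \<xi> \<partial>lborel)" for q
  have "linear L"
  proof (rule linearI)
    fix p q :: "'a \<times> 'a" and r :: real
    have "w (p + q) \<xi> = w p \<xi> + w q \<xi>" for \<xi> by (simp add: w_def inner_add_right algebra_simps)
    then have "E \<xi> * w (p + q) \<xi> = E \<xi> * w p \<xi> + E \<xi> * w q \<xi>" for \<xi> by (simp add: distrib_left)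
    then show "L (p + q) = L p + L q" unfolding L_def using iEw by simp
    have "w (r *\<^sub>R p) \<xi> = of_real r * w p \<xi>" for \<xi> by (simp add: w_def algebra_simps)
    then have wr: "E \<xi> * w (r *\<^sub>R p) \<xi> = of_real r * (E \<xi> * w p \<xi>)" for \<xi> by simp
    show "L (r *\<^sub>R p) = r *\<^sub>R L p" unfolding L_def wr scaleR_conv_of_real by (rule integral_mult_right_zero)
  qed
  then have bl: "bounded_linear L" by (simp add: linear_conv_bounded_linear)
  \<comment> \<open>32 = 4 * 8, with 4 from the square of the bound 2 norm q norm \<xi> on the
    exponent and 8 / k^2 from u^2 \<le> (8 / k^2) exp(k u / 2).\<close>
  define C where "C = (32 / k\<^sup>2) * (\<integral>\<xi>. D \<xi> \<partial>lborel)"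
  have "(lap g has_derivative L) (at (X, Y))"
  proof (rule has_derivativeI_sandwich[where e="k / 2" and H="\<lambda>y. C * norm (y - (X, Y))"])
    show "0 < k / 2" using k by simp
    show "bounded_linear L" by (rule bl)
    show "((\<lambda>y. C * norm (y - (X, Y))) \<longlongrightarrow> 0) (at (X, Y))"
    proof -
      have "((\<lambda>y. C * norm (y - (X, Y))) \<longlongrightarrow> C * norm ((X, Y) - (X, Y))) (at (X, Y))" by (intro tendsto_intros)
      then show ?thesis by simp
    qed
    fix y assume y: "y \<noteq> (X, Y)" "dist y (X, Y) < k / 2"
    define q where "q = y - (X, Y)"
    have q: "norm q < k / 2" "q \<noteq> 0" "y = (X, Y) + q" using y by (auto simp: q_def dist_norm)
    have lapy: "lap g y = (\<integral>\<xi>. E \<xi> * exp (w q \<xi>) \<partial>lborel)"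
      unfolding lap_def by (rule Bochner_Integration.integral_cong[OF refl])
        (simp add: E_def w_def q(3) inner_add_right mult.assoc exp_add[symmetric] algebra_simps)
    have lapx: "lap g (X, Y) = (\<integral>\<xi>. E \<xi> \<partial>lborel)" by (simp add: lap_def E_def)
    have bound: "norm (E \<xi> * (exp (w q \<xi>) - (1 + w q \<xi>))) \<le> (32 / k\<^sup>2 * (norm q)\<^sup>2) * D \<xi>" for \<xi>
    proof -
      define u where "u = norm \<xi>"
      have u: "u \<ge> 0" by (simp add: u_def)
      have "norm (exp (w q \<xi>) - (1 + w q \<xi>)) \<le> exp \<bar>Re (w q \<xi>)\<bar> * (norm (w q \<xi>))\<^sup>2"
        using Taylor_exp[of "w q \<xi>" 1] by (simp add: power2_eq_square)
      also have "\<dots> \<le> exp (norm q * u) * (2 * norm q * u)\<^sup>2"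
        using rw[of q \<xi>] nw[of q \<xi>] by (intro mult_mono power_mono) (auto simp: u_def)
      also have "\<dots> \<le> exp (k / 2 * u) * (2 * norm q * u)\<^sup>2"
        using mult_right_mono[of "norm q" "k / 2" u] q(1) u by (intro mult_right_mono) (simp_all only: exp_le_cancel_iff less_imp_le zero_le_power2)
      also have "(2 * norm q * u)\<^sup>2 = 4 * (norm q)\<^sup>2 * u\<^sup>2" by (simp add: power_mult_distrib)
      also have "u\<^sup>2 \<le> 8 / k\<^sup>2 * exp (k / 2 * u)"
      proof -
        have "(k / 2 * u)\<^sup>2 / 2 \<le> exp (k / 2 * u)"
          using exp_lower_Taylor_quadratic[of "k / 2 * u"] k u by (smt (verit) mult_nonneg_nonneg divide_nonneg_nonneg)
        then show ?thesis using k by (simp add: power_mult_distrib power_divide field_simps)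
      qed
      finally have "norm (exp (w q \<xi>) - (1 + w q \<xi>)) \<le> exp (k / 2 * u) * (4 * (norm q)\<^sup>2 * (8 / k\<^sup>2 * exp (k / 2 * u)))"
        by (simp add: mult_left_mono)
      also have "\<dots> = 32 / k\<^sup>2 * (norm q)\<^sup>2 * exp (k * u)"
        by (simp add: exp_add[symmetric] mult_ac flip: exp_double)
      finally have "norm (E \<xi> * (exp (w q \<xi>) - (1 + w q \<xi>))) \<le> cmod (g \<xi>) * exp (- (\<xi> \<bullet> Y)) * (32 / k\<^sup>2 * (norm q)\<^sup>2 * exp (k * u))"
        unfolding norm_mult nE by (intro mult_left_mono) auto
      then show ?thesis by (simp add: D_def u_def mult_ac)
    qed
    have iB: "integrable lborel (\<lambda>\<xi>. E \<xi> * (exp (w q \<xi>) - (1 + w q \<xi>)))"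
    proof (rule Bochner_Integration.integrable_bound)
      show "integrable lborel (\<lambda>\<xi>. (32 / k\<^sup>2 * (norm q)\<^sup>2) * D \<xi>)" using iD by (rule integrable_mult_right)
      show "AE \<xi> in lborel. norm (E \<xi> * (exp (w q \<xi>) - (1 + w q \<xi>))) \<le> norm ((32 / k\<^sup>2 * (norm q)\<^sup>2) * D \<xi>)"
      proof (intro AE_I2)
        fix \<xi> show "norm (E \<xi> * (exp (w q \<xi>) - (1 + w q \<xi>))) \<le> norm ((32 / k\<^sup>2 * (norm q)\<^sup>2) * D \<xi>)"
          using bound[of \<xi>] unfolding real_norm_def by linarith
      qed
    qed measurable
    have "lap g y - lap g (X, Y) - L q = (\<integral>\<xi>. E \<xi> * (exp (w q \<xi>) - (1 + w q \<xi>)) \<partial>lborel)"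
    proof -
      have "E \<xi> * exp (w q \<xi>) = E \<xi> * (exp (w q \<xi>) - (1 + w q \<xi>)) + (E \<xi> + E \<xi> * w q \<xi>)" for \<xi>
        by (simp add: algebra_simps)
      then have "lap g y = (\<integral>\<xi>. E \<xi> * (exp (w q \<xi>) - (1 + w q \<xi>)) + (E \<xi> + E \<xi> * w q \<xi>) \<partial>lborel)"
        unfolding lapy by (simp only:)
      also have "\<dots> = (\<integral>\<xi>. E \<xi> * (exp (w q \<xi>) - (1 + w q \<xi>)) \<partial>lborel) + ((\<integral>\<xi>. E \<xi> \<partial>lborel) + (\<integral>\<xi>. E \<xi> * w q \<xi> \<partial>lborel))"
        using iB iE iEw by simp
      finally show ?thesis by (simp add: lapx L_def)
    qed
    also have "norm \<dots> \<le> (\<integral>\<xi>. (32 / k\<^sup>2 * (norm q)\<^sup>2) * D \<xi> \<partial>lborel)"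
      using bound iD by (intro Bochner_Integration.integral_norm_bound_integral iB integrable_mult_right AE_I2)
    also have "\<dots> = C * (norm q)\<^sup>2" by (simp add: C_def)
    finally have "norm (lap g y - lap g (X, Y) - L (y - (X, Y))) \<le> C * (norm q)\<^sup>2" by (simp add: q_def)
    then show "norm (lap g y - lap g (X, Y) - L (y - (X, Y))) / norm (y - (X, Y)) \<le> C * norm (y - (X, Y))"
      using q(2) unfolding q_def[symmetric] by (simp add: divide_le_eq power2_eq_square mult_ac)
  qed
  then show ?thesis unfolding L_def E_def w_def .
qed

lemma lap_measurable:
  fixes g :: "'a::euclidean_space \<Rightarrow> complex"
  assumes [measurable]: "g \<in> borel_measurable borel"
  shows "lap g \<in> borel_measurable (borel \<Otimes>\<^sub>M borel)"
  unfolding lap_def[abs_def] by measurable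

text \<open>Along the complexified line in direction V the real derivative takes s to a fixed
  complex number times s, which is complex differentiability.\<close>

lemma lap_line_holomorphic:
  fixes g :: "'a::euclidean_space \<Rightarrow> complex"
  assumes S: "open S" and g: "g \<in> borel_measurable borel"
    and i: "\<And>Y. Y \<in> S \<Longrightarrow> integrable lborel (\<lambda>\<xi>. g \<xi> * of_real (exp (- (\<xi> \<bullet> Y))))"
  shows "(\<lambda>z. lap g (X + Re z *\<^sub>R V, Y + Im z *\<^sub>R V)) holomorphic_on {z. Y + Im z *\<^sub>R V \<in> S}"
proof (rule holomorphic_onI, rule field_differentiable_at_within)
  fix z assume z: "z \<in> {z. Y + Im z *\<^sub>R V \<in> S}"
  define E where "E \<xi> = g \<xi> * exp (\<i> * of_real (\<xi> \<bullet> (X + Re z *\<^sub>R V)) - of_real (\<xi> \<bullet> (Y + Im z *\<^sub>R V)))" for \<xi>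
  define c where "c = (\<integral>\<xi>. E \<xi> * (\<i> * of_real (\<xi> \<bullet> V)) \<partial>lborel)"
  have 1: "((\<lambda>z. (X + Re z *\<^sub>R V, Y + Im z *\<^sub>R V)) has_derivative (\<lambda>s. (Re s *\<^sub>R V, Im s *\<^sub>R V))) (at z)"
    by (auto intro!: derivative_eq_intros)
  have 2: "(lap g has_derivative (\<lambda>q. \<integral>\<xi>. E \<xi> * (\<i> * of_real (\<xi> \<bullet> fst q) - of_real (\<xi> \<bullet> snd q)) \<partial>lborel))
     (at (X + Re z *\<^sub>R V, Y + Im z *\<^sub>R V))"
    unfolding E_def using z by (intro lap_has_derivative[OF S _ g i]) auto
  have "((\<lambda>z. lap g (X + Re z *\<^sub>R V, Y + Im z *\<^sub>R V)) has_derivative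
     (\<lambda>s. \<integral>\<xi>. E \<xi> * (\<i> * of_real (\<xi> \<bullet> fst (Re s *\<^sub>R V, Im s *\<^sub>R V)) - of_real (\<xi> \<bullet> snd (Re s *\<^sub>R V, Im s *\<^sub>R V))) \<partial>lborel)) (at z)"
    using has_derivative_compose[OF 1 2] .
  also have "(\<lambda>s. \<integral>\<xi>. E \<xi> * (\<i> * of_real (\<xi> \<bullet> fst (Re s *\<^sub>R V, Im s *\<^sub>R V)) - of_real (\<xi> \<bullet> snd (Re s *\<^sub>R V, Im s *\<^sub>R V))) \<partial>lborel) = (*) c"
  proof
    fix s
    have "E \<xi> * (\<i> * of_real (\<xi> \<bullet> fst (Re s *\<^sub>R V, Im s *\<^sub>R V)) - of_real (\<xi> \<bullet> snd (Re s *\<^sub>R V, Im s *\<^sub>R V)))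
       = (E \<xi> * (\<i> * of_real (\<xi> \<bullet> V))) * s" for \<xi>
    proof -
      have "\<i> * of_real (\<xi> \<bullet> fst (Re s *\<^sub>R V, Im s *\<^sub>R V)) - of_real (\<xi> \<bullet> snd (Re s *\<^sub>R V, Im s *\<^sub>R V)) = (\<i> * of_real (\<xi> \<bullet> V)) * s"
        by (simp add: complex_eq_iff)
      then show ?thesis by (simp only: mult.assoc)
    qed
    then show "(\<integral>\<xi>. E \<xi> * (\<i> * of_real (\<xi> \<bullet> fst (Re s *\<^sub>R V, Im s *\<^sub>R V)) - of_real (\<xi> \<bullet> snd (Re s *\<^sub>R V, Im s *\<^sub>R V))) \<partial>lborel) = c * s"
      unfolding c_def by (simp only: integral_mult_left_zero)
  qed
  finally show "(\<lambda>z. lap g (X + Re z *\<^sub>R V, Y + Im z *\<^sub>R V)) field_differentiable at z"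
    unfolding field_differentiable_def has_field_derivative_def by blast
qed

section \<open>Functions on the Siegel domain in real coordinates\<close>

text \<open>Symmetrizing the entries makes this and \<open>Im_sym\<close> linear on all complex
  matrices, hence continuous and differentiable everywhere; on symmetric matrices
  \<open>Im_sym\<close> agrees with \<open>Im_symm\<close>.\<close>

definition Re_sym :: "complex ^ 'n ^ 'n \<Rightarrow> 'n::finite symm" where
  "Re_sym Z = Abs_symm (\<chi> i j. (Re (Z $ i $ j) + Re (Z $ j $ i)) / 2)"

definition Im_sym :: "complex ^ 'n ^ 'n \<Rightarrow> 'n::finite symm" where
  "Im_sym Z = Abs_symm (\<chi> i j. (Im (Z $ i $ j) + Im (Z $ j $ i)) / 2)"

lemma smat_Re_sym: "smat (Re_sym Z) = (\<chi> i j. (Re (Z $ i $ j) + Re (Z $ j $ i)) / 2)"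
  unfolding Re_sym_def by (rule smat_Abs_symm) (simp add: transpose_def vec_eq_iff add.commute)

lemma smat_Im_sym: "smat (Im_sym Z) = (\<chi> i j. (Im (Z $ i $ j) + Im (Z $ j $ i)) / 2)"
  unfolding Im_sym_def by (rule smat_Abs_symm) (simp add: transpose_def vec_eq_iff add.commute)

lemma bounded_linear_Re_sym: "bounded_linear Re_sym"
  unfolding linear_conv_bounded_linear[symmetric]
  by (rule linearI; rule symm_eqI; simp add: smat_add smat_scaleR smat_Re_sym vec_eq_iff add_divide_distrib algebra_simps)

lemma bounded_linear_Im_sym: "bounded_linear Im_sym"
  unfolding linear_conv_bounded_linear[symmetric]
  by (rule linearI; rule symm_eqI; simp add: smat_add smat_scaleR smat_Im_sym vec_eq_iff add_divide_distrib algebra_simps)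

lemma Re_sym_XiY [simp]: "Re_sym (XiY p) = fst p"
  by (rule symm_eqI) (simp add: smat_Re_sym XiY_def case_prod_unfold vec_eq_iff smat_sym)

lemma Im_sym_XiY [simp]: "Im_sym (XiY p) = snd p"
  by (rule symm_eqI) (simp add: smat_Im_sym XiY_def case_prod_unfold vec_eq_iff smat_sym)

lemma csymm_entry: "Z \<in> csymm \<Longrightarrow> Z $ i $ j = Z $ j $ i"
  unfolding csymm_def transpose_def by (auto simp: vec_eq_iff)

lemma XiY_sym: "Z \<in> csymm \<Longrightarrow> XiY (Re_sym Z, Im_sym Z) = Z"
  by (simp add: XiY_def smat_Re_sym smat_Im_sym vec_eq_iff csymm_entry complex_eq_iff)

lemma XiY_csymm: "XiY p \<in> csymm"
  by (simp add: XiY_def csymm_def case_prod_unfold transpose_def vec_eq_iff smat_sym[of "fst p"] smat_sym[of "snd p"])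

lemma Im_symm_eq: "Z \<in> csymm \<Longrightarrow> Im_symm Z = Im_sym Z"
  unfolding Im_symm_def Im_sym_def Im_mat_def
  by (rule arg_cong[where f=Abs_symm]) (simp add: vec_eq_iff csymm_entry)

lemma Im_symm_XiY [simp]: "Im_symm (XiY p) = snd p"
  by (simp add: Im_symm_eq XiY_csymm)

lemma siegel_iff: "Z \<in> siegel \<longleftrightarrow> Z \<in> csymm \<and> Im_sym Z \<in> pd_cone"
proof
  assume Z: "Z \<in> siegel"
  then obtain p where "p \<in> UNIV \<times> pd_cone" "Z = XiY p" unfolding siegel_eq_image by auto
  then show "Z \<in> csymm \<and> Im_sym Z \<in> pd_cone" by (auto simp: XiY_csymm)
next
  assume "Z \<in> csymm \<and> Im_sym Z \<in> pd_cone"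
  then have "Z = XiY (Re_sym Z, Im_sym Z)" "(Re_sym Z, Im_sym Z) \<in> UNIV \<times> pd_cone" by (simp_all add: XiY_sym)
  then show "Z \<in> siegel" unfolding siegel_eq_image by (metis image_eqI)
qed

lemma XiY_line: "XiY (X + Re z *\<^sub>R V, Y + Im z *\<^sub>R V) = XiY (X, Y) + (\<chi> i j. z * cplx V $ i $ j)"
  by (simp add: XiY_def cplx_def vec_eq_iff smat_add smat_scaleR complex_eq_iff)

lemma XiY_shift: "XiY (X, Y) + cplx S = XiY (X + S, Y)"
  by (simp add: XiY_def cplx_def vec_eq_iff smat_add complex_eq_iff)

lemma cplx_csymm: "cplx V \<in> csymm"
  by (simp add: cplx_def csymm_def transpose_def vec_eq_iff smat_sym[of V])

lemma XiY_measurable_borel: "(XiY :: 'n::finite symm \<times> 'n symm \<Rightarrow> _) \<in> borel_measurable (borel \<Otimes>\<^sub>M borel)"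
proof -
  have "linear (XiY :: 'n symm \<times> 'n symm \<Rightarrow> _)"
    by (rule linearI)
      (auto simp: XiY_def case_prod_unfold vec_eq_iff smat_add smat_scaleR complex_eq_iff)
  then have "continuous_on UNIV (XiY :: 'n symm \<times> 'n symm \<Rightarrow> _)" by (simp add: linear_continuous_on linear_conv_bounded_linear)
  then show ?thesis unfolding borel_prod by (rule borel_measurable_continuous_onI)
qed

lemma cone_integrand_measurable:
  "(\<lambda>Y::'n::finite symm. indicator pd_cone Y * (exp (- tr2 X Y) * sdet Y powr q)) \<in> borel_measurable borel"
  unfolding tr2_inner by measurable

abbreviation "siegel_borel \<equiv> restrict_space borel siegel"

section \<open>The measures on the cone and on the Siegel domain in coordinates\<close>

lemma cone_leb_space [simp]: "space cone_leb = pd_cone"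
  by (simp add: cone_leb_def space_restrict_space)

lemma cone_leb_id [measurable]: "(\<lambda>Y. Y) \<in> borel_measurable cone_leb"
  unfolding cone_leb_def by (rule measurable_restrict_space1) simp

lemma cone_leb_sigma_finite: "sigma_finite_measure cone_leb"
  unfolding cone_leb_def by (rule sigma_finite_measure_restrict_space) (auto simp: lborel.sigma_finite_measure_axioms)

lemma cone_leb_AE: "(AE Y in cone_leb. P Y) \<longleftrightarrow> (AE Y in lborel. Y \<in> pd_cone \<longrightarrow> P Y)"
  unfolding cone_leb_def by (rule AE_restrict_space_iff) simp

lemma cone_leb_nn_integral: "(\<integral>\<^sup>+Y. f Y \<partial>cone_leb) = (\<integral>\<^sup>+Y. f Y * indicator pd_cone Y \<partial>lborel)"
  unfolding cone_leb_def by (rule nn_integral_restrict_space) simp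

lemma cone_leb_measurable_iff:
  fixes f :: "'n::finite symm \<Rightarrow> complex"
  shows "f \<in> borel_measurable cone_leb \<longleftrightarrow> (\<lambda>X. indicator pd_cone X * f X) \<in> borel_measurable borel"
proof -
  have "(\<lambda>X. indicator pd_cone X * f X) = (\<lambda>X. indicator pd_cone X *\<^sub>R f X)" by (auto simp: indicator_def)
  then show ?thesis unfolding cone_leb_def by (subst borel_measurable_restrict_space_iff) auto
qed

lemma XiY_measurable: "XiY \<in> measurable (lborel \<Otimes>\<^sub>M cone_leb) siegel_borel"
proof (rule measurable_restrict_space2)
  have "(\<lambda>p. (fst p, snd p)) \<in> measurable (lborel \<Otimes>\<^sub>M cone_leb) (borel \<Otimes>\<^sub>M borel)" by measurable
  from measurable_compose[OF this XiY_measurable_borel] show "XiY \<in> borel_measurable (lborel \<Otimes>\<^sub>M cone_leb)" by simp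
qed (auto simp: space_pair_measure siegel_iff XiY_csymm)

lemma Im_symm_measurable: "Im_symm \<in> measurable siegel_borel cone_leb"
proof -
  have "Im_sym \<in> measurable siegel_borel cone_leb"
    unfolding cone_leb_def
  proof (rule measurable_restrict_space2)
    show "Im_sym \<in> measurable siegel_borel lborel"
      by (rule measurable_restrict_space1)
        (simp add: borel_measurable_continuous_onI linear_continuous_on bounded_linear_Im_sym)
  qed (auto simp: siegel_iff space_restrict_space)
  then show ?thesis
    by (subst measurable_cong[of _ _ Im_sym]) (auto simp: space_restrict_space siegel_iff Im_symm_eq)
qed

locale siegel_weight =
  fixes lam :: real and N :: "'n::finite symm measure"
  assumes lam: "lam > real CARD('n)" and N_def: "N = cone_wmeasure lam"
begin

text \<open>The dimension of the space of symmetric matrices; the next constant \<open>s\<close> is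
  the gamma parameter that belongs to the weight of \<open>N\<close>.\<close>

definition dm where "dm = real CARD('n) * (real CARD('n) + 1) / 2"
definition s where "s = lam - (real CARD('n) + 1) / 2"

lemma n1: "real CARD('n) \<ge> 1"
proof -
  have "CARD('n) \<ge> 1" by (simp add: Suc_leI)
  then show ?thesis by linarith
qed

lemma s_gt: "s > (real CARD('n) - 1) / 2" and lam_gt: "lam > (real CARD('n) - 1) / 2"
  using lam n1 by (auto simp: s_def field_simps)

definition wt :: "'n symm \<Rightarrow> real" where "wt = cone_weight lam"

lemma C_pos: "C_const CARD('n) lam > 0"
  unfolding C_const_def using Gamma_cone_pos[OF lam_gt] Gamma_cone_pos[OF s_gt] by (simp add: s_def)

lemma sdet_scale2: "sdet (2 *\<^sub>R Y) = 2 ^ CARD('n) * sdet (Y :: 'n symm)"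
proof -
  have "smat (2 *\<^sub>R Y) = (\<chi> i. (2::real) *s (smat Y $ i))"
    by (simp add: smat_scaleR vec_eq_iff)
  moreover have "det (\<chi> i. (2::real) *s (smat Y $ i)) = (\<Prod>i\<in>(UNIV::'n set). 2) * det (\<chi> i. smat Y $ i)"
    by (rule det_rows_mul)
  ultimately show ?thesis by (simp add: sdet_def)
qed

lemma wt_pos: "Y \<in> pd_cone \<Longrightarrow> wt Y > 0"
  using C_pos sdet_pos[of Y] by (simp add: wt_def cone_weight_def sdet_scale2)

lemma wt_nonneg: "wt Y \<ge> 0"
  using C_pos by (simp add: wt_def cone_weight_def)

lemma wt_measurable [measurable]: "wt \<in> borel_measurable borel"
  unfolding wt_def cone_weight_def[abs_def] by measurable

lemma wt_measurable_cone [measurable]: "wt \<in> borel_measurable cone_leb"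
  unfolding cone_leb_def by (rule measurable_restrict_space1) simp

lemma N_eq: "N = density cone_leb (\<lambda>Y. ennreal (wt Y))"
  by (simp add: N_def cone_wmeasure_def wt_def)

lemma sets_N [measurable_cong]: "sets N = sets cone_leb" by (simp add: N_eq)
lemma space_N [simp]: "space N = pd_cone" by (simp add: N_eq)

lemma sigma_finite_N': "sigma_finite_measure N"
proof -
  interpret sigma_finite_measure cone_leb by (rule cone_leb_sigma_finite)
  show ?thesis unfolding N_eq
    by (subst sigma_finite_iff_density_finite) auto
qed

lemma ft_fourier_integral: "fourier_integral = (ft :: ('n symm \<Rightarrow> complex) \<Rightarrow> _)"
proof (intro ext)
  fix f :: "'n symm \<Rightarrow> complex" and X
  have e: "real DIM('n symm) / 2 = real CARD('n) * (real CARD('n) + 1) / 4" using DIM_symm[where 'n='n] by linarith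
  show "fourier_integral f X = ft f X"
    by (simp only: fourier_integral_def ft_def tr2_inner e)
qed

lemma fourier_L2_spec:
  "bounded_l2_operator lborel lborel (fourier_L2 :: ('n symm \<Rightarrow> complex) \<Rightarrow> _) \<and>
   (\<forall>f\<in>L2 lborel. integrable lborel f \<longrightarrow> (AE X in lborel. (fourier_L2 :: ('n symm \<Rightarrow> complex) \<Rightarrow> _) f X = ft f X))"
proof -
  obtain A :: "('n symm \<Rightarrow> complex) \<Rightarrow> ('n symm \<Rightarrow> complex)"
    where "bounded_l2_operator lborel lborel A"
      "\<And>f. f \<in> L2 lborel \<Longrightarrow> integrable lborel f \<Longrightarrow> AE x in lborel. A f x = ft f x"
    using fourier_extension_exists by blast
  then have A: "bounded_l2_operator lborel lborel A \<and>
     (\<forall>f\<in>L2 lborel. integrable lborel f \<longrightarrow> (AE X in lborel. A f X = ft f X))" by blast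
  define Q where "Q V \<longleftrightarrow> bounded_l2_operator lborel lborel V \<and>
     (\<forall>f\<in>L2 lborel. integrable lborel f \<longrightarrow> (AE X in lborel. V f X = ft f X))"
    for V :: "('n symm \<Rightarrow> complex) \<Rightarrow> 'n symm \<Rightarrow> complex"
  have "fourier_L2 = Eps Q" unfolding fourier_L2_def ft_fourier_integral Q_def[abs_def] ..
  moreover have "Q (Eps Q)" by (rule someI[of Q A]) (unfold Q_def, rule A)
  ultimately have "Q fourier_L2" by simp
  then show ?thesis unfolding Q_def .
qed

sublocale partial_fourier N "fourier_L2 :: ('n symm \<Rightarrow> complex) \<Rightarrow> ('n symm \<Rightarrow> complex)"
  using sigma_finite_N' fourier_L2_spec
  by (intro partial_fourier.intro partial_fourier_axioms.intro) blast+

lemma sets_P: "sets P = sets (lborel \<Otimes>\<^sub>M cone_leb)"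
  by (rule sets_pair_measure_cong) (auto simp: sets_N)

lemma P_density: "P = density (lborel \<Otimes>\<^sub>M cone_leb) (\<lambda>p. ennreal (wt (snd p)))"
proof -
  have "P = density lborel (\<lambda>_. 1) \<Otimes>\<^sub>M density cone_leb (\<lambda>Y. ennreal (wt Y))"
    by (simp add: density_1 N_eq)
  also have "\<dots> = density (lborel \<Otimes>\<^sub>M cone_leb) (\<lambda>(x, y). 1 * ennreal (wt y))"
    by (rule pair_measure_density) (use cone_leb_sigma_finite sigma_finite_N' in \<open>auto simp: N_eq[symmetric]\<close>)
  finally show ?thesis by (simp add: case_prod_unfold)
qed

lemma XiY_P: "XiY \<in> measurable P siegel_borel"
  using XiY_measurable by (simp add: measurable_cong_sets[OF sets_P refl])

text \<open>In the coordinates (X, Y) the weighted measure is the product \<open>P\<close> on which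
  the partial Fourier transform acts.\<close>

lemma vhat_eq: "vhat lam = distr P siegel_borel XiY"
proof -
  have m: "(\<lambda>Z :: complex ^ 'n ^ 'n. ennreal (cone_weight lam (Im_symm Z))) \<in> borel_measurable siegel_borel"
    using measurable_compose[OF Im_symm_measurable wt_measurable_cone]
    by (intro measurable_compose[OF _ measurable_ennreal]) (simp add: wt_def)
  show ?thesis
    unfolding vhat_def siegel_leb_def P_density
    by (subst density_distr[OF m XiY_measurable]) (simp add: wt_def)
qed

lemma vhat_measurable: "f \<in> borel_measurable (vhat lam :: (complex ^ 'n ^ 'n) measure) \<longleftrightarrow> f \<in> borel_measurable siegel_borel"
  by (simp add: vhat_eq)

lemma vhat_L2:
  assumes "f \<in> borel_measurable siegel_borel"
  shows "f \<in> L2 (vhat lam) \<longleftrightarrow> (\<lambda>p. f (XiY p)) \<in> L2 P"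
proof -
  have "(\<lambda>p. f (XiY p)) \<in> borel_measurable P" by (rule measurable_compose[OF XiY_P assms])
  moreover have "sqnorm (vhat lam) f = sqnorm P (\<lambda>p. f (XiY p))"
    unfolding vhat_eq sqnorm_def using assms by (subst nn_integral_distr[OF XiY_P]) auto
  ultimately show ?thesis using assms by (simp add: L2_iff vhat_measurable)
qed

lemma vhat_L2D: "f \<in> L2 (vhat lam) \<Longrightarrow> (\<lambda>p. f (XiY p)) \<in> L2 P"
  using vhat_L2 vhat_measurable by blast

lemma vhat_inner:
  assumes "f \<in> borel_measurable siegel_borel" "g \<in> borel_measurable siegel_borel"
  shows "l2_inner (vhat lam) f g = l2_inner P (\<lambda>p. f (XiY p)) (\<lambda>p. g (XiY p))"
  unfolding vhat_eq l2_inner_def using assms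
  by (subst integral_distr[OF XiY_P]) (auto intro!: borel_measurable_times borel_measurable_cnj)

lemma siegel_leb_AE:
  assumes "AE Z in siegel_leb. Q Z" shows "AE p in P. Q (XiY p)"
proof -
  have "AE p in lborel \<Otimes>\<^sub>M cone_leb. Q (XiY p)"
    using assms unfolding siegel_leb_def by (rule AE_distrD[OF XiY_measurable])
  then show ?thesis unfolding P_density by (subst AE_density) (auto elim: eventually_mono)
qed

subsection \<open>Weighted exponential integrals\<close>

text \<open>On the cone this is the reciprocal of the \<open>N\<close>-integral of exp(-2 tr(XY)),
  and it is the square of the factor of X in the operator S.\<close>

definition \<kappa> :: "'n symm \<Rightarrow> real" where
  "\<kappa> X = (2 * pi) powr dm / Gamma_cone CARD('n) lam * sdet X powr s"

lemma \<kappa>_pos: "X \<in> pd_cone \<Longrightarrow> \<kappa> X > 0"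
  unfolding \<kappa>_def using Gamma_cone_pos[OF lam_gt] sdet_pos[of X] by simp

lemma nn_integral_N:
  assumes "f \<in> borel_measurable cone_leb"
  shows "(\<integral>\<^sup>+Y. f Y \<partial>N) = (\<integral>\<^sup>+Y. ennreal (wt Y) * f Y * indicator pd_cone Y \<partial>lborel)"
  unfolding N_eq using assms by (subst nn_integral_density) (auto simp: cone_leb_nn_integral)

lemma exp_inner_measurable: "(\<lambda>Y::'n symm. exp (- 2 * (X \<bullet> Y))) \<in> borel_measurable cone_leb"
  unfolding cone_leb_def by (rule measurable_restrict_space1) simp

text \<open>Stated without evaluating the gamma integral, so that it serves both inside the cone,
  where the integral is finite, and outside, where it diverges.\<close>

lemma N_exp:
  "(\<integral>\<^sup>+Y. ennreal (exp (- 2 * (X \<bullet> Y))) \<partial>N) =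
     ennreal (C_const CARD('n) lam * (2 ^ CARD('n)) powr (lam - real CARD('n) - 1)) *
     (\<integral>\<^sup>+Y. ennreal (indicator pd_cone Y * (exp (- tr2 (2 *\<^sub>R X) Y) * sdet Y powr (s - (real CARD('n) + 1) / 2))) \<partial>lborel)"
proof -
  have e: "s - (real CARD('n) + 1) / 2 = lam - real CARD('n) - 1" by (simp add: s_def field_simps)
  have "(\<integral>\<^sup>+Y. ennreal (exp (- 2 * (X \<bullet> Y))) \<partial>N) = (\<integral>\<^sup>+Y. ennreal (wt Y) * ennreal (exp (- 2 * (X \<bullet> Y))) * indicator pd_cone Y \<partial>lborel)"
    by (rule nn_integral_N) (intro measurable_compose[OF exp_inner_measurable measurable_ennreal])
  also have "\<dots> = (\<integral>\<^sup>+Y. ennreal (C_const CARD('n) lam * (2 ^ CARD('n)) powr (lam - real CARD('n) - 1)) *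
     ennreal (indicator pd_cone Y * (exp (- tr2 (2 *\<^sub>R X) Y) * sdet Y powr (s - (real CARD('n) + 1) / 2))) \<partial>lborel)"
  proof (rule nn_integral_cong)
    fix Y :: "'n symm"
    show "ennreal (wt Y) * ennreal (exp (- 2 * (X \<bullet> Y))) * indicator pd_cone Y =
      ennreal (C_const CARD('n) lam * (2 ^ CARD('n)) powr (lam - real CARD('n) - 1)) *
      ennreal (indicator pd_cone Y * (exp (- tr2 (2 *\<^sub>R X) Y) * sdet Y powr (s - (real CARD('n) + 1) / 2)))"
    proof (cases "Y \<in> pd_cone")
      case True
      then have "wt Y * exp (- 2 * (X \<bullet> Y)) = (C_const CARD('n) lam * (2 ^ CARD('n)) powr (lam - real CARD('n) - 1)) *
        (exp (- tr2 (2 *\<^sub>R X) Y) * sdet Y powr (s - (real CARD('n) + 1) / 2))"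
        using sdet_pos[OF True] unfolding e wt_def cone_weight_def sdet_scale2 tr2_inner by (simp add: powr_mult)
      then show ?thesis using True wt_nonneg[of Y] C_pos by (simp add: ennreal_mult[symmetric])
    qed simp
  qed
  also have "\<dots> = ennreal (C_const CARD('n) lam * (2 ^ CARD('n)) powr (lam - real CARD('n) - 1)) *
     (\<integral>\<^sup>+Y. ennreal (indicator pd_cone Y * (exp (- tr2 (2 *\<^sub>R X) Y) * sdet Y powr (s - (real CARD('n) + 1) / 2))) \<partial>lborel)"
    by (rule nn_integral_cmult) (intro measurable_compose[OF _ measurable_ennreal], simp add: cone_integrand_measurable)
  finally show ?thesis .
qed

lemma N_exp_cone:
  assumes X: "X \<in> pd_cone"
  shows "(\<integral>\<^sup>+Y. ennreal (exp (- 2 * (X \<bullet> Y))) \<partial>N) = ennreal (1 / \<kappa> X)"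
proof -
  define m where "m = real CARD('n)"
  define Gs where "Gs = Gamma_cone CARD('n) s"
  define Gl where "Gl = Gamma_cone CARD('n) lam"
  have G: "Gs > 0" "Gl > 0" unfolding Gs_def Gl_def by (intro Gamma_cone_pos s_gt lam_gt)+
  have C: "C_const CARD('n) lam = Gl / (pi powr dm * Gs)"
    by (simp add: C_const_def Gs_def Gl_def s_def dm_def)
  have d: "sdet X > 0" by (rule sdet_pos[OF X])
  have X2: "2 *\<^sub>R X \<in> pd_cone" by (rule pd_cone_scale[OF X]) simp
  have p2: "(2::real) ^ CARD('n) = 2 powr m" by (simp add: m_def powr_realpow)
  have "(\<integral>\<^sup>+Y. ennreal (exp (- 2 * (X \<bullet> Y))) \<partial>N) =
     ennreal (C_const CARD('n) lam * (2 ^ CARD('n)) powr (lam - m - 1)) * ennreal (Gs * sdet (2 *\<^sub>R X) powr (- s))"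
    unfolding N_exp nn_integral_cone[OF X2 s_gt] by (simp add: m_def Gs_def)
  also have "\<dots> = ennreal (C_const CARD('n) lam * (2 ^ CARD('n)) powr (lam - m - 1) * (Gs * sdet (2 *\<^sub>R X) powr (- s)))"
    using C_pos G by (intro ennreal_mult[symmetric]) auto
  also have "C_const CARD('n) lam * (2 ^ CARD('n)) powr (lam - m - 1) * (Gs * sdet (2 *\<^sub>R X) powr (- s)) = 1 / \<kappa> X"
  proof -
    \<comment> \<open>The powers of 2 combine to n (lam - n - 1 - s) = - n (n + 1) / 2.\<close>
    have "(2 ^ CARD('n)) powr (lam - m - 1) * (2 ^ CARD('n)) powr (- s) = (2::real) powr (- dm)"
      unfolding p2 powr_powr powr_add[symmetric]
      by (rule arg_cong[where f="\<lambda>x. 2 powr x"]) (simp add: dm_def s_def m_def field_simps)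
    moreover have "sdet (2 *\<^sub>R X) powr (- s) = (2 ^ CARD('n)) powr (- s) * sdet X powr (- s)"
      unfolding sdet_scale2 using d by (simp add: powr_mult)
    ultimately have "C_const CARD('n) lam * (2 ^ CARD('n)) powr (lam - m - 1) * (Gs * sdet (2 *\<^sub>R X) powr (- s))
       = Gl / (pi powr dm) * (2 powr (- dm) * sdet X powr (- s))"
      unfolding C using G by simp
    also have "\<dots> = Gl / (2 * pi) powr dm * (1 / sdet X powr s)"
      by (simp add: powr_mult powr_minus field_simps)
    finally show ?thesis unfolding \<kappa>_def Gl_def[symmetric] by simp
  qed
  finally show ?thesis .
qed

lemma N_exp_off:
  assumes X: "X \<notin> pd_cone"
  shows "(\<integral>\<^sup>+Y. ennreal (exp (- 2 * (X \<bullet> Y))) \<partial>N) = \<infinity>"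
proof -
  have "2 *\<^sub>R X \<notin> pd_cone"
  proof
    assume "2 *\<^sub>R X \<in> pd_cone"
    from pd_cone_scale[OF this, of "1/2"] X show False by simp
  qed
  from nn_integral_cone_infinite[OF this s_gt] show ?thesis
    unfolding N_exp using C_pos by (simp add: ennreal_mult_eq_top_iff)
qed

text \<open>The constant in the formula for \<gamma> is \<kappa> X times the constant of the weight,
  so \<gamma> is the mean of \<alpha> with respect to the density \<kappa> X exp(-2 tr(XY)) against
  \<open>N\<close>, which has total mass 1 when X is in the cone.\<close>

lemma gamma_fun_eq:
  fixes \<alpha> :: "'n symm \<Rightarrow> complex"
  assumes [measurable]: "\<alpha> \<in> borel_measurable cone_leb"
  shows "gamma_fun lam \<alpha> X = of_real (\<kappa> X) * (\<integral>Y. \<alpha> Y * of_real (exp (- 2 * (X \<bullet> Y))) \<partial>N)"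
    and "integrable cone_leb (gamma_integrand lam \<alpha> X) \<longleftrightarrow> integrable N (\<lambda>Y. \<alpha> Y * of_real (exp (- 2 * (X \<bullet> Y))))"
proof -
  let ?f = "\<lambda>Y. \<alpha> Y * of_real (exp (- 2 * (X \<bullet> Y)))"
  have eq: "wt Y *\<^sub>R ?f Y = of_real (C_const CARD('n) lam) * gamma_integrand lam \<alpha> X Y" for Y
    by (simp add: gamma_integrand_def wt_def cone_weight_def tr2_inner scaleR_conv_of_real mult_ac)
  have fm: "?f \<in> borel_measurable cone_leb" by measurable
  have "(\<integral>Y. ?f Y \<partial>N) = (\<integral>Y. wt Y *\<^sub>R ?f Y \<partial>cone_leb)"
    unfolding N_eq by (rule integral_density[OF fm]) (auto simp: wt_nonneg)
  also have "\<dots> = of_real (C_const CARD('n) lam) * (\<integral>Y. gamma_integrand lam \<alpha> X Y \<partial>cone_leb)"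
    unfolding eq by (rule integral_mult_right_zero)
  finally have i: "(\<integral>Y. ?f Y \<partial>N) = of_real (C_const CARD('n) lam) * (\<integral>Y. gamma_integrand lam \<alpha> X Y \<partial>cone_leb)" .
  have "integrable N ?f \<longleftrightarrow> integrable cone_leb (\<lambda>Y. wt Y *\<^sub>R ?f Y)"
    unfolding N_eq by (rule integrable_density[OF fm]) (auto simp: wt_nonneg)
  also have "\<dots> \<longleftrightarrow> integrable cone_leb (\<lambda>Y. of_real (C_const CARD('n) lam) * gamma_integrand lam \<alpha> X Y)"
    unfolding eq ..
  also have "\<dots> \<longleftrightarrow> integrable cone_leb (gamma_integrand lam \<alpha> X)"
  proof
    assume "integrable cone_leb (\<lambda>Y. of_real (C_const CARD('n) lam) * gamma_integrand lam \<alpha> X Y)"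
    from integrable_mult_right[OF this, of "1 / of_real (C_const CARD('n) lam)"]
    show "integrable cone_leb (gamma_integrand lam \<alpha> X)" using C_pos by simp
  qed (rule integrable_mult_right)
  finally show "integrable cone_leb (gamma_integrand lam \<alpha> X) \<longleftrightarrow> integrable N ?f" ..
  define Gs where "Gs = Gamma_cone CARD('n) s"
  define Gl where "Gl = Gamma_cone CARD('n) lam"
  have G: "Gs > 0" "Gl > 0" unfolding Gs_def Gl_def by (intro Gamma_cone_pos s_gt lam_gt)+
  have C: "C_const CARD('n) lam = Gl / (pi powr dm * Gs)"
    by (simp add: C_const_def Gs_def Gl_def s_def dm_def)
  have "\<kappa> X * C_const CARD('n) lam = 2 powr dm * sdet X powr s / Gs"
    unfolding \<kappa>_def Gl_def[symmetric] C using G by (simp add: powr_mult)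
  then have "of_real (\<kappa> X) * (\<integral>Y. ?f Y \<partial>N) = of_real (2 powr dm * sdet X powr s / Gs) * (\<integral>Y. gamma_integrand lam \<alpha> X Y \<partial>cone_leb)"
    unfolding i mult.assoc[symmetric] of_real_mult[symmetric] by simp
  then show "gamma_fun lam \<alpha> X = of_real (\<kappa> X) * (\<integral>Y. ?f Y \<partial>N)"
    by (simp add: gamma_fun_def dm_def s_def Gs_def)
qed

lemma AE_N: "(AE Y in N. Q Y) \<longleftrightarrow> (AE Y in cone_leb. Q Y)"
proof -
  have "(AE Y in N. Q Y) \<longleftrightarrow> (AE Y in cone_leb. 0 < ennreal (wt Y) \<longrightarrow> Q Y)"
    unfolding N_eq by (rule AE_density) simp
  also have "\<dots> \<longleftrightarrow> (AE Y in cone_leb. Q Y)"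
    by (rule AE_cong) (simp add: wt_pos)
  finally show ?thesis .
qed

text \<open>On the cone \<gamma> is an average of \<alpha> against a probability density, so it
  inherits the bound; |C| is written because C is not assumed nonnegative.\<close>

lemma gamma_facts:
  fixes \<alpha> :: "'n symm \<Rightarrow> complex"
  assumes [measurable]: "\<alpha> \<in> borel_measurable cone_leb" and b: "AE Y in cone_leb. cmod (\<alpha> Y) \<le> C"
  shows "X \<in> pd_cone \<Longrightarrow> integrable N (\<lambda>Y. \<alpha> Y * of_real (exp (- 2 * (X \<bullet> Y))))"
    and "X \<in> pd_cone \<Longrightarrow> cmod (gamma_fun lam \<alpha> X) \<le> \<bar>C\<bar>"
    and "gamma_fun lam \<alpha> \<in> borel_measurable cone_leb"
proof -
  have bN: "AE Y in N. cmod (\<alpha> Y) \<le> \<bar>C\<bar>" unfolding AE_N using b by eventually_elim auto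
  have [measurable]: "\<alpha> \<in> borel_measurable N" by simp
  show int: "integrable N (\<lambda>Y. \<alpha> Y * of_real (exp (- 2 * (X \<bullet> Y))))"
    and "cmod (gamma_fun lam \<alpha> X) \<le> \<bar>C\<bar>" if X: "X \<in> pd_cone"
  proof -
    have e: "integrable N (\<lambda>Y. exp (- 2 * (X \<bullet> Y)))"
      by (rule integrableI_nonneg) (auto simp: N_exp_cone[OF X, simplified])
    have eI: "(\<integral>Y. exp (- 2 * (X \<bullet> Y)) \<partial>N) = 1 / \<kappa> X"
      using N_exp_cone[OF X] \<kappa>_pos[OF X] by (intro integral_eq_nn_integral[THEN trans]) auto
    have bb: "AE Y in N. norm (\<alpha> Y * of_real (exp (- 2 * (X \<bullet> Y)))) \<le> \<bar>C\<bar> * exp (- 2 * (X \<bullet> Y))"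
      using bN by eventually_elim (simp add: norm_mult mult_right_mono)
    show i: "integrable N (\<lambda>Y. \<alpha> Y * of_real (exp (- 2 * (X \<bullet> Y))))"
    proof (rule Bochner_Integration.integrable_bound)
      show "integrable N (\<lambda>Y. \<bar>C\<bar> * exp (- 2 * (X \<bullet> Y)))" using e by (rule integrable_mult_right)
      show "AE Y in N. norm (\<alpha> Y * of_real (exp (- 2 * (X \<bullet> Y)))) \<le> norm (\<bar>C\<bar> * exp (- 2 * (X \<bullet> Y)))"
        using bb by eventually_elim simp
    qed measurable
    have "cmod (\<integral>Y. \<alpha> Y * of_real (exp (- 2 * (X \<bullet> Y))) \<partial>N) \<le> (\<integral>Y. \<bar>C\<bar> * exp (- 2 * (X \<bullet> Y)) \<partial>N)"
      by (rule order_trans[OF integral_norm_bound integral_mono_AE[OF integrable_norm[OF i] integrable_mult_right[OF e] bb]])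
    also have "\<dots> = \<bar>C\<bar> * (1 / \<kappa> X)" by (simp only: integral_mult_right_zero eI)
    finally have "\<kappa> X * cmod (\<integral>Y. \<alpha> Y * of_real (exp (- 2 * (X \<bullet> Y))) \<partial>N) \<le> \<kappa> X * (\<bar>C\<bar> * (1 / \<kappa> X))"
      using \<kappa>_pos[OF X] by (intro mult_left_mono) auto
    then show "cmod (gamma_fun lam \<alpha> X) \<le> \<bar>C\<bar>"
      unfolding gamma_fun_eq(1)[OF assms(1)] norm_mult using \<kappa>_pos[OF X] by simp
  qed
  have "(\<lambda>X. of_real (\<kappa> X) * (\<integral>Y. \<alpha> Y * of_real (exp (- 2 * (X \<bullet> Y))) \<partial>N)) \<in> borel_measurable borel"
  proof -
    have [measurable]: "(\<lambda>Y. Y) \<in> borel_measurable N" by (simp add: measurable_cong_sets[OF sets_N refl])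
    have [measurable]: "\<kappa> \<in> borel_measurable borel" unfolding \<kappa>_def[abs_def] by measurable
    show ?thesis by measurable
  qed
  then show "gamma_fun lam \<alpha> \<in> borel_measurable cone_leb"
    unfolding gamma_fun_eq(1)[OF assms(1), abs_def] cone_leb_def
    by (intro measurable_restrict_space1) simp
qed

end

subsection \<open>The isometry \<open>S\<close>\<close>

lemma closed_csymm: "closed (csymm :: (complex ^ ('n::finite) ^ 'n) set)"
proof -
  have eq: "csymm = {Z :: complex ^ 'n ^ 'n. \<forall>i j. Z $ i $ j = Z $ j $ i}"
    by (auto simp: csymm_def transpose_def vec_eq_iff)
  show ?thesis unfolding eq by (intro closed_Collect_all closed_Collect_eq continuous_intros)
qed

lemma siegel_sets: "(siegel :: (complex ^ ('n::finite) ^ 'n) set) \<in> sets borel"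
proof -
  have eq: "(siegel :: (complex ^ 'n ^ 'n) set) = csymm \<inter> (Im_sym -` pd_cone \<inter> space borel)"
    by (auto simp: siegel_iff)
  have m: "Im_sym \<in> borel_measurable (borel :: (complex ^ 'n ^ 'n) measure)"
    by (intro borel_measurable_continuous_onI linear_continuous_on bounded_linear_Im_sym)
  show ?thesis unfolding eq by (intro sets.Int borel_closed closed_csymm measurable_sets[OF m] pd_cone_sets)
qed

lemma holomorphic_siegel_continuous:
  fixes f :: "complex ^ ('n::finite) ^ 'n \<Rightarrow> complex"
  assumes f: "holomorphic_siegel f"
  shows "continuous_on siegel f"
  unfolding continuous_on_eq_continuous_within
proof
  fix Z :: "complex ^ 'n ^ 'n" assume Z: "Z \<in> siegel"
  then obtain D where "(f has_derivative D) (at Z within csymm)" using f by (auto simp: holomorphic_siegel_def)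
  then have "continuous (at Z within csymm) f" by (rule has_derivative_continuous)
  then show "continuous (at Z within siegel) f"
    by (rule continuous_within_subset) (auto simp: siegel_iff)
qed

lemma holomorphic_siegel_measurable: "holomorphic_siegel f \<Longrightarrow> f \<in> borel_measurable siegel_borel"
  by (intro borel_measurable_continuous_on_restrict holomorphic_siegel_continuous)

text \<open>The derivative of f exists only within the symmetric matrices. The complex line stays
  inside that subspace, so the chain rule relative to its range applies, and complex homogeneity of
  the derivative makes the composite complex differentiable.\<close>

lemma holomorphic_siegel_line:
  fixes f :: "complex ^ ('n::finite) ^ 'n \<Rightarrow> complex"
  assumes f: "holomorphic_siegel f"
  shows "(\<lambda>z. f (XiY (X + Re z *\<^sub>R V, Y + Im z *\<^sub>R V))) holomorphic_on {z. Y + Im z *\<^sub>R V \<in> pd_cone}"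
proof (rule holomorphic_onI, rule field_differentiable_at_within)
  fix z assume z: "z \<in> {z. Y + Im z *\<^sub>R V \<in> pd_cone}"
  define \<gamma> where "\<gamma> w = XiY (X + Re w *\<^sub>R V, Y + Im w *\<^sub>R V)" for w
  have "\<gamma> z \<in> siegel" using z by (simp add: \<gamma>_def siegel_iff XiY_csymm)
  then obtain D where D: "(f has_derivative D) (at (\<gamma> z) within csymm)"
    "\<And>c W. W \<in> csymm \<Longrightarrow> D (\<chi> i j. c * W $ i $ j) = c * D W"
    using f by (auto simp: holomorphic_siegel_def)
  define lz where "lz w = (\<chi> i j. w * cplx V $ i $ j)" for w
  have "linear lz" by (rule linearI) (auto simp: lz_def vec_eq_iff algebra_simps)
  then have "bounded_linear lz" by (simp add: linear_conv_bounded_linear)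
  then have "(lz has_derivative lz) (at z)" by (rule bounded_linear_imp_has_derivative)
  then have "((\<lambda>w. XiY (X, Y) + lz w) has_derivative lz) (at z)"
    by (auto intro!: derivative_eq_intros)
  then have \<gamma>': "(\<gamma> has_derivative lz) (at z)"
    unfolding \<gamma>_def XiY_line lz_def .
  have "(f has_derivative D) (at (\<gamma> z) within range \<gamma>)"
    by (rule has_derivative_subset[OF D(1)]) (auto simp: \<gamma>_def XiY_csymm)
  from has_derivative_in_compose[OF \<gamma>' this]
  have "((\<lambda>w. f (\<gamma> w)) has_derivative (\<lambda>w. D (lz w))) (at z)" .
  also have "(\<lambda>w. D (lz w)) = (*) (D (cplx V))"
    unfolding lz_def by (auto simp: D(2) cplx_csymm)
  finally show "(\<lambda>w. f (XiY (X + Re w *\<^sub>R V, Y + Im w *\<^sub>R V))) field_differentiable at z"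
    unfolding field_differentiable_def has_field_derivative_def \<gamma>_def by blast
qed

text \<open>\<open>Re_sym\<close> and \<open>Im_sym\<close> are linear on the whole matrix space, so
  the chain rule is immediate. Complex homogeneity holds because they mix under multiplication by c
  like real and imaginary parts, and the derivative kernel is i times the pairing with the complex
  direction.\<close>

lemma lap_holomorphic_siegel:
  fixes G :: "('n::finite) symm \<Rightarrow> complex"
  assumes G: "G \<in> borel_measurable borel"
    and i: "\<And>Y. Y \<in> pd_cone \<Longrightarrow> integrable lborel (\<lambda>\<xi>. G \<xi> * of_real (exp (- (\<xi> \<bullet> Y))))"
  shows "holomorphic_siegel (\<lambda>Z. lap G (Re_sym Z, Im_sym Z))"
  unfolding holomorphic_siegel_def
proof
  fix Z :: "complex ^ 'n ^ 'n" assume Z: "Z \<in> siegel"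
  define E where "E \<xi> = G \<xi> * exp (\<i> * of_real (\<xi> \<bullet> Re_sym Z) - of_real (\<xi> \<bullet> Im_sym Z))" for \<xi>
  define L where "L q = (\<integral>\<xi>. E \<xi> * (\<i> * of_real (\<xi> \<bullet> fst q) - of_real (\<xi> \<bullet> snd q)) \<partial>lborel)" for q
  have L: "(lap G has_derivative L) (at (Re_sym Z, Im_sym Z))"
    unfolding L_def E_def using Z by (intro lap_has_derivative[OF open_pd_cone _ G i]) (auto simp: siegel_iff)
  have "((\<lambda>Z. (Re_sym Z, Im_sym Z)) has_derivative (\<lambda>Z. (Re_sym Z, Im_sym Z))) (at Z)"
    by (intro has_derivative_Pair bounded_linear_imp_has_derivative bounded_linear_Re_sym bounded_linear_Im_sym)
  from has_derivative_compose[OF this L]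
  have der: "((\<lambda>Z. lap G (Re_sym Z, Im_sym Z)) has_derivative (\<lambda>W. L (Re_sym W, Im_sym W))) (at Z within csymm)"
    by (rule has_derivative_at_withinI)
  have "L (Re_sym (\<chi> i j. c * W $ i $ j), Im_sym (\<chi> i j. c * W $ i $ j)) = c * L (Re_sym W, Im_sym W)" for c and W :: "complex ^ 'n ^ 'n"
  proof -
    have 1: "Re_sym (\<chi> i j. c * W $ i $ j) = Re c *\<^sub>R Re_sym W - Im c *\<^sub>R Im_sym W"
      by (rule symm_eqI) (simp add: smat_Re_sym smat_Im_sym smat_diff smat_scaleR vec_eq_iff field_simps)
    have 2: "Im_sym (\<chi> i j. c * W $ i $ j) = Re c *\<^sub>R Im_sym W + Im c *\<^sub>R Re_sym W"
      by (rule symm_eqI) (simp add: smat_Re_sym smat_Im_sym smat_add smat_scaleR vec_eq_iff field_simps)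
    have "E \<xi> * (\<i> * of_real (\<xi> \<bullet> (Re c *\<^sub>R Re_sym W - Im c *\<^sub>R Im_sym W)) - of_real (\<xi> \<bullet> (Re c *\<^sub>R Im_sym W + Im c *\<^sub>R Re_sym W)))
       = c * (E \<xi> * (\<i> * of_real (\<xi> \<bullet> Re_sym W) - of_real (\<xi> \<bullet> Im_sym W)))" for \<xi>
    proof -
      have "\<i> * of_real (\<xi> \<bullet> (Re c *\<^sub>R Re_sym W - Im c *\<^sub>R Im_sym W)) - of_real (\<xi> \<bullet> (Re c *\<^sub>R Im_sym W + Im c *\<^sub>R Re_sym W))
        = c * (\<i> * of_real (\<xi> \<bullet> Re_sym W) - of_real (\<xi> \<bullet> Im_sym W))"
        by (simp add: complex_eq_iff inner_diff_right inner_add_right)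
      then show ?thesis by (simp only: mult.left_commute)
    qed
    then show ?thesis unfolding L_def 1 2 fst_conv snd_conv by (simp only: integral_mult_right_zero)
  qed
  then show "\<exists>D. ((\<lambda>Z. lap G (Re_sym Z, Im_sym Z)) has_derivative D) (at Z within csymm) \<and>
      (\<forall>c. \<forall>W\<in>csymm. D (\<chi> i j. c * W $ i $ j) = c * D W)"
    using der by blast
qed

context siegel_weight
begin

section \<open>The operator S and holomorphic functions with prescribed image\<close>

definition amp :: "'n symm \<Rightarrow> real" where
  "amp X = (2 * pi) powr (real CARD('n) * (real CARD('n) + 1) / 4) / sqrt (Gamma_cone CARD('n) lam) * sdet X powr (s / 2)"

lemma amp_measurable [measurable]: "amp \<in> borel_measurable borel"
  unfolding amp_def[abs_def] by measurable

lemma amp_sq: "(amp X)\<^sup>2 = \<kappa> X"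
proof -
  have "((2 * pi) powr (real CARD('n) * (real CARD('n) + 1) / 4))\<^sup>2 = (2 * pi) powr dm"
    by (simp add: power2_eq_square powr_add[symmetric] dm_def)
  moreover have "(sdet X powr (s / 2))\<^sup>2 = sdet X powr s"
    by (simp add: power2_eq_square powr_add[symmetric])
  moreover have "(sqrt (Gamma_cone CARD('n) lam))\<^sup>2 = Gamma_cone CARD('n) lam"
    using Gamma_cone_pos[OF lam_gt] by simp
  ultimately show ?thesis by (simp add: amp_def \<kappa>_def power_mult_distrib power_divide)
qed

lemma amp_nonzero: "X \<in> pd_cone \<Longrightarrow> amp X \<noteq> 0"
  using \<kappa>_pos[of X] amp_sq[of X] by auto

lemma S_eq: "S_op lam g p = of_real (amp (fst p)) * (indicator pd_cone (fst p) * g (fst p)) * of_real (exp (- (fst p \<bullet> snd p)))"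
proof -
  have e: "lam / 2 - (real CARD('n) + 1) / 4 = s / 2" by (simp add: s_def field_simps)
  show ?thesis unfolding S_op_def amp_def e case_prod_unfold tr2_inner by (simp add: mult_ac)
qed

lemma id_N [measurable]: "(\<lambda>Y. Y) \<in> borel_measurable N"
  by (simp add: measurable_cong_sets[OF sets_N refl])

lemma ext_measurable: "g \<in> borel_measurable cone_leb \<Longrightarrow> (\<lambda>X. indicator pd_cone X * g X) \<in> borel_measurable borel"
  for g :: "'n symm \<Rightarrow> complex"
  by (simp add: cone_leb_measurable_iff)

lemma ext_L2:
  fixes g :: "'n symm \<Rightarrow> complex"
  assumes "g \<in> L2 cone_leb" shows "(\<lambda>X. indicator pd_cone X * g X) \<in> L2 lborel"
proof -
  have "sqnorm lborel (\<lambda>X. indicator pd_cone X * g X) = sqnorm cone_leb g"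
    unfolding sqnorm_def cone_leb_nn_integral by (intro nn_integral_cong) (auto simp: indicator_def)
  then show ?thesis using assms ext_measurable[of g] by (simp add: L2_iff)
qed

lemma exp_weighted_sqnorm:
  fixes w :: "'n symm \<Rightarrow> complex"
  assumes [measurable]: "w \<in> borel_measurable borel"
  shows "sqnorm P (\<lambda>p. w (fst p) * of_real (exp (- (fst p \<bullet> snd p)))) =
    (\<integral>\<^sup>+X. ennreal ((cmod (w X))\<^sup>2) * (\<integral>\<^sup>+Y. ennreal (exp (- 2 * (X \<bullet> Y))) \<partial>N) \<partial>lborel)"
proof -
  have "sqnorm P (\<lambda>p. w (fst p) * of_real (exp (- (fst p \<bullet> snd p)))) =
    (\<integral>\<^sup>+X. \<integral>\<^sup>+Y. ennreal ((cmod (w X * of_real (exp (- (X \<bullet> Y)))))\<^sup>2) \<partial>N \<partial>lborel)"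
    unfolding sqnorm_def by (subst nn_integral_fst[symmetric]) auto
  also have "\<dots> = (\<integral>\<^sup>+X. \<integral>\<^sup>+Y. ennreal ((cmod (w X))\<^sup>2) * ennreal (exp (- 2 * (X \<bullet> Y))) \<partial>N \<partial>lborel)"
  proof (intro nn_integral_cong)
    fix X Y :: "'n symm"
    have "(exp (- (X \<bullet> Y)))\<^sup>2 = exp (- 2 * (X \<bullet> Y))" by (simp add: power2_eq_square exp_add[symmetric])
    then show "ennreal ((cmod (w X * of_real (exp (- (X \<bullet> Y)))))\<^sup>2) = ennreal ((cmod (w X))\<^sup>2) * ennreal (exp (- 2 * (X \<bullet> Y)))"
      by (simp add: norm_mult power_mult_distrib ennreal_mult[symmetric])
  qed
  also have "\<dots> = (\<integral>\<^sup>+X. ennreal ((cmod (w X))\<^sup>2) * (\<integral>\<^sup>+Y. ennreal (exp (- 2 * (X \<bullet> Y))) \<partial>N) \<partial>lborel)"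
    by (intro nn_integral_cong nn_integral_cmult) measurable
  finally show ?thesis .
qed

lemma S_isometry:
  fixes g :: "'n symm \<Rightarrow> complex"
  assumes g: "g \<in> borel_measurable cone_leb"
  shows "S_op lam g \<in> borel_measurable P" "sqnorm P (S_op lam g) = sqnorm cone_leb g"
proof -
  note [measurable] = ext_measurable[OF g]
  have S: "S_op lam g = (\<lambda>p. of_real (amp (fst p)) * (indicator pd_cone (fst p) * g (fst p)) * of_real (exp (- (fst p \<bullet> snd p))))"
    by (rule ext) (rule S_eq)
  show "S_op lam g \<in> borel_measurable P" unfolding S by measurable
  have "sqnorm P (S_op lam g) = (\<integral>\<^sup>+X. ennreal ((cmod (of_real (amp X) * (indicator pd_cone X * g X)))\<^sup>2) * (\<integral>\<^sup>+Y. ennreal (exp (- 2 * (X \<bullet> Y))) \<partial>N) \<partial>lborel)"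
    unfolding S by (rule exp_weighted_sqnorm) measurable
  also have "\<dots> = (\<integral>\<^sup>+X. ennreal ((cmod (g X))\<^sup>2) * indicator pd_cone X \<partial>lborel)"
  proof (rule nn_integral_cong)
    fix X
    show "ennreal ((cmod (of_real (amp X) * (indicator pd_cone X * g X)))\<^sup>2) * (\<integral>\<^sup>+Y. ennreal (exp (- 2 * (X \<bullet> Y))) \<partial>N) = ennreal ((cmod (g X))\<^sup>2) * indicator pd_cone X"
    proof (cases "X \<in> pd_cone")
      case True
      have "(cmod (of_real (amp X) * (indicator pd_cone X * g X)))\<^sup>2 = \<kappa> X * (cmod (g X))\<^sup>2"
        using True by (simp add: norm_mult power_mult_distrib amp_sq)
      then show ?thesis unfolding N_exp_cone[OF True] using \<kappa>_pos[OF True] True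
        by (subst ennreal_mult[symmetric]) auto
    qed simp
  qed
  also have "\<dots> = sqnorm cone_leb g" unfolding sqnorm_def cone_leb_nn_integral ..
  finally show "sqnorm P (S_op lam g) = sqnorm cone_leb g" .
qed

lemma S_L2: "g \<in> L2 cone_leb \<Longrightarrow> S_op lam g \<in> L2 P" for g :: "'n symm \<Rightarrow> complex"
  using S_isometry[of g] by (simp add: L2_iff)

lemma S_inner:
  fixes g h :: "'n symm \<Rightarrow> complex"
  assumes "g \<in> L2 cone_leb" "h \<in> L2 cone_leb"
  shows "l2_inner P (S_op lam g) (S_op lam h) = l2_inner cone_leb g h"
proof (rule isometry_inner[OF assms S_L2[OF assms(1)] S_L2[OF assms(2)]])
  show "sqnorm P (S_op lam g) = sqnorm cone_leb g" "sqnorm P (S_op lam h) = sqnorm cone_leb h"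
    using assms by (auto intro: S_isometry)
  fix c
  have "(\<lambda>p. S_op lam g p + c * S_op lam h p) = S_op lam (\<lambda>X. g X + c * h X)"
    by (rule ext) (simp add: S_eq algebra_simps)
  then show "sqnorm P (\<lambda>p. S_op lam g p + c * S_op lam h p) = sqnorm cone_leb (\<lambda>X. g X + c * h X)"
    using S_isometry(2)[OF L2_measurable[OF L2_lincomb[OF assms, of 1 c]]] by simp
qed

text \<open>The weak form of the identity that S* M S is multiplication by \<gamma>, where M
  multiplies by \<alpha>(Y). With X fixed, the two exponentials multiply to exp(-2 tr(XY)), and the
  integral over Y is the one in \<gamma>.\<close>

lemma S_mult_inner:
  fixes g h \<alpha> :: "'n symm \<Rightarrow> complex"
  assumes g: "g \<in> L2 cone_leb" and h: "h \<in> L2 cone_leb"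
    and \<alpha> [measurable]: "\<alpha> \<in> borel_measurable cone_leb" and b: "AE Y in cone_leb. cmod (\<alpha> Y) \<le> C"
  shows "l2_inner P (\<lambda>p. \<alpha> (snd p) * S_op lam g p) (S_op lam h) = l2_inner cone_leb (\<lambda>X. gamma_fun lam \<alpha> X * g X) h"
proof -
  have [measurable]: "\<alpha> \<in> borel_measurable N" by simp
  have bP: "AE p in P. cmod (\<alpha> (snd p)) \<le> C" using b by (intro AE_pair_snd[OF sigma_finite_N]) (simp add: AE_N)
  have aL: "(\<lambda>p. \<alpha> (snd p) * S_op lam g p) \<in> L2 P" by (rule L2_mult_bounded[OF S_L2[OF g] _ bP]) measurable
  have "l2_inner P (\<lambda>p. \<alpha> (snd p) * S_op lam g p) (S_op lam h) =
     (\<integral>X. \<integral>Y. \<alpha> (snd (X, Y)) * S_op lam g (X, Y) * cnj (S_op lam h (X, Y)) \<partial>N \<partial>lborel)"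
    unfolding l2_inner_def by (rule PP.integral_fst'[OF L2_inner_integrable[OF aL S_L2[OF h]], symmetric])
  also have "\<dots> = (\<integral>X. indicator pd_cone X *\<^sub>R (gamma_fun lam \<alpha> X * g X * cnj (h X)) \<partial>lborel)"
  proof (rule Bochner_Integration.integral_cong[OF refl])
    fix X :: "'n symm"
    show "(\<integral>Y. \<alpha> (snd (X, Y)) * S_op lam g (X, Y) * cnj (S_op lam h (X, Y)) \<partial>N) = indicator pd_cone X *\<^sub>R (gamma_fun lam \<alpha> X * g X * cnj (h X))"
    proof (cases "X \<in> pd_cone")
      case False then show ?thesis by (simp add: S_eq)
    next
      case True
      have "\<alpha> (snd (X, Y)) * S_op lam g (X, Y) * cnj (S_op lam h (X, Y)) = (of_real (\<kappa> X) * g X * cnj (h X)) * (\<alpha> Y * of_real (exp (- 2 * (X \<bullet> Y))))" for Y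
      proof -
        have e: "exp (- (X \<bullet> Y)) * exp (- (X \<bullet> Y)) = exp (- 2 * (X \<bullet> Y))" by (simp add: exp_add[symmetric])
        have "\<alpha> (snd (X, Y)) * S_op lam g (X, Y) * cnj (S_op lam h (X, Y)) =
          (of_real (amp X * amp X) * g X * cnj (h X)) * (\<alpha> Y * of_real (exp (- (X \<bullet> Y)) * exp (- (X \<bullet> Y))))"
          using True by (simp add: S_eq mult_ac)
        then show ?thesis unfolding e by (simp only: amp_sq[of X, unfolded power2_eq_square])
      qed
      then have "(\<integral>Y. \<alpha> (snd (X, Y)) * S_op lam g (X, Y) * cnj (S_op lam h (X, Y)) \<partial>N) = (of_real (\<kappa> X) * g X * cnj (h X)) * (\<integral>Y. \<alpha> Y * of_real (exp (- 2 * (X \<bullet> Y))) \<partial>N)"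
        by (simp only: integral_mult_right_zero)
      then show ?thesis using True by (simp add: gamma_fun_eq(1)[OF \<alpha>] mult_ac)
    qed
  qed
  also have "\<dots> = l2_inner cone_leb (\<lambda>X. gamma_fun lam \<alpha> X * g X) h"
    unfolding l2_inner_def cone_leb_def by (subst integral_restrict_space) auto
  finally show ?thesis .
qed

text \<open>A second use of the gamma integral, now over X: the squared norm is a constant times the
  integral with parameter lam at the point 2 Y.\<close>

lemma exp_amp_L2:
  assumes Y: "Y \<in> pd_cone"
  shows "(\<lambda>X. complex_of_real (amp X * (indicator pd_cone X * exp (- (X \<bullet> Y))))) \<in> L2 lborel"
proof -
  define c where "c = (2 * pi) powr dm / Gamma_cone CARD('n) lam"
  have c: "c \<ge> 0" using Gamma_cone_pos[OF lam_gt] by (simp add: c_def)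
  have Y2: "2 *\<^sub>R Y \<in> pd_cone" by (rule pd_cone_scale[OF Y]) simp
  have e: "lam - (real CARD('n) + 1) / 2 = s" by (simp add: s_def)
  have "sqnorm lborel (\<lambda>X. complex_of_real (amp X * (indicator pd_cone X * exp (- (X \<bullet> Y))))) =
    (\<integral>\<^sup>+X. ennreal c * ennreal (indicator pd_cone X * (exp (- tr2 (2 *\<^sub>R Y) X) * sdet X powr (lam - (real CARD('n) + 1) / 2))) \<partial>lborel)"
    unfolding sqnorm_def
  proof (rule nn_integral_cong)
    fix X :: "'n symm"
    have "(exp (- (X \<bullet> Y)))\<^sup>2 = exp (- tr2 (2 *\<^sub>R Y) X)"
      by (simp add: power2_eq_square exp_add[symmetric] tr2_inner inner_commute)
    then have "(cmod (complex_of_real (amp X * (indicator pd_cone X * exp (- (X \<bullet> Y))))))\<^sup>2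
      = c * (indicator pd_cone X * (exp (- tr2 (2 *\<^sub>R Y) X) * sdet X powr (lam - (real CARD('n) + 1) / 2)))"
      unfolding norm_of_real power2_abs power_mult_distrib amp_sq e
      by (auto simp: \<kappa>_def c_def indicator_def)
    then show "ennreal ((cmod (complex_of_real (amp X * (indicator pd_cone X * exp (- (X \<bullet> Y))))))\<^sup>2) =
      ennreal c * ennreal (indicator pd_cone X * (exp (- tr2 (2 *\<^sub>R Y) X) * sdet X powr (lam - (real CARD('n) + 1) / 2)))"
      using c by (simp add: ennreal_mult)
  qed
  also have "\<dots> = ennreal c * ennreal (Gamma_cone CARD('n) lam * sdet (2 *\<^sub>R Y) powr (- lam))"
    unfolding nn_integral_cone[OF Y2 lam_gt, symmetric]
    by (rule nn_integral_cmult) (intro measurable_compose[OF _ measurable_ennreal], simp add: cone_integrand_measurable)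
  also have "\<dots> < \<infinity>" by (simp add: ennreal_mult_less_top)
  finally show ?thesis by (simp add: L2_iff)
qed

lemma S_slice_integrable:
  fixes g :: "'n symm \<Rightarrow> complex"
  assumes g: "g \<in> L2 cone_leb" and Y: "Y \<in> pd_cone"
  shows "integrable lborel (\<lambda>X. S_op lam g (X, Y))"
proof -
  have "(\<lambda>X. S_op lam g (X, Y)) = (\<lambda>X. complex_of_real (amp X * (indicator pd_cone X * exp (- (X \<bullet> Y)))) * (indicator pd_cone X * g X))"
    by (auto simp: S_eq indicator_def)
  then show ?thesis using L2_mult_integrable[OF exp_amp_L2[OF Y] ext_L2[OF g]] by simp
qed

lemma U_W: "U_op lam f = W (\<lambda>p. f (XiY p))"
  unfolding U_op_def W_def by (simp only: N_def)

text \<open>The candidate is the inverse transform \<open>W_adj\<close> of S g. The slices of S g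
  are integrable, so this inverse is given by an integral, and that integral is a Laplace integral;
  hence it has a holomorphic representative.\<close>

lemma bergman_of_S:
  fixes g :: "'n symm \<Rightarrow> complex"
  assumes g: "g \<in> L2 cone_leb"
  shows "\<exists>f\<in>bergman_space lam. AE p in P. U_op lam f p = S_op lam g p"
proof -
  define c where "c = complex_of_real ((2 * pi) powr (- (real DIM('n symm) / 2)))"
  \<comment> \<open>Chosen so that G \<xi> exp(- tr(\<xi>Y)) is the Fourier constant times S g at
    (\<xi>, Y); the exponential is thus left to the Laplace kernel.\<close>
  define G where "G \<xi> = c * (of_real (amp \<xi>) * (indicator pd_cone \<xi> * g \<xi>))" for \<xi>
  note [measurable] = ext_measurable[OF L2_measurable[OF g]]
  have Gm: "G \<in> borel_measurable borel" unfolding G_def[abs_def] by measurable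
  have GS: "G \<xi> * of_real (exp (- (\<xi> \<bullet> Y))) = c * S_op lam g (\<xi>, Y)" for \<xi> Y
    by (simp add: G_def S_eq mult_ac)
  have Gi: "integrable lborel (\<lambda>\<xi>. G \<xi> * of_real (exp (- (\<xi> \<bullet> Y))))" if "Y \<in> pd_cone" for Y
    unfolding GS by (intro integrable_mult_right S_slice_integrable g that)
  define f where "f Z = lap G (Re_sym Z, Im_sym Z)" for Z
  have hol: "holomorphic_siegel f" unfolding f_def[abs_def] by (rule lap_holomorphic_siegel[OF Gm Gi])
  have fm: "f \<in> borel_measurable siegel_borel" by (rule holomorphic_siegel_measurable[OF hol])
  have SL: "S_op lam g \<in> L2 P" by (rule S_L2[OF g])
  have SD: "S_op lam g \<in> D"
    unfolding slice_dom_def using SL AE_space[of N] by (auto intro: S_slice_integrable[OF g] elim!: eventually_mono)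
  have fp: "f (XiY p) = cnj (pft (\<lambda>p. cnj (S_op lam g p)) p)" for p
  proof -
    have "cnj (pft (\<lambda>p. cnj (S_op lam g p)) p) = c * (\<integral>\<xi>. cnj (exp (- \<i> * of_real (fst p \<bullet> \<xi>)) * cnj (S_op lam g (\<xi>, snd p))) \<partial>lborel)"
      unfolding pft_def ft_def Bochner_Integration.integral_cnj by (simp add: c_def)
    also have "\<dots> = (\<integral>\<xi>. c * cnj (exp (- \<i> * of_real (fst p \<bullet> \<xi>)) * cnj (S_op lam g (\<xi>, snd p))) \<partial>lborel)"
      by (rule integral_mult_right_zero[symmetric])
    also have "\<dots> = f (XiY p)"
      unfolding f_def lap_def Re_sym_XiY Im_sym_XiY fst_conv snd_conv
    proof (rule Bochner_Integration.integral_cong[OF refl])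
      fix \<xi> :: "'n symm"
      have "cnj (exp (- \<i> * of_real (fst p \<bullet> \<xi>))) = exp (\<i> * of_real (\<xi> \<bullet> fst p))"
        by (simp add: exp_cnj inner_commute)
      then have "c * cnj (exp (- \<i> * of_real (fst p \<bullet> \<xi>)) * cnj (S_op lam g (\<xi>, snd p))) = exp (\<i> * of_real (\<xi> \<bullet> fst p)) * (c * S_op lam g (\<xi>, snd p))"
        by (simp add: mult_ac)
      also have "\<dots> = exp (\<i> * of_real (\<xi> \<bullet> fst p)) * (G \<xi> * of_real (exp (- (\<xi> \<bullet> snd p))))" unfolding GS ..
      also have "\<dots> = G \<xi> * exp (\<i> * of_real (\<xi> \<bullet> fst p) - of_real (\<xi> \<bullet> snd p))"
        by (simp add: exp_diff exp_minus exp_of_real divide_inverse mult_ac)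
      finally show "c * cnj (exp (- \<i> * of_real (fst p \<bullet> \<xi>)) * cnj (S_op lam g (\<xi>, snd p))) = G \<xi> * exp (\<i> * of_real (\<xi> \<bullet> fst p) - of_real (\<xi> \<bullet> snd p))" .
    qed
    finally show ?thesis ..
  qed
  have ae: "AE p in P. W_adj (S_op lam g) p = f (XiY p)"
    using W_adj_pft[OF SD] by (simp add: fp)
  have fXm: "(\<lambda>p. f (XiY p)) \<in> borel_measurable P" by (rule measurable_compose[OF XiY_P fm])
  have fL: "(\<lambda>p. f (XiY p)) \<in> L2 P" by (rule L2_cong_AE[OF W_adj_L2[OF SL] fXm ae])
  have "f \<in> bergman_space lam" unfolding bergman_space_def using hol fL fm by (simp add: vhat_L2)
  moreover have "AE p in P. U_op lam f p = S_op lam g p"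
    using W_cong[OF W_adj_L2[OF SL] fL ae] W_W_adj[OF SL] unfolding U_W by eventually_elim simp
  ultimately show ?thesis by blast
qed

end

subsection \<open>The image of the Bergman space\<close>

text \<open>The sets over which f integrates to 0 form a Dynkin system, because f is integrable; so
  they include everything generated by the rectangles.\<close>

lemma (in pair_sigma_finite) AE_zero_of_rectangles:
  fixes f :: "_ \<Rightarrow> complex"
  assumes f: "integrable (M1 \<Otimes>\<^sub>M M2) f"
    and z: "\<And>A B. A \<in> sets M1 \<Longrightarrow> B \<in> sets M2 \<Longrightarrow> (\<integral>p. indicator (A \<times> B) p *\<^sub>R f p \<partial>(M1 \<Otimes>\<^sub>M M2)) = 0"
  shows "AE p in M1 \<Otimes>\<^sub>M M2. f p = 0"
proof (rule density_zero[OF f])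
  let ?M = "M1 \<Otimes>\<^sub>M M2"
  let ?G = "{a \<times> b | a b. a \<in> sets M1 \<and> b \<in> sets M2}"
  have sg: "sets ?M = sigma_sets (space M1 \<times> space M2) ?G" by (rule sets_pair_measure)
  fix S assume "S \<in> sets ?M"
  then have S: "S \<in> sigma_sets (space M1 \<times> space M2) ?G" unfolding sg .
  show "set_lebesgue_integral ?M S f = 0"
    using Int_stable_pair_measure_generator pair_measure_closed S
  proof (induction rule: sigma_sets_induct_disjoint)
    case (basic A) then show ?case using z unfolding set_lebesgue_integral_def by blast
  next
    case empty then show ?case by (simp add: set_lebesgue_integral_def)
  next
    case (compl A)
    have A: "A \<in> sets ?M" using compl(1) unfolding sg .
    have "set_lebesgue_integral ?M (space M1 \<times> space M2 - A) f =
      (\<integral>p. indicator (space M1 \<times> space M2) p *\<^sub>R f p - indicator A p *\<^sub>R f p \<partial>?M)"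
      unfolding set_lebesgue_integral_def
      by (rule Bochner_Integration.integral_cong) (use sets.sets_into_space[OF A] in \<open>auto simp: indicator_def space_pair_measure\<close>)
    also have "\<dots> = (\<integral>p. indicator (space M1 \<times> space M2) p *\<^sub>R f p \<partial>?M) - (\<integral>p. indicator A p *\<^sub>R f p \<partial>?M)"
      by (intro Bochner_Integration.integral_diff integrable_mult_indicator f A) auto
    also have "\<dots> = 0" using z[of "space M1" "space M2"] compl(2) by (simp add: set_lebesgue_integral_def)
    finally show ?case .
  next
    case (union A)
    have m: "A i \<in> sets ?M" for i using union(2) unfolding sg by auto
    have "set_lebesgue_integral ?M (\<Union>i. A i) f = (\<Sum>i. set_lebesgue_integral ?M (A i) f)"
      using union(1) m f
      by (intro lebesgue_integral_countable_add) (auto simp: disjoint_family_on_def set_integrable_def intro!: integrable_mult_indicator)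
    then show ?case using union(3) by simp
  qed
qed

context siegel_weight
begin

section \<open>Test functions supported on boxes\<close>

lemma sets_N_I: "B \<in> sets borel \<Longrightarrow> B \<subseteq> pd_cone \<Longrightarrow> B \<in> sets N"
  by (simp add: sets_N cone_leb_def sets_restrict_space_iff)

lemma sets_N_D: "B \<in> sets N \<Longrightarrow> B \<in> sets borel"
  by (auto simp: sets_N cone_leb_def sets_restrict_space)

text \<open>On a compact set exp(-2 tr Y) is bounded below, and its \<open>N\<close>-integral is
  finite because the identity matrix lies in the cone.\<close>

lemma N_compact_finite:
  assumes K: "compact K" "K \<subseteq> pd_cone"
  shows "emeasure N K < \<infinity>"
proof -
  obtain b where b: "\<And>Y. Y \<in> K \<Longrightarrow> norm Y \<le> b" using compact_imp_bounded[OF K(1)] by (auto simp: bounded_iff)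
  define M where "M = 2 * (norm (symm_one :: 'n symm) * b)"
  have le: "2 * (symm_one \<bullet> Y) \<le> M" if "Y \<in> K" for Y :: "'n symm"
    using order_trans[OF norm_cauchy_schwarz[of symm_one Y] mult_left_mono[OF b[OF that] norm_ge_zero[of symm_one]]] by (simp add: M_def)
  have KN: "K \<in> sets N" using K by (intro sets_N_I) (auto simp: compact_imp_closed)
  have "emeasure N K = (\<integral>\<^sup>+Y. indicator K Y \<partial>N)" using KN by simp
  also have "\<dots> \<le> (\<integral>\<^sup>+Y. ennreal (exp M) * ennreal (exp (- 2 * (symm_one \<bullet> Y))) \<partial>N)"
  proof (rule nn_integral_mono)
    fix Y :: "'n symm"
    have "1 \<le> exp M * exp (- 2 * (symm_one \<bullet> Y))" if "Y \<in> K"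
      unfolding exp_add[symmetric] using le[OF that] by simp
    then show "indicator K Y \<le> ennreal (exp M) * ennreal (exp (- 2 * (symm_one \<bullet> Y)))"
      by (auto simp: indicator_def ennreal_mult[symmetric] simp flip: ennreal_1 intro!: ennreal_leI)
  qed
  also have "\<dots> = ennreal (exp M) * (\<integral>\<^sup>+Y. ennreal (exp (- 2 * (symm_one \<bullet> Y))) \<partial>N)"
    by (rule nn_integral_cmult) measurable
  also have "\<dots> < \<infinity>" unfolding N_exp_cone[OF symm_one_in] by (simp add: ennreal_mult_less_top)
  finally show ?thesis .
qed

text \<open>The growing exponential is there to cancel the factor exp(- tr(\<xi>Y)) that U f is
  going to have.\<close>

definition exp_box :: "'n symm set \<Rightarrow> 'n symm set \<Rightarrow> 'n symm \<times> 'n symm \<Rightarrow> complex" where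
  "exp_box A B p = indicator A (fst p) * indicator B (snd p) * of_real (exp (fst p \<bullet> snd p))"

text \<open>The entire function that the box produces on the side of the Siegel domain. The
  reflection of A turns the decaying exponential of \<open>lap\<close> into the growing one of
  \<open>exp_box\<close>.\<close>

definition exp_kernel :: "'n symm set \<Rightarrow> 'n symm \<times> 'n symm \<Rightarrow> complex" where
  "exp_kernel A = lap (\<lambda>\<xi>. indicator A (- \<xi>))"

definition ft_const :: complex where
  "ft_const = of_real ((2 * pi) powr (- (real DIM('n symm) / 2)))"

lemma exp_kernel_integrable:
  fixes A :: "'n symm set"
  assumes A: "A \<in> sets borel" "A \<subseteq> cball 0 r"
  shows "(\<lambda>\<xi>. indicator A (- \<xi>) :: complex) \<in> borel_measurable borel"
    "integrable lborel (\<lambda>\<xi>. indicator A (- \<xi>) * complex_of_real (exp (- (\<xi> \<bullet> Y))))"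
proof -
  note [measurable] = A(1)
  show m: "(\<lambda>\<xi>. indicator A (- \<xi>) :: complex) \<in> borel_measurable borel" by measurable
  show "integrable lborel (\<lambda>\<xi>. indicator A (- \<xi>) * complex_of_real (exp (- (\<xi> \<bullet> Y))))"
  proof (rule Bochner_Integration.integrable_bound)
    show "integrable lborel (\<lambda>\<xi>. exp (r * norm Y) * indicator (cball (0::'n symm) r) \<xi> :: real)"
      by (intro integrable_mult_right integrable_real_indicator) (auto simp: emeasure_bounded_finite[OF bounded_cball, simplified])
    show "AE \<xi> in lborel. norm (indicator A (- \<xi>) * complex_of_real (exp (- (\<xi> \<bullet> Y)))) \<le> norm (exp (r * norm Y) * indicator (cball 0 r) \<xi> :: real)"
    proof (rule AE_I2)
      fix \<xi> :: "'n symm"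
      show "norm (indicator A (- \<xi>) * complex_of_real (exp (- (\<xi> \<bullet> Y)))) \<le> norm (exp (r * norm Y) * indicator (cball 0 r) \<xi> :: real)"
      proof (cases "- \<xi> \<in> A")
        case True
        then have n: "norm \<xi> \<le> r" using A(2) by (auto dest!: subsetD)
        have "- (\<xi> \<bullet> Y) \<le> norm \<xi> * norm Y" using norm_cauchy_schwarz[of "- \<xi>" Y] by simp
        also have "\<dots> \<le> r * norm Y" using n by (simp add: mult_right_mono)
        finally show ?thesis using True n by (simp add: norm_mult)
      qed simp
    qed
    have "(\<lambda>\<xi>. complex_of_real (exp (- (\<xi> \<bullet> Y)))) \<in> borel_measurable borel"
      by (intro borel_measurable_continuous_onI continuous_intros)
    from borel_measurable_times[OF m this]
    show "(\<lambda>\<xi>. indicator A (- \<xi>) * complex_of_real (exp (- (\<xi> \<bullet> Y)))) \<in> borel_measurable lborel" by simp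
  qed
qed

text \<open>Boundedness of A and compactness of K keep the exponential bounded on the box and the
  measure of the box finite, so the box lies in \<open>D\<close> and its adjoint transform is given
  by the integral.\<close>

lemma exp_box_facts:
  fixes A B K :: "'n symm set"
  assumes A: "A \<in> sets borel" "A \<subseteq> cball 0 r" and K: "compact K" "K \<subseteq> pd_cone" and B: "B \<in> sets borel" "B \<subseteq> K"
  shows "exp_box A B \<in> D"
    and "AE p in P. cnj (W_adj (exp_box A B) p) = ft_const * (indicator B (snd p) * exp_kernel A p)"
proof -
  note [measurable] = A(1)
  have BN [measurable]: "B \<in> sets N" using B K by (intro sets_N_I) auto
  obtain b where b: "\<And>Y. Y \<in> K \<Longrightarrow> norm Y \<le> b" using compact_imp_bounded[OF K(1)] by (auto simp: bounded_iff)
  have KN: "K \<in> sets N" using K by (intro sets_N_I) (auto simp: compact_imp_closed)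
  have fA: "emeasure lborel A < \<infinity>"
    by (rule le_less_trans[OF emeasure_mono[OF A(2)]]) (auto simp: emeasure_bounded_finite[OF bounded_cball, simplified])
  have fB: "emeasure N B < \<infinity>"
    by (rule le_less_trans[OF emeasure_mono[OF B(2) KN] N_compact_finite[OF K]])
  have t: "(\<lambda>p. indicator A (fst p) * indicator B (snd p) :: complex) \<in> L2 P"
    using A(1) by (intro L2_tensor sigma_finite_N L2_indicator fA fB BN) simp
  have L: "exp_box A B \<in> L2 P"
  proof (rule L2_bound[OF t])
    show "exp_box A B \<in> borel_measurable P" unfolding exp_box_def[abs_def] by measurable
    show "AE p in P. cmod (exp_box A B p) \<le> exp (r * b) * cmod (indicator A (fst p) * indicator B (snd p))"
    proof (rule AE_I2)
      fix p
      show "cmod (exp_box A B p) \<le> exp (r * b) * cmod (indicator A (fst p) * indicator B (snd p))"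
      proof (cases "fst p \<in> A \<and> snd p \<in> B")
        case True
        then have n: "norm (fst p) \<le> r" "norm (snd p) \<le> b" using A(2) B(2) b by (auto dest!: subsetD)
        have "fst p \<bullet> snd p \<le> norm (fst p) * norm (snd p)" by (rule norm_cauchy_schwarz)
        also have "\<dots> \<le> r * b" using n by (intro mult_mono) (auto intro: order_trans[OF norm_ge_zero])
        finally show ?thesis using True by (simp add: exp_box_def norm_mult)
      qed (auto simp: exp_box_def)
    qed
  qed
  show D: "exp_box A B \<in> D"
    unfolding slice_dom_def
  proof (clarsimp simp: L)
    have e: "(\<lambda>\<xi>. indicator (cball 0 r) \<xi> * exp_box A B (\<xi>, y)) = (\<lambda>\<xi>. exp_box A B (\<xi>, y))" for y
      using A(2) by (fastforce simp: exp_box_def indicator_def)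
    show "AE y in N. integrable lborel (\<lambda>\<xi>. exp_box A B (\<xi>, y))"
      using L2_slices[OF L] by eventually_elim (drule L2_ball_integrable[where r=r], simp only: e)
  qed
  have "cnj (cnj (pft (\<lambda>p. cnj (exp_box A B p)) p)) = ft_const * (indicator B (snd p) * exp_kernel A p)" for p
  proof -
    let ?k = "\<lambda>\<xi>. indicator A (- \<xi>) * exp (\<i> * of_real (\<xi> \<bullet> fst p) - of_real (\<xi> \<bullet> snd p)) :: complex"
    have km: "?k \<in> borel_measurable borel" by measurable
    \<comment> \<open>The substitution of - \<xi> for \<xi> undoes the reflection in
      \<open>exp_kernel\<close>.\<close>
    have k: "exp_kernel A p = (\<integral>\<xi>. ?k (0 + (-1) *\<^sub>R \<xi>) \<partial>lborel)"
      using lborel_integral_affine(1)[OF _ km, of "-1" 0] unfolding exp_kernel_def lap_def by simp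
    have "indicator B (snd p) * exp_kernel A p = (\<integral>\<xi>. indicator B (snd p) * ?k (0 + (-1) *\<^sub>R \<xi>) \<partial>lborel)"
      unfolding k by (simp only: integral_mult_right_zero)
    also have "\<dots> = (\<integral>\<xi>. exp (- \<i> * of_real (fst p \<bullet> \<xi>)) * cnj (exp_box A B (\<xi>, snd p)) \<partial>lborel)"
    proof (rule Bochner_Integration.integral_cong[OF refl])
      fix \<xi> :: "'n symm"
      have e: "exp (\<i> * of_real ((0 + (-1) *\<^sub>R \<xi>) \<bullet> fst p) - of_real ((0 + (-1) *\<^sub>R \<xi>) \<bullet> snd p))
        = exp (- \<i> * of_real (fst p \<bullet> \<xi>)) * complex_of_real (exp (\<xi> \<bullet> snd p))"
        unfolding exp_of_real[symmetric] exp_add[symmetric]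
        by (rule arg_cong[where f=exp]) (simp add: inner_commute[of \<xi> "fst p"])
      have "- (0 + (-1) *\<^sub>R \<xi>) = \<xi>" by simp
      then show "indicator B (snd p) * ?k (0 + (-1) *\<^sub>R \<xi>) = exp (- \<i> * of_real (fst p \<bullet> \<xi>)) * cnj (exp_box A B (\<xi>, snd p))"
        unfolding e exp_box_def fst_conv snd_conv
        by (cases "\<xi> \<in> A"; cases "snd p \<in> B") (simp_all only: indicator_simps(1,2) complex_cnj_mult complex_cnj_one complex_cnj_zero complex_cnj_complex_of_real mult_1_left mult_1_right mult_zero_left mult_zero_right not_False_eq_True)
    qed
    finally show ?thesis by (simp add: pft_def ft_def ft_const_def)
  qed
  then show "AE p in P. cnj (W_adj (exp_box A B) p) = ft_const * (indicator B (snd p) * exp_kernel A p)"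
    using W_adj_pft[OF D] by (auto elim!: eventually_mono)
qed

text \<open>Testing \<open>U f\<close> against a box in which the exponential is removed turns the pairing into integrals of
  a holomorphic function over the horizontal lines of the tube, which do not depend on the height.\<close>

lemma U_box_integral:
  fixes A :: "'n symm set"
  assumes f: "f \<in> bergman_space lam" and A: "A \<in> sets borel" "A \<subseteq> cball 0 r"
  shows "\<exists>k. \<forall>K B. compact K \<and> K \<subseteq> pd_cone \<and> B \<in> sets borel \<and> B \<subseteq> K \<longrightarrow>
     integrable P (\<lambda>p. indicator (A \<times> B) p *\<^sub>R (U_op lam f p * of_real (exp (fst p \<bullet> snd p)))) \<and>
     (\<integral>p. indicator (A \<times> B) p *\<^sub>R (U_op lam f p * of_real (exp (fst p \<bullet> snd p))) \<partial>P) = k * of_real (measure N B)"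
proof -
  have hol: "holomorphic_siegel f" and fv: "f \<in> L2 (vhat lam)" using f by (auto simp: bergman_space_def)
  define F where "F p = f (XiY p)" for p
  have F: "F \<in> L2 P" unfolding F_def[abs_def] by (rule vhat_L2D[OF fv])
  have UF: "U_op lam f = W F" unfolding U_W F_def[abs_def] ..
  have UL: "U_op lam f \<in> L2 P" unfolding UF by (rule W_L2[OF F])
  have pair: "integrable P (\<lambda>p. indicator (A \<times> B) p *\<^sub>R (U_op lam f p * of_real (exp (fst p \<bullet> snd p))))"
      "integrable P (\<lambda>p. F p * (indicator B (snd p) * exp_kernel A p))"
      "(\<integral>p. indicator (A \<times> B) p *\<^sub>R (U_op lam f p * of_real (exp (fst p \<bullet> snd p))) \<partial>P) =
        ft_const * (\<integral>p. F p * (indicator B (snd p) * exp_kernel A p) \<partial>P)"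
    if K: "compact K" "K \<subseteq> pd_cone" and B: "B \<in> sets borel" "B \<subseteq> K" for K B
  proof -
    note box = exp_box_facts[OF A K B]
    have GL: "exp_box A B \<in> L2 P" by (rule D_L2[OF box(1)])
    have e: "indicator (A \<times> B) p *\<^sub>R (U_op lam f p * of_real (exp (fst p \<bullet> snd p))) = U_op lam f p * cnj (exp_box A B p)" for p
      by (cases p) (auto simp: exp_box_def indicator_def)
    show "integrable P (\<lambda>p. indicator (A \<times> B) p *\<^sub>R (U_op lam f p * of_real (exp (fst p \<bullet> snd p))))"
      unfolding e by (rule L2_inner_integrable[OF UL GL])
    have i: "integrable P (\<lambda>p. F p * cnj (W_adj (exp_box A B) p))"
      by (rule L2_inner_integrable[OF F W_adj_L2[OF GL]])
    have BN [measurable]: "B \<in> sets N" using B K by (intro sets_N_I) auto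
    have Km: "exp_kernel A \<in> borel_measurable P"
    proof -
      have "exp_kernel A \<in> borel_measurable (borel \<Otimes>\<^sub>M borel)"
        unfolding exp_kernel_def by (rule lap_measurable[OF exp_kernel_integrable(1)[OF A]])
      moreover have "(\<lambda>p. (fst p, snd p)) \<in> measurable P (borel \<Otimes>\<^sub>M borel)" by measurable
      ultimately show ?thesis using measurable_compose by fastforce
    qed
    note [measurable] = Km L2_measurable[OF F] L2_measurable[OF W_adj_L2[OF GL]]
    have ae: "AE p in P. F p * cnj (W_adj (exp_box A B) p) = ft_const * (F p * (indicator B (snd p) * exp_kernel A p))"
      using box(2) by eventually_elim simp
    have m1: "(\<lambda>p. F p * cnj (W_adj (exp_box A B) p)) \<in> borel_measurable P" by measurable
    have m2: "(\<lambda>p. ft_const * (F p * (indicator B (snd p) * exp_kernel A p))) \<in> borel_measurable P" by measurable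
    have i2: "integrable P (\<lambda>p. ft_const * (F p * (indicator B (snd p) * exp_kernel A p)))"
      using i integrable_cong_AE[OF m1 m2 ae] by simp
    have c0: "ft_const \<noteq> 0" by (simp add: ft_const_def)
    from integrable_mult_right[OF i2, of "1 / ft_const"] c0
    show "integrable P (\<lambda>p. F p * (indicator B (snd p) * exp_kernel A p))" by simp
    have "(\<integral>p. indicator (A \<times> B) p *\<^sub>R (U_op lam f p * of_real (exp (fst p \<bullet> snd p))) \<partial>P) = l2_inner P (W F) (exp_box A B)"
      unfolding e l2_inner_def unfolding UF ..
    also have "\<dots> = (\<integral>p. F p * cnj (W_adj (exp_box A B) p) \<partial>P)"
      unfolding W_adjoint[OF F GL] unfolding l2_inner_def ..
    also have "\<dots> = (\<integral>p. ft_const * (F p * (indicator B (snd p) * exp_kernel A p)) \<partial>P)"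
      by (rule integral_cong_AE[OF m1 m2 ae])
    also have "\<dots> = ft_const * (\<integral>p. F p * (indicator B (snd p) * exp_kernel A p) \<partial>P)"
      by (rule integral_mult_right_zero)
    finally show "(\<integral>p. indicator (A \<times> B) p *\<^sub>R (U_op lam f p * of_real (exp (fst p \<bullet> snd p))) \<partial>P) =
        ft_const * (\<integral>p. F p * (indicator B (snd p) * exp_kernel A p) \<partial>P)" .
  qed
  \<comment> \<open>Extending f by 0 off the Siegel domain makes h Borel on the full coordinate
    space, as \<open>tube_integral_constant\<close> requires.\<close>
  define h where "h p = (indicator siegel (XiY p) *\<^sub>R f (XiY p)) * exp_kernel A p" for p
  have ind: "indicator siegel (XiY p) = (indicator pd_cone (snd p) :: real)" for p :: "'n symm \<times> 'n symm"
    by (auto simp: indicator_def siegel_iff XiY_csymm)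
  have hm [measurable]: "h \<in> borel_measurable (borel \<Otimes>\<^sub>M borel)"
  proof -
    have "f \<in> borel_measurable siegel_borel" by (rule holomorphic_siegel_measurable[OF hol])
    then have "(\<lambda>Z. indicator siegel Z *\<^sub>R f Z) \<in> borel_measurable borel"
      by (subst (asm) borel_measurable_restrict_space_iff) (auto simp: siegel_sets)
    from measurable_compose[OF XiY_measurable_borel this]
    have [measurable]: "(\<lambda>p. indicator siegel (XiY p) *\<^sub>R f (XiY p)) \<in> borel_measurable (borel \<Otimes>\<^sub>M borel)" .
    have [measurable]: "exp_kernel A \<in> borel_measurable (borel \<Otimes>\<^sub>M borel)"
      unfolding exp_kernel_def by (rule lap_measurable[OF exp_kernel_integrable(1)[OF A]])
    show ?thesis unfolding h_def[abs_def] by measurable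
  qed
  have hh: "F p * (indicator B (snd p) * exp_kernel A p) = indicator B (snd p) * h p" if "snd p \<in> pd_cone" for p B
    using that by (simp add: h_def ind F_def)
  have holh: "(\<lambda>z. h (X + Re z *\<^sub>R V, Y + Im z *\<^sub>R V)) holomorphic_on {z. Y + Im z *\<^sub>R V \<in> pd_cone}" for X Y V
  proof -
    have "(\<lambda>z. exp_kernel A (X + Re z *\<^sub>R V, Y + Im z *\<^sub>R V)) holomorphic_on {z. Y + Im z *\<^sub>R V \<in> UNIV}"
      unfolding exp_kernel_def by (rule lap_line_holomorphic) (auto intro: exp_kernel_integrable[OF A])
    then have "(\<lambda>z. exp_kernel A (X + Re z *\<^sub>R V, Y + Im z *\<^sub>R V)) holomorphic_on {z. Y + Im z *\<^sub>R V \<in> pd_cone}"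
      by (rule holomorphic_on_subset) auto
    from holomorphic_on_mult[OF holomorphic_siegel_line[OF hol, where X=X and V=V and Y=Y] this]
    show ?thesis by (rule holomorphic_transform) (simp add: h_def ind)
  qed
  have fin: "(\<integral>\<^sup>+Y. indicator K Y * (\<integral>\<^sup>+X. ennreal (cmod (h (X, Y))) \<partial>lborel) \<partial>lborel) < \<infinity>"
    if K: "compact K" "K \<subseteq> pd_cone" for K
  proof (cases "K = {}")
    case False
    have Kb: "K \<in> sets borel" using K(1) by (simp add: compact_imp_closed)
    have KN: "K \<in> sets N" by (rule sets_N_I[OF Kb K(2)])
    \<comment> \<open>On a compact part of the cone the weight has a positive minimum, so
      integrability with respect to \<open>N\<close> yields the integrability with respect to
      Lebesgue measure that the tube argument asks for.\<close>
    have "continuous_on K wt"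
      unfolding wt_def cone_weight_def sdet_scale2 using K(2) sdet_pos
      by (intro continuous_intros continuous_on_subset[OF continuous_on_sdet]) fastforce+
    from continuous_attains_inf[OF K(1) False this]
    obtain Y0 where Y0: "Y0 \<in> K" "\<And>Y. Y \<in> K \<Longrightarrow> wt Y0 \<le> wt Y" by blast
    define m where "m = wt Y0"
    have m: "m > 0" unfolding m_def using Y0 K(2) by (intro wt_pos) auto
    define \<phi> where "\<phi> Y = indicator K Y * (\<integral>\<^sup>+X. ennreal (cmod (h (X, Y))) \<partial>lborel)" for Y
    have \<phi>m [measurable]: "\<phi> \<in> borel_measurable borel" unfolding \<phi>_def[abs_def] using Kb by measurable
    have \<phi>c: "\<phi> \<in> borel_measurable cone_leb" unfolding cone_leb_def by (rule measurable_restrict_space1) simp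
    have "(\<integral>\<^sup>+Y. \<phi> Y \<partial>N) = (\<integral>\<^sup>+Y. \<integral>\<^sup>+X. ennreal (cmod (F (X, Y) * (indicator K (snd (X, Y)) * exp_kernel A (X, Y)))) \<partial>lborel \<partial>N)"
    proof (rule nn_integral_cong)
      fix Y assume "Y \<in> space N"
      then have Y: "Y \<in> pd_cone" by simp
      show "\<phi> Y = (\<integral>\<^sup>+X. ennreal (cmod (F (X, Y) * (indicator K (snd (X, Y)) * exp_kernel A (X, Y)))) \<partial>lborel)"
      proof -
        have e: "F (X, Y) * (indicator K (snd (X, Y)) * exp_kernel A (X, Y)) = indicator K Y * h (X, Y)" for X
          using hh[of "(X, Y)" K] Y by simp
        show ?thesis unfolding e by (cases "Y \<in> K") (simp_all add: \<phi>_def)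
      qed
    qed
    also have "\<dots> = (\<integral>\<^sup>+p. ennreal (cmod (F p * (indicator K (snd p) * exp_kernel A p))) \<partial>P)"
      using pair(2)[OF K Kb subset_refl] by (intro PP.nn_integral_snd) auto
    also have "\<dots> < \<infinity>" using pair(2)[OF K Kb subset_refl] by (simp add: integrable_iff_bounded)
    finally have fN: "(\<integral>\<^sup>+Y. \<phi> Y \<partial>N) < \<infinity>" .
    have "(\<integral>\<^sup>+Y. \<phi> Y \<partial>lborel) \<le> (\<integral>\<^sup>+Y. ennreal (1 / m) * (ennreal (wt Y) * \<phi> Y * indicator pd_cone Y) \<partial>lborel)"
    proof (rule nn_integral_mono)
      fix Y
      show "\<phi> Y \<le> ennreal (1 / m) * (ennreal (wt Y) * \<phi> Y * indicator pd_cone Y)"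
      proof (cases "Y \<in> K")
        case True
        have "1 \<le> (1 / m) * wt Y" using Y0(2)[OF True] m by (simp add: m_def)
        then have "1 \<le> ennreal ((1 / m) * wt Y)" by simp
        also have "\<dots> = ennreal (1 / m) * ennreal (wt Y)" using m wt_nonneg by (intro ennreal_mult) auto
        finally have "1 * \<phi> Y \<le> ennreal (1 / m) * ennreal (wt Y) * \<phi> Y" by (rule mult_right_mono) simp
        then show ?thesis using True K(2) by (auto simp: mult.assoc)
      qed (simp add: \<phi>_def)
    qed
    also have "\<dots> = ennreal (1 / m) * (\<integral>\<^sup>+Y. ennreal (wt Y) * \<phi> Y * indicator pd_cone Y \<partial>lborel)"
    proof (intro nn_integral_cmult borel_measurable_times_ennreal)
      show "(\<lambda>Y. ennreal (wt Y)) \<in> borel_measurable lborel"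
        using measurable_compose[OF wt_measurable measurable_ennreal] by simp
      show "\<phi> \<in> borel_measurable lborel" using \<phi>m by simp
      show "(indicator pd_cone :: _ \<Rightarrow> ennreal) \<in> borel_measurable lborel" using pd_cone_sets by simp
    qed
    also have "\<dots> = ennreal (1 / m) * (\<integral>\<^sup>+Y. \<phi> Y \<partial>N)" unfolding nn_integral_N[OF \<phi>c] ..
    also have "\<dots> < \<infinity>" using fN by (simp add: ennreal_mult_less_top)
    finally show ?thesis unfolding \<phi>_def .
  qed simp
  obtain c where c: "AE Y in lborel. Y \<in> pd_cone \<longrightarrow> (\<integral>X. h (X, Y) \<partial>lborel) = c"
    using tube_integral_constant[OF open_pd_cone convex_pd_cone _ pd_cone_add pd_cone_scale hm holh fin] symm_one_in by blast
  have cN: "AE Y in N. (\<integral>X. h (X, Y) \<partial>lborel) = c" unfolding AE_N cone_leb_AE by (rule c)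
  have "(\<integral>p. F p * (indicator B (snd p) * exp_kernel A p) \<partial>P) = c * of_real (measure N B)"
    if K: "compact K" "K \<subseteq> pd_cone" and B: "B \<in> sets borel" "B \<subseteq> K" for K B
  proof -
    note i = pair(2)[OF K B]
    have BN [measurable]: "B \<in> sets N" using B K by (intro sets_N_I) auto
    have KN: "K \<in> sets N" using K by (intro sets_N_I) (auto simp: compact_imp_closed)
    have fB: "emeasure N B < \<infinity>"
      by (rule le_less_trans[OF emeasure_mono[OF B(2) KN] N_compact_finite[OF K]])
    have "(\<integral>p. F p * (indicator B (snd p) * exp_kernel A p) \<partial>P) =
       (\<integral>Y. \<integral>X. F (X, Y) * (indicator B (snd (X, Y)) * exp_kernel A (X, Y)) \<partial>lborel \<partial>N)"
      using PP.integral_snd[of "\<lambda>X Y. F (X, Y) * (indicator B (snd (X, Y)) * exp_kernel A (X, Y))"] i by (simp add: case_prod_unfold)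
    also have "\<dots> = (\<integral>Y. indicator B Y *\<^sub>R (\<integral>X. h (X, Y) \<partial>lborel) \<partial>N)"
    proof (rule Bochner_Integration.integral_cong[OF refl])
      fix Y assume "Y \<in> space N"
      then have Y: "Y \<in> pd_cone" by simp
      show "(\<integral>X. F (X, Y) * (indicator B (snd (X, Y)) * exp_kernel A (X, Y)) \<partial>lborel) = indicator B Y *\<^sub>R (\<integral>X. h (X, Y) \<partial>lborel)"
      proof -
        have e: "F (X, Y) * (indicator B (snd (X, Y)) * exp_kernel A (X, Y)) = indicator B Y * h (X, Y)" for X
          using hh[of "(X, Y)" B] Y by simp
        show ?thesis unfolding e by (cases "Y \<in> B") simp_all
      qed
    qed
    also have "\<dots> = (\<integral>Y. indicator B Y *\<^sub>R c \<partial>N)"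
    proof (rule integral_cong_AE)
      show "AE Y in N. indicator B Y *\<^sub>R (\<integral>X. h (X, Y) \<partial>lborel) = indicator B Y *\<^sub>R c" using cN by eventually_elim simp
    qed measurable
    also have "\<dots> = (\<integral>Y. indicator B Y \<partial>N) *\<^sub>R c" using fB BN by (intro integral_scaleR_left) simp
    also have "\<dots> = c * of_real (measure N B)" using sets.sets_into_space[OF BN] by (simp add: Int_absorb2 scaleR_conv_of_real)
    finally show ?thesis .
  qed
  then show ?thesis using pair by (intro exI[of _ "ft_const * c"]) auto
qed

end

context siegel_weight
begin

text \<open>The function H, which is U f with the exponential removed, integrates over A \<times> B
  to a quantity depending on A times the measure of B. So it should be a function of \<xi> alone.
  That function is defined as an average, and it is compared with H on all bounded
  rectangles.\<close>

lemma bergman_U_exp: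
  assumes f: "f \<in> bergman_space lam"
  obtains w :: "'n symm \<Rightarrow> complex" where "w \<in> borel_measurable borel"
    "AE p in P. U_op lam f p = w (fst p) * of_real (exp (- (fst p \<bullet> snd p)))"
proof -
  have fv: "f \<in> L2 (vhat lam)" using f by (auto simp: bergman_space_def)
  have UL: "U_op lam f \<in> L2 P" unfolding U_W by (rule W_L2[OF vhat_L2D[OF fv]])
  define H where "H p = U_op lam f p * of_real (exp (fst p \<bullet> snd p))" for p
  have Hm [measurable]: "H \<in> borel_measurable P"
    unfolding H_def[abs_def] using L2_measurable[OF UL] by measurable
  obtain r0 where r0: "r0 > 0" "cball (symm_one :: 'n symm) r0 \<subseteq> pd_cone"
    using open_pd_cone symm_one_in by (auto simp: open_contains_cball)
  define B0 where "B0 = cball (symm_one :: 'n symm) r0"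
  have B0: "compact B0" "B0 \<subseteq> pd_cone" "B0 \<in> sets borel" using r0 by (auto simp: B0_def)
  have B0N [measurable]: "B0 \<in> sets N" by (rule sets_N_I[OF B0(3,2)])
  \<comment> \<open>A ball inside the open cone has positive measure because the weight is positive
    there; the average below divides by it.\<close>
  have mu: "measure N B0 \<noteq> 0"
  proof
    assume "measure N B0 = 0"
    then have "emeasure N B0 = 0"
      using N_compact_finite[OF B0(1,2)] by (simp add: emeasure_eq_ennreal_measure)
    then have "AE Y in N. Y \<notin> B0" using B0N by (auto intro: AE_not_in simp: null_sets_def)
    then have "AE Y in lborel. Y \<in> pd_cone \<longrightarrow> Y \<notin> B0" unfolding AE_N cone_leb_AE .
    from AE_lborel_open_ex[OF this open_ball[of symm_one r0]] r0(1)
    obtain Y where "Y \<in> ball symm_one r0" "Y \<in> pd_cone \<longrightarrow> Y \<notin> B0" by auto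
    moreover from this have "Y \<in> B0" by (simp add: B0_def)
    ultimately show False using B0(2) by blast
  qed
  \<comment> \<open>The average of H over one fixed ball of heights. It is measurable in \<xi> for
    every H, and it recovers H if H does not depend on Y.\<close>
  define w where "w \<xi> = (\<integral>Y. indicator B0 Y *\<^sub>R H (\<xi>, Y) \<partial>N) / of_real (measure N B0)" for \<xi>
  have wm [measurable]: "w \<in> borel_measurable borel"
  proof -
    have "(\<lambda>\<xi>. \<integral>Y. indicator B0 Y *\<^sub>R H (\<xi>, Y) \<partial>N) \<in> borel_measurable lborel" by measurable
    then show ?thesis unfolding w_def[abs_def] by simp
  qed
  have boxw: "integrable lborel (\<lambda>\<xi>. indicator A \<xi> *\<^sub>R w \<xi>)"
    "integrable P (\<lambda>p. indicator (A \<times> B) p *\<^sub>R H p)" "integrable P (\<lambda>p. indicator (A \<times> B) p *\<^sub>R w (fst p))"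
    "(\<integral>p. indicator (A \<times> B) p *\<^sub>R H p \<partial>P) = (\<integral>p. indicator (A \<times> B) p *\<^sub>R w (fst p) \<partial>P)"
    if A: "A \<in> sets borel" "A \<subseteq> cball 0 r" and K: "compact K" "K \<subseteq> pd_cone" and B: "B \<in> sets borel" "B \<subseteq> K" for A r B K
  proof -
    have "\<exists>k. \<forall>K B. compact K \<and> K \<subseteq> pd_cone \<and> B \<in> sets borel \<and> B \<subseteq> K \<longrightarrow>
        integrable P (\<lambda>p. indicator (A \<times> B) p *\<^sub>R H p) \<and>
        (\<integral>p. indicator (A \<times> B) p *\<^sub>R H p \<partial>P) = k * of_real (measure N B)"
      unfolding H_def by (rule U_box_integral[OF f A])
    then obtain k where k: "\<forall>K B. compact K \<and> K \<subseteq> pd_cone \<and> B \<in> sets borel \<and> B \<subseteq> K \<longrightarrow>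
        integrable P (\<lambda>p. indicator (A \<times> B) p *\<^sub>R H p) \<and>
        (\<integral>p. indicator (A \<times> B) p *\<^sub>R H p \<partial>P) = k * of_real (measure N B)" ..
    note kB = k[rule_format, OF conjI[OF K(1) conjI[OF K(2) conjI[OF B]]]]
      and k0 = k[rule_format, OF conjI[OF B0(1) conjI[OF B0(2) conjI[OF B0(3) subset_refl]]]]
    have BN: "B \<in> sets N" using B K by (intro sets_N_I) auto
    have KN: "K \<in> sets N" using K by (intro sets_N_I) (auto simp: compact_imp_closed)
    have fB: "emeasure N B < \<infinity>"
      by (rule le_less_trans[OF emeasure_mono[OF B(2) KN] N_compact_finite[OF K]])
    have sl: "(\<integral>Y. indicator (A \<times> B0) (\<xi>, Y) *\<^sub>R H (\<xi>, Y) \<partial>N) = (indicator A \<xi> *\<^sub>R w \<xi>) * of_real (measure N B0)" for \<xi>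
      using mu by (cases "\<xi> \<in> A") (simp_all add: w_def indicator_times)
    have "integrable lborel (\<lambda>\<xi>. \<integral>Y. indicator (A \<times> B0) (\<xi>, Y) *\<^sub>R H (\<xi>, Y) \<partial>N)"
      using k0 by (intro PP.integrable_fst') auto
    then have "integrable lborel (\<lambda>\<xi>. ((indicator A \<xi> *\<^sub>R w \<xi>) * of_real (measure N B0)) * (1 / of_real (measure N B0)))"
      unfolding sl by (rule integrable_mult_left)
    moreover have "((indicator A \<xi> *\<^sub>R w \<xi>) * of_real (measure N B0)) * (1 / of_real (measure N B0)) = indicator A \<xi> *\<^sub>R w \<xi>" for \<xi>
      using mu by (simp add: scaleR_conv_of_real)
    ultimately show iw: "integrable lborel (\<lambda>\<xi>. indicator A \<xi> *\<^sub>R w \<xi>)" by (simp only:)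
    have "(\<integral>\<xi>. (indicator A \<xi> *\<^sub>R w \<xi>) * of_real (measure N B0) \<partial>lborel) = (\<integral>p. indicator (A \<times> B0) p *\<^sub>R H p \<partial>P)"
      unfolding sl[symmetric] using k0 by (intro PP.integral_fst') auto
    then have "(\<integral>\<xi>. indicator A \<xi> *\<^sub>R w \<xi> \<partial>lborel) * of_real (measure N B0) = k * of_real (measure N B0)"
      unfolding conjunct2[OF k0] by (simp only: integral_mult_left_zero)
    then have Iw: "(\<integral>\<xi>. indicator A \<xi> *\<^sub>R w \<xi> \<partial>lborel) = k" using mu by simp
    have oB: "(\<lambda>Y. complex_of_real (indicator B Y)) = indicator B" by (auto simp: indicator_def)
    have iB: "integrable N (indicator B :: _ \<Rightarrow> complex)"
      using integrable_of_real[OF integrable_real_indicator[OF BN fB]] unfolding oB[symmetric] .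
    have e: "indicator (A \<times> B) p *\<^sub>R w (fst p) = (indicator A (fst p) *\<^sub>R w (fst p)) * indicator B (snd p)" for p
      by (cases p) (auto simp: indicator_def)
    note T = integrable_tensor[OF lborel.sigma_finite_measure_axioms sigma_finite_N iw iB]
    show "integrable P (\<lambda>p. indicator (A \<times> B) p *\<^sub>R H p)" using kB by blast
    show "integrable P (\<lambda>p. indicator (A \<times> B) p *\<^sub>R w (fst p))" unfolding e by (rule T(1))
    have "(\<integral>Y. indicator B Y \<partial>N) = complex_of_real (measure N B)"
      using sets.sets_into_space[OF BN] unfolding oB[symmetric] integral_of_real by (simp add: Int_absorb2)
    then show "(\<integral>p. indicator (A \<times> B) p *\<^sub>R H p \<partial>P) = (\<integral>p. indicator (A \<times> B) p *\<^sub>R w (fst p) \<partial>P)"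
      unfolding e T(2) Iw conjunct2[OF kB] by simp
  qed
  obtain C :: "nat \<Rightarrow> 'n symm set" where C: "\<And>n. compact (C n)" "\<And>n. C n \<subseteq> pd_cone" "\<Union>(range C) = pd_cone"
    by (rule open_Union_compact_subsets[OF open_pd_cone]) (rule that)
  have Cb: "C n \<in> sets borel" for n using C(1) by (simp add: compact_imp_closed)
  \<comment> \<open>Products of balls with the compact sets C n exhaust the space, and on each of
    them both functions are integrable, so equality on rectangles yields equality almost
    everywhere.\<close>
  have ae: "AE p in P. indicator (cball 0 (real m) \<times> C n) p *\<^sub>R (H p - w (fst p)) = 0" for m n
  proof (rule PP.AE_zero_of_rectangles)
    have cb: "cball (0 :: 'n symm) (real m) \<in> sets borel" by simp
    note b = boxw(2,3)[OF cb subset_refl C(1) C(2) Cb subset_refl]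
    show "integrable P (\<lambda>p. indicator (cball 0 (real m) \<times> C n) p *\<^sub>R (H p - w (fst p)))"
      unfolding scaleR_diff_right by (rule Bochner_Integration.integrable_diff[OF b])
    fix A :: "'n symm set" and B assume A: "A \<in> sets lborel" and B: "B \<in> sets N"
    let ?A = "A \<inter> cball 0 (real m)" and ?B = "B \<inter> C n"
    have AB: "?A \<in> sets borel" "?A \<subseteq> cball 0 (real m)" "?B \<in> sets borel" "?B \<subseteq> C n" using A sets_N_D[OF B] Cb by auto
    note b' = boxw(2,3,4)[OF AB(1,2) C(1) C(2) AB(3,4)]
    have "(\<integral>p. indicator (A \<times> B) p *\<^sub>R indicator (cball 0 (real m) \<times> C n) p *\<^sub>R (H p - w (fst p)) \<partial>P) =
      (\<integral>p. indicator (?A \<times> ?B) p *\<^sub>R H p - indicator (?A \<times> ?B) p *\<^sub>R w (fst p) \<partial>P)"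
      by (rule Bochner_Integration.integral_cong) (auto simp: indicator_def)
    also have "\<dots> = 0" using b' by (subst Bochner_Integration.integral_diff) auto
    finally show "(\<integral>p. indicator (A \<times> B) p *\<^sub>R indicator (cball 0 (real m) \<times> C n) p *\<^sub>R (H p - w (fst p)) \<partial>P) = 0" .
  qed
  have "AE p in P. \<forall>m n. indicator (cball 0 (real m) \<times> C n) p *\<^sub>R (H p - w (fst p)) = 0"
    by (intro AE_all_countable[THEN iffD2] allI ae)
  then have "AE p in P. U_op lam f p = w (fst p) * of_real (exp (- (fst p \<bullet> snd p)))"
    using AE_space
  proof eventually_elim
    fix p assume z: "\<forall>m n. indicator (cball 0 (real m) \<times> C n) p *\<^sub>R (H p - w (fst p)) = 0" and p: "p \<in> space P"
    have "snd p \<in> \<Union>(range C)" using p unfolding C(3) by (auto simp: space_pair_measure)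
    then obtain n where n: "snd p \<in> C n" by blast
    obtain m where m: "norm (fst p) \<le> real m" using real_arch_simple by blast
    have "p \<in> cball 0 (real m) \<times> C n" using n m by (cases p) auto
    then have Hw: "H p = w (fst p)" using z[rule_format, of m n] by simp
    have e: "exp (fst p \<bullet> snd p) * exp (- (fst p \<bullet> snd p)) = 1" by (simp add: exp_minus)
    have "U_op lam f p = H p * of_real (exp (- (fst p \<bullet> snd p)))"
      unfolding H_def mult.assoc of_real_mult[symmetric] e by simp
    then show "U_op lam f p = w (fst p) * of_real (exp (- (fst p \<bullet> snd p)))" unfolding Hw .
  qed
  with wm show ?thesis by (rule that)
qed

text \<open>Dividing w by \<open>amp\<close> gives |g|^2 = |w|^2 / \<kappa> on the cone, which is
  what remains of the finite norm of U f after integration over Y. Off the cone that inner integral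
  is infinite, so w vanishes there.\<close>

lemma bergman_S:
  assumes f: "f \<in> bergman_space lam"
  shows "\<exists>g\<in>L2 cone_leb. AE p in P. U_op lam f p = S_op lam g p"
proof -
  obtain w :: "'n symm \<Rightarrow> complex" where w [measurable]: "w \<in> borel_measurable borel"
    and ae: "AE p in P. U_op lam f p = w (fst p) * of_real (exp (- (fst p \<bullet> snd p)))"
    using bergman_U_exp[OF f] by blast
  have fv: "f \<in> L2 (vhat lam)" using f by (auto simp: bergman_space_def)
  have UL: "U_op lam f \<in> L2 P" unfolding U_W by (rule W_L2[OF vhat_L2D[OF fv]])
  define I where "I X = (\<integral>\<^sup>+Y. ennreal (exp (- 2 * (X \<bullet> Y))) \<partial>N)" for X :: "'n symm"
  have Im [measurable]: "I \<in> borel_measurable borel"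
  proof -
    have "I \<in> borel_measurable lborel" unfolding I_def[abs_def] by measurable
    then show ?thesis by simp
  qed
  have tot: "(\<integral>\<^sup>+X. ennreal ((cmod (w X))\<^sup>2) * I X \<partial>lborel) < \<infinity>"
    using UL unfolding L2_iff sqnorm_cong_AE[OF ae] exp_weighted_sqnorm[OF w] I_def by simp
  have "AE X in lborel. ennreal ((cmod (w X))\<^sup>2) * I X \<noteq> \<infinity>"
    using tot by (intro nn_integral_PInf_AE) auto
  then have off: "AE X in lborel. X \<notin> pd_cone \<longrightarrow> w X = 0"
    by eventually_elim (auto simp: I_def N_exp_off[simplified] ennreal_mult_eq_top_iff)
  define g where "g X = w X / of_real (amp X)" for X
  have "(\<lambda>X. complex_of_real (amp X)) \<in> borel_measurable borel"
    by (rule measurable_compose[OF amp_measurable]) (intro borel_measurable_continuous_onI continuous_intros)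
  from borel_measurable_divide[OF w this] have gm: "g \<in> borel_measurable cone_leb"
    unfolding g_def[abs_def] cone_leb_def by (intro measurable_restrict_space1) simp
  have "sqnorm cone_leb g = (\<integral>\<^sup>+X. ennreal ((cmod (g X))\<^sup>2) * indicator pd_cone X \<partial>lborel)"
    unfolding sqnorm_def cone_leb_nn_integral ..
  also have "\<dots> \<le> (\<integral>\<^sup>+X. ennreal ((cmod (w X))\<^sup>2) * I X \<partial>lborel)"
  proof (rule nn_integral_mono)
    fix X
    show "ennreal ((cmod (g X))\<^sup>2) * indicator pd_cone X \<le> ennreal ((cmod (w X))\<^sup>2) * I X"
    proof (cases "X \<in> pd_cone")
      case True
      have "(cmod (g X))\<^sup>2 = (cmod (w X))\<^sup>2 * (1 / \<kappa> X)"
        by (simp add: g_def norm_divide power_divide amp_sq)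
      then show ?thesis using True \<kappa>_pos[OF True] unfolding I_def N_exp_cone[OF True]
        by (simp add: ennreal_mult[symmetric])
    qed simp
  qed
  also have "\<dots> < \<infinity>" by (rule tot)
  finally have gL: "g \<in> L2 cone_leb" using gm by (simp add: L2_iff)
  have "AE p in P. U_op lam f p = S_op lam g p"
    using ae AE_pair_fst[OF sigma_finite_N off]
  proof eventually_elim
    fix p assume "U_op lam f p = w (fst p) * of_real (exp (- (fst p \<bullet> snd p)))" "fst p \<notin> pd_cone \<longrightarrow> w (fst p) = 0"
    then show "U_op lam f p = S_op lam g p"
      by (cases "fst p \<in> pd_cone") (auto simp: S_eq g_def amp_nonzero)
  qed
  with gL show ?thesis by blast
qed

end

subsection \<open>Toeplitz operators with invariant symbols\<close>

context siegel_weight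
begin

text \<open>Since S preserves pairings, g satisfies the condition from which
  \<open>l2_adjoint\<close> chooses, and two functions satisfying it agree almost
  everywhere.\<close>

lemma R_eq:
  assumes g: "g \<in> L2 cone_leb" and U: "U_op lam f \<in> L2 P" and ae: "AE p in P. U_op lam f p = S_op lam g p"
  shows "AE X in cone_leb. R_op lam f X = g X"
proof -
  define Q where "Q h \<longleftrightarrow> h \<in> L2 cone_leb \<and> (\<forall>k\<in>L2 cone_leb. l2_inner cone_leb k h = l2_inner P (S_op lam k) (U_op lam f))" for h
  have "R_op lam f = Eps Q" unfolding R_op_def l2_adjoint_def Q_def[abs_def] N_def ..
  moreover have "Q g"
    unfolding Q_def
  proof (intro conjI ballI g)
    fix k :: "'n symm \<Rightarrow> complex" assume k: "k \<in> L2 cone_leb"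
    have "l2_inner P (S_op lam k) (U_op lam f) = l2_inner P (S_op lam k) (S_op lam g)"
      using ae L2_measurable[OF S_L2[OF k]] L2_measurable[OF S_L2[OF g]] L2_measurable[OF U] by (intro l2_inner_cong_AE) auto
    then show "l2_inner cone_leb k g = l2_inner P (S_op lam k) (U_op lam f)" by (simp add: S_inner[OF k g])
  qed
  ultimately have "Q (R_op lam f)" using someI[of Q g] by simp
  then show ?thesis using \<open>Q g\<close> unfolding Q_def by (intro L2_eq_AE_I) auto
qed

lemma bergman_U_L2: "f \<in> bergman_space lam \<Longrightarrow> U_op lam f \<in> L2 P"
  unfolding U_W bergman_space_def by (auto intro: W_L2 vhat_L2D)

text \<open>Carries the orthogonality condition that defines the projection over to the cone, where
  it compares \<gamma> g with g1. The multiplication by \<alpha>(Y) passes through the unitary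
  operator unchanged.\<close>

lemma residual_inner:
  fixes \<alpha> :: "'n symm \<Rightarrow> complex"
  assumes f: "f \<in> bergman_space lam" "g \<in> L2 cone_leb" "AE p in P. U_op lam f p = S_op lam g p"
    and f1: "f1 \<in> bergman_space lam" "g1 \<in> L2 cone_leb" "AE p in P. U_op lam f1 p = S_op lam g1 p"
    and h: "h \<in> bergman_space lam" "k \<in> L2 cone_leb" "AE p in P. U_op lam h p = S_op lam k p"
    and a: "a \<in> borel_measurable siegel_borel" "AE p in P. a (XiY p) = \<alpha> (snd p)"
    and \<alpha>: "\<alpha> \<in> borel_measurable cone_leb" "AE Y in cone_leb. cmod (\<alpha> Y) \<le> C"
  shows "l2_inner (vhat lam) (\<lambda>Z. a Z * f Z - f1 Z) h =
    l2_inner cone_leb (\<lambda>X. gamma_fun lam \<alpha> X * g X) k - l2_inner cone_leb g1 k"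
proof -
  define F F1 H where "F p = f (XiY p)" and "F1 p = f1 (XiY p)" and "H p = h (XiY p)" for p
  have m: "f \<in> borel_measurable siegel_borel" "f1 \<in> borel_measurable siegel_borel" "h \<in> borel_measurable siegel_borel"
    using f(1) f1(1) h(1) by (auto simp: bergman_space_def intro: holomorphic_siegel_measurable)
  have L: "F \<in> L2 P" "F1 \<in> L2 P" "H \<in> L2 P"
    unfolding F_def[abs_def] F1_def[abs_def] H_def[abs_def] using f(1) f1(1) h(1) by (auto simp: bergman_space_def intro: vhat_L2D)
  have U: "U_op lam f = W F" "U_op lam f1 = W F1" "U_op lam h = W H"
    unfolding U_W F_def[abs_def] F1_def[abs_def] H_def[abs_def] by simp_all
  note SL = S_L2[OF f(2)] S_L2[OF f1(2)] S_L2[OF h(2)]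
  note WL = W_L2[OF L(1)] W_L2[OF L(2)] W_L2[OF L(3)]
  have \<alpha>N: "\<alpha> \<in> borel_measurable N" "AE Y in N. cmod (\<alpha> Y) \<le> C" using \<alpha> by (simp_all add: AE_N measurable_cong_sets[OF sets_N refl])
  have \<alpha>P: "(\<lambda>p. \<alpha> (snd p)) \<in> borel_measurable P" by (rule measurable_compose[OF measurable_snd \<alpha>N(1)])
  have bP: "AE p in P. cmod (\<alpha> (snd p)) \<le> C" by (rule AE_pair_snd[OF sigma_finite_N \<alpha>N(2)])
  have \<alpha>F: "(\<lambda>p. \<alpha> (snd p) * F p) \<in> L2 P" by (rule L2_mult_bounded[OF L(1) \<alpha>P bP])
  have \<alpha>S: "(\<lambda>p. \<alpha> (snd p) * S_op lam g p) \<in> L2 P" by (rule L2_mult_bounded[OF SL(1) \<alpha>P bP])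
  have am: "(\<lambda>p. a (XiY p)) \<in> borel_measurable P" by (rule measurable_compose[OF XiY_P a(1)])
  have "l2_inner (vhat lam) (\<lambda>Z. a Z * f Z - f1 Z) h = l2_inner P (\<lambda>p. a (XiY p) * F p - F1 p) H"
    unfolding F_def F1_def H_def[abs_def] by (rule vhat_inner) (intro borel_measurable_diff borel_measurable_times a m)+
  also have "\<dots> = l2_inner P (\<lambda>p. \<alpha> (snd p) * F p - F1 p) H"
  proof (rule l2_inner_cong_AE)
    show "AE p in P. a (XiY p) * F p - F1 p = \<alpha> (snd p) * F p - F1 p" using a(2) by eventually_elim simp
  qed (use L am \<alpha>P in \<open>auto intro!: borel_measurable_diff borel_measurable_times\<close>)
  also have "\<dots> = l2_inner P (\<lambda>p. \<alpha> (snd p) * F p) H - l2_inner P F1 H" by (rule l2_inner_diff_left[OF \<alpha>F L(2,3)])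
  also have "l2_inner P F1 H = l2_inner P (S_op lam g1) (S_op lam k)"
    unfolding W_inner[OF L(2,3), symmetric] using f1(3) h(3) WL SL unfolding U by (intro l2_inner_cong_AE) auto
  also have "\<dots> = l2_inner cone_leb g1 k" by (rule S_inner[OF f1(2) h(2)])
  also have "l2_inner P (\<lambda>p. \<alpha> (snd p) * F p) H = l2_inner P (\<lambda>p. \<alpha> (snd p) * S_op lam g p) (S_op lam k)"
    unfolding W_inner[OF \<alpha>F L(3), symmetric]
  proof (rule l2_inner_cong_AE)
    show "AE p in P. W (\<lambda>p. \<alpha> (snd p) * F p) p = \<alpha> (snd p) * S_op lam g p"
      using W_mult_snd[OF L(1) \<alpha>N] f(3) unfolding U by eventually_elim simp
    show "AE p in P. W H p = S_op lam k p" using h(3) unfolding U .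
  qed (use W_L2[OF \<alpha>F] \<alpha>S WL SL in auto)
  also have "\<dots> = l2_inner cone_leb (\<lambda>X. gamma_fun lam \<alpha> X * g X) k" by (rule S_mult_inner[OF f(2) h(2) \<alpha>])
  finally show ?thesis .
qed

text \<open>The preimage of \<gamma> g in the Bergman space satisfies the condition for the
  projection, so the choice in \<open>bergman_proj\<close> is not void. Whatever was chosen has the
  form S g' after U, and since every k in L2 of the cone comes from some h, the same condition
  forces g' = \<gamma> g.\<close>

lemma R_toeplitz:
  fixes \<alpha> :: "'n symm \<Rightarrow> complex"
  assumes f: "f \<in> bergman_space lam"
    and a: "a \<in> borel_measurable siegel_borel" "AE p in P. a (XiY p) = \<alpha> (snd p)"
    and \<alpha>: "\<alpha> \<in> borel_measurable cone_leb" "AE Y in cone_leb. cmod (\<alpha> Y) \<le> C"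
  shows "AE X in cone_leb. R_op lam (toeplitz lam a f) X = gamma_fun lam \<alpha> X * R_op lam f X"
proof -
  obtain g where g: "g \<in> L2 cone_leb" "AE p in P. U_op lam f p = S_op lam g p" using bergman_S[OF f] by blast
  let ?\<gamma>g = "\<lambda>X. gamma_fun lam \<alpha> X * g X"
  have "AE X in cone_leb. cmod (gamma_fun lam \<alpha> X) \<le> \<bar>C\<bar>" by (rule AE_I2) (simp add: gamma_facts(2)[OF \<alpha>])
  then have \<gamma>g: "?\<gamma>g \<in> L2 cone_leb" by (rule L2_mult_bounded[OF g(1) gamma_facts(3)[OF \<alpha>]])
  obtain f1 where f1: "f1 \<in> bergman_space lam" "AE p in P. U_op lam f1 p = S_op lam ?\<gamma>g p"
    using bergman_of_S[OF \<gamma>g] by blast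
  define Q where "Q f' \<longleftrightarrow> f' \<in> bergman_space lam \<and> (\<forall>h\<in>bergman_space lam. l2_inner (vhat lam) (\<lambda>Z. a Z * f Z - f' Z) h = 0)" for f'
  have T: "toeplitz lam a f = Eps Q" unfolding toeplitz_def bergman_proj_def Q_def[abs_def] ..
  have "Q f1"
    unfolding Q_def
  proof (intro conjI ballI f1)
    fix h :: "complex ^ 'n ^ 'n \<Rightarrow> complex" assume h: "h \<in> bergman_space lam"
    obtain k where k: "k \<in> L2 cone_leb" "AE p in P. U_op lam h p = S_op lam k p" using bergman_S[OF h] by blast
    show "l2_inner (vhat lam) (\<lambda>Z. a Z * f Z - f1 Z) h = 0"
      unfolding residual_inner[OF f g f1(1) \<gamma>g f1(2) h k a \<alpha>] by simp
  qed
  then have "Q (toeplitz lam a f)" using someI[of Q f1] by (simp add: T)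
  then have tb: "toeplitz lam a f \<in> bergman_space lam"
    and t0: "\<And>h. h \<in> bergman_space lam \<Longrightarrow> l2_inner (vhat lam) (\<lambda>Z. a Z * f Z - toeplitz lam a f Z) h = 0"
    unfolding Q_def by auto
  obtain g' where g': "g' \<in> L2 cone_leb" "AE p in P. U_op lam (toeplitz lam a f) p = S_op lam g' p" using bergman_S[OF tb] by blast
  have "AE X in cone_leb. ?\<gamma>g X = g' X"
  proof (rule L2_eq_AE_I[OF \<gamma>g g'(1)])
    fix k :: "'n symm \<Rightarrow> complex" assume k: "k \<in> L2 cone_leb"
    obtain h where h: "h \<in> bergman_space lam" "AE p in P. U_op lam h p = S_op lam k p" using bergman_of_S[OF k] by blast
    have "l2_inner cone_leb ?\<gamma>g k = l2_inner cone_leb g' k"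
      using residual_inner[OF f g tb g' h(1) k h(2) a \<alpha>] t0[OF h(1)] by simp
    then show "l2_inner cone_leb k ?\<gamma>g = l2_inner cone_leb k g'"
      using l2_inner_commute[of cone_leb k] by simp
  qed
  with R_eq[OF g'(1) bergman_U_L2[OF tb] g'(2)] R_eq[OF g(1) bergman_U_L2[OF f] g(2)]
  show ?thesis by eventually_elim simp
qed

lemma depends_on_Im_AE:
  fixes \<alpha> :: "'n symm \<Rightarrow> complex"
  assumes "depends_on_Im a \<alpha>" shows "AE p in P. a (XiY p) = \<alpha> (snd p)"
  using siegel_leb_AE[of "\<lambda>Z. a Z = \<alpha> (Im_symm Z)"] assms by (simp add: depends_on_Im_def)

text \<open>A null set in the product has a null slice at almost every X, so a single X
  suffices.\<close>

lemma depends_on_Im_bounded: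
  fixes \<alpha> :: "'n symm \<Rightarrow> complex"
  assumes d: "depends_on_Im a \<alpha>" and b: "AE Z in siegel_leb. cmod (a Z) \<le> C"
  shows "AE Y in cone_leb. cmod (\<alpha> Y) \<le> C"
proof -
  have "AE p in P. cmod (\<alpha> (snd p)) \<le> C"
    using depends_on_Im_AE[OF d] siegel_leb_AE[OF b] by eventually_elim simp
  from PP.AE_pair[OF this] have "AE X in (lborel :: 'n symm measure). AE Y in N. cmod (\<alpha> Y) \<le> C" by simp
  from AE_lborel_open_ex[OF this open_UNIV] show ?thesis by (simp add: AE_N)
qed

end

section \<open>Invariant symbols as functions of the imaginary part\<close>

lemma sets_Collect_eq_complex:
  fixes f g :: "'a \<Rightarrow> complex"
  assumes "f \<in> borel_measurable M" "g \<in> borel_measurable M"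
  shows "{x\<in>space M. f x = g x} \<in> sets M"
proof -
  have eq: "{x\<in>space M. f x = g x} = (\<lambda>x. f x - g x) -` {0} \<inter> space M" by auto
  show ?thesis unfolding eq by (rule measurable_sets[OF borel_measurable_diff[OF assms]]) simp
qed

lemma siegel_leb_measurable: "borel_measurable (siegel_leb :: (complex ^ ('n::finite) ^ 'n) measure) = borel_measurable siegel_borel"
  by (simp add: siegel_leb_def)

text \<open>The exceptional null set of the invariance varies with S. Fubini over all shifts and
  points yields one base point X0 such that, for almost every Y, the value at X0 + S equals the
  value at X0 for almost every S; the slice at X0 then serves as \<alpha>.\<close>

lemma symm_invariant_depends_on_Im:
  fixes a :: "complex ^ ('n::finite) ^ 'n \<Rightarrow> complex"
  assumes am: "a \<in> borel_measurable siegel_borel" and inv: "symm_invariant a"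
  shows "\<exists>\<alpha>. depends_on_Im a \<alpha>"
proof -
  let ?M = "(lborel :: 'n symm measure) \<Otimes>\<^sub>M (cone_leb :: 'n symm measure)"
  interpret C: sigma_finite_measure "cone_leb :: 'n symm measure" by (rule cone_leb_sigma_finite)
  interpret PC: pair_sigma_finite "lborel :: 'n symm measure" "cone_leb :: 'n symm measure" ..
  interpret PM: pair_sigma_finite "lborel :: 'n symm measure" ?M ..
  define b where "b p = a (XiY p)" for p
  have bm: "b \<in> borel_measurable ?M" unfolding b_def[abs_def] by (rule measurable_compose[OF XiY_measurable am])
  have sh: "AE p in ?M. b (fst p + S, snd p) = b p" for S
  proof -
    have "AE Z in siegel_leb. a (Z + cplx S) = a Z" using inv by (auto simp: symm_invariant_def)
    then have "AE p in ?M. a (XiY p + cplx S) = a (XiY p)" unfolding siegel_leb_def by (rule AE_distrD[OF XiY_measurable])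
    then show ?thesis by eventually_elim (simp add: b_def XiY_shift[symmetric])
  qed
  have 1: "(\<lambda>q. fst (snd q) + fst q) \<in> measurable (lborel \<Otimes>\<^sub>M ?M) lborel"
  proof -
    have "(\<lambda>q. fst (snd q)) \<in> measurable (lborel \<Otimes>\<^sub>M ?M) lborel" "fst \<in> measurable (lborel \<Otimes>\<^sub>M ?M) lborel"
      by (intro measurable_compose[OF measurable_snd measurable_fst] measurable_fst)+
    then show ?thesis by (simp add: borel_measurable_add)
  qed
  have 2: "(\<lambda>q. snd (snd q)) \<in> measurable ((lborel :: 'n symm measure) \<Otimes>\<^sub>M ?M) cone_leb"
    by (rule measurable_compose[OF measurable_snd measurable_snd])
  have set1: "{q \<in> space ((lborel :: 'n symm measure) \<Otimes>\<^sub>M ?M). b (fst (snd q) + fst q, snd (snd q)) = b (snd q)} \<in> sets (lborel \<Otimes>\<^sub>M ?M)"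
    by (intro sets_Collect_eq_complex measurable_compose[OF measurable_Pair[OF 1 2] bm] measurable_compose[OF measurable_snd bm])
  have "AE S in lborel. AE p in ?M. b (fst p + S, snd p) = b p" by (rule AE_I2) (rule sh)
  then have "AE p in ?M. AE S in lborel. b (fst p + S, snd p) = b p" using PM.AE_commute[OF set1] by simp
  from PC.AE_pair[OF this] have "AE X in lborel. AE Y in cone_leb. AE S in lborel. b (X + S, Y) = b (X, Y)" by simp
  from AE_lborel_open_ex[OF this open_UNIV] obtain X0 where X0: "AE Y in cone_leb. AE S in lborel. b (X0 + S, Y) = b (X0, Y)" by auto
  define \<alpha> where "\<alpha> Y = b (X0, Y)" for Y
  have \<alpha>m: "\<alpha> \<in> borel_measurable cone_leb"
    unfolding \<alpha>_def[abs_def] by (rule measurable_compose[OF measurable_Pair1' bm]) simp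
  have YX: "AE Y in cone_leb. AE X in lborel. b (X, Y) = \<alpha> Y"
    using X0
  proof eventually_elim
    fix Y assume "AE S in lborel. b (X0 + S, Y) = b (X0, Y)"
    from AE_lborel_translate[OF this, of "- X0"] show "AE X in lborel. b (X, Y) = \<alpha> Y" by (simp add: \<alpha>_def)
  qed
  have set2: "{p \<in> space ?M. b p = \<alpha> (snd p)} \<in> sets ?M"
    by (intro sets_Collect_eq_complex bm measurable_compose[OF measurable_snd \<alpha>m])
  have "AE X in lborel. AE Y in cone_leb. b (X, Y) = \<alpha> Y"
    using YX PC.AE_commute[of "\<lambda>X Y. b (X, Y) = \<alpha> Y"] set2 by simp
  then have "AE p in ?M. b p = \<alpha> (snd p)" by (intro PC.AE_pair_measure set2) simp
  moreover have "{Z \<in> space siegel_borel. a Z = \<alpha> (Im_symm Z)} \<in> sets siegel_borel"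
    by (intro sets_Collect_eq_complex am measurable_compose[OF Im_symm_measurable \<alpha>m])
  ultimately have "AE Z in siegel_leb. a Z = \<alpha> (Im_symm Z)"
    unfolding siegel_leb_def by (subst AE_distr_iff[OF XiY_measurable]) (auto simp: b_def)
  with \<alpha>m show ?thesis unfolding depends_on_Im_def by blast
qed

theorem theorem6p8:
  fixes lam :: real and a :: "complex ^ ('n::finite) ^ 'n \<Rightarrow> complex"
  assumes "lam > real CARD('n)"
    and "a \<in> Linf siegel_leb"
    and "symm_invariant a"
  shows "(\<exists>\<alpha> :: 'n symm \<Rightarrow> complex. depends_on_Im a \<alpha>) \<and>
    (\<forall>\<alpha> :: 'n symm \<Rightarrow> complex. depends_on_Im a \<alpha> \<longrightarrow>
       (\<forall>X\<in>pd_cone. integrable cone_leb (gamma_integrand lam \<alpha> X)) \<and>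
       gamma_fun lam \<alpha> \<in> Linf cone_leb \<and>
       (\<forall>f\<in>bergman_space lam.
          AE X in cone_leb. R_op lam (toeplitz lam a f) X = gamma_fun lam \<alpha> X * R_op lam f X))"
proof -
  interpret siegel_weight lam "cone_wmeasure lam :: 'n symm measure" by standard (use assms in auto)
  obtain C where am: "a \<in> borel_measurable siegel_borel" and C: "AE Z in siegel_leb. cmod (a Z) \<le> C"
    using assms(2) unfolding Linf_def siegel_leb_measurable by blast
  have "(\<forall>X\<in>pd_cone. integrable cone_leb (gamma_integrand lam \<alpha> X)) \<and> gamma_fun lam \<alpha> \<in> Linf cone_leb \<and>
       (\<forall>f\<in>bergman_space lam. AE X in cone_leb. R_op lam (toeplitz lam a f) X = gamma_fun lam \<alpha> X * R_op lam f X)"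
    if d: "depends_on_Im a \<alpha>" for \<alpha> :: "'n symm \<Rightarrow> complex"
  proof -
    have \<alpha>: "\<alpha> \<in> borel_measurable cone_leb" "AE Y in cone_leb. cmod (\<alpha> Y) \<le> C"
      using d depends_on_Im_bounded[OF d C] by (auto simp: depends_on_Im_def)
    have "AE X in cone_leb. cmod (gamma_fun lam \<alpha> X) \<le> \<bar>C\<bar>" by (rule AE_I2) (simp add: gamma_facts(2)[OF \<alpha>])
    then have "gamma_fun lam \<alpha> \<in> Linf cone_leb" using gamma_facts(3)[OF \<alpha>] unfolding Linf_def by blast
    then show ?thesis
      using gamma_facts(1)[OF \<alpha>] gamma_fun_eq(2)[OF \<alpha>(1)] R_toeplitz[OF _ am depends_on_Im_AE[OF d] \<alpha>] by blast
  qed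
  with symm_invariant_depends_on_Im[OF am assms(3)] show ?thesis by blast
qed

end
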